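(* Let $n\ge 3$, $N\ge 2$, and let $A:\mathbb{R}^{N\times n}\to\mathbb{R}^N$ be a (constant) linear map for which there is $\nu>0$ with $$|A:\eta\otimes a|\ \ge\ \nu\,|\eta|\,|a|\qquad\text{for all }\eta\in\mathbb{R}^N,\ a\in\mathbb{R}^n.$$ Let $f\in L^2(\mathbb{R}^n)^N$. Then the problem $$A:Du=f\quad\text{a.e. on }\mathbb{R}^n$$ has a unique solution $u$ in the space $W^{1;2^*,2}(\mathbb{R}^n)^N$, and this solution satisfies $$\|u\|_{L^{2^*}(\mathbb{R}^n)}+\|Du\|_{L^2(\mathbb{R}^n)}\le C\,\|f\|_{L^2(\mathbb{R}^n)}$$ for some $C>0$ depending only on $A$. Moreover, the solution has the representation $$u=-\frac{1}{2\pi i}\lim_{m\to\infty}\left\{\widehat{h_m}\ast\left[\frac{\operatorname{cof}(A\,\mathrm{sgn})^\top}{\det(A\,\mathrm{sgn})}\,\overset{\vee}{f}\right]^{\wedge}\right\},$$ where $(h_m)_{m=1}^\infty\subseteq\mathcal{S}(\mathbb{R}^n)$ is any sequence of even functions in the Schwartz class such that, for a.e. $x\in\mathbb{R}^n$, $0\le h_m(x)\le \frac{1}{|x|}$ for all $m$ and $h_m(x)\to\frac{1}{|x|}$ as $m\to\infty$. The limit is meant in the weak $L^{2^*}$ sense as well as a.e. on $\mathbb{R}^n$, and $u$ is independent of the choice of the sequence $(h_m)_{m=1}^\infty$.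
   Context: Maps $u,f:\mathbb{R}^n\to\mathbb{R}^N$ are real vector valued. $|\cdot|$ denotes the Euclidean norm on $\mathbb{R}^n$, $\mathbb{R}^N$ and $\mathbb{R}^{N\times n}$. $2^*=\frac{2n}{n-2}$ and $L^{2^*}$ means $L^p$ with $p=2^*$. The space is $$W^{1;2^*,2}(\mathbb{R}^n)^N:=\{u\in L^{2^*}(\mathbb{R}^n)^N : Du\in L^2(\mathbb{R}^n)^{Nn}\},$$ where $Du=(D_iu_\alpha)\in\mathbb{R}^{N\times n}$ is the weak gradient matrix. A linear map $A:\mathbb{R}^{N\times n}\to\mathbb{R}^N$ is identified with its components $A_{\alpha\beta j}$, $1\le\alpha,\beta\le N$, $1\le j\le n$, via $(A:Q)_\alpha=\sum_{\beta,j}A_{\alpha\beta j}Q_{\beta j}$. For $\eta\in\mathbb{R}^N$, $a\in\mathbb{R}^n$, $\eta\otimes a\in\mathbb{R}^{N\times n}$ has entries $\eta_\beta a_j$. For $a\in\mathbb{R}^n$, $Aa$ is the $N\times N$ matrix with entries $(Aa)_{\alpha\beta}=\sum_jA_{\alpha\beta j}a_j$. $\mathrm{sgn}(x)=x/|x|$ for $x\in\mathbb{R}^n\setminus\{0\}$ and $\mathrm{sgn}(0)=0$; $A\,\mathrm{sgn}$ denotes the matrix-valued function $z\mapsto A\,\mathrm{sgn}(z)$. For $X\in\mathbb{R}^{N\times N}$, $\operatorname{cof}(X)$ is the cofactor matrix, so that $X\operatorname{cof}(X)^\top=\operatorname{cof}(X)^\top X=\det(X)I$. The Fourier transform and its inverse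 are (extended to $L^2$ as usual, and applied componentwise) $$\widehat{u}(z)=\int_{\mathbb{R}^n}u(x)e^{-2\pi i x\cdot z}\,dx,\qquad \overset{\vee}{u}(x)=\int_{\mathbb{R}^n}u(z)e^{2\pi i x\cdot z}\,dz,$$ and $[\,\cdot\,]^{\wedge}$ also denotes the Fourier transform. $\ast$ denotes convolution.
   Formalization: The a.e. limit is stated up to subsequences (every subsequence has a further subsequence converging a.e. to u), since a.e. convergence of the whole sequence fails for some f in L^2 and some admissible (h_m); the weak L^{2*} limit is for the whole sequence. *)

theory Defs
  imports "HOL-Analysis.Analysis"
begin

section \<open>Lebesgue spaces on Euclidean space\<close>

definition memLp :: "real \<Rightarrow> ('a::euclidean_space \<Rightarrow> 'b::euclidean_space) \<Rightarrow> bool" where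
  "memLp p f \<longleftrightarrow> f \<in> borel_measurable lebesgue \<and> integrable lebesgue (\<lambda>x. norm (f x) powr p)"

definition Lp_norm :: "real \<Rightarrow> ('a::euclidean_space \<Rightarrow> 'b::euclidean_space) \<Rightarrow> real" where
  "Lp_norm p f = (LINT x|lebesgue. norm (f x) powr p) powr (1 / p)"

definition Lp_tendsto ::
  "real \<Rightarrow> (nat \<Rightarrow> 'a::euclidean_space \<Rightarrow> 'b::euclidean_space) \<Rightarrow> ('a \<Rightarrow> 'b) \<Rightarrow> bool" where
  "Lp_tendsto p v u \<longleftrightarrow>
     (\<forall>k. memLp p (\<lambda>x. v k x - u x)) \<and> (\<lambda>k. Lp_norm p (\<lambda>x. v k x - u x)) \<longlonglongrightarrow> 0"

text \<open>Weak convergence in \<open>L\<^sup>p\<close> for \<open>1 < p < \<infinity>\<close>; \<open>p / (p - 1)\<close> is the conjugate exponent. For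
  complex vectors the pairing is the real part of the Hermitian product; testing also with
  \<open>\<i> \<phi>\<close> recovers the imaginary part.\<close>

definition weak_Lp_tendsto ::
  "real \<Rightarrow> (nat \<Rightarrow> 'a::euclidean_space \<Rightarrow> 'b::euclidean_space) \<Rightarrow> ('a \<Rightarrow> 'b) \<Rightarrow> bool" where
  "weak_Lp_tendsto p v u \<longleftrightarrow>
     (\<forall>m. memLp p (v m)) \<and> memLp p u \<and>
     (\<forall>\<phi>. memLp (p / (p - 1)) \<phi> \<longrightarrow>
        (\<lambda>m. LINT x|lebesgue. v m x \<bullet> \<phi> x) \<longlonglongrightarrow> (LINT x|lebesgue. u x \<bullet> \<phi> x))"

definition locally_integrable :: "('a::euclidean_space \<Rightarrow> 'b::euclidean_space) \<Rightarrow> bool" where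
  "locally_integrable f \<longleftrightarrow> (\<forall>K. compact K \<longrightarrow> set_integrable lebesgue K f)"


section \<open>Smooth functions and weak gradients\<close>

definition partial_deriv :: "'n \<Rightarrow> (real^'n::finite \<Rightarrow> real) \<Rightarrow> real^'n \<Rightarrow> real" where
  "partial_deriv i f x = frechet_derivative f (at x) (axis i 1)"

definition partial_derivs :: "'n list \<Rightarrow> (real^'n::finite \<Rightarrow> real) \<Rightarrow> real^'n \<Rightarrow> real" where
  "partial_derivs is f = foldr partial_deriv is f"

definition smooth :: "(real^'n::finite \<Rightarrow> real) \<Rightarrow> bool" where
  "smooth f \<longleftrightarrow> (\<forall>is x. partial_derivs is f differentiable (at x))"

definition test_function :: "(real^'n::finite \<Rightarrow> real) \<Rightarrow> bool" where
  "test_function \<phi> \<longleftrightarrow> smooth \<phi> \<and> compact (closure {x. \<phi> x \<noteq> 0})"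

definition schwartz :: "(real^'n::finite \<Rightarrow> real) \<Rightarrow> bool" where
  "schwartz f \<longleftrightarrow>
     smooth f \<and> (\<forall>is k. bounded (range (\<lambda>x. norm x ^ k * partial_derivs is f x)))"

definition is_weak_gradient ::
  "(real^'n::finite \<Rightarrow> real^'N::finite) \<Rightarrow> (real^'n \<Rightarrow> real^'n^'N) \<Rightarrow> bool" where
  "is_weak_gradient u G \<longleftrightarrow>
     locally_integrable u \<and> locally_integrable G \<and>
     (\<forall>\<phi> \<alpha> i. test_function \<phi> \<longrightarrow>
        (LINT x|lebesgue. u x $ \<alpha> * partial_deriv i \<phi> x)
          = - (LINT x|lebesgue. G x $ \<alpha> $ i * \<phi> x))"

text \<open>A weak gradient is unique up to null sets, so the choice of a representative is harmless.\<close>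

definition weak_gradient ::
  "(real^'n::finite \<Rightarrow> real^'N::finite) \<Rightarrow> real^'n \<Rightarrow> real^'n^'N" where
  "weak_gradient u = (SOME G. is_weak_gradient u G)"

definition sobolev_exponent :: "nat \<Rightarrow> real" where
  "sobolev_exponent n = 2 * real n / (real n - 2)"

text \<open>The space \<open>W\<^sup>1\<close> with exponents \<open>p\<close> for the function and \<open>q\<close> for its gradient.\<close>

definition W1 :: "real \<Rightarrow> real \<Rightarrow> (real^'n::finite \<Rightarrow> real^'N::finite) set" where
  "W1 p q = {u. memLp p u \<and> (\<exists>G. is_weak_gradient u G) \<and> memLp q (weak_gradient u)}"


section \<open>Linear maps on matrices\<close>

definition tensor :: "real^'N::finite \<Rightarrow> real^'n::finite \<Rightarrow> real^'n^'N" where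
  "tensor \<eta> a = (\<chi> \<beta> j. \<eta> $ \<beta> * a $ j)"

definition matrix_unit :: "'N::finite \<Rightarrow> 'n::finite \<Rightarrow> real^'n^'N" where
  "matrix_unit \<beta> j = (\<chi> \<beta>' j'. if \<beta>' = \<beta> \<and> j' = j then 1 else 0)"

definition tensor_component ::
  "(real^'n::finite^'N::finite \<Rightarrow> real^'N) \<Rightarrow> 'N \<Rightarrow> 'N \<Rightarrow> 'n \<Rightarrow> real" where
  "tensor_component A \<alpha> \<beta> j = A (matrix_unit \<beta> j) $ \<alpha>"

lemma linear_tensor_component:
  fixes A :: "real^'n::finite^'N::finite \<Rightarrow> real^'N"
  assumes "linear A"
  shows "A Q $ \<alpha> = (\<Sum>\<beta>\<in>UNIV. \<Sum>j\<in>UNIV. tensor_component A \<alpha> \<beta> j * Q $ \<beta> $ j)"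
proof -
  have "(\<Sum>\<beta>\<in>UNIV. \<Sum>j\<in>UNIV. Q $ \<beta> $ j *\<^sub>R matrix_unit \<beta> j) $ b $ c = Q $ b $ c" for b c
  proof -
    have "(\<Sum>\<beta>\<in>UNIV. \<Sum>j\<in>UNIV. Q $ \<beta> $ j *\<^sub>R matrix_unit \<beta> j) $ b $ c
        = (\<Sum>\<beta>\<in>UNIV. if b = \<beta> then (\<Sum>j\<in>UNIV. if c = j then Q $ \<beta> $ j else 0) else 0)"
      unfolding sum_component by (rule sum.cong) (auto simp: matrix_unit_def if_distrib cong: if_cong)
    then show ?thesis by simp
  qed
  then have "Q = (\<Sum>\<beta>\<in>UNIV. \<Sum>j\<in>UNIV. Q $ \<beta> $ j *\<^sub>R matrix_unit \<beta> j)"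
    unfolding vec_eq_iff by metis
  then have "A Q = A (\<Sum>\<beta>\<in>UNIV. \<Sum>j\<in>UNIV. Q $ \<beta> $ j *\<^sub>R matrix_unit \<beta> j)"
    by (rule arg_cong)
  also have "\<dots> = (\<Sum>\<beta>\<in>UNIV. \<Sum>j\<in>UNIV. Q $ \<beta> $ j *\<^sub>R A (matrix_unit \<beta> j))"
    using assms by (simp add: linear_sum linear_cmul)
  finally show ?thesis
    by (simp add: tensor_component_def mult.commute)
qed

text \<open>The matrix \<open>Aa\<close>.\<close>

definition symbol :: "(real^'n::finite^'N::finite \<Rightarrow> real^'N) \<Rightarrow> real^'n \<Rightarrow> real^'N^'N" where
  "symbol A a = (\<chi> \<alpha> \<beta>. \<Sum>j\<in>UNIV. tensor_component A \<alpha> \<beta> j * a $ j)"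

text \<open>The \<open>(i, j)\<close> cofactor: instead of deleting row \<open>i\<close> and column \<open>j\<close> (and inserting the sign),
  row \<open>i\<close> is replaced by the \<open>j\<close>-th unit vector.\<close>

definition cof :: "real^'k::finite^'k \<Rightarrow> real^'k^'k" where
  "cof X = (\<chi> i j. det (\<chi> r. if r = i then axis j 1 else X $ r))"

lemma det_replace_row:
  fixes X :: "real^'k::finite^'k"
  shows "(\<Sum>j\<in>UNIV. a $ j * cof X $ i $ j) = det (\<chi> r. if r = i then a else X $ r)"
proof -
  have "(\<Sum>j\<in>UNIV. a $ j * cof X $ i $ j)
      = (\<Sum>j\<in>UNIV. det (\<chi> r. if r = i then a $ j *s axis j 1 else X $ r))"
    by (simp add: cof_def det_row_mul)
  also have "\<dots> = det (\<chi> r. if r = i then (\<Sum>j\<in>UNIV. a $ j *s axis j 1) else X $ r)"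
    by (rule det_linear_row_sum[symmetric]) simp
  finally show ?thesis unfolding basis_expansion .
qed

lemma matrix_mult_transpose_cof: "X ** transpose (cof X) = det X *\<^sub>R mat 1"
proof -
  have "(\<Sum>j\<in>UNIV. X $ i $ j * cof X $ k $ j) = (if i = k then det X else 0)" for i k
  proof (cases "i = k")
    case True
    have "(\<chi> r. if r = k then X $ k else X $ r) = X"
      by (auto simp: vec_eq_iff)
    then show ?thesis
      using True by (simp add: det_replace_row)
  next
    case False
    have "det (\<chi> r. if r = k then X $ i else X $ r) = 0"
      by (rule det_identical_rows[OF False]) (use False in \<open>simp add: row_def vec_eq_iff\<close>)
    then show ?thesis using False by (simp add: det_replace_row)
  qed
  then show ?thesis
    by (simp add: vec_eq_iff matrix_matrix_mult_def transpose_def mat_def)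
qed


section \<open>Fourier transform and convolution\<close>

definition fourier_int :: "(real^'n::finite \<Rightarrow> complex) \<Rightarrow> real^'n \<Rightarrow> complex" where
  "fourier_int g z =
     (LINT x|lebesgue. g x * exp (- (2 * complex_of_real pi * \<i> * complex_of_real (x \<bullet> z))))"

definition inv_fourier_int :: "(real^'n::finite \<Rightarrow> complex) \<Rightarrow> real^'n \<Rightarrow> complex" where
  "inv_fourier_int g x =
     (LINT z|lebesgue. g z * exp (2 * complex_of_real pi * \<i> * complex_of_real (x \<bullet> z)))"

text \<open>Extension by continuity to \<open>L\<^sup>2\<close> of an operator given on \<open>L\<^sup>1 \<inter> L\<^sup>2\<close>. For the two
  operators above the result is determined up to null sets by Plancherel's theorem.\<close>

definition L2_extension ::
  "((real^'n::finite \<Rightarrow> complex) \<Rightarrow> real^'n \<Rightarrow> complex) \<Rightarrow>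
   (real^'n \<Rightarrow> complex) \<Rightarrow> real^'n \<Rightarrow> complex" where
  "L2_extension T g = (SOME G. memLp 2 G \<and>
     (\<exists>gk. (\<forall>k. memLp 1 (gk k) \<and> memLp 2 (gk k)) \<and>
       Lp_tendsto 2 gk g \<and> Lp_tendsto 2 (\<lambda>k. T (gk k)) G))"

definition fourier_L2 ::
  "(real^'n::finite \<Rightarrow> complex^'N::finite) \<Rightarrow> real^'n \<Rightarrow> complex^'N" where
  "fourier_L2 F z = (\<chi> \<alpha>. L2_extension fourier_int (\<lambda>x. F x $ \<alpha>) z)"

definition inv_fourier_L2 ::
  "(real^'n::finite \<Rightarrow> complex^'N::finite) \<Rightarrow> real^'n \<Rightarrow> complex^'N" where
  "inv_fourier_L2 F x = (\<chi> \<alpha>. L2_extension inv_fourier_int (\<lambda>z. F z $ \<alpha>) x)"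

definition convolution ::
  "(real^'n::finite \<Rightarrow> complex) \<Rightarrow> (real^'n \<Rightarrow> complex^'N::finite) \<Rightarrow> real^'n \<Rightarrow> complex^'N" where
  "convolution g F x = (\<chi> \<alpha>. LINT y|lebesgue. g (x - y) * F y $ \<alpha>)"

definition cvec :: "real^'N::finite \<Rightarrow> complex^'N" where
  "cvec v = (\<chi> \<alpha>. complex_of_real (v $ \<alpha>))"


section \<open>The system and its representation formula\<close>

definition solves ::
  "(real^'n::finite^'N::finite \<Rightarrow> real^'N) \<Rightarrow> (real^'n \<Rightarrow> real^'N) \<Rightarrow> (real^'n \<Rightarrow> real^'N) \<Rightarrow> bool" where
  "solves A f u \<longleftrightarrow>
     u \<in> W1 (sobolev_exponent CARD('n)) 2 \<and> (AE x in lebesgue. A (weak_gradient u x) = f x)"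

definition multiplier ::
  "(real^'n::finite^'N::finite \<Rightarrow> real^'N) \<Rightarrow> real^'n \<Rightarrow> real^'N^'N" where
  "multiplier A z =
     (1 / det (symbol A (sgn z))) *\<^sub>R transpose (cof (symbol A (sgn z)))"

definition approximant ::
  "(real^'n::finite^'N::finite \<Rightarrow> real^'N) \<Rightarrow> (real^'n \<Rightarrow> real^'N) \<Rightarrow> (real^'n \<Rightarrow> real) \<Rightarrow>
   real^'n \<Rightarrow> complex^'N" where
  "approximant A f h x =
     (- (1 / (2 * complex_of_real pi * \<i>))) *s
       convolution (fourier_int (\<lambda>y. complex_of_real (h y)))
         (fourier_L2 (\<lambda>z. map_matrix complex_of_real (multiplier A z) *v
            inv_fourier_L2 (\<lambda>y. cvec (f y)) z)) x"

definition admissible_sequence :: "(nat \<Rightarrow> real^'n::finite \<Rightarrow> real) \<Rightarrow> bool" where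
  "admissible_sequence h \<longleftrightarrow>
     (\<forall>m. schwartz (h m) \<and> (\<forall>x. h m (- x) = h m x)) \<and>
     (AE x in lebesgue. (\<forall>m. 0 \<le> h m x \<and> h m x \<le> 1 / norm x) \<and>
        (\<lambda>m. h m x) \<longlonglongrightarrow> 1 / norm x)"

text \<open>Almost everywhere convergence up to subsequences: every subsequence has a further subsequence
  converging almost everywhere to the same limit. Convergence almost everywhere along the whole
  sequence fails for some admissible sequences and some \<open>f\<close>: if \<open>g\<close> is the inverse Fourier
  transform of \<open>f\<close> multiplied by the multiplier, then \<open>g(x) / \<bar>x\<bar>\<close> need not be integrable at
  infinity (as \<open>n \<ge> 3\<close>), and cutting suitable subsets of far away annuli out of \<open>1 / \<bar>x\<bar>\<close>, which does
  not affect the pointwise limit, makes the approximants unbounded at every point.\<close>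

definition AE_tendsto_subseq ::
  "(nat \<Rightarrow> 'a::euclidean_space \<Rightarrow> 'b::euclidean_space) \<Rightarrow> ('a \<Rightarrow> 'b) \<Rightarrow> bool" where
  "AE_tendsto_subseq v u \<longleftrightarrow>
     (\<forall>s::nat \<Rightarrow> nat. strict_mono s \<longrightarrow>
        (\<exists>r::nat \<Rightarrow> nat. strict_mono r \<and> (AE x in lebesgue. (\<lambda>m. v (s (r m)) x) \<longlonglongrightarrow> u x)))"

end

theory Submission
  imports Defs "HOL-Probability.Probability"
begin

text \<open>Everything happens on the Fourier side. There \<open>A:Du = f\<close> becomes the linear system
\<open>2\<pi>i (Az) u^(z) = f^(z)\<close> at each frequency \<open>z\<close> (up to the sign fixed by the convention for the
transform). The ellipticity bound makes the symbol \<open>A sgn z\<close> invertible, and its inverse, the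
multiplier \<open>cof\<^sup>T / det\<close>, is bounded by \<open>1 / \<nu>\<close>. So the density
\<open>G = multiplier \<cdot> (inverse transform of f)\<close> is square integrable, \<open>u\<close> has to be
\<open>-1/(2\<pi>i)\<close> times the transform of \<open>w = G / \<bar>z\<bar>\<close>, and \<open>D\<^sub>j u\<close> the transform of
\<open>z\<^sub>j G / \<bar>z\<bar>\<close>. The estimate for \<open>Du\<close> is then Plancherel's theorem, which is proved on
\<open>L\<^sup>1 \<inter> L\<^sup>2\<close> by testing the autocorrelation against Gaussians (\<open>plancherel\<close>) and extended
to \<open>L\<^sup>2\<close> by density (\<open>fourier_L2_inversion\<close>).

As \<open>n \<ge> 3\<close>, the function \<open>w\<close> is integrable near the origin and square integrable away from it, so
its transform makes sense (\<open>fourier_ext\<close>). That it lies in \<open>L\<^sup>p\<close> with \<open>p = 2n/(n-2)\<close>, with norm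
at most a constant times the \<open>L\<^sup>2\<close> norm of \<open>\<bar>z\<bar>w\<close>, is the Sobolev inequality
(\<open>sobolev_fourier_ext\<close>). It follows from a splitting of frequencies due to Chemin and Xu: for each
level \<open>\<lambda>\<close> the frequency radius is chosen so that the low part is at most \<open>\<lambda>/2\<close> everywhere; Chebyshev's
inequality for the high part bounds the measure of \<open>{\<bar>u\<bar> > \<lambda>}\<close>, and integration over \<open>\<lambda>\<close> closes the
argument.

Uniqueness (\<open>homogeneous_zero\<close>): a weak gradient is curl free, hence on the Fourier side a rank-one
matrix \<open>\<eta> \<otimes> z\<close>. If \<open>A\<close> annihilates it, ellipticity forces \<open>\<eta> = 0\<close>. A function in \<open>L\<^sup>p\<close> with zero
weak gradient vanishes, because pairing it with a test function gives the same value for all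
translates of the test function, and this value tends to zero along an escaping sequence of
translates.

Representation: the duality between the two transforms identifies the approximant for \<open>h\<close> at every
point with \<open>-1/(2\<pi>i)\<close> times the transform of \<open>h G\<close>. Its distance to \<open>u\<close> in \<open>L\<^sup>p\<close> is, by the Sobolev
inequality, at most a constant times the \<open>L\<^sup>2\<close> norm of \<open>(\<bar>z\<bar>h - 1)G\<close>, which tends to zero by dominated
convergence. So the approximants converge strongly in \<open>L\<^sup>p\<close> (\<open>approximant_converges\<close>), which gives
weak convergence and almost everywhere convergence along subsequences.\<close>

section \<open>Square integrable functions\<close>

text \<open>The squared norm is the convenient quantity: \<open>sq_norm (f + g) \<le> 2 sq_norm f + 2 sq_norm g\<close> is all
that is needed of the triangle inequality, and limits of integrals apply to it directly.\<close>

definition sq_norm :: "('a::euclidean_space \<Rightarrow> 'b::euclidean_space) \<Rightarrow> real" where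
  "sq_norm f = (LINT x|lebesgue. (norm (f x))\<^sup>2)"

lemma powr_two: "0 \<le> (x::real) \<Longrightarrow> x powr 2 = x\<^sup>2"
  by (cases "x = 0") auto

lemma memLp_2_iff:
  "memLp 2 f \<longleftrightarrow> f \<in> borel_measurable lebesgue \<and> integrable lebesgue (\<lambda>x. (norm (f x))\<^sup>2)"
  by (simp add: memLp_def powr_two)

lemma memLp_1_iff: "memLp 1 f \<longleftrightarrow> integrable lebesgue f"
  by (auto simp: memLp_def integrable_norm_iff)

lemma Lp_norm_2: "Lp_norm 2 f = sqrt (sq_norm f)"
  by (simp add: Lp_norm_def sq_norm_def powr_two powr_half_sqrt)

lemma memLp_measurable: "memLp p f \<Longrightarrow> f \<in> borel_measurable lebesgue"
  by (simp add: memLp_def)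

lemma sq_norm_nonneg [simp]: "0 \<le> sq_norm f"
  by (simp add: sq_norm_def)

lemma sq_norm_cong_AE:
  assumes "f \<in> borel_measurable lebesgue" "g \<in> borel_measurable lebesgue"
    and "AE x in lebesgue. f x = g x"
  shows "sq_norm f = sq_norm g"
  unfolding sq_norm_def using assms by (intro integral_cong_AE) auto

lemma memLp_cong_AE:
  assumes "memLp p f" "g \<in> borel_measurable lebesgue" "AE x in lebesgue. f x = g x"
  shows "memLp p g"
proof -
  have [measurable]: "f \<in> borel_measurable lebesgue" "g \<in> borel_measurable lebesgue"
    using assms by (auto simp: memLp_def)
  have "integrable lebesgue (\<lambda>x. norm (g x) powr p)"
    using assms unfolding memLp_def
    by (subst integrable_cong_AE[of _ _ "\<lambda>x. norm (f x) powr p"]) auto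
  then show ?thesis using assms by (auto simp: memLp_def)
qed

text \<open>Lebesgue measure is complete, so a change on a null set preserves measurability.\<close>

lemma measurable_AE_eq:
  fixes f g :: "'a::euclidean_space \<Rightarrow> 'b::euclidean_space"
  assumes "f \<in> borel_measurable lebesgue" "AE x in lebesgue. f x = g x"
  shows "g \<in> borel_measurable lebesgue"
proof -
  obtain N where N0: "\<And>x. x \<in> space lebesgue - N \<Longrightarrow> f x = g x" and N1: "N \<in> null_sets lebesgue"
    by (rule AE_E3[OF assms(2)]) (rule that)
  then have N: "{x. f x \<noteq> g x} \<subseteq> N" by auto
  show ?thesis
  proof (rule borel_measurableI)
    fix S :: "'b set" assume "open S"
    have 1: "f -` S \<in> sets lebesgue"
      using measurable_sets[OF assms(1), of S] \<open>open S\<close> by auto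
    have "g -` S = (f -` S - {x. f x \<noteq> g x}) \<union> ({x. f x \<noteq> g x} \<inter> g -` S)"
      by auto
    moreover have "{x. f x \<noteq> g x} \<in> null_sets lebesgue" "{x. f x \<noteq> g x} \<inter> g -` S \<in> null_sets lebesgue"
      using N by (auto intro!: null_sets_completion_subset[OF _ N1])
    then have "{x. f x \<noteq> g x} \<in> sets lebesgue" "{x. f x \<noteq> g x} \<inter> g -` S \<in> sets lebesgue"
      by blast+
    ultimately have "g -` S \<in> sets lebesgue"
      using 1 by (metis sets.Un sets.Diff)
    then show "g -` S \<inter> space lebesgue \<in> sets lebesgue" by simp
  qed
qed

lemma memLp_cong_AE':
  assumes "memLp p f" "AE x in lebesgue. f x = g x"
  shows "memLp p g"
  by (rule memLp_cong_AE[OF assms(1) measurable_AE_eq assms(2)])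
     (use assms in \<open>auto simp: memLp_def\<close>)

lemma memLp_2_bound:
  fixes g :: "'a::euclidean_space \<Rightarrow> 'b::euclidean_space" and f :: "'a \<Rightarrow> 'c::euclidean_space"
  assumes f: "memLp 2 f" and [measurable]: "g \<in> borel_measurable lebesgue"
    and le: "AE x in lebesgue. norm (g x) \<le> C * norm (f x)"
  shows "memLp 2 g" "sq_norm g \<le> C\<^sup>2 * sq_norm f"
proof -
  have le': "AE x in lebesgue. (norm (g x))\<^sup>2 \<le> C\<^sup>2 * (norm (f x))\<^sup>2"
    using le
  proof eventually_elim
    case (elim x)
    then have "(norm (g x))\<^sup>2 \<le> (C * norm (f x))\<^sup>2" by (intro power_mono) auto
    then show ?case by (simp add: power_mult_distrib)
  qed
  have int: "integrable lebesgue (\<lambda>x. C\<^sup>2 * (norm (f x))\<^sup>2)"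
    using f by (auto simp: memLp_2_iff)
  have i2: "integrable lebesgue (\<lambda>x. (norm (g x))\<^sup>2)"
    using le' by (intro Bochner_Integration.integrable_bound[OF int]) auto
  then show "memLp 2 g" by (simp add: memLp_2_iff)
  show "sq_norm g \<le> C\<^sup>2 * sq_norm f"
    using integral_mono_AE[OF i2 int le'] by (simp add: sq_norm_def)
qed

lemma norm_add_sq_le: "(norm (a + b))\<^sup>2 \<le> 2 * (norm a)\<^sup>2 + 2 * (norm (b::'a::real_normed_vector))\<^sup>2"
proof -
  have "(norm (a + b))\<^sup>2 \<le> (norm a + norm b)\<^sup>2"
    by (intro power_mono norm_triangle_ineq) auto
  also have "\<dots> \<le> 2 * (norm a)\<^sup>2 + 2 * (norm b)\<^sup>2"
    using sum_squares_bound[of "norm a" "norm b"] by (simp add: power2_sum)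
  finally show ?thesis .
qed

lemma memLp_2_add:
  assumes "memLp 2 f" "memLp 2 g"
  shows "memLp 2 (\<lambda>x. f x + g x)" and sq_norm_add_le: "sq_norm (\<lambda>x. f x + g x) \<le> 2 * sq_norm f + 2 * sq_norm g"
proof -
  have [measurable]: "f \<in> borel_measurable lebesgue" "g \<in> borel_measurable lebesgue"
    using assms by (auto simp: memLp_def)
  have int: "integrable lebesgue (\<lambda>x. 2 * (norm (f x))\<^sup>2 + 2 * (norm (g x))\<^sup>2)"
    using assms by (auto simp: memLp_2_iff)
  have i2: "integrable lebesgue (\<lambda>x. (norm (f x + g x))\<^sup>2)"
    by (rule Bochner_Integration.integrable_bound[OF int]) (auto intro!: AE_I2 norm_add_sq_le)
  then show "memLp 2 (\<lambda>x. f x + g x)" by (simp add: memLp_2_iff)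
  have "sq_norm (\<lambda>x. f x + g x) \<le> (LINT x|lebesgue. 2 * (norm (f x))\<^sup>2 + 2 * (norm (g x))\<^sup>2)"
    unfolding sq_norm_def using i2 int by (intro integral_mono norm_add_sq_le)
  also have "\<dots> = 2 * sq_norm f + 2 * sq_norm g"
    using assms by (simp add: sq_norm_def memLp_2_iff)
  finally show "sq_norm (\<lambda>x. f x + g x) \<le> 2 * sq_norm f + 2 * sq_norm g" .
qed

lemma memLp_2_uminus: "memLp 2 f \<Longrightarrow> memLp 2 (\<lambda>x. - f x)"
  by (simp add: memLp_2_iff)

lemma sq_norm_uminus: "sq_norm (\<lambda>x. - f x) = sq_norm f"
  by (simp add: sq_norm_def)

lemma memLp_2_diff:
  assumes "memLp 2 f" "memLp 2 g"
  shows "memLp 2 (\<lambda>x. f x - g x)" and sq_norm_diff_le: "sq_norm (\<lambda>x. f x - g x) \<le> 2 * sq_norm f + 2 * sq_norm g"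
  using memLp_2_add[OF assms(1) memLp_2_uminus[OF assms(2)]] sq_norm_add_le[OF assms(1) memLp_2_uminus[OF assms(2)]]
  by (auto simp: sq_norm_uminus)

lemma memLp_2_cmult:
  fixes f :: "'a::euclidean_space \<Rightarrow> complex"
  assumes "memLp 2 f"
  shows "memLp 2 (\<lambda>x. c * f x)" "sq_norm (\<lambda>x. c * f x) = (norm c)\<^sup>2 * sq_norm f"
  using assms by (auto simp: memLp_2_iff sq_norm_def norm_mult power_mult_distrib)

lemma sq_norm_eq_0_iff:
  assumes "memLp 2 f"
  shows "sq_norm f = 0 \<longleftrightarrow> (AE x in lebesgue. f x = 0)"
  unfolding sq_norm_def using assms
  by (subst integral_nonneg_eq_0_iff_AE) (auto simp: memLp_2_iff)

lemma L2_product_integrable: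
  assumes "memLp 2 f" "memLp 2 g"
  shows "integrable lebesgue (\<lambda>x. norm (f x) * norm (g x))"
proof -
  have [measurable]: "f \<in> borel_measurable lebesgue" "g \<in> borel_measurable lebesgue"
    using assms by (auto simp: memLp_def)
  have int: "integrable lebesgue (\<lambda>x. (norm (f x))\<^sup>2 + (norm (g x))\<^sup>2)"
    using assms by (auto simp: memLp_2_iff)
  show ?thesis
  proof (rule Bochner_Integration.integrable_bound[OF int])
    show "(\<lambda>x. norm (f x) * norm (g x)) \<in> borel_measurable lebesgue" by measurable
    show "AE x in lebesgue. norm (norm (f x) * norm (g x)) \<le> norm ((norm (f x))\<^sup>2 + (norm (g x))\<^sup>2)"
    proof (rule AE_I2)
    fix x show "norm (norm (f x) * norm (g x)) \<le> norm ((norm (f x))\<^sup>2 + (norm (g x))\<^sup>2)"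
      using sum_squares_bound[of "norm (f x)" "norm (g x)"]
        mult_nonneg_nonneg[OF norm_ge_zero norm_ge_zero, of "f x" "g x"]
      by (simp only: real_norm_def abs_of_nonneg sum_power2_ge_zero)
    qed
  qed
qed

lemma L2_Cauchy_Schwarz:
  assumes f: "memLp 2 f" and g: "memLp 2 g"
  shows "(LINT x|lebesgue. norm (f x) * norm (g x)) \<le> sqrt (sq_norm f) * sqrt (sq_norm g)"
proof -
  let ?r = "sqrt (sq_norm f)" and ?s = "sqrt (sq_norm g)"
  let ?I = "LINT x|lebesgue. norm (f x) * norm (g x)"
  have [measurable]: "f \<in> borel_measurable lebesgue" "g \<in> borel_measurable lebesgue"
    using assms by (auto simp: memLp_def)
  note int = L2_product_integrable[OF f g]
  show ?thesis
  proof (cases "?r = 0 \<or> ?s = 0")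
    case True
    then have "(AE x in lebesgue. f x = 0) \<or> (AE x in lebesgue. g x = 0)"
      using sq_norm_eq_0_iff[OF f] sq_norm_eq_0_iff[OF g] by simp
    then have "AE x in lebesgue. norm (f x) * norm (g x) = 0"
      by auto
    then have "?I = 0"
      using integral_cong_AE[of "\<lambda>x. norm (f x) * norm (g x)" lebesgue "\<lambda>x. 0"] by simp
    then show ?thesis by simp
  next
    case False
    then have pos: "0 < ?r * ?s" by (simp add: less_le)
    have "0 \<le> (LINT x|lebesgue. (?s * norm (f x) - ?r * norm (g x))\<^sup>2)" by simp
    also have "\<dots> = (LINT x|lebesgue. ?s\<^sup>2 * (norm (f x))\<^sup>2 + ?r\<^sup>2 * (norm (g x))\<^sup>2 - 2 * (?r * ?s) * (norm (f x) * norm (g x)))"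
      by (intro Bochner_Integration.integral_cong) (auto simp: power2_diff power_mult_distrib algebra_simps)
    also have "\<dots> = ?s\<^sup>2 * sq_norm f + ?r\<^sup>2 * sq_norm g - 2 * (?r * ?s) * ?I"
      using f g int by (simp add: memLp_2_iff sq_norm_def)
    also have "\<dots> = 2 * (?r * ?s) * (?r * ?s - ?I)"
      by (simp add: algebra_simps power2_eq_square)
    finally have "0 \<le> ?r * ?s - ?I"
      using pos by (simp add: zero_le_mult_iff)
    then show ?thesis by simp
  qed
qed

text \<open>Every pairing dominated by the product of the norms (in particular the inner product, and the
  product of complex numbers) is continuous in each argument for the \<open>L\<^sup>2\<close> norm.\<close>

lemma L2_pairing:
  fixes f :: "'a::euclidean_space \<Rightarrow> 'b::euclidean_space" and g :: "'a \<Rightarrow> 'c::euclidean_space"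
    and prod :: "'b \<Rightarrow> 'c \<Rightarrow> 'd::euclidean_space"
  assumes f: "memLp 2 f" and g: "memLp 2 g"
    and bl: "bounded_bilinear prod" and le: "\<And>a b. norm (prod a b) \<le> norm a * norm b"
  shows "integrable lebesgue (\<lambda>x. prod (f x) (g x))"
    and "norm (LINT x|lebesgue. prod (f x) (g x)) \<le> sqrt (sq_norm f) * sqrt (sq_norm g)"
proof -
  have [measurable]: "f \<in> borel_measurable lebesgue" "g \<in> borel_measurable lebesgue"
    using assms by (auto simp: memLp_def)
  have m: "(\<lambda>x. prod (f x) (g x)) \<in> borel_measurable lebesgue"
    by (rule borel_measurable_continuous_Pair[where H=prod])
       (auto intro!: continuous_intros bounded_bilinear.continuous_on[OF bl])
  show int: "integrable lebesgue (\<lambda>x. prod (f x) (g x))"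
    by (rule Bochner_Integration.integrable_bound[OF L2_product_integrable[OF f g] m])
       (use le in \<open>auto intro!: AE_I2\<close>)
  have "norm (LINT x|lebesgue. prod (f x) (g x)) \<le> (LINT x|lebesgue. norm (prod (f x) (g x)))"
    by (rule integral_norm_bound)
  also have "\<dots> \<le> (LINT x|lebesgue. norm (f x) * norm (g x))"
    by (intro integral_mono integrable_norm int L2_product_integrable f g le)
  also have "\<dots> \<le> sqrt (sq_norm f) * sqrt (sq_norm g)"
    by (rule L2_Cauchy_Schwarz[OF f g])
  finally show "norm (LINT x|lebesgue. prod (f x) (g x)) \<le> sqrt (sq_norm f) * sqrt (sq_norm g)" .
qed

lemma L2_pairing_tendsto:
  fixes f :: "'a::euclidean_space \<Rightarrow> 'b::euclidean_space" and g :: "'a \<Rightarrow> 'c::euclidean_space"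
    and prod :: "'b \<Rightarrow> 'c \<Rightarrow> 'd::euclidean_space"
  assumes fk: "\<And>k. memLp 2 (fk k)" and f: "memLp 2 f" and g: "memLp 2 g"
    and bl: "bounded_bilinear prod" and le: "\<And>a b. norm (prod a b) \<le> norm a * norm b"
    and lim: "(\<lambda>k. sq_norm (\<lambda>x. fk k x - f x)) \<longlonglongrightarrow> 0"
  shows "(\<lambda>k. LINT x|lebesgue. prod (fk k x) (g x)) \<longlonglongrightarrow> (LINT x|lebesgue. prod (f x) (g x))"
proof -
  have d: "memLp 2 (\<lambda>x. fk k x - f x)" for k by (intro memLp_2_diff fk f)
  have eq: "(LINT x|lebesgue. prod (fk k x) (g x)) - (LINT x|lebesgue. prod (f x) (g x))
      = (LINT x|lebesgue. prod (fk k x - f x) (g x))" for k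
    by (subst Bochner_Integration.integral_diff[symmetric])
       (auto intro!: L2_pairing(1)[OF _ g bl le] fk f simp: bounded_bilinear.diff_left[OF bl])
  have "(\<lambda>k. sqrt (sq_norm (\<lambda>x. fk k x - f x)) * sqrt (sq_norm g)) \<longlonglongrightarrow> sqrt 0 * sqrt (sq_norm g)"
    by (intro tendsto_intros lim)
  then have "(\<lambda>k. sqrt (sq_norm (\<lambda>x. fk k x - f x)) * sqrt (sq_norm g)) \<longlonglongrightarrow> 0" by simp
  then have "(\<lambda>k. (LINT x|lebesgue. prod (fk k x) (g x)) - (LINT x|lebesgue. prod (f x) (g x))) \<longlonglongrightarrow> 0"
    by (rule Lim_null_comparison[rotated]) (auto intro!: always_eventually simp: eq L2_pairing(2)[OF d g bl le])
  then show ?thesis by (simp add: LIM_zero_iff)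
qed

lemma complex_mult_pairing: "bounded_bilinear ((*) :: complex \<Rightarrow> complex \<Rightarrow> complex)"
  "norm ((a::complex) * b) \<le> norm a * norm b"
  by (auto simp: bounded_bilinear_mult norm_mult)

lemma inner_pairing: "bounded_bilinear ((\<bullet>) :: 'b::euclidean_space \<Rightarrow> 'b \<Rightarrow> real)"
  "norm ((a::'b) \<bullet> b) \<le> norm a * norm b"
  by (auto simp: bounded_bilinear_inner Cauchy_Schwarz_ineq2)

lemmas L2_mult_integrable = L2_pairing(1)[OF _ _ complex_mult_pairing]
lemmas L2_mult_tendsto = L2_pairing_tendsto[OF _ _ _ complex_mult_pairing]
lemmas L2_inner_integrable = L2_pairing(1)[OF _ _ inner_pairing]
lemmas L2_inner_tendsto = L2_pairing_tendsto[OF _ _ _ inner_pairing]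

lemma sq_norm_add:
  assumes f: "memLp 2 f" and g: "memLp 2 g"
  shows "sq_norm (\<lambda>x. f x + g x) = sq_norm f + 2 * (LINT x|lebesgue. f x \<bullet> g x) + sq_norm g"
proof -
  have "(norm (f x + g x))\<^sup>2 = (norm (f x))\<^sup>2 + 2 * (f x \<bullet> g x) + (norm (g x))\<^sup>2" for x
    by (simp add: power2_norm_eq_inner inner_add_left inner_add_right inner_commute)
  then show ?thesis
    using f g L2_inner_integrable[OF f g] by (simp add: sq_norm_def memLp_2_iff)
qed

lemma sq_norm_tendsto:
  assumes fk: "\<And>k. memLp 2 (fk k)" and f: "memLp 2 f"
    and lim: "(\<lambda>k. sq_norm (\<lambda>x. fk k x - f x)) \<longlonglongrightarrow> 0"
  shows "(\<lambda>k. sq_norm (fk k)) \<longlonglongrightarrow> sq_norm f"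
proof -
  have d: "memLp 2 (\<lambda>x. fk k x - f x)" for k by (intro memLp_2_diff fk f)
  have "sq_norm (fk k) = sq_norm (\<lambda>x. (fk k x - f x)) + 2 * (LINT x|lebesgue. (fk k x - f x) \<bullet> f x) + sq_norm f" for k
    using sq_norm_add[OF d f] by simp
  moreover have "(\<lambda>k. LINT x|lebesgue. (fk k x - f x) \<bullet> f x) \<longlonglongrightarrow> (LINT x|lebesgue. 0 \<bullet> f x)"
    by (rule L2_inner_tendsto[OF d _ f]) (use lim in \<open>auto simp: memLp_2_iff\<close>)
  then have "(\<lambda>k. sq_norm (\<lambda>x. (fk k x - f x)) + 2 * (LINT x|lebesgue. (fk k x - f x) \<bullet> f x) + sq_norm f)
      \<longlonglongrightarrow> 0 + 2 * 0 + sq_norm f"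
    by (intro tendsto_intros lim) simp
  ultimately show ?thesis by simp
qed

lemma Lp_tendsto_2_iff:
  "Lp_tendsto 2 v u \<longleftrightarrow> (\<forall>k. memLp 2 (\<lambda>x. v k x - u x)) \<and> (\<lambda>k. sq_norm (\<lambda>x. v k x - u x)) \<longlonglongrightarrow> 0"
proof -
  have "((\<lambda>k. sqrt (sq_norm (\<lambda>x. v k x - u x))) \<longlonglongrightarrow> 0) \<longleftrightarrow> (\<lambda>k. sq_norm (\<lambda>x. v k x - u x)) \<longlonglongrightarrow> 0"
  proof
    assume "(\<lambda>k. sqrt (sq_norm (\<lambda>x. v k x - u x))) \<longlonglongrightarrow> 0"
    from tendsto_power[OF this, of 2] show "(\<lambda>k. sq_norm (\<lambda>x. v k x - u x)) \<longlonglongrightarrow> 0" by simp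
  next
    assume "(\<lambda>k. sq_norm (\<lambda>x. v k x - u x)) \<longlonglongrightarrow> 0"
    from tendsto_real_sqrt[OF this] show "(\<lambda>k. sqrt (sq_norm (\<lambda>x. v k x - u x))) \<longlonglongrightarrow> 0" by simp
  qed
  then show ?thesis by (simp add: Lp_tendsto_def Lp_norm_2)
qed

subsection \<open>Completeness\<close>

lemma L2_positive_weight:
  obtains \<rho> :: "'a::euclidean_space \<Rightarrow> real" where "memLp 2 \<rho>" "\<And>x. 0 < \<rho> x"
proof -
  obtain h :: "'a \<Rightarrow> real" where h: "h \<in> borel_measurable lborel" "\<And>x. 0 < h x" "integrable lborel h"
    using sigma_finite_measure.obtain_positive_integrable_function[OF sigma_finite_lborel] by (metis measurable_lborel1)
  have "memLp 2 (\<lambda>x. sqrt (h x))"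
    using h by (auto simp: memLp_2_iff less_imp_le integrable_completion intro!: measurable_completion)
  with h(2) that show ?thesis by force
qed

text \<open>Multiplication by a positive square integrable weight turns an \<open>L\<^sup>2\<close> Cauchy sequence into an
  \<open>L\<^sup>1\<close> Cauchy sequence, so a subsequence converges pointwise; Fatou's lemma then identifies its
  limit as the limit in \<open>L\<^sup>2\<close>.\<close>

lemma L2_complete:
  fixes f :: "nat \<Rightarrow> 'a::euclidean_space \<Rightarrow> 'b::euclidean_space"
  assumes f: "\<And>k. memLp 2 (f k)"
    and cauchy: "\<And>e. e > 0 \<Longrightarrow> \<exists>N. \<forall>i\<ge>N. \<forall>j\<ge>N. sq_norm (\<lambda>x. f i x - f j x) < e"
  obtains F where "memLp 2 F" "(\<lambda>k. sq_norm (\<lambda>x. f k x - F x)) \<longlonglongrightarrow> 0"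
proof -
  have [measurable]: "f k \<in> borel_measurable lebesgue" for k using f by (auto simp: memLp_def)
  obtain \<rho> :: "'a \<Rightarrow> real" where \<rho>: "memLp 2 \<rho>" "\<And>x. 0 < \<rho> x" by (rule L2_positive_weight) blast
  have d: "memLp 2 (\<lambda>x. f i x - f j x)" for i j by (intro memLp_2_diff f)
  have i1: "integrable lebesgue (\<lambda>x. \<rho> x *\<^sub>R f i x)" for i
    by (rule L2_pairing(1)[OF \<rho>(1) f bounded_bilinear_scaleR]) simp
  have "\<exists>N. \<forall>i\<ge>N. \<forall>j\<ge>N. (LINT x|lebesgue. norm (\<rho> x *\<^sub>R f i x - \<rho> x *\<^sub>R f j x)) < e" if "e > 0" for e
  proof -
    let ?R = "sqrt (sq_norm \<rho>) + 1"
    have R: "?R > 0" by (simp add: add_nonneg_pos)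
    obtain N where N: "\<forall>i\<ge>N. \<forall>j\<ge>N. sq_norm (\<lambda>x. f i x - f j x) < (e / ?R)\<^sup>2"
      using cauchy[OF zero_less_power[OF divide_pos_pos[OF \<open>e > 0\<close> R], of 2]] by metis
    show ?thesis
    proof (intro exI allI impI)
      fix i j assume ij: "i \<ge> N" "j \<ge> N"
      have "(LINT x|lebesgue. norm (\<rho> x *\<^sub>R f i x - \<rho> x *\<^sub>R f j x))
          = (LINT x|lebesgue. norm (\<rho> x) * norm (f i x - f j x))"
        by (simp add: scaleR_diff_right[symmetric])
      also have "\<dots> \<le> sqrt (sq_norm \<rho>) * sqrt (sq_norm (\<lambda>x. f i x - f j x))"
        by (rule L2_Cauchy_Schwarz[OF \<rho>(1) d])
      also have "\<dots> \<le> sqrt (sq_norm \<rho>) * (e / ?R)"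
        using N ij that R by (intro mult_left_mono real_le_lsqrt) (auto intro: less_imp_le)
      also have "\<dots> < ?R * (e / ?R)"
        using that R by (intro mult_strict_right_mono) auto
      also have "\<dots> = e" using R by simp
      finally show "(LINT x|lebesgue. norm (\<rho> x *\<^sub>R f i x - \<rho> x *\<^sub>R f j x)) < e" .
    qed
  qed
  from cauchy_L1_AE_cauchy_subseq[OF i1 this]
  obtain r where r: "strict_mono r" "AE x in lebesgue. Cauchy (\<lambda>i. \<rho> x *\<^sub>R f (r i) x)" by blast
  define F where "F x = lim (\<lambda>i. f (r i) x)" for x
  have conv: "AE x in lebesgue. (\<lambda>i. f (r i) x) \<longlonglongrightarrow> F x"
    using r(2)
  proof eventually_elim
    case (elim x)
    then have "convergent (\<lambda>i. \<rho> x *\<^sub>R f (r i) x)" by (simp add: Cauchy_convergent_iff)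
    then obtain l where "(\<lambda>i. \<rho> x *\<^sub>R f (r i) x) \<longlonglongrightarrow> l" by (auto simp: convergent_def)
    then have "(\<lambda>i. inverse (\<rho> x) *\<^sub>R (\<rho> x *\<^sub>R f (r i) x)) \<longlonglongrightarrow> inverse (\<rho> x) *\<^sub>R l"
      by (intro tendsto_intros)
    moreover have "inverse (\<rho> x) *\<^sub>R (\<rho> x *\<^sub>R f (r i) x) = f (r i) x" for i
      using \<rho>(2)[of x] by simp
    ultimately have "(\<lambda>i. f (r i) x) \<longlonglongrightarrow> inverse (\<rho> x) *\<^sub>R l" by simp
    then show ?case unfolding F_def using limI by force
  qed
  have [measurable]: "F \<in> borel_measurable lebesgue"
    unfolding F_def by measurable
  have fatou: "(\<integral>\<^sup>+x. ennreal ((norm (f k x - F x))\<^sup>2) \<partial>lebesgue) \<le> ennreal e"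
    if N: "\<forall>i\<ge>N. \<forall>j\<ge>N. sq_norm (\<lambda>x. f i x - f j x) < e" and k: "k \<ge> N" for e k N
  proof -
    have "(\<integral>\<^sup>+x. ennreal ((norm (f k x - F x))\<^sup>2) \<partial>lebesgue)
        = (\<integral>\<^sup>+x. liminf (\<lambda>i. ennreal ((norm (f k x - f (r i) x))\<^sup>2)) \<partial>lebesgue)"
    proof (rule nn_integral_cong_AE)
      show "AE x in lebesgue. ennreal ((norm (f k x - F x))\<^sup>2) = liminf (\<lambda>i. ennreal ((norm (f k x - f (r i) x))\<^sup>2))"
        using conv
      proof eventually_elim
        case (elim x)
        then have "(\<lambda>i. ennreal ((norm (f k x - f (r i) x))\<^sup>2)) \<longlonglongrightarrow> ennreal ((norm (f k x - F x))\<^sup>2)"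
          by (intro tendsto_intros tendsto_ennrealI)
        then show ?case by (intro lim_imp_Liminf[symmetric]) simp_all
      qed
    qed
    also have "\<dots> \<le> liminf (\<lambda>i. \<integral>\<^sup>+x. ennreal ((norm (f k x - f (r i) x))\<^sup>2) \<partial>lebesgue)"
      by (rule nn_integral_liminf) measurable
    also have "\<dots> \<le> ennreal e"
    proof (rule Liminf_le)
      show "\<forall>\<^sub>F i in sequentially. (\<integral>\<^sup>+x. ennreal ((norm (f k x - f (r i) x))\<^sup>2) \<partial>lebesgue) \<le> ennreal e"
        using eventually_ge_at_top[of N]
      proof eventually_elim
        case (elim i)
        then have "r i \<ge> N" using seq_suble[OF r(1), of i] by linarith
        then have "sq_norm (\<lambda>x. f k x - f (r i) x) < e" using N k by blast
        moreover have "(\<integral>\<^sup>+x. ennreal ((norm (f k x - f (r i) x))\<^sup>2) \<partial>lebesgue) = ennreal (sq_norm (\<lambda>x. f k x - f (r i) x))"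
          unfolding sq_norm_def using d by (intro nn_integral_eq_integral) (auto simp: memLp_2_iff)
        ultimately show ?case by (simp add: ennreal_leI)
      qed
    qed simp
    finally show ?thesis .
  qed
  have dF: "memLp 2 (\<lambda>x. f k x - F x) \<and> sq_norm (\<lambda>x. f k x - F x) \<le> e"
    if N: "\<forall>i\<ge>N. \<forall>j\<ge>N. sq_norm (\<lambda>x. f i x - f j x) < e" and k: "k \<ge> N" and e: "e > 0" for e k N
  proof -
    note fa = fatou[OF N k]
    have i: "integrable lebesgue (\<lambda>x. (norm (f k x - F x))\<^sup>2)"
      by (rule integrableI_nonneg) (use fa in \<open>auto intro: le_less_trans\<close>)
    moreover have "sq_norm (\<lambda>x. f k x - F x) \<le> e"
      using fa e nn_integral_eq_integral[OF i] by (simp add: sq_norm_def)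
    ultimately show ?thesis by (simp add: memLp_2_iff)
  qed
  obtain N where N: "\<forall>i\<ge>N. \<forall>j\<ge>N. sq_norm (\<lambda>x. f i x - f j x) < 1"
    using cauchy[of 1] by auto
  have "memLp 2 (\<lambda>x. f N x - (f N x - F x))"
    by (rule memLp_2_diff(1)[OF f]) (use dF[OF N, of N] in simp)
  then have F: "memLp 2 F" by simp
  have "(\<lambda>k. sq_norm (\<lambda>x. f k x - F x)) \<longlonglongrightarrow> 0"
  proof (rule LIMSEQ_I)
    fix e :: real assume e: "e > 0"
    obtain N where N: "\<forall>i\<ge>N. \<forall>j\<ge>N. sq_norm (\<lambda>x. f i x - f j x) < e/2"
      using cauchy[of "e/2"] e by auto
    have "sq_norm (\<lambda>x. f k x - F x) < e" if "k \<ge> N" for k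
      using dF[OF N that] e by auto
    then show "\<exists>no. \<forall>n\<ge>no. norm (sq_norm (\<lambda>x. f n x - F x) - 0) < e" by auto
  qed
  with F that show ?thesis by blast
qed

subsection \<open>Truncation\<close>

text \<open>Cutting off both the variable and the value produces bounded functions with bounded support, which
lie in \<open>L\<^sup>1\<close> and \<open>L\<^sup>2\<close> whatever \<open>g\<close> is.\<close>

definition truncation :: "nat \<Rightarrow> ('a::euclidean_space \<Rightarrow> 'b::euclidean_space) \<Rightarrow> 'a \<Rightarrow> 'b" where
  "truncation k g x = (if norm x \<le> real k \<and> norm (g x) \<le> real k then g x else 0)"

lemma integrable_indicator_cball: "integrable lebesgue (indicat_real (cball (a::'a::euclidean_space) r))"
  using emeasure_lborel_cball_finite[of a r]
  by (intro integrable_real_indicator) (auto simp: less_top)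

lemma truncation:
  fixes g :: "'a::euclidean_space \<Rightarrow> 'b::euclidean_space"
  assumes [measurable]: "g \<in> borel_measurable lebesgue"
  shows "truncation k g \<in> borel_measurable lebesgue" "memLp 1 (truncation k g)" "memLp 2 (truncation k g)"
    "norm (truncation k g x) \<le> real k" "norm (truncation k g x) \<le> norm (g x)"
    "(\<lambda>k. truncation k g x) \<longlonglongrightarrow> g x"
proof -
  have idm [measurable]: "(\<lambda>x::'a. x) \<in> lebesgue \<rightarrow>\<^sub>M borel"
    using id_borel_measurable_lebesgue by (simp add: id_def)
  show m [measurable]: "truncation k g \<in> borel_measurable lebesgue"
    unfolding truncation_def by measurable
  show b: "norm (truncation k g x) \<le> real k" for x by (auto simp: truncation_def)
  show "norm (truncation k g x) \<le> norm (g x)" by (auto simp: truncation_def)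
  have int: "integrable lebesgue (\<lambda>x::'a. real k ^ j * indicat_real (cball 0 (real k)) x)" for j
    by (intro integrable_mult_right integrable_indicator_cball)
  show "memLp 1 (truncation k g)"
    unfolding memLp_1_iff
    by (rule Bochner_Integration.integrable_bound[OF int[of 1] m])
       (auto intro!: AE_I2 simp: truncation_def indicator_def)
  have "integrable lebesgue (\<lambda>x. (norm (truncation k g x))\<^sup>2)"
    by (rule Bochner_Integration.integrable_bound[OF int[of 2]])
       (auto intro!: AE_I2 power_mono simp: truncation_def indicator_def)
  then show "memLp 2 (truncation k g)" by (simp add: memLp_2_iff)
  obtain k0 :: nat where k0: "max (norm x) (norm (g x)) \<le> real k0" using real_arch_simple by blast
  have "\<forall>\<^sub>F k in sequentially. truncation k g x = g x"
    using eventually_ge_at_top[of k0]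
  proof eventually_elim
    case (elim k)
    then have "real k0 \<le> real k" by simp
    then show ?case using k0 by (simp add: truncation_def)
  qed
  then show "(\<lambda>k. truncation k g x) \<longlonglongrightarrow> g x" by (rule tendsto_eventually)
qed

lemma sq_norm_dominated_tendsto_0:
  fixes d :: "nat \<Rightarrow> 'a::euclidean_space \<Rightarrow> 'b::euclidean_space" and g :: "'a \<Rightarrow> 'c::euclidean_space"
  assumes g: "memLp 2 g" and [measurable]: "\<And>k. d k \<in> borel_measurable lebesgue"
    and le: "\<And>k. AE x in lebesgue. norm (d k x) \<le> norm (g x)"
    and lim: "AE x in lebesgue. (\<lambda>k. d k x) \<longlonglongrightarrow> 0"
  shows "(\<lambda>k. sq_norm (d k)) \<longlonglongrightarrow> 0"
proof -
  have int: "integrable lebesgue (\<lambda>x. (norm (g x))\<^sup>2)" using g by (auto simp: memLp_2_iff)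
  have "(\<lambda>k. LINT x|lebesgue. (norm (d k x))\<^sup>2) \<longlonglongrightarrow> (LINT x::'a|lebesgue. (0::real))"
  proof (rule integral_dominated_convergence[OF _ _ int])
    show "AE x in lebesgue. (\<lambda>k. (norm (d k x))\<^sup>2) \<longlonglongrightarrow> 0"
      using lim
    proof eventually_elim
      case (elim x)
      then have "(\<lambda>k. (norm (d k x))\<^sup>2) \<longlonglongrightarrow> (norm (0::'b))\<^sup>2" by (intro tendsto_intros)
      then show ?case by simp
    qed
    show "AE x in lebesgue. norm ((norm (d k x))\<^sup>2) \<le> (norm (g x))\<^sup>2" for k
      using le[of k] by eventually_elim (auto intro: power_mono)
  qed auto
  then show ?thesis by (simp add: sq_norm_def)
qed

lemma truncation_L2:
  assumes "memLp 2 g"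
  shows "(\<lambda>k. sq_norm (\<lambda>x. truncation k g x - g x)) \<longlonglongrightarrow> 0"
proof -
  have [measurable]: "g \<in> borel_measurable lebesgue" using assms by (simp add: memLp_def)
  note [measurable] = truncation(1)[OF this]
  show ?thesis
  proof (rule sq_norm_dominated_tendsto_0[OF assms])
    show "AE x in lebesgue. (\<lambda>k. truncation k g x - g x) \<longlonglongrightarrow> 0"
      using truncation(6)[of g] by (auto simp: LIM_zero_iff)
    show "(\<lambda>x. truncation k g x - g x) \<in> borel_measurable lebesgue" for k
      by measurable
  qed (auto simp: truncation_def)
qed

definition L1_L2 :: "('a::euclidean_space \<Rightarrow> 'b::euclidean_space) \<Rightarrow> bool" where
  "L1_L2 g \<longleftrightarrow> memLp 1 g \<and> memLp 2 g"

lemma L1_L2_add: "L1_L2 f \<Longrightarrow> L1_L2 g \<Longrightarrow> L1_L2 (\<lambda>x. f x + g x)"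
  by (auto simp: L1_L2_def memLp_1_iff memLp_2_add)

lemma L1_L2_cmult: "L1_L2 f \<Longrightarrow> L1_L2 (\<lambda>x. (c::complex) * f x)"
  by (auto simp: L1_L2_def memLp_1_iff memLp_2_cmult)

lemma L1_L2_cnj: "L1_L2 f \<Longrightarrow> L1_L2 (\<lambda>x. cnj (f x))"
proof -
  assume "L1_L2 f"
  then have "f \<in> borel_measurable lebesgue" by (auto simp: L1_L2_def memLp_def)
  then have "(\<lambda>x. cnj (f x)) \<in> borel_measurable lebesgue"
    by (rule borel_measurable_continuous_on[rotated]) (intro continuous_intros)
  then show ?thesis using \<open>L1_L2 f\<close> by (auto simp: L1_L2_def memLp_def)
qed

text \<open>Fubini's theorem is applied on products of \<open>lborel\<close>, to functions such as \<open>g (x - y)\<close> whose joint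
measurability is immediate only for Borel functions.\<close>

lemma AE_lebesgue_borel_version:
  fixes f :: "'a::euclidean_space \<Rightarrow> complex"
  assumes f: "f \<in> borel_measurable lebesgue"
  obtains g where "g \<in> borel_measurable borel" "AE x in lebesgue. f x = g x"
proof -
  have "(\<lambda>x. Re (f x)) \<in> borel_measurable lebesgue" "(\<lambda>x. Im (f x)) \<in> borel_measurable lebesgue"
    using f by measurable
  then obtain a b where a: "a \<in> borel_measurable lborel" "AE x in lborel. Re (f x) = a x"
    and b: "b \<in> borel_measurable lborel" "AE x in lborel. Im (f x) = b x"
    using completion_ex_borel_measurable_real by metis
  show ?thesis
  proof (rule that)
    show "(\<lambda>x. Complex (a x) (b x)) \<in> borel_measurable borel"
      using a b by (auto simp: borel_measurable_complex_iff)
    show "AE x in lebesgue. f x = Complex (a x) (b x)"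
      using AE_completion[OF a(2)] AE_completion[OF b(2)] by eventually_elim (simp add: complex_eq_iff)
  qed
qed

section \<open>Plancherel's theorem\<close>

lemma exp_eq_cis: "exp (2 * complex_of_real pi * \<i> * complex_of_real t) = cis (2 * pi * t)"
  "exp (- (2 * complex_of_real pi * \<i> * complex_of_real t)) = cis (- (2 * pi * t))"
  by (simp_all add: cis_conv_exp mult_ac)

lemma fourier_int_cis: "fourier_int g z = (LINT x|lebesgue. g x * cis (- (2 * pi * (x \<bullet> z))))"
  by (simp add: fourier_int_def exp_eq_cis)

lemma inv_fourier_int_cis: "inv_fourier_int g z = (LINT x|lebesgue. g x * cis (2 * pi * (z \<bullet> x)))"
  by (simp add: inv_fourier_int_def exp_eq_cis)

lemma continuous_on_cis: "continuous_on A cis"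
proof -
  have "continuous_on A (\<lambda>x. exp (\<i> * complex_of_real x))" by (intro continuous_intros)
  then show ?thesis by (simp add: cis_conv_exp[abs_def])
qed

lemma measurable_cis [measurable]: "cis \<in> borel_measurable borel"
  by (intro borel_measurable_continuous_onI continuous_on_cis)

lemma measurable_cis_phase [measurable]:
  fixes f g :: "'a \<Rightarrow> 'b::euclidean_space"
  assumes [measurable]: "f \<in> M \<rightarrow>\<^sub>M borel" "g \<in> M \<rightarrow>\<^sub>M borel"
  shows "(\<lambda>x. cis (2 * pi * (f x \<bullet> g x))) \<in> M \<rightarrow>\<^sub>M borel" "(\<lambda>x. cis (- (2 * pi * (f x \<bullet> g x)))) \<in> M \<rightarrow>\<^sub>M borel"
  by measurable

lemma measurable_lebesgue_borel: "f \<in> borel_measurable borel \<Longrightarrow> f \<in> borel_measurable lebesgue"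
  by (rule measurable_completion) simp

lemma phase_measurable_lebesgue [measurable]:
  fixes z :: "'a::euclidean_space"
  shows "(\<lambda>x. cis (- (2 * pi * (x \<bullet> z)))) \<in> borel_measurable lebesgue"
    "(\<lambda>x. cis (2 * pi * (z \<bullet> x))) \<in> borel_measurable lebesgue"
  by (rule measurable_lebesgue_borel, measurable)+

lemma integrable_times_unimodular:
  fixes g :: "'a \<Rightarrow> complex"
  assumes g: "integrable M g" and [measurable]: "u \<in> borel_measurable M" and u: "\<And>x. norm (u x) = 1"
  shows "integrable M (\<lambda>x. g x * u x)"
proof (rule Bochner_Integration.integrable_bound[OF g])
  show "(\<lambda>x. g x * u x) \<in> borel_measurable M" using borel_measurable_integrable[OF g] by measurable
qed (simp add: norm_mult u)

lemma fourier_int_integrand: 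
  assumes "integrable lebesgue (g :: real^'n::finite \<Rightarrow> complex)"
  shows "integrable lebesgue (\<lambda>x. g x * cis (- (2 * pi * (x \<bullet> z))))" 
    "integrable lebesgue (\<lambda>x. g x * cis (2 * pi * (z \<bullet> x)))"
  by (rule integrable_times_unimodular[OF assms phase_measurable_lebesgue(1)]; simp)
     (rule integrable_times_unimodular[OF assms phase_measurable_lebesgue(2)]; simp)

lemma fourier_int_cong_AE:
  assumes "g \<in> borel_measurable lebesgue" "AE x in lebesgue. g x = h x"
  shows "fourier_int g = fourier_int h"
proof
  fix z
  have [measurable]: "g \<in> borel_measurable lebesgue" "h \<in> borel_measurable lebesgue"
    using assms measurable_AE_eq by auto
  show "fourier_int g z = fourier_int h z"
    unfolding fourier_int_cis by (intro integral_cong_AE; (measurable; fail)?) (use assms in auto)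
qed

lemma fourier_int_norm_le:
  assumes "integrable lebesgue g"
  shows "norm (fourier_int g z) \<le> (LINT x|lebesgue. norm (g x))"
  unfolding fourier_int_cis
  by (rule order_trans[OF integral_norm_bound]) (simp add: norm_mult)

lemma fourier_int_borel_lborel:
  assumes [measurable]: "g \<in> borel_measurable borel"
  shows "fourier_int g z = (LINT x|lborel. g x * cis (- (2 * pi * (x \<bullet> z))))"
proof -
  have "(\<lambda>x. g x * cis (- (2 * pi * (x \<bullet> z)))) \<in> borel_measurable borel" by measurable
  then show ?thesis unfolding fourier_int_cis by (intro integral_completion) simp
qed

lemma fourier_int_measurable:
  assumes "g \<in> borel_measurable lebesgue"
  shows "fourier_int g \<in> borel_measurable borel"
proof -
  obtain g' where [measurable]: "g' \<in> borel_measurable borel" and ae: "AE x in lebesgue. g x = g' x"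
    using AE_lebesgue_borel_version[OF assms] by blast
  have "fourier_int g = (\<lambda>z. LINT x|lborel. g' x * cis (- (2 * pi * (x \<bullet> z))))"
    unfolding fourier_int_cong_AE[OF assms ae] by (intro ext fourier_int_borel_lborel) measurable
  then show ?thesis by simp
qed

lemma fourier_int_measurable_lebesgue:
  "g \<in> borel_measurable lebesgue \<Longrightarrow> fourier_int g \<in> borel_measurable lebesgue"
  by (rule measurable_lebesgue_borel[OF fourier_int_measurable])

lemma fourier_int_add:
  assumes "integrable lebesgue g" "integrable lebesgue h"
  shows "fourier_int (\<lambda>x. g x + h x) = (\<lambda>z. fourier_int g z + fourier_int h z)"
  by (rule ext) (simp add: fourier_int_cis distrib_right fourier_int_integrand assms)

lemma fourier_int_cmult: "fourier_int (\<lambda>x. c * g x) = (\<lambda>z. c * fourier_int g z)"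
  by (rule ext) (simp add: fourier_int_cis mult.assoc)

lemma fourier_int_diff:
  assumes "integrable lebesgue g" "integrable lebesgue h"
  shows "fourier_int (\<lambda>x. g x - h x) = (\<lambda>z. fourier_int g z - fourier_int h z)"
  by (rule ext) (simp add: fourier_int_cis left_diff_distrib fourier_int_integrand assms)

lemma inv_fourier_int_cnj: "inv_fourier_int g z = cnj (fourier_int (\<lambda>x. cnj (g x)) z)"
proof -
  have "inv_fourier_int g z = (LINT x|lebesgue. cnj (cnj (g x) * cis (- (2 * pi * (x \<bullet> z)))))"
    by (simp add: inv_fourier_int_cis cis_cnj inner_commute)
  also have "\<dots> = cnj (LINT x|lebesgue. cnj (g x) * cis (- (2 * pi * (x \<bullet> z))))"
    by (rule Bochner_Integration.integral_cnj)
  finally show ?thesis by (simp only: fourier_int_cis)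
qed

lemma integrable_completion_I: "f \<in> borel_measurable borel \<Longrightarrow> integrable lebesgue f \<Longrightarrow> integrable lborel f"
  for f :: "_ \<Rightarrow> _ :: {banach, second_countable_topology}"
  using integrable_completion[of f lborel] by simp

lemma integrable_lebesgueI: "f \<in> borel_measurable borel \<Longrightarrow> integrable lborel f \<Longrightarrow> integrable lebesgue f"
  for f :: "_ \<Rightarrow> _ :: {banach, second_countable_topology}"
  using integrable_completion[of f lborel] by simp

text \<open>The multiplication formula: Fubini's theorem applied to the symmetric kernel of the transform.\<close>

lemma fourier_int_multiplication:
  fixes g h :: "real^'n::finite \<Rightarrow> complex"
  assumes g: "integrable lebesgue g" and h: "integrable lebesgue h"
  shows "(LINT z|lebesgue. fourier_int g z * h z) = (LINT x|lebesgue. g x * fourier_int h x)"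
proof -
  obtain g' where g'[measurable]: "g' \<in> borel_measurable borel" and aeg: "AE x in lebesgue. g x = g' x"
    using AE_lebesgue_borel_version[OF borel_measurable_integrable[OF g]] by blast
  obtain h' where h'[measurable]: "h' \<in> borel_measurable borel" and aeh: "AE x in lebesgue. h x = h' x"
    using AE_lebesgue_borel_version[OF borel_measurable_integrable[OF h]] by blast
  have [measurable]: "g \<in> borel_measurable lebesgue" "h \<in> borel_measurable lebesgue"
    "g' \<in> borel_measurable lebesgue" "h' \<in> borel_measurable lebesgue"
    using g h g' h' by (auto intro: measurable_lebesgue_borel)
  note [measurable] = fourier_int_measurable[OF \<open>g' \<in> borel_measurable lebesgue\<close>]
    fourier_int_measurable[OF \<open>h' \<in> borel_measurable lebesgue\<close>]
    fourier_int_measurable_lebesgue[OF \<open>g' \<in> borel_measurable lebesgue\<close>]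
    fourier_int_measurable_lebesgue[OF \<open>h' \<in> borel_measurable lebesgue\<close>]
  have ig: "integrable lborel g'"
    using integrable_cong_AE_imp[OF g _ aeg] by (intro integrable_completion_I) auto
  have ih: "integrable lborel h'"
    using integrable_cong_AE_imp[OF h _ aeh] by (intro integrable_completion_I) auto
  let ?k = "\<lambda>x z. g' x * cis (- (2 * pi * (x \<bullet> z))) * h' z"
  have "integrable (lborel \<Otimes>\<^sub>M lborel) (case_prod ?k)"
  proof (rule lborel_pair.Fubini_integrable)
    show "case_prod ?k \<in> borel_measurable (lborel \<Otimes>\<^sub>M lborel)" by measurable
    show "integrable lborel (\<lambda>x. LINT y|lborel. norm (case (x, y) of (x, z) \<Rightarrow> ?k x z))"
      using ig by (simp add: norm_mult)
    have "integrable lborel (\<lambda>z. cis (- (2 * pi * (x \<bullet> z))) * h' z)" for x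
      using integrable_times_unimodular[OF ih, of "\<lambda>z. cis (- (2 * pi * (x \<bullet> z)))"] by (simp add: mult.commute)
    then show "AE x in lborel. integrable lborel (\<lambda>y. case (x, y) of (x, z) \<Rightarrow> ?k x z)"
      by (simp add: mult.assoc)
  qed
  from lborel_pair.Fubini_integral[OF this]
  have "(LINT z|lborel. LINT x|lborel. ?k x z) = (LINT x|lborel. LINT z|lborel. ?k x z)" by simp
  moreover have "(LINT z|lborel. LINT x|lborel. ?k x z) = (LINT z|lborel. fourier_int g' z * h' z)"
    by (simp add: fourier_int_borel_lborel)
  moreover have "(LINT x|lborel. LINT z|lborel. ?k x z) = (LINT x|lborel. g' x * fourier_int h' x)"
    by (simp add: fourier_int_borel_lborel mult_ac inner_commute)
  ultimately have "(LINT z|lebesgue. fourier_int g' z * h' z) = (LINT x|lebesgue. g' x * fourier_int h' x)"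
    by (subst (1 2) integral_completion) auto
  moreover have "(LINT z|lebesgue. fourier_int g' z * h z) = (LINT z|lebesgue. fourier_int g' z * h' z)"
    using aeh by (intro integral_cong_AE) auto
  moreover have "(LINT z|lebesgue. g z * fourier_int h' z) = (LINT z|lebesgue. g' z * fourier_int h' z)"
    using aeg by (intro integral_cong_AE) auto
  moreover have "fourier_int g = fourier_int g'" "fourier_int h = fourier_int h'"
    by (intro fourier_int_cong_AE aeg aeh; simp)+
  ultimately show ?thesis by simp
qed

subsection \<open>Changes of variables\<close>

lemma distr_lborel_reflect: "distr lborel borel (\<lambda>y. x - y) = (lborel :: 'a::euclidean_space measure)"
  using lborel_affine[of "-1" x] by (simp add: density_1)

lemma lborel_integral_reflect:
  fixes f :: "'a::euclidean_space \<Rightarrow> 'b::euclidean_space"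
  assumes [measurable]: "f \<in> borel_measurable borel"
  shows "(LINT y|lborel. f (x - y)) = (LINT y|lborel. f y)" "integrable lborel (\<lambda>y. f (x - y)) \<longleftrightarrow> integrable lborel f"
proof -
  show "(LINT y|lborel. f (x - y)) = (LINT y|lborel. f y)"
    by (subst (2) distr_lborel_reflect[of x, symmetric], subst integral_distr) auto
  show "integrable lborel (\<lambda>y. f (x - y)) \<longleftrightarrow> integrable lborel f"
    using integrable_distr_eq[of "\<lambda>y. x - y" lborel borel f] by (simp add: distr_lborel_reflect)
qed

lemma lborel_integral_translate:
  fixes f :: "'a::euclidean_space \<Rightarrow> 'b::euclidean_space"
  assumes [measurable]: "f \<in> borel_measurable borel"
  shows "(LINT y|lborel. f (y - x)) = (LINT y|lborel. f y)" "integrable lborel (\<lambda>y. f (y - x)) \<longleftrightarrow> integrable lborel f"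
proof -
  have eq: "distr lborel borel (\<lambda>y. y - x) = (lborel :: 'a measure)"
  proof -
    have "(+) (- x) = (\<lambda>y. y - x)" by (rule ext) simp
    then show ?thesis using lborel_distr_plus[of "-x"] by (simp only:)
  qed
  show "(LINT y|lborel. f (y - x)) = (LINT y|lborel. f y)"
    by (subst (2) eq[symmetric], subst integral_distr) auto
  show "integrable lborel (\<lambda>y. f (y - x)) \<longleftrightarrow> integrable lborel f"
    using integrable_distr_eq[of "\<lambda>y. y - x" lborel borel f] by (simp add: eq)
qed

lemma lborel_integral_scale:
  fixes f :: "'a::euclidean_space \<Rightarrow> 'b::euclidean_space"
  assumes [measurable]: "f \<in> borel_measurable borel" and c: "c > 0"
  shows "(LINT y|lborel. f y) = c ^ DIM('a) *\<^sub>R (LINT y|lborel. f (c *\<^sub>R y))"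
proof -
  have eq: "(lborel :: 'a measure) = density (distr lborel borel (\<lambda>x. c *\<^sub>R x)) (\<lambda>_. ennreal (c ^ DIM('a)))"
    using lborel_affine[of c "0::'a"] c by simp
  show ?thesis
    by (subst eq, subst integral_density) (use c in \<open>auto simp: integral_distr\<close>)
qed

text \<open>Lebesgue measure is the image of the product measure indexed by the basis.\<close>

lemma product_integral_cart:
  fixes f :: "'n::finite \<Rightarrow> real \<Rightarrow> complex"
  assumes f: "\<And>i. integrable lborel (f i)"
  shows "integrable lborel (\<lambda>x::real^'n. \<Prod>i\<in>UNIV. f i (x $ i))"
    "(LINT x::(real^'n)|lborel. (\<Prod>i\<in>UNIV. f i (x $ i))) = (\<Prod>i\<in>UNIV. (LINT t|lborel. f i t))"
proof -
  interpret P: product_sigma_finite "\<lambda>b::real^'n. (lborel :: real measure)" ..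
  have [measurable]: "f i \<in> borel_measurable borel" for i using borel_measurable_integrable[OF f[of i]] by simp
  have inj: "inj (\<lambda>i::'n. axis i (1::real))" by (auto simp: inj_on_def axis_eq_axis)
  have B: "(Basis :: (real^'n) set) = range (\<lambda>i. axis i 1)" by (auto simp: Basis_vec_def)
  define F where "F b = f (inv (\<lambda>i. axis i (1::real)) b)" for b :: "real^'n"
  have F: "F (axis i 1) = f i" for i by (simp add: F_def inv_f_f[OF inj])
  have intF: "integrable lborel (F b)" if "b \<in> Basis" for b using f by (simp add: F_def)
  have eq: "(\<Prod>i\<in>UNIV. f i ((\<Sum>b\<in>Basis. y b *\<^sub>R b) $ i)) = (\<Prod>b\<in>Basis. F b (y b))" for y :: "real^'n \<Rightarrow> real"
  proof -
    have "(\<Sum>b\<in>Basis. y b *\<^sub>R b) $ i = y (axis i 1)" for i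
    proof -
      have "(\<Sum>b\<in>Basis. y b *\<^sub>R b) $ i = (\<Sum>b\<in>Basis. y b *\<^sub>R b) \<bullet> axis i 1"
        by (simp add: inner_axis)
      also have "\<dots> = y (axis i 1)" by (subst inner_sum_left_Basis) (auto simp: B)
      finally show ?thesis .
    qed
    then show ?thesis unfolding B by (subst prod.reindex[OF inj]) (simp add: F)
  qed
  have m: "(\<lambda>y. \<Sum>b\<in>Basis. y b *\<^sub>R b :: real^'n) \<in> (\<Pi>\<^sub>M b\<in>Basis. lborel) \<rightarrow>\<^sub>M borel" by measurable
  have m2: "(\<lambda>x::real^'n. \<Prod>i\<in>UNIV. f i (x $ i)) \<in> borel_measurable borel" by measurable
  show "integrable lborel (\<lambda>x::real^'n. \<Prod>i\<in>UNIV. f i (x $ i))"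
    by (subst lborel_eq, subst integrable_distr_eq[OF m m2], unfold eq)
       (intro P.product_integrable_prod finite_Basis intF)
  show "(LINT x::(real^'n)|lborel. (\<Prod>i\<in>UNIV. f i (x $ i))) = (\<Prod>i\<in>UNIV. (LINT t|lborel. f i t))"
    by (subst lborel_eq, subst integral_distr[OF m m2], unfold eq, subst P.product_integral_prod)
       (auto simp: intF B prod.reindex[OF inj] F)
qed

subsection \<open>Gaussian functions\<close>

definition gauss :: "real \<Rightarrow> real^'n::finite \<Rightarrow> complex" where
  "gauss e z = (\<Prod>i\<in>UNIV. complex_of_real (exp (- (e * z $ i)\<^sup>2 / 2)))"

text \<open>The transform of \<open>gauss e\<close>: a product of normal densities with standard deviation \<open>e / (2\<pi>)\<close>, an
approximate identity as \<open>e \<rightarrow> 0\<close>.\<close>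

definition gauss_kernel :: "real \<Rightarrow> real^'n::finite \<Rightarrow> complex" where
  "gauss_kernel e y = (\<Prod>i\<in>UNIV. complex_of_real (normal_density 0 (e / (2 * pi)) (y $ i)))"

text \<open>After rescaling this is the characteristic function of the standard normal distribution.\<close>

lemma gauss_1d:
  assumes e: "e > 0"
  shows "integrable lborel (\<lambda>t. complex_of_real (exp (- (e * t)\<^sup>2 / 2)) * cis (- (2 * pi * (x * t))))"
    "(LINT t|lborel. complex_of_real (exp (- (e * t)\<^sup>2 / 2)) * cis (- (2 * pi * (x * t))))
       = complex_of_real (normal_density 0 (e / (2 * pi)) x)"
proof -
  let ?s = "- (2 * pi * x / e)"
  let ?h = "\<lambda>t. complex_of_real (std_normal_density t) * cis (?s * t)"
  have "integrable lborel (\<lambda>t. complex_of_real (std_normal_density t))" by simp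
  then have int: "integrable lborel ?h" by (rule integrable_times_unimodular) auto
  have "char std_normal_distribution ?s = (LINT t|lborel. ?h t)"
    unfolding char_def
    by (subst integral_density) (auto simp: cis_conv_exp scaleR_conv_of_real)
  then have hval: "(LINT t|lborel. ?h t) = complex_of_real (exp (- (?s)\<^sup>2 / 2))"
    by (simp add: char_std_normal_distribution)
  have eq: "complex_of_real (exp (- (e * t)\<^sup>2 / 2)) * cis (- (2 * pi * (x * t))) = complex_of_real (sqrt (2 * pi)) * ?h (0 + e * t)" for t
    using e by (simp add: std_normal_density_def field_simps)
  show "integrable lborel (\<lambda>t. complex_of_real (exp (- (e * t)\<^sup>2 / 2)) * cis (- (2 * pi * (x * t))))"
    unfolding eq by (intro integrable_mult_right lborel_integrable_real_affine int) (use e in auto)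
  have "(LINT t|lborel. ?h t) = e *\<^sub>R (LINT t|lborel. ?h (0 + e * t))"
    using lborel_integral_real_affine[of e ?h 0] e by (simp only: abs_of_pos)
  then have "(LINT t|lborel. ?h (0 + e * t)) = complex_of_real (exp (- (?s)\<^sup>2 / 2) / e)"
    using e unfolding hval by (simp add: scaleR_conv_of_real field_simps del: add_0)
  then have "(LINT t|lborel. complex_of_real (exp (- (e * t)\<^sup>2 / 2)) * cis (- (2 * pi * (x * t))))
      = complex_of_real (sqrt (2 * pi) * (exp (- (?s)\<^sup>2 / 2) / e))"
    unfolding eq by simp
  also have "sqrt (2 * pi) * (exp (- (?s)\<^sup>2 / 2) / e) = normal_density 0 (e / (2 * pi)) x"
  proof -
    have "sqrt (2 * pi * (e / (2 * pi))\<^sup>2) = sqrt (2 * pi) * (e / (2 * pi))"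
      using e by (simp add: real_sqrt_mult)
    moreover have "1 / (sqrt (2 * pi) * (e / (2 * pi))) = sqrt (2 * pi) / e"
      using e by (simp add: field_simps real_sqrt_mult[symmetric] del: real_sqrt_mult)
    moreover have "- (?s)\<^sup>2 / 2 = - (x - 0)\<^sup>2 / (2 * (e / (2 * pi))\<^sup>2)"
      using e by (simp add: field_simps power2_eq_square)
    ultimately show ?thesis unfolding normal_density_def by simp
  qed
  finally show "(LINT t|lborel. complex_of_real (exp (- (e * t)\<^sup>2 / 2)) * cis (- (2 * pi * (x * t))))
       = complex_of_real (normal_density 0 (e / (2 * pi)) x)" .
qed

lemma inner_cart: "x \<bullet> (z::real^'n::finite) = (\<Sum>i\<in>UNIV. x $ i * z $ i)"
  by (simp add: inner_vec_def)

lemma cis_sum: "cis (\<Sum>i\<in>I. f i) = (\<Prod>i\<in>I. cis (f i))"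
  by (induction I rule: infinite_finite_induct) (auto simp: cis_mult[symmetric])

lemma gauss_measurable [measurable]: "gauss e \<in> borel_measurable borel" "gauss_kernel e \<in> borel_measurable borel"
  unfolding gauss_def[abs_def] gauss_kernel_def[abs_def] by measurable

lemma fourier_gauss:
  assumes e: "e > 0"
  shows "integrable lborel (gauss e :: real^'n::finite \<Rightarrow> complex)"
    "fourier_int (gauss e) (y::real^'n) = gauss_kernel e y"
proof -
  have "integrable lborel (\<lambda>t. complex_of_real (exp (- (e * t)\<^sup>2 / 2)))"
    using gauss_1d(1)[OF e, of 0] by simp
  from product_integral_cart(1)[OF this]
  show "integrable lborel (gauss e :: real^'n \<Rightarrow> complex)" by (simp add: gauss_def[abs_def])
  have "fourier_int (gauss e) y = (LINT x|lborel. gauss e x * cis (- (2 * pi * (x \<bullet> y))))"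
    by (intro fourier_int_borel_lborel) measurable
  also have "\<dots> = (LINT x|lborel. (\<Prod>i\<in>UNIV. complex_of_real (exp (- (e * x $ i)\<^sup>2 / 2)) * cis (- (2 * pi * (y $ i * x $ i)))))"
  proof -
    have "- (2 * pi * (x \<bullet> y)) = (\<Sum>i\<in>UNIV. - (2 * pi * (y $ i * x $ i)))" for x :: "real^'n"
      by (simp add: inner_cart sum_negf sum_distrib_left mult_ac)
    then show ?thesis by (simp only: gauss_def cis_sum prod.distrib)
  qed
  also have "\<dots> = gauss_kernel e y"
    unfolding gauss_kernel_def
    by (subst product_integral_cart(2)) (simp_all only: gauss_1d[OF e])
  finally show "fourier_int (gauss e) y = gauss_kernel e y" .
qed

lemma gauss_kernel_integral:
  assumes e: "e > 0"
  shows "integrable lborel (gauss_kernel e :: real^'n::finite \<Rightarrow> complex)"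
    "(LINT y::(real^'n)|lborel. gauss_kernel e y) = 1"
proof -
  have i: "integrable lborel (\<lambda>t. complex_of_real (normal_density 0 (e / (2 * pi)) t))"
    using e by simp
  from product_integral_cart(1)[OF i] show "integrable lborel (gauss_kernel e :: real^'n \<Rightarrow> complex)"
    by (simp add: gauss_kernel_def[abs_def])
  have "(LINT t|lborel. complex_of_real (normal_density 0 (e / (2 * pi)) t)) = 1"
    using e by simp
  then show "(LINT y::(real^'n)|lborel. gauss_kernel e y) = 1"
    using product_integral_cart(2)[OF i] by (simp add: gauss_kernel_def[abs_def])
qed

lemma gauss_kernel_scale:
  assumes e: "e > 0"
  shows "of_real (e ^ CARD('n)) * gauss_kernel e (e *\<^sub>R y) = gauss_kernel 1 (y::real^'n::finite)"
proof -
  have "complex_of_real e * complex_of_real (normal_density 0 (e / (2 * pi)) (e * t)) = complex_of_real (normal_density 0 (1 / (2 * pi)) t)" for t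
  proof -
    have "e * normal_density 0 (e / (2 * pi)) (e * t) = normal_density 0 (1 / (2 * pi)) t"
      using e unfolding normal_density_def
      by (simp add: real_sqrt_mult power_divide power_mult_distrib real_sqrt_divide)
    then show ?thesis by (metis of_real_mult)
  qed
  moreover have "complex_of_real (e ^ CARD('n)) = (\<Prod>i::'n\<in>UNIV. complex_of_real e)" by simp
  ultimately show ?thesis
    unfolding gauss_kernel_def by (simp only: prod.distrib[symmetric] vector_scaleR_component real_scaleR_def)
qed

subsection \<open>Continuity of translations in \<open>L\<^sup>1\<close>\<close>

text \<open>For an open set, \<open>1\<^sub>U(x) 1\<^sub>U(x - y) \<rightarrow> 1\<^sub>U(x)\<close> at every point as \<open>y \<rightarrow> 0\<close>, and the \<open>L\<^sup>1\<close> distance is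
twice the defect of the integral of this product.\<close>

lemma translation_tendsto_indicator_open:
  fixes U :: "'a::euclidean_space set" and Y :: "nat \<Rightarrow> 'a"
  assumes U: "open U" "emeasure lborel U < \<infinity>" and Y: "Y \<longlonglongrightarrow> 0"
  shows "(\<lambda>k. LINT x|lborel. \<bar>indicat_real U (x - Y k) - indicat_real U x\<bar>) \<longlonglongrightarrow> 0"
proof -
  have [measurable]: "U \<in> sets borel" using U by simp
  have iU: "integrable lborel (indicat_real U)" using U by (intro integrable_real_indicator) auto
  have iUs: "integrable lborel (\<lambda>x. indicat_real U (x - y))" "(LINT x|lborel. indicat_real U (x - y)) = measure lborel U" for y
    using lborel_integral_translate[of "indicat_real U" y] iU by auto
  have im: "integrable lborel (\<lambda>x. indicat_real U x * indicat_real U (x - y))" for y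
    by (rule Bochner_Integration.integrable_bound[OF iU]) (auto simp: indicator_def)
  have "(\<lambda>k. LINT x|lborel. indicat_real U x * indicat_real U (x - Y k)) \<longlonglongrightarrow> (LINT x|lborel. indicat_real U x)"
  proof (rule integral_dominated_convergence[OF _ _ iU])
    show "AE x in lborel. (\<lambda>k. indicat_real U x * indicat_real U (x - Y k)) \<longlonglongrightarrow> indicat_real U x"
    proof (rule AE_I2)
      fix x
      show "(\<lambda>k. indicat_real U x * indicat_real U (x - Y k)) \<longlonglongrightarrow> indicat_real U x"
      proof (cases "x \<in> U")
        case True
        have "(\<lambda>k. x - Y k) \<longlonglongrightarrow> x - 0" by (intro tendsto_intros Y)
        then have "\<forall>\<^sub>F k in sequentially. x - Y k \<in> U"
          using U True by (auto dest: topological_tendstoD)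
        then have "\<forall>\<^sub>F k in sequentially. indicat_real U x * indicat_real U (x - Y k) = indicat_real U x"
          by eventually_elim (use True in simp)
        then show ?thesis by (rule tendsto_eventually)
      qed simp
    qed
  qed (auto simp: indicator_def)
  then have "(\<lambda>k. 2 * measure lborel U - 2 * (LINT x|lborel. indicat_real U x * indicat_real U (x - Y k)))
      \<longlonglongrightarrow> 2 * measure lborel U - 2 * measure lborel U"
    by (intro tendsto_intros) simp
  moreover have "(LINT x|lborel. \<bar>indicat_real U (x - y) - indicat_real U x\<bar>)
      = 2 * measure lborel U - 2 * (LINT x|lborel. indicat_real U x * indicat_real U (x - y))" for y
  proof -
    have "\<bar>indicat_real U (x - y) - indicat_real U x\<bar>
        = indicat_real U (x - y) + indicat_real U x - 2 * (indicat_real U x * indicat_real U (x - y))" for x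
      by (auto simp: indicator_def)
    then show ?thesis using iU iUs im by simp
  qed
  ultimately show ?thesis by simp
qed

text \<open>Sets of finite measure are approximated by open sets from outside; simple functions and limits follow.\<close>

lemma translation_tendsto_L1:
  fixes g :: "'a::euclidean_space \<Rightarrow> complex" and Y :: "nat \<Rightarrow> 'a"
  assumes g: "integrable lborel g" and Y: "Y \<longlonglongrightarrow> 0"
  shows "(\<lambda>k. LINT x|lborel. norm (g (x - Y k) - g x)) \<longlonglongrightarrow> 0"
  using g
proof (induction rule: integrable_induct)
  case (base A c)
  then have [measurable]: "A \<in> sets borel" by simp
  have "(\<lambda>k. LINT x|lborel. \<bar>indicat_real A (x - Y k) - indicat_real A x\<bar>) \<longlonglongrightarrow> 0"
  proof (rule LIMSEQ_I)
    fix e :: real assume e: "e > 0"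
    obtain U where U: "A \<subseteq> U" "open U" "emeasure lborel (U - A) < ennreal (e / 4)"
      using outer_regular_lborel[OF \<open>A \<in> sets borel\<close>, of "e/4"] e by (metis zero_less_divide_iff zero_less_numeral)
    have [measurable]: "U \<in> sets borel" using U by simp
    have "emeasure lborel U \<le> emeasure lborel A + emeasure lborel (U - A)"
      using U by (metis Diff_partition \<open>A \<in> sets borel\<close> \<open>U \<in> sets borel\<close> emeasure_subadditive sets.Diff sets_lborel)
    also have "\<dots> < \<infinity>" using base U(3) by (auto simp: less_top intro: less_trans)
    finally have fU: "emeasure lborel U < \<infinity>" .
    have fD: "emeasure lborel (U - A) < \<infinity>" using U(3) by (auto intro: less_trans)
    have mD: "measure lborel (U - A) < e / 4"
      using U(3) e emeasure_eq_ennreal_measure[of lborel "U - A"] fD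
      by (metis ennreal_less_iff infinity_ennreal_def less_irrefl measure_nonneg)
    have iD: "integrable lborel (indicat_real (U - A))" using fD by (intro integrable_real_indicator) auto
    have iDs: "integrable lborel (\<lambda>x. indicat_real (U - A) (x - y))" "(LINT x|lborel. indicat_real (U - A) (x - y)) = measure lborel (U - A)" for y
      using lborel_integral_translate[of "indicat_real (U - A)" y] iD by auto
    have iU: "integrable lborel (indicat_real U)" using fU by (intro integrable_real_indicator) auto
    have iUs: "integrable lborel (\<lambda>x. indicat_real U (x - y))" for y
      using lborel_integral_translate[of "indicat_real U" y] iU by auto
    have iA: "integrable lborel (indicat_real A)" using base by (intro integrable_real_indicator) auto
    have iAs: "integrable lborel (\<lambda>x. indicat_real A (x - y))" for y
      using lborel_integral_translate[of "indicat_real A" y] iA by auto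
    obtain N where N: "\<And>k. k \<ge> N \<Longrightarrow> (LINT x|lborel. \<bar>indicat_real U (x - Y k) - indicat_real U x\<bar>) < e / 2"
      using LIMSEQ_D[OF translation_tendsto_indicator_open[OF U(2) fU Y], of "e/2"] e by auto
    have "norm ((LINT x|lborel. \<bar>indicat_real A (x - Y k) - indicat_real A x\<bar>) - 0) < e" if "k \<ge> N" for k
    proof -
      have "(LINT x|lborel. \<bar>indicat_real A (x - Y k) - indicat_real A x\<bar>)
          \<le> (LINT x|lborel. \<bar>indicat_real U (x - Y k) - indicat_real U x\<bar> + indicat_real (U - A) (x - Y k) + indicat_real (U - A) x)"
        using U(1) by (intro integral_mono Bochner_Integration.integrable_add integrable_abs
            Bochner_Integration.integrable_diff iU iUs iA iAs iD iDs) (auto simp: indicator_def)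
      also have "\<dots> = (LINT x|lborel. \<bar>indicat_real U (x - Y k) - indicat_real U x\<bar>) + measure lborel (U - A) + measure lborel (U - A)"
        using iU iUs iD iDs by simp
      also have "\<dots> < e" using N[OF that] mD by simp
      finally show ?thesis by simp
    qed
    then show "\<exists>no. \<forall>n\<ge>no. norm ((LINT x|lborel. \<bar>indicat_real A (x - Y n) - indicat_real A x\<bar>) - 0) < e" by blast
  qed
  then have "(\<lambda>k. (LINT x|lborel. \<bar>indicat_real A (x - Y k) - indicat_real A x\<bar>) * norm c) \<longlonglongrightarrow> 0 * norm c"
    by (intro tendsto_intros)
  then show ?case by (simp add: scaleR_diff_left[symmetric] del: scaleR_conv_of_real)
next
  case (add f g)
  have [measurable]: "f \<in> borel_measurable borel" "g \<in> borel_measurable borel"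
    using borel_measurable_integrable[OF add.hyps(1)] borel_measurable_integrable[OF add.hyps(2)] by auto
  have i: "integrable lborel (\<lambda>x. norm (f (x - y) - f x))" "integrable lborel (\<lambda>x. norm (g (x - y) - g x))" for y
    using add.hyps lborel_integral_translate(2)[of f y] lborel_integral_translate(2)[of g y] by auto
  have i3: "integrable lborel (\<lambda>x. norm (f (x - y) + g (x - y) - (f x + g x)))" for y
    using add.hyps lborel_integral_translate(2)[of f y] lborel_integral_translate(2)[of g y] by auto
  have le: "(LINT x|lborel. norm (f (x - y) + g (x - y) - (f x + g x)))
      \<le> (LINT x|lborel. norm (f (x - y) - f x)) + (LINT x|lborel. norm (g (x - y) - g x))" for y
  proof -
    have "(LINT x|lborel. norm (f (x - y) + g (x - y) - (f x + g x)))
        \<le> (LINT x|lborel. norm (f (x - y) - f x) + norm (g (x - y) - g x))"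
      by (intro integral_mono i3 Bochner_Integration.integrable_add i) (simp add: norm_diff_triangle_ineq)
    then show ?thesis using i by simp
  qed
  have "(\<lambda>k. (LINT x|lborel. norm (f (x - Y k) - f x)) + (LINT x|lborel. norm (g (x - Y k) - g x))) \<longlonglongrightarrow> 0 + 0"
    by (intro tendsto_intros add.IH)
  then have "(\<lambda>k. (LINT x|lborel. norm (f (x - Y k) - f x)) + (LINT x|lborel. norm (g (x - Y k) - g x))) \<longlonglongrightarrow> 0"
    by simp
  moreover have "\<forall>\<^sub>F k in sequentially. norm (LINT x|lborel. norm (f (x - Y k) + g (x - Y k) - (f x + g x)))
      \<le> (LINT x|lborel. norm (f (x - Y k) - f x)) + (LINT x|lborel. norm (g (x - Y k) - g x))"
    using le by (intro always_eventually allI) simp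
  ultimately show ?case by (rule Lim_null_comparison[rotated])
next
  case (lim f s)
  have [measurable]: "f \<in> borel_measurable borel" "s i \<in> borel_measurable borel" for i
    using borel_measurable_integrable[OF lim.hyps(4)] borel_measurable_integrable[OF lim.hyps(1)] by auto
  have "(\<lambda>i. LINT x|lborel. norm (s i x - f x)) \<longlonglongrightarrow> (LINT x::'a|lborel. (0::real))"
  proof (rule integral_dominated_convergence)
    show "integrable lborel (\<lambda>x. 3 * norm (f x))" using lim.hyps(4) by simp
    show "AE x in lborel. (\<lambda>i. norm (s i x - f x)) \<longlonglongrightarrow> 0"
      using lim.hyps(2) by (auto simp: tendsto_norm_zero_iff LIM_zero_iff)
    show "AE x in lborel. norm (norm (s i x - f x)) \<le> 3 * norm (f x)" for i
    proof (rule AE_I2)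
      fix x
      have "norm (s i x - f x) \<le> norm (s i x) + norm (f x)" by (rule norm_triangle_ineq4)
      also have "\<dots> \<le> 3 * norm (f x)" using lim.hyps(3)[of x i] by simp
      finally show "norm (norm (s i x - f x)) \<le> 3 * norm (f x)" by simp
    qed
  qed auto
  then have L: "(\<lambda>i. LINT x|lborel. norm (s i x - f x)) \<longlonglongrightarrow> 0" by simp
  show ?case
  proof (rule LIMSEQ_I)
    fix e :: real assume e: "e > 0"
    obtain i where i: "(LINT x|lborel. norm (s i x - f x)) < e / 3"
      using LIMSEQ_D[OF L, of "e/3"] e by auto
    obtain N where N: "\<And>k. k \<ge> N \<Longrightarrow> (LINT x|lborel. norm (s i (x - Y k) - s i x)) < e / 3"
      using LIMSEQ_D[OF lim.IH[of i], of "e/3"] e by auto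
    have "norm ((LINT x|lborel. norm (f (x - Y k) - f x)) - 0) < e" if "k \<ge> N" for k
    proof -
      have t: "integrable lborel (\<lambda>x. f (x - Y k))" "integrable lborel (\<lambda>x. s i (x - Y k))"
        using lborel_integral_translate(2)[of f "Y k"] lborel_integral_translate(2)[of "s i" "Y k"] lim.hyps by auto
      have t2: "(LINT x|lborel. norm (s i (x - Y k) - f (x - Y k))) = (LINT x|lborel. norm (s i x - f x))"
        using lborel_integral_translate(1)[of "\<lambda>x. norm (s i x - f x)" "Y k"] by simp
      have le: "norm (f (x - Y k) - f x) \<le> norm (s i (x - Y k) - f (x - Y k)) + norm (s i (x - Y k) - s i x) + norm (s i x - f x)" for x
      proof -
        have "f (x - Y k) - f x = (f (x - Y k) - s i (x - Y k)) + (s i (x - Y k) - s i x) + (s i x - f x)" by simp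
        then have "norm (f (x - Y k) - f x) = norm ((f (x - Y k) - s i (x - Y k)) + (s i (x - Y k) - s i x) + (s i x - f x))" by simp
        then show ?thesis
          using norm_triangle_ineq[of "(f (x - Y k) - s i (x - Y k)) + (s i (x - Y k) - s i x)" "s i x - f x"]
            norm_triangle_ineq[of "f (x - Y k) - s i (x - Y k)" "s i (x - Y k) - s i x"]
            norm_minus_commute[of "f (x - Y k)" "s i (x - Y k)"] by linarith
      qed
      have "(LINT x|lborel. norm (f (x - Y k) - f x))
          \<le> (LINT x|lborel. norm (s i (x - Y k) - f (x - Y k)) + norm (s i (x - Y k) - s i x) + norm (s i x - f x))"
        by (intro integral_mono Bochner_Integration.integrable_add integrable_norm
            Bochner_Integration.integrable_diff t lim.hyps le)
      also have "\<dots> = (LINT x|lborel. norm (s i x - f x)) + (LINT x|lborel. norm (s i (x - Y k) - s i x)) + (LINT x|lborel. norm (s i x - f x))"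
        using t lim.hyps t2 by simp
      also have "\<dots> < e" using N[OF that] i by simp
      finally show ?thesis by simp
    qed
    then show "\<exists>no. \<forall>n\<ge>no. norm ((LINT x|lborel. norm (f (x - Y n) - f x)) - 0) < e" by blast
  qed
qed

subsection \<open>Plancherel's theorem on \<open>L\<^sup>1 \<inter> L\<^sup>2\<close>\<close>

text \<open>Its Fourier transform is \<open>\<bar>g^\<bar>\<^sup>2\<close> and its value at the origin is the squared norm of \<open>g\<close>, so that
Plancherel's theorem is Fourier inversion for the autocorrelation at the origin.\<close>

definition autocorrelation :: "('a::euclidean_space \<Rightarrow> complex) \<Rightarrow> 'a \<Rightarrow> complex" where
  "autocorrelation g y = (LINT x|lborel. g x * cnj (g (x - y)))"

lemma autocorrelation_measurable [measurable]:
  assumes [measurable]: "g \<in> borel_measurable borel"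
  shows "autocorrelation g \<in> borel_measurable borel"
proof -
  have [measurable]: "(\<lambda>x. cnj (g x)) \<in> borel_measurable borel"
    by (rule borel_measurable_continuous_on[OF _ assms]) (intro continuous_intros)
  show ?thesis unfolding autocorrelation_def[abs_def] by measurable
qed

lemma cnj_measurable [measurable (raw)]: "f \<in> M \<rightarrow>\<^sub>M borel \<Longrightarrow> (\<lambda>x. cnj (f x)) \<in> M \<rightarrow>\<^sub>M borel"
  by (rule borel_measurable_continuous_on) (intro continuous_intros)

text \<open>Boundedness of \<open>g\<close> reduces the continuity of the autocorrelation at the origin to the continuity of
translations in \<open>L\<^sup>1\<close>.\<close>

lemma autocorrelation_bounded_case:
  fixes g :: "'a::euclidean_space \<Rightarrow> complex"
  assumes g: "integrable lborel g" and B: "\<And>x. norm (g x) \<le> B"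
  shows "integrable lborel (\<lambda>x. g x * cnj (g (x - y)))"
    "norm (autocorrelation g y) \<le> B * (LINT x|lborel. norm (g x))"
    "Y \<longlonglongrightarrow> 0 \<Longrightarrow> (\<lambda>k. autocorrelation g (Y k)) \<longlonglongrightarrow> autocorrelation g 0"
proof -
  have [measurable]: "g \<in> borel_measurable borel" using borel_measurable_integrable[OF g] by simp
  have b: "norm (g x * cnj (g (x - y))) \<le> B * norm (g x)" for x y
    using mult_left_mono[OF B[of "x - y"], of "norm (g x)"] by (simp add: norm_mult mult.commute)
  have iB: "integrable lborel (\<lambda>x. B * norm (g x))" using g by simp
  have int: "integrable lborel (\<lambda>x. g x * cnj (g (x - y)))" for y
  proof (rule Bochner_Integration.integrable_bound[OF iB])
    show "AE x in lborel. norm (g x * cnj (g (x - y))) \<le> norm (B * norm (g x))"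
      using b by (auto intro!: AE_I2 order_trans[OF _ abs_ge_self])
  qed measurable
  then show "integrable lborel (\<lambda>x. g x * cnj (g (x - y)))" .
  have "norm (autocorrelation g y) \<le> (LINT x|lborel. norm (g x * cnj (g (x - y))))"
    unfolding autocorrelation_def by (rule integral_norm_bound)
  also have "\<dots> \<le> (LINT x|lborel. B * norm (g x))"
    by (intro integral_mono integrable_norm int iB b)
  also have "\<dots> = B * (LINT x|lborel. norm (g x))" by (rule integral_mult_right_zero)
  finally show "norm (autocorrelation g y) \<le> B * (LINT x|lborel. norm (g x))" .
  assume Y: "Y \<longlonglongrightarrow> 0"
  have gt: "integrable lborel (\<lambda>x. g (x - y))" for y
    using g lborel_integral_translate(2)[of g y] by simp
  have le: "norm (autocorrelation g y - autocorrelation g 0) \<le> B * (LINT x|lborel. norm (g (x - y) - g x))" for y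
  proof -
    have "autocorrelation g y - autocorrelation g 0 = (LINT x|lborel. g x * cnj (g (x - y)) - g x * cnj (g (x - 0)))"
      unfolding autocorrelation_def by (intro Bochner_Integration.integral_diff[symmetric] int)
    also have "norm \<dots> \<le> (LINT x|lborel. norm (g x * cnj (g (x - y)) - g x * cnj (g (x - 0))))"
      by (rule integral_norm_bound)
    also have "\<dots> \<le> (LINT x|lborel. B * norm (g (x - y) - g x))"
    proof (intro integral_mono integrable_norm Bochner_Integration.integrable_diff int integrable_mult_right gt g)
      fix x
      have "g x * cnj (g (x - y)) - g x * cnj (g (x - 0)) = g x * cnj (g (x - y) - g x)"
        by (simp add: right_diff_distrib)
      then show "norm (g x * cnj (g (x - y)) - g x * cnj (g (x - 0))) \<le> B * norm (g (x - y) - g x)"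
        using mult_right_mono[OF B[of x], of "norm (g (x - y) - g x)"]
        by (simp only: norm_mult complex_mod_cnj norm_ge_zero)
    qed
    also have "\<dots> = B * (LINT x|lborel. norm (g (x - y) - g x))"
      by (rule integral_mult_right_zero)
    finally show ?thesis .
  qed
  have "(\<lambda>k. B * (LINT x|lborel. norm (g (x - Y k) - g x))) \<longlonglongrightarrow> 0"
    using tendsto_mult_left[OF translation_tendsto_L1[OF g Y], of B] by simp
  moreover have "\<forall>\<^sub>F k in sequentially. norm (autocorrelation g (Y k) - autocorrelation g 0)
      \<le> B * (LINT x|lborel. norm (g (x - Y k) - g x))"
    using le by (intro always_eventually allI)
  ultimately have "(\<lambda>k. autocorrelation g (Y k) - autocorrelation g 0) \<longlonglongrightarrow> 0"
    by (rule Lim_null_comparison[rotated])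
  then show "(\<lambda>k. autocorrelation g (Y k)) \<longlonglongrightarrow> autocorrelation g 0" by (simp add: LIM_zero_iff)
qed

lemma fourier_autocorrelation:
  fixes g :: "real^'n::finite \<Rightarrow> complex"
  assumes g: "integrable lborel g"
  shows "integrable lborel (autocorrelation g)"
    "fourier_int (autocorrelation g) z = of_real ((norm (fourier_int g z))\<^sup>2)"
proof -
  have [measurable]: "g \<in> borel_measurable borel" using borel_measurable_integrable[OF g] by simp
  let ?k = "\<lambda>x y. g x * cnj (g (x - y))"
  have cg: "integrable lborel (\<lambda>y. cnj (g (x - y)))" for x
    using lborel_integral_reflect(2)[of "\<lambda>y. cnj (g y)" x] g by simp
  have nk: "(LINT y|lborel. norm (?k x y)) = norm (g x) * (LINT y|lborel. norm (g y))" for x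
    using lborel_integral_reflect(1)[of "\<lambda>y. norm (g y)" x] by (simp add: norm_mult)
  have int: "integrable (lborel \<Otimes>\<^sub>M lborel) (\<lambda>(x, y). ?k x y * u y)"
    if [measurable]: "u \<in> borel_measurable borel" and u: "\<And>y. norm (u y) = 1" for u
  proof (rule lborel_pair.Fubini_integrable)
    show "(\<lambda>(x, y). ?k x y * u y) \<in> borel_measurable (lborel \<Otimes>\<^sub>M lborel)" by measurable
    show "integrable lborel (\<lambda>x. LINT y|lborel. norm (case (x, y) of (x, y) \<Rightarrow> ?k x y * u y))"
    proof -
      have "(\<lambda>x. LINT y|lborel. norm (case (x, y) of (x, y) \<Rightarrow> ?k x y * u y)) = (\<lambda>x. norm (g x) * (LINT y|lborel. norm (g y)))"
        unfolding nk[symmetric] by (simp add: norm_mult u)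
      then show ?thesis using g by simp
    qed
    show "AE x in lborel. integrable lborel (\<lambda>y. case (x, y) of (x, y) \<Rightarrow> ?k x y * u y)"
      using integrable_times_unimodular[OF cg, of u] u by (intro AE_I2) (simp add: mult.assoc)
  qed
  have 1: "autocorrelation g = (\<lambda>y. LINT x|lborel. ?k x y)" by (simp add: autocorrelation_def[abs_def])
  show "integrable lborel (autocorrelation g)"
    unfolding 1 using lborel_pair.integrable_snd[OF int[of "\<lambda>_. 1"]] by simp
  let ?e = "\<lambda>y. cis (- (2 * pi * (y \<bullet> z)))"
  have "fourier_int (autocorrelation g) z = (LINT y|lborel. autocorrelation g y * ?e y)"
    by (intro fourier_int_borel_lborel) measurable
  also have "\<dots> = (LINT y|lborel. (LINT x|lborel. ?k x y * ?e y))"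
    by (simp add: 1)
  also have "\<dots> = (LINT x|lborel. (LINT y|lborel. ?k x y * ?e y))"
    by (rule lborel_pair.Fubini_integral[OF int]) auto
  also have "\<dots> = (LINT x|lborel. g x * ?e x * cnj (LINT y|lborel. g y * ?e y))"
  proof (rule Bochner_Integration.integral_cong[OF refl])
    fix x
    have ph: "?e y = ?e x * cnj (?e (x - y))" for y
      by (simp add: cis_cnj cis_mult inner_diff_left algebra_simps)
    have "(LINT y|lborel. ?k x y * ?e y) = (LINT y|lborel. (g x * ?e x) * cnj (g (x - y) * ?e (x - y)))"
    proof (rule Bochner_Integration.integral_cong[OF refl])
      fix y show "?k x y * ?e y = (g x * ?e x) * cnj (g (x - y) * ?e (x - y))"
        by (subst ph[of y]) (simp only: complex_cnj_mult mult_ac)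
    qed
    also have "\<dots> = (g x * ?e x) * (LINT y|lborel. cnj (g (x - y) * ?e (x - y)))" by simp
    also have "(LINT y|lborel. cnj (g (x - y) * ?e (x - y))) = (LINT y|lborel. cnj (g y * ?e y))"
      by (rule lborel_integral_reflect(1)[of "\<lambda>y. cnj (g y * ?e y)" x]) measurable
    also have "\<dots> = cnj (LINT y|lborel. g y * ?e y)" by (rule Bochner_Integration.integral_cnj)
    finally show "(LINT y|lborel. ?k x y * ?e y) = g x * ?e x * cnj (LINT y|lborel. g y * ?e y)" .
  qed
  also have "\<dots> = fourier_int g z * cnj (fourier_int g z)"
    by (simp add: fourier_int_borel_lborel)
  finally show "fourier_int (autocorrelation g) z = of_real ((norm (fourier_int g z))\<^sup>2)"
    by (simp only: complex_norm_square)
qed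

lemma gauss_real: "gauss e z = of_real (exp (- e\<^sup>2 * (norm (z::real^'n::finite))\<^sup>2 / 2))"
proof -
  have "(\<Sum>i\<in>UNIV. - (e * z $ i)\<^sup>2 / 2) = - e\<^sup>2 * (norm z)\<^sup>2 / 2"
    by (simp add: norm_vec_def L2_set_def sum_nonneg power_mult_distrib sum_negf sum_distrib_left[symmetric] sum_divide_distrib[symmetric])
  then show ?thesis
    unfolding gauss_def by (simp only: of_real_prod[symmetric] exp_sum[symmetric] finite_class.finite_UNIV)
qed

text \<open>By the multiplication formula, the integral of \<open>\<bar>g^\<bar>\<^sup>2\<close> against a Gaussian of width \<open>1 / e\<close> is the
autocorrelation averaged with a Gaussian of width about \<open>e\<close>. As \<open>e \<rightarrow> 0\<close> one side increases to the
integral of \<open>\<bar>g^\<bar>\<^sup>2\<close> and the other tends to the autocorrelation at the origin.\<close>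

lemma plancherel_bounded:
  fixes g :: "real^'n::finite \<Rightarrow> complex"
  assumes g: "integrable lborel g" and B: "\<And>x. norm (g x) \<le> B"
  shows "memLp 2 (fourier_int g)" "sq_norm (fourier_int g) = sq_norm g"
proof -
  have gm [measurable]: "g \<in> borel_measurable borel" using borel_measurable_integrable[OF g] by simp
  have gl [measurable]: "g \<in> borel_measurable lebesgue" by (rule measurable_lebesgue_borel[OF gm])
  have gi: "integrable lebesgue g" using g integrable_completion[of g lborel] by simp
  note [measurable] = fourier_int_measurable[OF gl] fourier_int_measurable_lebesgue[OF gl]
  let ?a = "autocorrelation g" and ?G = "\<lambda>z. (norm (fourier_int g z))\<^sup>2"
  define e where "e k = 1 / real (Suc k)" for k
  have e: "e k > 0" "e k \<le> 1" for k by (auto simp: e_def)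
  let ?w = "\<lambda>k z. exp (- (e k)\<^sup>2 * (norm (z::real^'n))\<^sup>2 / 2)"
  have w: "gauss (e k) z = of_real (?w k z)" for k z by (rule gauss_real)
  have iw: "integrable lebesgue (gauss (e k) :: real^'n \<Rightarrow> complex)" for k
    by (rule integrable_lebesgueI[OF gauss_measurable(1) fourier_gauss(1)[OF e(1)]])
  have iw': "integrable lborel (?w k)" for k
    using fourier_gauss(1)[OF e(1)[of k], where 'n='n] unfolding w[abs_def] complex_of_real_integrable_eq .
  have ia: "integrable lebesgue ?a"
    using fourier_autocorrelation(1)[OF g] integrable_completion[of ?a lborel] by simp
  have 1: "(LINT z|lborel. ?G z * ?w k z) = Re (LINT y|lborel. ?a y * gauss_kernel (e k) y)" for k
  proof -
    have "of_real (LINT z|lborel. ?G z * ?w k z) = (LINT z|lborel. fourier_int ?a z * gauss (e k) z)"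
      unfolding integral_complex_of_real[symmetric]
      by (simp only: fourier_autocorrelation(2)[OF g] w of_real_mult)
    also have "\<dots> = (LINT z|lebesgue. fourier_int ?a z * gauss (e k) z)"
      by (rule integral_completion[symmetric])
        (use fourier_int_measurable[OF borel_measurable_integrable[OF ia]] in simp)
    also have "\<dots> = (LINT y|lebesgue. ?a y * fourier_int (gauss (e k)) y)"
      by (rule fourier_int_multiplication[OF ia iw])
    also have "\<dots> = (LINT y|lborel. ?a y * gauss_kernel (e k) y)"
      unfolding fourier_gauss(2)[OF e(1)] by (rule integral_completion) simp
    finally have "complex_of_real (LINT z|lborel. ?G z * ?w k z) = (LINT y|lborel. ?a y * gauss_kernel (e k) y)" .
    from arg_cong[OF this, of Re] show ?thesis by (simp only: Re_complex_of_real)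
  qed
  have 2: "(LINT y|lborel. ?a y * gauss_kernel (e k) y) = (LINT y|lborel. ?a (e k *\<^sub>R y) * gauss_kernel 1 y)" for k
  proof -
    have "(LINT y|lborel. ?a y * gauss_kernel (e k) y)
        = (e k ^ DIM(real^'n)) *\<^sub>R (LINT y|lborel. ?a (e k *\<^sub>R y) * gauss_kernel (e k) (e k *\<^sub>R y))"
      by (rule lborel_integral_scale[OF _ e(1)]) measurable
    also have "\<dots> = (LINT y|lborel. ?a (e k *\<^sub>R y) * (of_real (e k ^ CARD('n)) * gauss_kernel (e k) (e k *\<^sub>R y)))"
      by (simp add: scaleR_conv_of_real mult.left_commute)
    finally show ?thesis by (simp only: gauss_kernel_scale[OF e(1)])
  qed
  have e0: "e \<longlonglongrightarrow> 0" unfolding e_def by (rule LIMSEQ_Suc[OF lim_1_over_n])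
  have 3: "(\<lambda>k. LINT y|lborel. ?a (e k *\<^sub>R y) * gauss_kernel 1 y) \<longlonglongrightarrow> (LINT y::(real^'n)|lborel. ?a 0 * gauss_kernel 1 y)"
  proof (rule integral_dominated_convergence)
    let ?C = "B * (LINT x|lborel. norm (g x))"
    show "integrable lborel (\<lambda>y::real^'n. ?C * norm (gauss_kernel 1 y))"
      by (intro integrable_mult_right integrable_norm gauss_kernel_integral) simp
    show "AE y::real^'n in lborel. (\<lambda>k. ?a (e k *\<^sub>R y) * gauss_kernel 1 y) \<longlonglongrightarrow> ?a 0 * gauss_kernel 1 y"
    proof (rule AE_I2)
      fix y :: "real^'n"
      have "(\<lambda>k. e k *\<^sub>R y) \<longlonglongrightarrow> 0" using tendsto_scaleR[OF e0 tendsto_const[of y]] by simp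
      then show "(\<lambda>k. ?a (e k *\<^sub>R y) * gauss_kernel 1 y) \<longlonglongrightarrow> ?a 0 * gauss_kernel 1 y"
        by (intro tendsto_intros autocorrelation_bounded_case(3)[OF g B])
    qed
    show "AE y in lborel. norm (?a (e k *\<^sub>R y) * gauss_kernel 1 y) \<le> ?C * norm (gauss_kernel 1 y :: complex)" for k
      unfolding norm_mult
      by (intro AE_I2 mult_right_mono autocorrelation_bounded_case(2)[OF g B] norm_ge_zero)
  qed measurable
  have sg: "sq_norm g = Re (?a 0)"
  proof -
    have "sq_norm g = (LINT x|lborel. (norm (g x))\<^sup>2)"
      unfolding sq_norm_def by (rule integral_completion) simp
    moreover have "?a 0 = of_real (LINT x|lborel. (norm (g x))\<^sup>2)"
      unfolding autocorrelation_def integral_complex_of_real[symmetric] by (simp only: complex_norm_square diff_zero)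
    ultimately show ?thesis by simp
  qed
  have "(LINT y::(real^'n)|lborel. ?a 0 * gauss_kernel 1 y) = ?a 0"
    by (simp add: gauss_kernel_integral)
  with 3 have lim: "(\<lambda>k. LINT z|lborel. ?G z * ?w k z) \<longlonglongrightarrow> sq_norm g"
    unfolding 1 2 sg by (auto intro: tendsto_Re)
  have int: "integrable lborel (\<lambda>z. ?G z * ?w k z)" for k
  proof (rule Bochner_Integration.integrable_bound)
    let ?D = "(LINT x|lebesgue. norm (g x))\<^sup>2"
    show "integrable lborel (\<lambda>z. ?D * ?w k z)" using iw' by simp
    show "AE z in lborel. norm (?G z * ?w k z) \<le> norm (?D * ?w k z)"
      by (intro AE_I2) (auto simp: abs_mult intro!: mult_right_mono power_mono fourier_int_norm_le[OF gi])
  qed measurable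
  have mono: "AE z in lborel. mono (\<lambda>k. ?G z * ?w k z)"
  proof (rule AE_I2, rule monoI)
    fix z :: "real^'n" and j k :: nat assume "j \<le> k"
    then have "e k \<le> e j" by (simp add: e_def frac_le)
    then have "(e k)\<^sup>2 * (norm z)\<^sup>2 \<le> (e j)\<^sup>2 * (norm z)\<^sup>2"
      using e(1)[of k] by (intro mult_right_mono power_mono) auto
    then show "?G z * ?w j z \<le> ?G z * ?w k z" by (intro mult_left_mono) auto
  qed
  have ptw: "AE z in lborel. (\<lambda>k. ?G z * ?w k z) \<longlonglongrightarrow> ?G z"
  proof (rule AE_I2)
    fix z :: "real^'n"
    have "(\<lambda>k. ?G z * ?w k z) \<longlonglongrightarrow> ?G z * exp (- 0\<^sup>2 * (norm z)\<^sup>2 / 2)"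
      by (intro tendsto_intros e0) simp
    then show "(\<lambda>k. ?G z * ?w k z) \<longlonglongrightarrow> ?G z" by simp
  qed
  have Gm: "?G \<in> borel_measurable lborel" by simp
  have "integrable lborel ?G" "(LINT z|lborel. ?G z) = sq_norm g"
    using integrable_monotone_convergence[OF int mono ptw lim Gm]
      integral_monotone_convergence[OF int mono ptw lim Gm] by auto
  then show "memLp 2 (fourier_int g)" "sq_norm (fourier_int g) = sq_norm g"
    using integrable_completion[of ?G lborel] integral_completion[of ?G lborel]
    by (simp_all add: memLp_2_iff sq_norm_def)
qed

lemma plancherel_bounded_lebesgue:
  fixes g :: "real^'n::finite \<Rightarrow> complex"
  assumes g: "integrable lebesgue g" and B: "\<And>x. norm (g x) \<le> B"
  shows "memLp 2 (fourier_int g)" "sq_norm (fourier_int g) = sq_norm g"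
proof -
  have gm: "g \<in> borel_measurable lebesgue" using g by auto
  obtain h where h [measurable]: "h \<in> borel_measurable borel" and ae: "AE x in lebesgue. g x = h x"
    using AE_lebesgue_borel_version[OF gm] by blast
  \<comment> \<open>a Borel version that keeps the bound at every point\<close>
  define k where "k x = (if norm (h x) \<le> B then h x else 0)" for x
  have k [measurable]: "k \<in> borel_measurable borel" unfolding k_def by measurable
  have B0: "B \<ge> 0" using B[of 0] norm_ge_zero order_trans by blast
  have ae': "AE x in lebesgue. g x = k x"
    using ae
  proof eventually_elim
    case (elim x)
    then show ?case using B[of x] by (simp add: k_def)
  qed
  have "integrable lebesgue k"
    using integrable_cong_AE_imp[OF g measurable_lebesgue_borel[OF k]] ae' by (auto simp: eq_commute)
  then have i: "integrable lborel k" by (rule integrable_completion_I[OF k])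
  have b: "norm (k x) \<le> B" for x using B0 by (auto simp: k_def)
  have "fourier_int g = fourier_int k" by (rule fourier_int_cong_AE[OF gm ae'])
  moreover have "sq_norm g = sq_norm k"
    by (rule sq_norm_cong_AE[OF gm measurable_lebesgue_borel[OF k] ae'])
  ultimately show "memLp 2 (fourier_int g)" "sq_norm (fourier_int g) = sq_norm g"
    using plancherel_bounded[OF i b] by simp_all
qed

text \<open>Truncations of \<open>g\<close> converge in \<open>L\<^sup>1\<close>, so their transforms converge pointwise; Fatou's lemma gives the
inequality \<open>\<le>\<close>. Applied to the error of truncation, this inequality turns the convergence of the
transforms into convergence in \<open>L\<^sup>2\<close>, and equality passes to the limit.\<close>

theorem plancherel:
  fixes g :: "real^'n::finite \<Rightarrow> complex"
  assumes "L1_L2 g"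
  shows "memLp 2 (fourier_int g)" "sq_norm (fourier_int g) = sq_norm g"
proof -
  have bound: "memLp 2 (fourier_int h) \<and> sq_norm (fourier_int h) \<le> sq_norm h" if h: "L1_L2 h" for h :: "real^'n \<Rightarrow> complex"
  proof -
    have h1: "integrable lebesgue h" and h2: "memLp 2 h" using h by (auto simp: L1_L2_def memLp_1_iff)
    have hm [measurable]: "h \<in> borel_measurable lebesgue" using h1 by auto
    note tr = truncation[OF hm]
    note [measurable] = tr(1) fourier_int_measurable_lebesgue[OF hm] fourier_int_measurable_lebesgue[OF tr(1)]
    have ti: "integrable lebesgue (truncation k h)" for k using tr(2) by (simp add: memLp_1_iff)
    have ptw: "(\<lambda>k. fourier_int (truncation k h) z) \<longlonglongrightarrow> fourier_int h z" for z
      unfolding fourier_int_cis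
    proof (rule integral_dominated_convergence)
      show "integrable lebesgue (\<lambda>x. norm (h x))" using h1 by simp
      show "AE x in lebesgue. (\<lambda>k. truncation k h x * cis (- (2 * pi * (x \<bullet> z)))) \<longlonglongrightarrow> h x * cis (- (2 * pi * (x \<bullet> z)))"
        by (intro AE_I2 tendsto_intros tr(6))
      show "AE x in lebesgue. norm (truncation k h x * cis (- (2 * pi * (x \<bullet> z)))) \<le> norm (h x)" for k
        using tr(5) by (simp add: norm_mult)
    qed measurable
    have "(\<integral>\<^sup>+z. ennreal ((norm (fourier_int h z))\<^sup>2) \<partial>lebesgue)
        = (\<integral>\<^sup>+z. liminf (\<lambda>k. ennreal ((norm (fourier_int (truncation k h) z))\<^sup>2)) \<partial>lebesgue)"
    proof (rule nn_integral_cong)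
      fix z
      have "(\<lambda>k. ennreal ((norm (fourier_int (truncation k h) z))\<^sup>2)) \<longlonglongrightarrow> ennreal ((norm (fourier_int h z))\<^sup>2)"
        by (intro tendsto_ennrealI tendsto_intros ptw)
      then show "ennreal ((norm (fourier_int h z))\<^sup>2) = liminf (\<lambda>k. ennreal ((norm (fourier_int (truncation k h) z))\<^sup>2))"
        by (intro lim_imp_Liminf[symmetric]) simp_all
    qed
    also have "\<dots> \<le> liminf (\<lambda>k. \<integral>\<^sup>+z. ennreal ((norm (fourier_int (truncation k h) z))\<^sup>2) \<partial>lebesgue)"
      by (rule nn_integral_liminf) measurable
    also have "\<dots> \<le> ennreal (sq_norm h)"
    proof (rule Liminf_le)
      show "\<forall>\<^sub>F k in sequentially. (\<integral>\<^sup>+z. ennreal ((norm (fourier_int (truncation k h) z))\<^sup>2) \<partial>lebesgue) \<le> ennreal (sq_norm h)"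
      proof (rule always_eventually, rule allI)
        fix k
        have "(\<integral>\<^sup>+z. ennreal ((norm (fourier_int (truncation k h) z))\<^sup>2) \<partial>lebesgue) = ennreal (sq_norm (fourier_int (truncation k h)))"
          unfolding sq_norm_def using plancherel_bounded_lebesgue(1)[OF ti tr(4)]
          by (intro nn_integral_eq_integral) (auto simp: memLp_2_iff)
        also have "\<dots> \<le> ennreal (sq_norm h)"
          using memLp_2_bound(2)[OF h2 tr(1), of k 1] tr(5)
          by (intro ennreal_leI) (simp add: plancherel_bounded_lebesgue(2)[OF ti tr(4)])
        finally show "(\<integral>\<^sup>+z. ennreal ((norm (fourier_int (truncation k h) z))\<^sup>2) \<partial>lebesgue) \<le> ennreal (sq_norm h)" .
      qed
    qed simp
    finally have f: "(\<integral>\<^sup>+z. ennreal ((norm (fourier_int h z))\<^sup>2) \<partial>lebesgue) \<le> ennreal (sq_norm h)" .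
    have i: "integrable lebesgue (\<lambda>z. (norm (fourier_int h z))\<^sup>2)"
      by (rule integrableI_nonneg) (use f in \<open>auto intro: le_less_trans\<close>)
    moreover have "sq_norm (fourier_int h) \<le> sq_norm h"
      using f nn_integral_eq_integral[OF i] by (simp add: sq_norm_def)
    ultimately show ?thesis by (simp add: memLp_2_iff fourier_int_measurable_lebesgue[OF hm])
  qed
  from bound[OF assms] show M: "memLp 2 (fourier_int g)" by blast
  have g1: "integrable lebesgue g" and g2: "memLp 2 g" using assms by (auto simp: L1_L2_def memLp_1_iff)
  have gm: "g \<in> borel_measurable lebesgue" using g1 by auto
  note tr = truncation[OF gm]
  have ti: "integrable lebesgue (truncation k g)" for k using tr(2) by (simp add: memLp_1_iff)
  have "L1_L2 (\<lambda>x. truncation k g x - g x)" for k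
    using ti g1 tr(3) g2 by (auto simp: L1_L2_def memLp_1_iff memLp_2_diff)
  from bound[OF this]
  have "sq_norm (\<lambda>z. fourier_int (truncation k g) z - fourier_int g z) \<le> sq_norm (\<lambda>x. truncation k g x - g x)" for k
    by (simp add: fourier_int_diff[OF ti g1])
  then have lim: "(\<lambda>k. sq_norm (\<lambda>z. fourier_int (truncation k g) z - fourier_int g z)) \<longlonglongrightarrow> 0"
    by (intro Lim_null_comparison[OF _ truncation_L2[OF g2]] always_eventually allI) simp
  have "(\<lambda>k. sq_norm (fourier_int (truncation k g))) \<longlonglongrightarrow> sq_norm (fourier_int g)"
    by (rule sq_norm_tendsto[OF _ M lim]) (rule plancherel_bounded_lebesgue(1)[OF ti tr(4)])
  then have "(\<lambda>k. sq_norm (truncation k g)) \<longlonglongrightarrow> sq_norm (fourier_int g)"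
    by (simp add: plancherel_bounded_lebesgue(2)[OF ti tr(4)])
  moreover have "(\<lambda>k. sq_norm (truncation k g)) \<longlonglongrightarrow> sq_norm g"
    by (rule sq_norm_tendsto[OF tr(3) g2 truncation_L2[OF g2]])
  ultimately show "sq_norm (fourier_int g) = sq_norm g" by (rule LIMSEQ_unique)
qed

section \<open>The Fourier transform on \<open>L\<^sup>2\<close>\<close>

lemma tendsto_0_le:
  fixes a b :: "nat \<Rightarrow> real"
  assumes "\<And>k. 0 \<le> a k" "\<And>k. a k \<le> b k" "b \<longlonglongrightarrow> 0"
  shows "a \<longlonglongrightarrow> 0"
  by (rule Lim_null_comparison[OF always_eventually assms(3)]) (simp add: assms)

lemma inner_complex_cnj: "(a::complex) \<bullet> b = Re (a * cnj b)"
  by (simp add: inner_complex_def)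

lemma integral_inner_complex:
  fixes f g :: "'a::euclidean_space \<Rightarrow> complex"
  assumes "memLp 2 f" "memLp 2 g"
  shows "(LINT x|lebesgue. f x \<bullet> g x) = Re (LINT x|lebesgue. f x * cnj (g x))"
proof -
  have "memLp 2 (\<lambda>x. cnj (g x))"
    using assms(2) by (simp add: memLp_2_iff cnj_measurable)
  then show ?thesis
    unfolding inner_complex_cnj
    by (rule integral_Re[OF L2_mult_integrable[OF assms(1)]])
qed

text \<open>The two transforms extend from \<open>L\<^sup>1 \<inter> L\<^sup>2\<close> to \<open>L\<^sup>2\<close> for the same reasons, collected here: they
  are linear and isometric there.\<close>

locale L2_isometry =
  fixes T :: "(real^'n::finite \<Rightarrow> complex) \<Rightarrow> real^'n \<Rightarrow> complex"
  assumes T_add: "L1_L2 g \<Longrightarrow> L1_L2 h \<Longrightarrow> T (\<lambda>x. g x + h x) = (\<lambda>z. T g z + T h z)"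
    and T_cmult: "T (\<lambda>x. c * g x) = (\<lambda>z. c * T g z)"
    and T_L2: "L1_L2 g \<Longrightarrow> memLp 2 (T g)"
    and T_norm: "L1_L2 g \<Longrightarrow> sq_norm (T g) = sq_norm g"
begin

abbreviation "X \<equiv> L2_extension T"

text \<open>The closure of the graph of \<open>T\<close>. Stating linearity and isometry for this relation avoids any
reference to the value that the choice operator picks.\<close>

definition extends_to :: "(real^'n \<Rightarrow> complex) \<Rightarrow> (real^'n \<Rightarrow> complex) \<Rightarrow> bool" where
  "extends_to g G \<longleftrightarrow> memLp 2 G \<and> (\<exists>gk. (\<forall>k. memLp 1 (gk k) \<and> memLp 2 (gk k)) \<and>
     Lp_tendsto 2 gk g \<and> Lp_tendsto 2 (\<lambda>k. T (gk k)) G)"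

lemma X_eq_some: "X g = (SOME G. extends_to g G)"
  by (simp add: L2_extension_def extends_to_def)

lemma T_diff:
  assumes "L1_L2 g" "L1_L2 h"
  shows "T (\<lambda>x. g x - h x) = (\<lambda>z. T g z - T h z)"
  using T_add[OF assms(1) L1_L2_cmult[OF assms(2), of "-1"]] T_cmult[of "-1" h] by simp

lemma L1_L2_diff: "L1_L2 g \<Longrightarrow> L1_L2 h \<Longrightarrow> L1_L2 (\<lambda>x. (g x::complex) - h x)"
  using L1_L2_add[OF _ L1_L2_cmult, of g h "-1"] by simp

lemma extends_toE:
  assumes "extends_to g G"
  obtains gk where "\<And>k. L1_L2 (gk k)" "(\<lambda>k. sq_norm (\<lambda>x. gk k x - g x)) \<longlonglongrightarrow> 0"
    "(\<lambda>k. sq_norm (\<lambda>x. T (gk k) x - G x)) \<longlonglongrightarrow> 0" "memLp 2 G"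
  using assms unfolding extends_to_def Lp_tendsto_2_iff L1_L2_def by blast

lemma extends_toI:
  assumes gk: "\<And>k. L1_L2 (gk k)" and g: "memLp 2 g" and G: "memLp 2 G"
    and "(\<lambda>k. sq_norm (\<lambda>x. gk k x - g x)) \<longlonglongrightarrow> 0" "(\<lambda>k. sq_norm (\<lambda>x. T (gk k) x - G x)) \<longlonglongrightarrow> 0"
  shows "extends_to g G"
proof -
  have "memLp 2 (\<lambda>x. gk k x - g x)" "memLp 2 (\<lambda>x. T (gk k) x - G x)" for k
    using gk[of k] g G T_L2 by (auto simp: L1_L2_def intro!: memLp_2_diff)
  then show ?thesis
    using assms unfolding extends_to_def Lp_tendsto_2_iff L1_L2_def by blast
qed

lemma extends_to_exists:
  assumes g: "memLp 2 g"
  shows "\<exists>G. extends_to g G"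
proof -
  let ?t = "\<lambda>k. truncation k g"
  note tr = truncation[OF memLp_measurable[OF g]]
  have t: "L1_L2 (?t k)" for k using tr by (simp add: L1_L2_def)
  have t2: "memLp 2 (?t k)" for k using tr by simp
  have "\<exists>N. \<forall>i\<ge>N. \<forall>j\<ge>N. sq_norm (\<lambda>x. T (?t i) x - T (?t j) x) < e" if e: "e > 0" for e
  proof -
    obtain N where N: "\<And>k. k \<ge> N \<Longrightarrow> sq_norm (\<lambda>x. ?t k x - g x) < e / 4"
      using LIMSEQ_D[OF truncation_L2[OF g], of "e/4"] e by auto
    have "sq_norm (\<lambda>x. T (?t i) x - T (?t j) x) < e" if "i \<ge> N" "j \<ge> N" for i j
    proof -
      have "sq_norm (\<lambda>x. T (?t i) x - T (?t j) x) = sq_norm (\<lambda>x. ?t i x - ?t j x)"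
        using T_norm[OF L1_L2_diff[OF t t]] T_diff[OF t t] by simp
      also have "\<dots> = sq_norm (\<lambda>x. (?t i x - g x) - (?t j x - g x))" by simp
      also have "\<dots> \<le> 2 * sq_norm (\<lambda>x. ?t i x - g x) + 2 * sq_norm (\<lambda>x. ?t j x - g x)"
        by (intro sq_norm_diff_le memLp_2_diff t2 g)
      also have "\<dots> < e" using N[OF that(1)] N[OF that(2)] by simp
      finally show ?thesis .
    qed
    then show ?thesis by blast
  qed
  from L2_complete[OF T_L2[OF t] this]
  obtain G where "memLp 2 G" "(\<lambda>k. sq_norm (\<lambda>x. T (?t k) x - G x)) \<longlonglongrightarrow> 0" by blast
  then show ?thesis using extends_toI[OF t g _ truncation_L2[OF g]] by blast
qed

lemma extends_to_X: "memLp 2 g \<Longrightarrow> extends_to g (X g)"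
  unfolding X_eq_some by (rule someI_ex[OF extends_to_exists])

lemma extends_to_add:
  assumes g: "memLp 2 g" "extends_to g G" and h: "memLp 2 h" "extends_to h H"
  shows "extends_to (\<lambda>x. g x + c * h x) (\<lambda>z. G z + c * H z)"
proof -
  obtain gk where gk: "\<And>k. L1_L2 (gk k)" "(\<lambda>k. sq_norm (\<lambda>x. gk k x - g x)) \<longlonglongrightarrow> 0"
    "(\<lambda>k. sq_norm (\<lambda>x. T (gk k) x - G x)) \<longlonglongrightarrow> 0" and G: "memLp 2 G"
    using extends_toE[OF g(2)] by blast
  obtain hk where hk: "\<And>k. L1_L2 (hk k)" "(\<lambda>k. sq_norm (\<lambda>x. hk k x - h x)) \<longlonglongrightarrow> 0"
    "(\<lambda>k. sq_norm (\<lambda>x. T (hk k) x - H x)) \<longlonglongrightarrow> 0" and H: "memLp 2 H"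
    using extends_toE[OF h(2)] by blast
  have lim: "(\<lambda>k. sq_norm (\<lambda>x. (ak k x + c * bk k x) - (a x + c * b x))) \<longlonglongrightarrow> 0"
    if "\<And>k. memLp 2 (ak k)" "\<And>k. memLp 2 (bk k)" "memLp 2 a" "memLp 2 b"
      and l: "(\<lambda>k. sq_norm (\<lambda>x. ak k x - a x)) \<longlonglongrightarrow> 0" "(\<lambda>k. sq_norm (\<lambda>x. bk k x - b x)) \<longlonglongrightarrow> 0"
    for ak bk :: "nat \<Rightarrow> real^'n \<Rightarrow> complex" and a b
  proof -
    have "sq_norm (\<lambda>x. (ak k x + c * bk k x) - (a x + c * b x))
        \<le> 2 * sq_norm (\<lambda>x. ak k x - a x) + 2 * ((norm c)\<^sup>2 * sq_norm (\<lambda>x. bk k x - b x))" for k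
    proof -
      have d: "memLp 2 (\<lambda>x. ak k x - a x)" "memLp 2 (\<lambda>x. bk k x - b x)" by (intro memLp_2_diff that)+
      have "(\<lambda>x. (ak k x + c * bk k x) - (a x + c * b x)) = (\<lambda>x. (ak k x - a x) + c * (bk k x - b x))"
        by (simp add: algebra_simps)
      then show ?thesis
        using sq_norm_add_le[OF d(1) memLp_2_cmult(1)[OF d(2), of c]] memLp_2_cmult(2)[OF d(2), of c] by simp
    qed
    moreover have "(\<lambda>k. 2 * sq_norm (\<lambda>x. ak k x - a x) + 2 * ((norm c)\<^sup>2 * sq_norm (\<lambda>x. bk k x - b x))) \<longlonglongrightarrow> 2 * 0 + 2 * ((norm c)\<^sup>2 * 0)"
      by (intro tendsto_intros l)
    then have "(\<lambda>k. 2 * sq_norm (\<lambda>x. ak k x - a x) + 2 * ((norm c)\<^sup>2 * sq_norm (\<lambda>x. bk k x - b x))) \<longlonglongrightarrow> 0" by simp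
    ultimately show ?thesis by (rule tendsto_0_le[OF sq_norm_nonneg])
  qed
  have gk2: "memLp 2 (gk k)" and hk2: "memLp 2 (hk k)" for k using gk(1) hk(1) by (auto simp: L1_L2_def)
  show ?thesis
  proof (rule extends_toI)
    show "L1_L2 (\<lambda>x. gk k x + c * hk k x)" for k by (intro L1_L2_add L1_L2_cmult gk hk)
    show "(\<lambda>k. sq_norm (\<lambda>x. (gk k x + c * hk k x) - (g x + c * h x))) \<longlonglongrightarrow> 0"
      by (intro lim gk2 hk2 g h gk hk)
    have "T (\<lambda>x. gk k x + c * hk k x) = (\<lambda>z. T (gk k) z + c * T (hk k) z)" for k
      using T_add[OF gk(1) L1_L2_cmult[OF hk(1)]] T_cmult by metis
    then show "(\<lambda>k. sq_norm (\<lambda>x. T (\<lambda>x. gk k x + c * hk k x) x - (G x + c * H x))) \<longlonglongrightarrow> 0"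
      by (simp only:) (intro lim T_L2 gk hk G H)
  qed (intro memLp_2_add memLp_2_cmult g h G H)+
qed

lemma extends_to_norm:
  assumes g: "memLp 2 g" and "extends_to g G"
  shows "sq_norm G = sq_norm g"
proof -
  obtain gk where gk: "\<And>k. L1_L2 (gk k)" "(\<lambda>k. sq_norm (\<lambda>x. gk k x - g x)) \<longlonglongrightarrow> 0"
    "(\<lambda>k. sq_norm (\<lambda>x. T (gk k) x - G x)) \<longlonglongrightarrow> 0" and G: "memLp 2 G"
    using extends_toE[OF assms(2)] by blast
  have gk2: "memLp 2 (gk k)" for k using gk(1) by (auto simp: L1_L2_def)
  have "(\<lambda>k. sq_norm (gk k)) \<longlonglongrightarrow> sq_norm g" by (rule sq_norm_tendsto[OF gk2 g gk(2)])
  moreover have "(\<lambda>k. sq_norm (T (gk k))) \<longlonglongrightarrow> sq_norm G" by (rule sq_norm_tendsto[OF T_L2[OF gk(1)] G gk(3)])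
  ultimately show ?thesis by (simp add: T_norm[OF gk(1)] LIMSEQ_unique)
qed

lemma extends_to_L1_L2:
  assumes "L1_L2 g" shows "extends_to g (T g)"
  using assms T_L2[OF assms] by (intro extends_toI[of "\<lambda>_. g"]) (auto simp: L1_L2_def sq_norm_def)

lemma X_memLp: "memLp 2 g \<Longrightarrow> memLp 2 (X g)"
  using extends_to_X by (auto simp: extends_to_def)

lemma X_measurable: "memLp 2 g \<Longrightarrow> X g \<in> borel_measurable lebesgue"
  using X_memLp memLp_measurable by blast

lemma X_norm: "memLp 2 g \<Longrightarrow> sq_norm (X g) = sq_norm g"
  by (intro extends_to_norm extends_to_X)

text \<open>Linearity and isometry of the relation make its value unique up to null sets.\<close>

lemma extends_to_unique:
  assumes g: "memLp 2 g" and G: "extends_to g G"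
  shows "AE z in lebesgue. X g z = G z"
proof -
  have m: "memLp 2 (X g)" "memLp 2 G" using X_memLp[OF g] G by (auto simp: extends_to_def)
  have "extends_to (\<lambda>x. g x + (-1) * g x) (\<lambda>z. X g z + (-1) * G z)"
    by (intro extends_to_add extends_to_X g G)
  then have "sq_norm (\<lambda>z. X g z + (-1) * G z) = sq_norm (\<lambda>x. g x + (-1) * g x)"
    by (intro extends_to_norm memLp_2_add memLp_2_cmult g)
  then have "sq_norm (\<lambda>z. X g z - G z) = 0" by (simp add: sq_norm_def)
  then show ?thesis using sq_norm_eq_0_iff[OF memLp_2_diff(1)[OF m]] by simp
qed

lemma X_add_cmult:
  assumes "memLp 2 g" "memLp 2 h"
  shows "AE z in lebesgue. X (\<lambda>x. g x + c * h x) z = X g z + c * X h z"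
  by (intro extends_to_unique extends_to_add extends_to_X memLp_2_add memLp_2_cmult assms)

lemma memLp_2_0: "memLp 2 (\<lambda>_. 0)"
  by (simp add: memLp_2_iff)

lemma X_0: "AE z in lebesgue. X (\<lambda>_. 0) z = 0"
  using sq_norm_eq_0_iff[OF X_memLp[OF memLp_2_0]] X_norm[OF memLp_2_0] by (simp add: sq_norm_def)

lemma X_diff:
  assumes "memLp 2 g" "memLp 2 h" shows "AE z in lebesgue. X (\<lambda>x. g x - h x) z = X g z - X h z"
  using X_add_cmult[OF assms, of "-1"] by simp

lemma X_add:
  assumes "memLp 2 g" "memLp 2 h" shows "AE z in lebesgue. X (\<lambda>x. g x + h x) z = X g z + X h z"
  using X_add_cmult[OF assms, of 1] by simp

lemma X_sum:
  assumes "finite I" "\<And>i. i \<in> I \<Longrightarrow> memLp 2 (g i)"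
  shows "memLp 2 (\<lambda>x. \<Sum>i\<in>I. c i * g i x) \<and> (AE z in lebesgue. X (\<lambda>x. \<Sum>i\<in>I. c i * g i x) z = (\<Sum>i\<in>I. c i * X (g i) z))"
  using assms
proof (induction I rule: finite_induct)
  case empty
  show ?case using X_0 memLp_2_0 by simp
next
  case (insert i I)
  then have m: "memLp 2 (\<lambda>x. \<Sum>i\<in>I. c i * g i x)" "memLp 2 (g i)"
    and ae: "AE z in lebesgue. X (\<lambda>x. \<Sum>i\<in>I. c i * g i x) z = (\<Sum>i\<in>I. c i * X (g i) z)" by auto
  have "AE z in lebesgue. X (\<lambda>x. (\<Sum>i\<in>I. c i * g i x) + c i * g i x) z = X (\<lambda>x. \<Sum>i\<in>I. c i * g i x) z + c i * X (g i) z"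
    by (rule X_add_cmult[OF m])
  then have "AE z in lebesgue. X (\<lambda>x. c i * g i x + (\<Sum>i\<in>I. c i * g i x)) z = c i * X (g i) z + (\<Sum>i\<in>I. c i * X (g i) z)"
    using ae by eventually_elim (simp add: add.commute)
  then show ?case using insert.hyps memLp_2_add(1)[OF memLp_2_cmult(1)[OF m(2), of "c i"] m(1)] by simp
qed

lemma X_cong:
  assumes g: "memLp 2 g" and ae: "AE x in lebesgue. g x = h x"
  shows "AE z in lebesgue. X g z = X h z"
proof -
  have h: "memLp 2 h" by (rule memLp_cong_AE'[OF g ae])
  have d: "memLp 2 (\<lambda>x. g x - h x)" by (rule memLp_2_diff(1)[OF g h])
  have "sq_norm (\<lambda>x. g x - h x) = 0"
    using sq_norm_eq_0_iff[OF d] ae by auto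
  then have "AE z in lebesgue. X (\<lambda>x. g x - h x) z = 0"
    using X_norm[OF d] sq_norm_eq_0_iff[OF X_memLp[OF d]] by simp
  with X_diff[OF g h] show ?thesis by eventually_elim simp
qed

lemma X_eq_T: "L1_L2 g \<Longrightarrow> AE z in lebesgue. X g z = T g z"
  using extends_to_unique[OF _ extends_to_L1_L2] by (auto simp: L1_L2_def)

lemma X_inner:
  assumes g: "memLp 2 g" and h: "memLp 2 h"
  shows "(LINT z|lebesgue. X g z \<bullet> X h z) = (LINT x|lebesgue. g x \<bullet> h x)"
proof -
  have m: "memLp 2 (\<lambda>x. g x + h x)" by (rule memLp_2_add(1)[OF g h])
  have "sq_norm (\<lambda>z. X g z + X h z) = sq_norm (X (\<lambda>x. g x + h x))"
    by (rule sq_norm_cong_AE[symmetric, OF X_measurable[OF m] _ X_add[OF g h]])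
       (rule memLp_measurable[OF memLp_2_add(1)[OF X_memLp[OF g] X_memLp[OF h]]])
  also have "\<dots> = sq_norm (\<lambda>x. g x + h x)" by (rule X_norm[OF m])
  finally show ?thesis
    unfolding sq_norm_add[OF g h] sq_norm_add[OF X_memLp[OF g] X_memLp[OF h]] X_norm[OF g] X_norm[OF h] by simp
qed

end

locale L2_transform = L2_isometry +
  assumes T_multiplication: "L1_L2 a \<Longrightarrow> L1_L2 b \<Longrightarrow>
    (LINT z|lebesgue. T a z * b z) = (LINT x|lebesgue. a x * T b x)"
begin

lemma X_multiplication:
  assumes a: "memLp 2 a" and b: "L1_L2 b"
  shows "(LINT z|lebesgue. X a z * b z) = (LINT x|lebesgue. a x * T b x)"
proof -
  obtain ak where ak: "\<And>k. L1_L2 (ak k)" "(\<lambda>k. sq_norm (\<lambda>x. ak k x - a x)) \<longlonglongrightarrow> 0"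
    "(\<lambda>k. sq_norm (\<lambda>x. T (ak k) x - X a x)) \<longlonglongrightarrow> 0"
    using extends_toE[OF extends_to_X[OF a]] by blast
  have ak2: "memLp 2 (ak k)" for k using ak(1) by (auto simp: L1_L2_def)
  have b2: "memLp 2 b" using b by (simp add: L1_L2_def)
  have "(\<lambda>k. LINT z|lebesgue. T (ak k) z * b z) \<longlonglongrightarrow> (LINT z|lebesgue. X a z * b z)"
    by (rule L2_mult_tendsto[OF T_L2[OF ak(1)] X_memLp[OF a] b2 ak(3)])
  moreover have "(\<lambda>k. LINT x|lebesgue. ak k x * T b x) \<longlonglongrightarrow> (LINT x|lebesgue. a x * T b x)"
    by (rule L2_mult_tendsto[OF ak2 a T_L2[OF b] ak(2)])
  ultimately show ?thesis by (simp add: T_multiplication[OF ak(1) b] LIMSEQ_unique)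
qed

end

text \<open>Testing \<open>D\<close> with its own truncations yields their squared norms.\<close>

lemma L2_weakly_zero:
  fixes D :: "'a::euclidean_space \<Rightarrow> 'b::euclidean_space"
  assumes D: "memLp 2 D" and orth: "\<And>\<psi>. L1_L2 \<psi> \<Longrightarrow> (LINT x|lebesgue. D x \<bullet> \<psi> x) = 0"
  shows "AE x in lebesgue. D x = 0"
proof -
  note tr = truncation[OF memLp_measurable[OF D]]
  have "sq_norm (truncation k D) = 0" for k
  proof -
    have "L1_L2 (truncation k D)" using tr by (simp add: L1_L2_def)
    from orth[OF this] have "(LINT x|lebesgue. D x \<bullet> truncation k D x) = 0" .
    moreover have "D x \<bullet> truncation k D x = (norm (truncation k D x))\<^sup>2" for x
      by (simp add: truncation_def dot_square_norm)
    ultimately show ?thesis by (simp add: sq_norm_def)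
  qed
  then have "sq_norm D = 0"
    using sq_norm_tendsto[OF tr(3) D truncation_L2[OF D]] by (simp add: LIMSEQ_const_iff)
  then show ?thesis by (simp add: sq_norm_eq_0_iff[OF D])
qed

text \<open>The multiplication formula says that the transform \<open>T'\<close> is adjoint to \<open>T\<close>. For isometries this
  means that it is a left inverse.\<close>

lemma L2_transform_inverse:
  assumes "L2_transform T" "L2_transform T'"
    and cnj: "\<And>\<psi>. T' (\<lambda>x. cnj (\<psi> x)) = (\<lambda>z. cnj (T \<psi> z))" and g: "memLp 2 g"
  shows "AE x in lebesgue. L2_extension T' (L2_extension T g) x = g x"
proof -
  interpret A: L2_transform T by fact
  interpret B: L2_transform T' by fact
  let ?g = "B.X (A.X g)"
  have Xg: "memLp 2 (A.X g)" by (rule A.X_memLp[OF g])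
  have gg: "memLp 2 ?g" by (rule B.X_memLp[OF Xg])
  have "AE x in lebesgue. ?g x - g x = 0"
  proof (rule L2_weakly_zero[OF memLp_2_diff(1)[OF gg g]])
    fix \<psi> :: "real^'a \<Rightarrow> complex" assume \<psi>: "L1_L2 \<psi>"
    then have \<psi>2: "memLp 2 \<psi>" by (simp add: L1_L2_def)
    have "(LINT x|lebesgue. ?g x \<bullet> \<psi> x) = Re (LINT x|lebesgue. ?g x * cnj (\<psi> x))"
      by (rule integral_inner_complex[OF gg \<psi>2])
    also have "(LINT x|lebesgue. ?g x * cnj (\<psi> x)) = (LINT z|lebesgue. A.X g z * cnj (T \<psi> z))"
      using B.X_multiplication[OF Xg L1_L2_cnj[OF \<psi>]] by (simp add: cnj)
    also have "Re \<dots> = (LINT z|lebesgue. A.X g z \<bullet> T \<psi> z)"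
      by (rule integral_inner_complex[OF Xg A.T_L2[OF \<psi>], symmetric])
    also have "\<dots> = (LINT z|lebesgue. A.X g z \<bullet> A.X \<psi> z)"
    proof (rule integral_cong_AE)
      show "AE z in lebesgue. A.X g z \<bullet> T \<psi> z = A.X g z \<bullet> A.X \<psi> z"
        using A.X_eq_T[OF \<psi>] by eventually_elim simp
    qed (auto intro!: borel_measurable_integrable L2_inner_integrable Xg A.X_memLp \<psi>2 A.T_L2 \<psi>)
    also have "\<dots> = (LINT x|lebesgue. g x \<bullet> \<psi> x)" by (rule A.X_inner[OF g \<psi>2])
    finally show "(LINT x|lebesgue. (?g x - g x) \<bullet> \<psi> x) = 0"
      by (simp add: inner_diff_left L2_inner_integrable gg g \<psi>2)
  qed
  then show ?thesis by simp
qed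

lemma inv_fourier_int_eq: "inv_fourier_int g = (\<lambda>z. cnj (fourier_int (\<lambda>x. cnj (g x)) z))"
  by (rule ext) (rule inv_fourier_int_cnj)

global_interpretation F: L2_transform "fourier_int :: (real^'n::finite \<Rightarrow> complex) \<Rightarrow> _"
proof
  fix g h :: "real^'n \<Rightarrow> complex" and c
  show "L1_L2 g \<Longrightarrow> L1_L2 h \<Longrightarrow> fourier_int (\<lambda>x. g x + h x) = (\<lambda>z. fourier_int g z + fourier_int h z)"
    by (simp add: fourier_int_add L1_L2_def memLp_1_iff)
  show "fourier_int (\<lambda>x. c * g x) = (\<lambda>z. c * fourier_int g z)" by (rule fourier_int_cmult)
  show "L1_L2 g \<Longrightarrow> memLp 2 (fourier_int g)" "L1_L2 g \<Longrightarrow> sq_norm (fourier_int g) = sq_norm g"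
    by (rule plancherel; simp)+
  show "L1_L2 g \<Longrightarrow> L1_L2 h \<Longrightarrow> (LINT z|lebesgue. fourier_int g z * h z) = (LINT x|lebesgue. g x * fourier_int h x)"
    by (simp add: fourier_int_multiplication L1_L2_def memLp_1_iff)
qed

global_interpretation I: L2_transform "inv_fourier_int :: (real^'n::finite \<Rightarrow> complex) \<Rightarrow> _"
proof
  fix g h :: "real^'n \<Rightarrow> complex" and c
  show "L1_L2 g \<Longrightarrow> L1_L2 h \<Longrightarrow> inv_fourier_int (\<lambda>x. g x + h x) = (\<lambda>z. inv_fourier_int g z + inv_fourier_int h z)"
    by (simp add: inv_fourier_int_eq F.T_add L1_L2_cnj)
  show "inv_fourier_int (\<lambda>x. c * g x) = (\<lambda>z. c * inv_fourier_int g z)"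
    by (simp add: inv_fourier_int_eq F.T_cmult)
  show "memLp 2 (inv_fourier_int g)" if "L1_L2 g"
    using F.T_L2[OF L1_L2_cnj[OF that]] unfolding inv_fourier_int_eq
    by (simp add: memLp_2_iff cnj_measurable)
  show "sq_norm (inv_fourier_int g) = sq_norm g" if "L1_L2 g"
    using F.T_norm[OF L1_L2_cnj[OF that]] unfolding inv_fourier_int_eq by (simp add: sq_norm_def)
  show "(LINT z|lebesgue. inv_fourier_int g z * h z) = (LINT x|lebesgue. g x * inv_fourier_int h x)"
    if "L1_L2 g" "L1_L2 h"
  proof -
    let ?g = "\<lambda>x. cnj (g x)" and ?h = "\<lambda>x. cnj (h x)"
    have "(LINT z|lebesgue. inv_fourier_int g z * h z) = (LINT z|lebesgue. cnj (fourier_int ?g z * ?h z))"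
      by (simp add: inv_fourier_int_eq)
    also have "\<dots> = cnj (LINT z|lebesgue. fourier_int ?g z * ?h z)" by (rule Bochner_Integration.integral_cnj)
    also have "\<dots> = cnj (LINT z|lebesgue. ?g z * fourier_int ?h z)"
      by (simp add: F.T_multiplication[OF L1_L2_cnj[OF that(1)] L1_L2_cnj[OF that(2)]])
    also have "\<dots> = (LINT z|lebesgue. cnj (?g z * fourier_int ?h z))" by (rule Bochner_Integration.integral_cnj[symmetric])
    finally show ?thesis by (simp add: inv_fourier_int_eq)
  qed
qed

theorem fourier_L2_inversion:
  assumes "memLp 2 g"
  shows "AE x in lebesgue. L2_extension inv_fourier_int (L2_extension fourier_int g) x = g x"
    "AE x in lebesgue. L2_extension fourier_int (L2_extension inv_fourier_int g) x = g x"
  by (rule L2_transform_inverse[OF F.L2_transform_axioms I.L2_transform_axioms _ assms], simp add: inv_fourier_int_eq)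
     (rule L2_transform_inverse[OF I.L2_transform_axioms F.L2_transform_axioms _ assms], simp add: inv_fourier_int_eq)

section \<open>The Sobolev inequality on the Fourier side\<close>

subsection \<open>The inverse square near the origin\<close>

text \<open>The ball is covered by dyadic shells. On the shell at distance about \<open>R / 2\<^sup>k\<close> the integrand is of
order \<open>4\<^sup>k / R\<^sup>2\<close> and the volume of order \<open>R\<^sup>n / 2\<^bsup>nk\<^esup>\<close>, so the sum over the shells is a
convergent geometric series exactly when \<open>n \<ge> 3\<close>.\<close>

lemma inverse_square_nn_integral:
  assumes n: "CARD('n::finite) \<ge> 3"
  obtains K where "K > 0"
    "\<And>R. R > 0 \<Longrightarrow> (\<integral>\<^sup>+z. ennreal ((if norm (z::real^'n) \<le> R then 1 / norm z else 0)\<^sup>2) \<partial>lborel) \<le> ennreal (K * R ^ (CARD('n) - 2))"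
proof -
  let ?n = "CARD('n)"
  define V where "V = unit_ball_vol (real ?n)"
  have V: "V > 0" by (simp add: V_def)
  show ?thesis
  proof (rule that[of "8 * V"])
    fix R :: real assume R: "R > 0"
    let ?c = "\<lambda>k::nat. 4 ^ (k + 1) / R\<^sup>2"
    let ?h = "\<lambda>k z. ennreal (?c k) * indicator (cball (0::real^'n) (R / 2 ^ k)) z"
    have ptw: "ennreal ((if norm z \<le> R then 1 / norm z else 0)\<^sup>2) \<le> (\<Sum>k. ?h k z)" for z :: "real^'n"
    proof (cases "norm z \<le> R \<and> z \<noteq> 0")
      case True
      then have z: "norm z > 0" "norm z \<le> R" by auto
      obtain m where m: "R / norm z < 2 ^ m" using real_arch_pow[of 2 "R / norm z"] by auto
      \<comment> \<open>the shell that contains \<open>z\<close>: \<open>2\<^sup>k \<le> R / \<bar>z\<bar> < 2\<^bsup>k + 1\<^esup>\<close>\<close>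
      define k where "k = (LEAST m. R / norm z < 2 ^ (m + 1))"
      have ex: "R / norm z < 2 ^ (m + 1)" using m by (rule less_trans) simp
      have k1: "R / norm z < 2 ^ (k + 1)" unfolding k_def by (rule LeastI[of "\<lambda>m. R / norm z < 2 ^ (m + 1)", OF ex])
      have k2: "2 ^ k \<le> R / norm z"
      proof (cases k)
        case 0 then show ?thesis using z by simp
      next
        case (Suc j)
        then have "\<not> R / norm z < 2 ^ (j + 1)" using not_less_Least[of j "\<lambda>m. R / norm z < 2 ^ (m + 1)"] k_def by simp
        then show ?thesis using Suc by simp
      qed
      have in_ball: "norm z \<le> R / 2 ^ k" using k2 z by (simp add: field_simps)
      have "1 / norm z \<le> 2 ^ (k + 1) / R" using k1 z R by (simp add: field_simps)
      then have "(1 / norm z)\<^sup>2 \<le> (2 ^ (k + 1) / R)\<^sup>2" using z by (intro power_mono) auto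
      also have "\<dots> = ?c k" by (simp add: power_divide power_mult_distrib power2_eq_square power_mult[symmetric] mult.commute flip: power_mult_distrib)
      finally have "ennreal ((1 / norm z)\<^sup>2) \<le> ?h k z" using in_ball by (simp add: ennreal_leI)
      also have "\<dots> = (\<Sum>j\<in>{k}. ?h j z)"
        by (simp only: sum.insert finite.emptyI empty_iff sum.empty add_0_right simp_thms)
      also have "\<dots> \<le> (\<Sum>k. ?h k z)" by (rule sum_le_suminf) auto
      finally show ?thesis using z by simp
    qed auto
    have meas: "(\<integral>\<^sup>+z. ?h k z \<partial>lborel) \<le> ennreal (4 * V * R ^ (?n - 2) * (1/2) ^ k)" for k
    proof -
      have e: "emeasure lborel (cball (0::real^'n) (R / 2 ^ k)) = ennreal (V * (R / 2 ^ k) ^ ?n)"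
        using emeasure_cball[of "R / 2 ^ k" "0::real^'n"] R by (simp add: V_def)
      have "(\<integral>\<^sup>+z. ?h k z \<partial>lborel) = ennreal (?c k) * ennreal (V * (R / 2 ^ k) ^ ?n)"
        by (subst nn_integral_cmult_indicator) (auto simp: e)
      also have "\<dots> = ennreal (?c k * (V * (R / 2 ^ k) ^ ?n))"
        using R V by (subst ennreal_mult) auto
      also have "\<dots> \<le> ennreal (4 * V * R ^ (?n - 2) * (1/2) ^ k)"
      proof (rule ennreal_leI)
        have "2 + (?n - 2) = ?n" using n by simp
        then have Rn: "R ^ ?n = R\<^sup>2 * R ^ (?n - 2)" by (metis power_add)
        have 2: "(2::real) ^ (3 * k) \<le> (2 ^ k) ^ ?n"
          unfolding power_mult[symmetric] using n by (intro power_increasing) auto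
        have "?c k * (V * (R / 2 ^ k) ^ ?n) = 4 * V * R ^ (?n - 2) * (4 ^ k / (2 ^ k) ^ ?n)"
          using R by (simp add: Rn power_divide field_simps)
        also have "\<dots> \<le> 4 * V * R ^ (?n - 2) * (4 ^ k / 2 ^ (3 * k))"
          using R V 2 by (intro mult_left_mono divide_left_mono) auto
        also have "(4::real) ^ k / 2 ^ (3 * k) = (1/2) ^ k"
          by (simp add: power_mult power_divide[symmetric])
        finally show "?c k * (V * (R / 2 ^ k) ^ ?n) \<le> 4 * V * R ^ (?n - 2) * (1/2) ^ k" .
      qed
      finally show ?thesis .
    qed
    have "(\<integral>\<^sup>+z. ennreal ((if norm (z::real^'n) \<le> R then 1 / norm z else 0)\<^sup>2) \<partial>lborel)
        \<le> (\<integral>\<^sup>+z. (\<Sum>k. ?h k z) \<partial>lborel)"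
      by (intro nn_integral_mono ptw)
    also have "\<dots> = (\<Sum>k. \<integral>\<^sup>+z. ?h k z \<partial>lborel)" 
      by (rule nn_integral_suminf) (auto intro!: borel_measurable_indicator borel_measurable_times_ennreal)
    also have "\<dots> \<le> (\<Sum>k. ennreal (4 * V * R ^ (?n - 2) * (1/2) ^ k))" by (intro suminf_le meas) auto
    also have "\<dots> = ennreal (\<Sum>k. 4 * V * R ^ (?n - 2) * (1/2) ^ k)"
      using R V by (intro suminf_ennreal2 summable_mult summable_geometric) auto
    also have "(\<Sum>k. 4 * V * R ^ (?n - 2) * (1/2::real) ^ k) = 8 * V * R ^ (?n - 2)"
      by (subst suminf_mult) (auto simp: suminf_geometric summable_geometric)
    finally show "(\<integral>\<^sup>+z. ennreal ((if norm (z::real^'n) \<le> R then 1 / norm z else 0)\<^sup>2) \<partial>lborel) \<le> ennreal (8 * V * R ^ (?n - 2))" .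
  qed (use V in simp)
qed

definition inv_norm_low :: "real \<Rightarrow> 'a::euclidean_space \<Rightarrow> real" where
  "inv_norm_low R z = (if norm z \<le> R then 1 / norm z else 0)"

lemma inv_norm_low_L2:
  assumes "CARD('n::finite) \<ge> 3"
  obtains K where "K > 0"
    "\<And>R. R > 0 \<Longrightarrow> memLp 2 (inv_norm_low R :: real^'n \<Rightarrow> real)"
    "\<And>R. R > 0 \<Longrightarrow> sq_norm (inv_norm_low R :: real^'n \<Rightarrow> real) \<le> K * R ^ (CARD('n) - 2)"
proof -
  obtain K where K: "K > 0" "\<And>R. R > 0 \<Longrightarrow> (\<integral>\<^sup>+z. ennreal ((if norm (z::real^'n) \<le> R then 1 / norm z else 0)\<^sup>2) \<partial>lborel) \<le> ennreal (K * R ^ (CARD('n) - 2))"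
    using inverse_square_nn_integral[OF assms] by blast
  have m [measurable]: "(inv_norm_low R :: real^'n \<Rightarrow> real) \<in> borel_measurable borel" for R
    unfolding inv_norm_low_def[abs_def] by measurable
  have i: "integrable lebesgue (\<lambda>z::real^'n. (norm (inv_norm_low R z))\<^sup>2) \<and> sq_norm (inv_norm_low R :: real^'n \<Rightarrow> real) \<le> K * R ^ (CARD('n) - 2)"
    if R: "R > 0" for R
  proof -
    have fin: "(\<integral>\<^sup>+z. ennreal ((norm (inv_norm_low R (z::real^'n)))\<^sup>2) \<partial>lebesgue) \<le> ennreal (K * R ^ (CARD('n) - 2))"
      using K(2)[OF R] by (simp add: nn_integral_completion inv_norm_low_def)
    have i: "integrable lebesgue (\<lambda>z::real^'n. (norm (inv_norm_low R z))\<^sup>2)"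
      by (rule integrableI_nonneg)
         (use fin measurable_lebesgue_borel[OF m] in \<open>auto intro: le_less_trans\<close>)
    then show ?thesis
      using fin nn_integral_eq_integral[OF i] K(1) R by (simp add: sq_norm_def)
  qed
  show ?thesis
    by (rule that[OF K(1)]) (use i measurable_lebesgue_borel[OF m] in \<open>auto simp: memLp_2_iff\<close>)
qed

subsection \<open>Low and high frequencies\<close>

definition low :: "real \<Rightarrow> ('a::euclidean_space \<Rightarrow> complex) \<Rightarrow> 'a \<Rightarrow> complex" where
  "low R w z = (if norm z \<le> R then w z else 0)"

definition high :: "real \<Rightarrow> ('a::euclidean_space \<Rightarrow> complex) \<Rightarrow> 'a \<Rightarrow> complex" where
  "high R w z = (if norm z \<le> R then 0 else w z)"

definition weighted_L2 :: "('a::euclidean_space \<Rightarrow> complex) \<Rightarrow> bool" where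
  "weighted_L2 w \<longleftrightarrow> w \<in> borel_measurable lebesgue \<and> memLp 2 (\<lambda>z. norm z *\<^sub>R w z)"

abbreviation weighted_sq_norm :: "('a::euclidean_space \<Rightarrow> complex) \<Rightarrow> real" where
  "weighted_sq_norm w \<equiv> sq_norm (\<lambda>z. norm z *\<^sub>R w z)"

lemma norm_lebesgue_measurable [measurable]: "(\<lambda>x::'a::euclidean_space. norm x) \<in> borel_measurable lebesgue"
  by (rule measurable_lebesgue_borel) measurable

lemma low_high_measurable:
  fixes w :: "'a::euclidean_space \<Rightarrow> complex"
  assumes [measurable]: "w \<in> borel_measurable lebesgue"
  shows "low R w \<in> borel_measurable lebesgue" "high R w \<in> borel_measurable lebesgue"
  unfolding low_def[abs_def] high_def[abs_def] by measurable

lemma AE_nonzero: "AE z::'a::euclidean_space in lebesgue. z \<noteq> 0"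
  using AE_completion[OF AE_lborel_singleton[of "0::'a"]] by simp

lemma high_L2:
  assumes w: "weighted_L2 w" and R: "R > 0"
  shows "memLp 2 (high R w)"
proof (rule memLp_2_bound(1)[of "\<lambda>z. norm z *\<^sub>R w z" _ "1 / R"])
  show "memLp 2 (\<lambda>z. norm z *\<^sub>R w z)" "high R w \<in> borel_measurable lebesgue"
    using w low_high_measurable by (auto simp: weighted_L2_def)
  show "AE z in lebesgue. norm (high R w z) \<le> 1 / R * norm (norm z *\<^sub>R w z)"
  proof (rule AE_I2)
    fix z
    show "norm (high R w z) \<le> 1 / R * norm (norm z *\<^sub>R w z)"
    proof (cases "norm z \<le> R")
      case False
      then have "1 * norm (w z) \<le> (norm z / R) * norm (w z)"
        using R by (intro mult_right_mono) (auto simp: field_simps)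
      then show ?thesis using False R by (simp add: high_def)
    qed (use R in \<open>simp add: high_def\<close>)
  qed
qed

lemma low_L1:
  fixes w :: "real^'n::finite \<Rightarrow> complex"
  assumes w: "weighted_L2 w" and i: "memLp 2 (inv_norm_low R :: real^'n \<Rightarrow> real)"
  shows "integrable lebesgue (low R w)"
    "(LINT z|lebesgue. norm (low R w z)) \<le> sqrt (sq_norm (inv_norm_low R :: real^'n \<Rightarrow> real)) * sqrt (weighted_sq_norm w)"
proof -
  have w2: "memLp 2 (\<lambda>z. norm z *\<^sub>R w z)" and wm: "w \<in> borel_measurable lebesgue" using w by (auto simp: weighted_L2_def)
  note [measurable] = low_high_measurable[OF wm] wm memLp_measurable[OF i]
  have ae: "AE z in lebesgue. norm (inv_norm_low R z) * norm (norm z *\<^sub>R w z) = norm (low R w z)"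
    using AE_nonzero by eventually_elim (simp add: inv_norm_low_def low_def)
  have pi: "integrable lebesgue (\<lambda>z. norm (inv_norm_low R z) * norm (norm z *\<^sub>R w z))"
    by (rule L2_product_integrable[OF i w2])
  have "integrable lebesgue (\<lambda>z. norm (low R w z))"
    by (rule integrable_cong_AE_imp[OF pi _ ae]) measurable
  then show "integrable lebesgue (low R w)" by (simp add: integrable_norm_iff)
  have "(LINT z|lebesgue. norm (low R w z)) = (LINT z|lebesgue. norm (inv_norm_low R z) * norm (norm z *\<^sub>R w z))"
    using ae by (intro integral_cong_AE) auto
  also have "\<dots> \<le> sqrt (sq_norm (inv_norm_low R :: real^'n \<Rightarrow> real)) * sqrt (weighted_sq_norm w)"
    by (rule L2_Cauchy_Schwarz[OF i w2])
  finally show "(LINT z|lebesgue. norm (low R w z)) \<le> sqrt (sq_norm (inv_norm_low R :: real^'n \<Rightarrow> real)) * sqrt (weighted_sq_norm w)" .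
qed

text \<open>The Fourier transform of a function \<open>w\<close> with \<open>\<bar>z\<bar> w(z)\<close> square integrable: \<open>w\<close> is integrable near
  the origin (as \<open>n \<ge> 3\<close>) and square integrable away from it.\<close>

definition fourier_ext :: "(real^'n::finite \<Rightarrow> complex) \<Rightarrow> real^'n \<Rightarrow> complex" where
  "fourier_ext w x = fourier_int (low 1 w) x + L2_extension fourier_int (high 1 w) x"

lemma low_high_sum: "(\<lambda>z. low R w z + high R w z) = w"
  by (auto simp: low_def high_def)

lemma integrable_mult_fourier_int:
  fixes a b :: "real^'n::finite \<Rightarrow> complex"
  assumes a: "integrable lebesgue a" and b: "integrable lebesgue b"
  shows "integrable lebesgue (\<lambda>x. a x * fourier_int b x)"
proof (rule Bochner_Integration.integrable_bound)
  let ?C = "LINT x|lebesgue. norm (b x)"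
  show "integrable lebesgue (\<lambda>x. ?C * norm (a x))" using a by simp
  have [measurable]: "a \<in> borel_measurable lebesgue" "fourier_int b \<in> borel_measurable lebesgue"
    using a b by (auto intro: fourier_int_measurable_lebesgue)
  show "(\<lambda>x. a x * fourier_int b x) \<in> borel_measurable lebesgue" by measurable
  have "norm (a x * fourier_int b x) \<le> ?C * norm (a x)" for x
    using mult_right_mono[OF fourier_int_norm_le[OF b, of x] norm_ge_zero[of "a x"]] by (simp add: norm_mult mult.commute)
  then show "AE x in lebesgue. norm (a x * fourier_int b x) \<le> norm (?C * norm (a x))"
    by (intro AE_I2) (metis abs_ge_self order_trans real_norm_def)
qed

lemma nn_integral_powr_Icc:
  assumes "s > -1" "a \<ge> 0"
  shows "(\<integral>\<^sup>+t. ennreal (indicator {0..a} t * t powr s) \<partial>lborel) = ennreal (a powr (s + 1) / (s + 1))"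
  using nn_integral_has_integral_lebesgue[OF _ has_integral_powr_from_0[OF assms]] by simp

context
  assumes n: "CARD('n::finite) \<ge> 3"
begin

lemma inv_norm_low_memLp: "R > 0 \<Longrightarrow> memLp 2 (inv_norm_low R :: real^'n \<Rightarrow> real)"
  using inv_norm_low_L2[OF n] by metis

lemma low_integrable:
  assumes "weighted_L2 w" "R > 0" shows "integrable lebesgue (low R w :: real^'n \<Rightarrow> complex)"
  by (rule low_L1(1)[OF assms(1) inv_norm_low_memLp[OF assms(2)]])

lemma fourier_ext_measurable:
  assumes "weighted_L2 (w :: real^'n \<Rightarrow> complex)"
  shows "fourier_ext w \<in> borel_measurable lebesgue"
proof -
  have [measurable]: "fourier_int (low 1 w) \<in> borel_measurable lebesgue"
    using assms low_high_measurable by (intro fourier_int_measurable_lebesgue) (auto simp: weighted_L2_def)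
  have [measurable]: "F.X (high 1 w) \<in> borel_measurable lebesgue"
    by (intro F.X_measurable high_L2 assms) simp
  show ?thesis unfolding fourier_ext_def[abs_def] by measurable
qed

text \<open>The part of \<open>w\<close> between two cutoff radii lies in \<open>L\<^sup>1 \<inter> L\<^sup>2\<close>, where both transforms agree. So
\<open>fourier_ext\<close> depends on the cutoff radius only up to null sets, and the radius can be chosen freely.\<close>

lemma fourier_ext_split:
  fixes w :: "real^'n \<Rightarrow> complex"
  assumes w: "weighted_L2 w" and R: "R > 0"
  shows "AE x in lebesgue. fourier_ext w x = fourier_int (low R w) x + F.X (high R w) x"
proof -
  define d where "d z = low R w z - low 1 w z" for z
  have l: "integrable lebesgue (low R w)" "integrable lebesgue (low 1 w)"
    using low_integrable[OF w] R by auto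
  have h: "memLp 2 (high R w)" "memLp 2 (high 1 w)" using high_L2[OF w] R by auto
  have d1: "memLp 1 d" using l by (simp add: memLp_1_iff d_def[abs_def])
  have d': "d = (\<lambda>z. high 1 w z - high R w z)" by (auto simp: d_def low_def high_def)
  then have d2: "memLp 2 d" using h by (simp add: memLp_2_diff)
  have L: "L1_L2 d" using d1 d2 by (simp add: L1_L2_def)
  have Fd: "fourier_int d = (\<lambda>z. fourier_int (low R w) z - fourier_int (low 1 w) z)"
    unfolding d_def[abs_def] by (rule fourier_int_diff[OF l])
  have "AE x in lebesgue. F.X d x = F.X (high 1 w) x - F.X (high R w) x"
    unfolding d' by (rule F.X_diff[OF h(2,1)])
  with F.X_eq_T[OF L] show ?thesis
    unfolding fourier_ext_def by eventually_elim (simp add: Fd algebra_simps)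
qed

lemma fourier_ext_diff:
  fixes v w :: "real^'n \<Rightarrow> complex"
  assumes v: "weighted_L2 v" and w: "weighted_L2 w"
  shows "weighted_L2 (\<lambda>z. v z - w z)" "AE x in lebesgue. fourier_ext (\<lambda>z. v z - w z) x = fourier_ext v x - fourier_ext w x"
proof -
  have [measurable]: "v \<in> borel_measurable lebesgue" "w \<in> borel_measurable lebesgue"
    using v w by (auto simp: weighted_L2_def)
  have "(\<lambda>z. v z - w z) \<in> borel_measurable lebesgue" by measurable
  then show "weighted_L2 (\<lambda>z. v z - w z)"
    using v w memLp_2_diff(1)[of "\<lambda>z. norm z *\<^sub>R v z" "\<lambda>z. norm z *\<^sub>R w z"]
    by (simp add: weighted_L2_def scaleR_diff_right)
  have l: "low 1 (\<lambda>z. v z - w z) = (\<lambda>z. low 1 v z - low 1 w z)" by (auto simp: low_def)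
  have h: "high 1 (\<lambda>z. v z - w z) = (\<lambda>z. high 1 v z - high 1 w z)" by (auto simp: high_def)
  have Fl: "fourier_int (low 1 (\<lambda>z. v z - w z)) = (\<lambda>z. fourier_int (low 1 v) z - fourier_int (low 1 w) z)"
    unfolding l by (intro fourier_int_diff low_integrable v w) auto
  have "AE x in lebesgue. F.X (high 1 (\<lambda>z. v z - w z)) x = F.X (high 1 v) x - F.X (high 1 w) x"
    unfolding h by (intro F.X_diff high_L2 v w) auto
  then show "AE x in lebesgue. fourier_ext (\<lambda>z. v z - w z) x = fourier_ext v x - fourier_ext w x"
    unfolding fourier_ext_def by eventually_elim (simp add: Fl)
qed

lemma fourier_ext_L1_L2:
  fixes w :: "real^'n \<Rightarrow> complex"
  assumes w: "weighted_L2 w" and L: "L1_L2 w"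
  shows "AE x in lebesgue. fourier_ext w x = fourier_int w x"
proof -
  have w1: "integrable lebesgue w" using L by (simp add: L1_L2_def memLp_1_iff)
  have l: "integrable lebesgue (low 1 w)" by (intro low_integrable w) simp
  have h2: "memLp 2 (high 1 w)" by (intro high_L2 w) simp
  have h': "high 1 w = (\<lambda>z. w z - low 1 w z)" by (auto simp: low_def high_def)
  then have h: "integrable lebesgue (high 1 w)" using w1 l by simp
  have Fw: "fourier_int w = (\<lambda>z. fourier_int (low 1 w) z + fourier_int (high 1 w) z)"
    using fourier_int_add[OF l h] by (simp add: low_high_sum)
  have "AE x in lebesgue. F.X (high 1 w) x = fourier_int (high 1 w) x"
    by (intro F.X_eq_T) (simp add: L1_L2_def memLp_1_iff h h2)
  then show ?thesis unfolding fourier_ext_def by eventually_elim (simp add: Fw)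
qed

lemma fourier_ext_multiplication:
  fixes w \<psi> :: "real^'n \<Rightarrow> complex"
  assumes w: "weighted_L2 w" and \<psi>: "L1_L2 \<psi>"
  shows "integrable lebesgue (\<lambda>x. fourier_ext w x * \<psi> x)" "integrable lebesgue (\<lambda>z. w z * fourier_int \<psi> z)"
    "(LINT x|lebesgue. fourier_ext w x * \<psi> x) = (LINT z|lebesgue. w z * fourier_int \<psi> z)"
proof -
  have l: "integrable lebesgue (low 1 w)" by (intro low_integrable w) simp
  have h: "memLp 2 (high 1 w)" by (intro high_L2 w) simp
  have p1: "integrable lebesgue \<psi>" and p2: "memLp 2 \<psi>" using \<psi> by (auto simp: L1_L2_def memLp_1_iff)
  have i1: "integrable lebesgue (\<lambda>x. fourier_int (low 1 w) x * \<psi> x)"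
    using integrable_mult_fourier_int[OF p1 l] by (simp add: mult.commute)
  have i2: "integrable lebesgue (\<lambda>x. F.X (high 1 w) x * \<psi> x)" by (intro L2_mult_integrable F.X_memLp h p2)
  have j1: "integrable lebesgue (\<lambda>z. low 1 w z * fourier_int \<psi> z)" by (rule integrable_mult_fourier_int[OF l p1])
  have j2: "integrable lebesgue (\<lambda>z. high 1 w z * fourier_int \<psi> z)" by (intro L2_mult_integrable h F.T_L2 \<psi>)
  have sum: "w z * fourier_int \<psi> z = low 1 w z * fourier_int \<psi> z + high 1 w z * fourier_int \<psi> z" for z
    by (simp add: low_def high_def)
  show "integrable lebesgue (\<lambda>x. fourier_ext w x * \<psi> x)"
    unfolding fourier_ext_def distrib_right by (intro Bochner_Integration.integrable_add i1 i2)
  show "integrable lebesgue (\<lambda>z. w z * fourier_int \<psi> z)"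
    unfolding sum by (intro Bochner_Integration.integrable_add j1 j2)
  show "(LINT x|lebesgue. fourier_ext w x * \<psi> x) = (LINT z|lebesgue. w z * fourier_int \<psi> z)"
    unfolding fourier_ext_def distrib_right sum
    using fourier_int_multiplication[OF l p1] F.X_multiplication[OF h \<psi>] i1 i2 j1 j2 by simp
qed

subsection \<open>The inequality\<close>

text \<open>The radius \<open>R\<close> is chosen so that the transform of the low frequencies is at most \<open>l/2\<close> everywhere;
where the whole function exceeds \<open>l\<close>, the high part then exceeds \<open>l/2\<close>, and Plancherel's theorem bounds
the measure of this set by the mass of the frequencies \<open>\<bar>z\<bar> > R\<close>. The indicator on the right
expresses this condition on \<open>z\<close> as a condition on \<open>l\<close>. The bound \<open>M\<close> replaces the weighted norm
itself so that \<open>R\<close> is defined when this norm is zero.\<close>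

lemma distribution_bound:
  fixes w :: "real^'n \<Rightarrow> complex"
  assumes w: "weighted_L2 w"
    and K: "K > 0" "\<And>R. R > 0 \<Longrightarrow> sq_norm (inv_norm_low R :: real^'n \<Rightarrow> real) \<le> K * R ^ (CARD('n) - 2)"
    and M: "weighted_sq_norm w \<le> M" "M > 0" and l: "l > 0"
  shows "(\<integral>\<^sup>+x. indicator {l..} (norm (fourier_ext w x)) \<partial>lebesgue)
    \<le> ennreal (4 / l\<^sup>2) * (\<integral>\<^sup>+z. ennreal (indicator {0..2 * sqrt (K * M) * norm z powr ((real CARD('n) - 2) / 2)} l * (norm (w z))\<^sup>2) \<partial>lebesgue)"
proof -
  let ?m = "real CARD('n) - 2"
  define B where "B = 2 * sqrt (K * M)"
  have B: "B > 0" using K M by (simp add: B_def)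
  have m: "?m > 0" using n by simp
  define R where "R = (l / B) powr (2 / ?m)"
  have R: "R > 0" using l B by (simp add: R_def)
  have Rm: "R ^ (CARD('n) - 2) = (l / B)\<^sup>2"
  proof -
    have "R ^ (CARD('n) - 2) = R powr real (CARD('n) - 2)" using R by (simp add: powr_realpow)
    also have "\<dots> = R powr ?m" using n by (simp add: of_nat_diff)
    also have "\<dots> = (l / B) powr (2 / ?m * ?m)" by (simp only: R_def powr_powr)
    also have "2 / ?m * ?m = 2" using m by (metis less_irrefl nonzero_eq_divide_eq)
    finally show ?thesis using l B by simp
  qed
  have i: "memLp 2 (inv_norm_low R :: real^'n \<Rightarrow> real)" by (rule inv_norm_low_memLp[OF R])
  have low_le: "norm (fourier_int (low R w) x) \<le> l / 2" for x
  proof -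
    have "norm (fourier_int (low R w) x) \<le> (LINT z|lebesgue. norm (low R w z))"
      by (rule fourier_int_norm_le[OF low_integrable[OF w R]])
    also have "\<dots> \<le> sqrt (sq_norm (inv_norm_low R :: real^'n \<Rightarrow> real)) * sqrt (weighted_sq_norm w)"
      by (rule low_L1(2)[OF w i])
    also have "\<dots> \<le> sqrt (K * (l / B)\<^sup>2) * sqrt M"
      using K(2)[OF R] M K(1) by (intro mult_mono) (auto simp: Rm)
    also have "\<dots> = sqrt (K * M) * (l / B)"
      using l B by (simp add: real_sqrt_mult)
    also have "\<dots> = l / 2" using B K M l by (simp add: B_def)
    finally show ?thesis .
  qed
  have h: "memLp 2 (high R w)" by (rule high_L2[OF w R])
  have ih: "integrable lebesgue (\<lambda>x. (norm (F.X (high R w) x))\<^sup>2)" using F.X_memLp[OF h] by (simp add: memLp_2_iff)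
  have "(\<integral>\<^sup>+x. indicator {l..} (norm (fourier_ext w x)) \<partial>lebesgue)
      \<le> (\<integral>\<^sup>+x. ennreal (4 / l\<^sup>2 * (norm (F.X (high R w) x))\<^sup>2) \<partial>lebesgue)"
  proof (rule nn_integral_mono_AE)
    show "AE x in lebesgue. indicator {l..} (norm (fourier_ext w x)) \<le> ennreal (4 / l\<^sup>2 * (norm (F.X (high R w) x))\<^sup>2)"
      using fourier_ext_split[OF w R]
    proof eventually_elim
      case (elim x)
      show ?case
      proof (cases "norm (fourier_ext w x) \<ge> l")
        case True
        have "norm (fourier_ext w x) \<le> norm (fourier_int (low R w) x) + norm (F.X (high R w) x)"
          unfolding elim by (rule norm_triangle_ineq)
        with True low_le[of x] have "l / 2 \<le> norm (F.X (high R w) x)" by simp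
        then have "(l / 2)\<^sup>2 \<le> (norm (F.X (high R w) x))\<^sup>2" using l by (intro power_mono) auto
        then have "1 \<le> 4 / l\<^sup>2 * (norm (F.X (high R w) x))\<^sup>2" using l by (simp add: field_simps power2_eq_square)
        then show ?thesis using True by (simp add: ennreal_leI flip: ennreal_1)
      qed simp
    qed
  qed
  also have "\<dots> = ennreal (4 / l\<^sup>2 * sq_norm (high R w))"
    using nn_integral_eq_integral[of lebesgue "\<lambda>x. 4 / l\<^sup>2 * (norm (F.X (high R w) x))\<^sup>2"] ih F.X_norm[OF h]
    by (simp add: sq_norm_def)
  also have "\<dots> = ennreal (4 / l\<^sup>2) * (\<integral>\<^sup>+z. ennreal ((norm (high R w z))\<^sup>2) \<partial>lebesgue)"
  proof -
    have "(\<integral>\<^sup>+z. ennreal ((norm (high R w z))\<^sup>2) \<partial>lebesgue) = ennreal (sq_norm (high R w))"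
      unfolding sq_norm_def using h by (intro nn_integral_eq_integral) (auto simp: memLp_2_iff)
    then show ?thesis by (simp only:) (intro ennreal_mult; simp)
  qed
  also have "\<dots> \<le> ennreal (4 / l\<^sup>2) * (\<integral>\<^sup>+z. ennreal (indicator {0..2 * sqrt (K * M) * norm z powr (?m / 2)} l * (norm (w z))\<^sup>2) \<partial>lebesgue)"
  proof (intro mult_left_mono nn_integral_mono ennreal_leI)
    fix z :: "real^'n"
    show "(norm (high R w z))\<^sup>2 \<le> indicator {0..2 * sqrt (K * M) * norm z powr (?m / 2)} l * (norm (w z))\<^sup>2"
    proof (cases "norm z \<le> R")
      case False
      then have "R powr (?m / 2) \<le> norm z powr (?m / 2)" using R m by (intro powr_mono2) auto
      moreover have "R powr (?m / 2) = l / B"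
      proof -
        have "R powr (?m / 2) = (l / B) powr (2 / ?m * (?m / 2))" by (simp only: R_def powr_powr)
        also have "2 / ?m * (?m / 2) = 1" using m by simp
        finally show ?thesis using l B by simp
      qed
      ultimately have "l \<le> B * norm z powr (?m / 2)" using B by (simp add: field_simps)
      then show ?thesis using l by (simp add: high_def B_def)
    qed (simp add: high_def)
  qed simp
  finally show ?thesis .
qed

text \<open>Integration of \<open>p l\<^bsup>p - 1\<^esup>\<close> times the distribution bound over all levels \<open>l\<close>, with the order of
integration exchanged. The inner integral over \<open>l\<close> is a multiple of
\<open>(\<bar>z\<bar>\<^bsup>(n-2)/2\<^esup>)\<^bsup>p - 2\<^esup>\<close>, and the exponent \<open>p = 2n/(n-2)\<close> is the one for which this is
\<open>\<bar>z\<bar>\<^sup>2\<close>.\<close>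

lemma fourier_ext_power_bound:
  fixes w :: "real^'n \<Rightarrow> complex"
  assumes w: "weighted_L2 w"
    and K: "K > 0" "\<And>R. R > 0 \<Longrightarrow> sq_norm (inv_norm_low R :: real^'n \<Rightarrow> real) \<le> K * R ^ (CARD('n) - 2)"
    and M: "weighted_sq_norm w \<le> M" "M > 0"
  defines "p \<equiv> sobolev_exponent CARD('n)"
  shows "(\<integral>\<^sup>+x. ennreal (norm (fourier_ext w x) powr p) \<partial>lebesgue)
    \<le> ennreal (4 * p / (p - 2) * (2 * sqrt (K * M)) powr (p - 2) * weighted_sq_norm w)"
proof -
  let ?m = "real CARD('n) - 2"
  have m: "?m > 0" using n by simp
  have p: "p = 2 + 4 / ?m" using m by (simp add: p_def sobolev_exponent_def field_simps)
  then have p2: "p > 2" using m by simp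
  define B where "B = 2 * sqrt (K * M)"
  have B: "B > 0" using K M by (simp add: B_def)
  let ?\<tau> = "\<lambda>z::real^'n. B * norm z powr (?m / 2)"
  have wm: "w \<in> borel_measurable lebesgue" using w by (simp add: weighted_L2_def)
  obtain e where e [measurable]: "e \<in> borel_measurable borel" and aee: "AE x in lebesgue. fourier_ext w x = e x"
    using AE_lebesgue_borel_version[OF fourier_ext_measurable[OF w]] by blast
  obtain v where v [measurable]: "v \<in> borel_measurable borel" and aev: "AE x in lebesgue. w x = v x"
    using AE_lebesgue_borel_version[OF wm] by blast
  have 1: "ennreal (t powr p) = (\<integral>\<^sup>+l. ennreal (p * (indicator {0..t} l * l powr (p - 1))) \<partial>lborel)" if "t \<ge> 0" for t
  proof -
    have "(\<integral>\<^sup>+l. ennreal (p * (indicator {0..t} l * l powr (p - 1))) \<partial>lborel)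
        = ennreal p * (\<integral>\<^sup>+l. ennreal (indicator {0..t} l * l powr (p - 1)) \<partial>lborel)"
      using p2 by (simp add: ennreal_mult nn_integral_cmult)
    also have "\<dots> = ennreal p * ennreal (t powr p / p)"
      using nn_integral_powr_Icc[of "p - 1" t] p2 that by simp
    also have "\<dots> = ennreal (t powr p)" using p2 by (simp add: ennreal_mult[symmetric])
    finally show ?thesis by simp
  qed
  have "(\<integral>\<^sup>+x. ennreal (norm (fourier_ext w x) powr p) \<partial>lebesgue) = (\<integral>\<^sup>+x. ennreal (norm (e x) powr p) \<partial>lebesgue)"
    by (rule nn_integral_cong_AE) (use aee in \<open>eventually_elim, simp\<close>)
  also have "\<dots> = (\<integral>\<^sup>+x. ennreal (norm (e x) powr p) \<partial>lborel)" by (rule nn_integral_completion)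
  also have "\<dots> = (\<integral>\<^sup>+x. (\<integral>\<^sup>+l. ennreal (p * (indicator {0..norm (e x)} l * l powr (p - 1))) \<partial>lborel) \<partial>lborel)"
    by (intro nn_integral_cong 1) simp
  also have "\<dots> = (\<integral>\<^sup>+l. (\<integral>\<^sup>+x. ennreal (p * (indicator {0..norm (e x)} l * l powr (p - 1))) \<partial>lborel) \<partial>lborel)"
    by (rule lborel_pair.Fubini'[symmetric]) (simp add: indicator_def, measurable)
  also have "\<dots> \<le> (\<integral>\<^sup>+l. (\<integral>\<^sup>+z. ennreal (4 * p * (indicator {0..?\<tau> z} l * l powr (p - 3)) * (norm (v z))\<^sup>2) \<partial>lborel) \<partial>lborel)"
  proof (rule nn_integral_mono)
    fix l :: real
    show "(\<integral>\<^sup>+x. ennreal (p * (indicator {0..norm (e x)} l * l powr (p - 1))) \<partial>lborel)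
        \<le> (\<integral>\<^sup>+z. ennreal (4 * p * (indicator {0..?\<tau> z} l * l powr (p - 3)) * (norm (v z))\<^sup>2) \<partial>lborel)"
    proof (cases "l > 0")
      case l: True
      have "(\<integral>\<^sup>+x. ennreal (p * (indicator {0..norm (e x)} l * l powr (p - 1))) \<partial>lborel)
          = (\<integral>\<^sup>+x. ennreal (p * l powr (p - 1)) * indicator {l..} (norm (e x)) \<partial>lborel)"
        using l by (intro nn_integral_cong) (simp add: indicator_def)
      also have "\<dots> = ennreal (p * l powr (p - 1)) * (\<integral>\<^sup>+x. indicator {l..} (norm (e x)) \<partial>lborel)"
        by (rule nn_integral_cmult) (simp add: indicator_def)
      also have "(\<integral>\<^sup>+x. indicator {l..} (norm (e x)) \<partial>lborel) = (\<integral>\<^sup>+x. indicator {l..} (norm (e x)) \<partial>lebesgue)"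
        by (rule nn_integral_completion[symmetric])
      also have "\<dots> = (\<integral>\<^sup>+x. indicator {l..} (norm (fourier_ext w x)) \<partial>lebesgue)"
        by (rule nn_integral_cong_AE) (use aee in \<open>eventually_elim, simp\<close>)
      also have "\<dots> \<le> ennreal (4 / l\<^sup>2) * (\<integral>\<^sup>+z. ennreal (indicator {0..?\<tau> z} l * (norm (w z))\<^sup>2) \<partial>lebesgue)"
        unfolding B_def by (rule distribution_bound[OF w K M l])
      also have "(\<integral>\<^sup>+z. ennreal (indicator {0..?\<tau> z} l * (norm (w z))\<^sup>2) \<partial>lebesgue) = (\<integral>\<^sup>+z. ennreal (indicator {0..?\<tau> z} l * (norm (v z))\<^sup>2) \<partial>lebesgue)"
        by (rule nn_integral_cong_AE) (use aev in \<open>eventually_elim, simp\<close>)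
      also have "\<dots> = (\<integral>\<^sup>+z. ennreal (indicator {0..?\<tau> z} l * (norm (v z))\<^sup>2) \<partial>lborel)"
        by (rule nn_integral_completion)
      also have "ennreal (p * l powr (p - 1)) * (ennreal (4 / l\<^sup>2) * \<dots>)
          = ennreal (p * l powr (p - 1) * (4 / l\<^sup>2)) * (\<integral>\<^sup>+z. ennreal (indicator {0..?\<tau> z} l * (norm (v z))\<^sup>2) \<partial>lborel)"
        using p2 by (subst ennreal_mult) (auto simp: mult.assoc)
      also have "\<dots> = (\<integral>\<^sup>+z. ennreal (p * l powr (p - 1) * (4 / l\<^sup>2)) * ennreal (indicator {0..?\<tau> z} l * (norm (v z))\<^sup>2) \<partial>lborel)"
        by (rule nn_integral_cmult[symmetric]) (simp add: indicator_def)
      also have "p * l powr (p - 1) * (4 / l\<^sup>2) = 4 * p * l powr (p - 3)"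
      proof -
        have "l powr (p - 1) = l powr (p - 3) * l powr 2" by (simp add: powr_add[symmetric])
        then show ?thesis using l by (simp add: field_simps)
      qed
      also have "(\<integral>\<^sup>+z. ennreal (4 * p * l powr (p - 3)) * ennreal (indicator {0..?\<tau> z} l * (norm (v z))\<^sup>2) \<partial>lborel)
          = (\<integral>\<^sup>+z. ennreal (4 * p * (indicator {0..?\<tau> z} l * l powr (p - 3)) * (norm (v z))\<^sup>2) \<partial>lborel)"
        using p2 by (intro nn_integral_cong) (simp add: ennreal_mult[symmetric] mult_ac)
      finally show ?thesis by (simp add: mult_left_mono)
    next
      case False
      then have "indicator {0..norm (e x)} l * l powr (p - 1) = 0" for x by (cases "l = 0") auto
      then have "(\<integral>\<^sup>+x. ennreal (p * (indicator {0..norm (e x)} l * l powr (p - 1))) \<partial>lborel) = 0"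
        by (simp only: mult_zero_right ennreal_0 nn_integral_const mult_zero_left)
      then show ?thesis by (simp only: zero_le)
    qed
  qed
  also have "\<dots> = (\<integral>\<^sup>+z. (\<integral>\<^sup>+l. ennreal (4 * p * (indicator {0..?\<tau> z} l * l powr (p - 3)) * (norm (v z))\<^sup>2) \<partial>lborel) \<partial>lborel)"
    by (rule lborel_pair.Fubini') (simp add: indicator_def, measurable)
  also have "\<dots> = (\<integral>\<^sup>+z. ennreal (4 * p / (p - 2) * B powr (p - 2) * (norm (norm z *\<^sub>R v z))\<^sup>2) \<partial>lborel)"
  proof (rule nn_integral_cong)
    fix z :: "real^'n"
    have "(\<integral>\<^sup>+l. ennreal (4 * p * (indicator {0..?\<tau> z} l * l powr (p - 3)) * (norm (v z))\<^sup>2) \<partial>lborel)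
        = (\<integral>\<^sup>+l. ennreal (4 * p * (norm (v z))\<^sup>2) * ennreal (indicator {0..?\<tau> z} l * l powr (p - 3)) \<partial>lborel)"
      using p2 by (intro nn_integral_cong) (simp add: ennreal_mult[symmetric] mult_ac)
    also have "\<dots> = ennreal (4 * p * (norm (v z))\<^sup>2) * ennreal (?\<tau> z powr (p - 2) / (p - 2))"
      using nn_integral_powr_Icc[of "p - 3" "?\<tau> z"] p2 B by (subst nn_integral_cmult) auto
    also have "?\<tau> z powr (p - 2) = B powr (p - 2) * (norm z)\<^sup>2"
    proof -
      have "x / 2 * (2 + 4 / x - 2) = 2" if "x > 0" for x :: real using that by (simp add: field_simps)
      from this[OF m] have "?m / 2 * (p - 2) = 2" by (simp only: p)
      then have "(norm z powr (?m / 2)) powr (p - 2) = norm z powr 2" by (simp add: powr_powr)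
      then show ?thesis using B by (simp add: powr_mult powr_two)
    qed
    also have "ennreal (4 * p * (norm (v z))\<^sup>2) * ennreal (B powr (p - 2) * (norm z)\<^sup>2 / (p - 2))
        = ennreal (4 * p / (p - 2) * B powr (p - 2) * (norm (norm z *\<^sub>R v z))\<^sup>2)"
      using p2 by (simp add: ennreal_mult[symmetric] power_mult_distrib mult_ac)
    finally show "(\<integral>\<^sup>+l. ennreal (4 * p * (indicator {0..?\<tau> z} l * l powr (p - 3)) * (norm (v z))\<^sup>2) \<partial>lborel)
        = ennreal (4 * p / (p - 2) * B powr (p - 2) * (norm (norm z *\<^sub>R v z))\<^sup>2)" .
  qed
  also have "\<dots> = (\<integral>\<^sup>+z. ennreal (4 * p / (p - 2) * B powr (p - 2) * (norm (norm z *\<^sub>R v z))\<^sup>2) \<partial>lebesgue)"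
    by (rule nn_integral_completion[symmetric])
  also have "\<dots> = (\<integral>\<^sup>+z. ennreal (4 * p / (p - 2) * B powr (p - 2) * (norm (norm z *\<^sub>R w z))\<^sup>2) \<partial>lebesgue)"
    by (rule nn_integral_cong_AE) (use aev in \<open>eventually_elim, simp\<close>)
  also have "\<dots> = ennreal (4 * p / (p - 2) * B powr (p - 2) * weighted_sq_norm w)"
    using w p2 unfolding weighted_L2_def memLp_2_iff sq_norm_def
    by (subst nn_integral_eq_integral) auto
  finally show ?thesis by (simp add: B_def)
qed

end

theorem sobolev_fourier_ext:
  assumes n: "CARD('n::finite) \<ge> 3"
  obtains C where "C > 0"
    "\<And>w :: real^'n \<Rightarrow> complex. weighted_L2 w \<Longrightarrow> memLp (sobolev_exponent CARD('n)) (fourier_ext w)"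
    "\<And>w :: real^'n \<Rightarrow> complex. weighted_L2 w \<Longrightarrow>
       (LINT x|lebesgue. norm (fourier_ext w x) powr sobolev_exponent CARD('n)) \<le> C * weighted_sq_norm w powr (sobolev_exponent CARD('n) / 2)"
proof -
  let ?p = "sobolev_exponent CARD('n)"
  have p2: "?p > 2" using n by (simp add: sobolev_exponent_def field_simps)
  obtain K where K: "K > 0" "\<And>R. R > 0 \<Longrightarrow> sq_norm (inv_norm_low R :: real^'n \<Rightarrow> real) \<le> K * R ^ (CARD('n) - 2)"
    using inv_norm_low_L2[OF n] by metis
  define C where "C = 4 * ?p / (?p - 2) * (2 * sqrt K) powr (?p - 2)"
  have C: "C > 0" using p2 K by (simp add: C_def)
  have main: "integrable lebesgue (\<lambda>x. norm (fourier_ext w x) powr ?p) \<and> (LINT x|lebesgue. norm (fourier_ext w x) powr ?p) \<le> C * weighted_sq_norm w powr (?p / 2)"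
    if w: "weighted_L2 w" for w :: "real^'n \<Rightarrow> complex"
  proof -
    \<comment> \<open>the power bound with \<open>M\<close> equal to the norm, unless this is zero and any positive \<open>M\<close> will do\<close>
    define M where "M = (if weighted_sq_norm w = 0 then 1 else weighted_sq_norm w)"
    have M: "weighted_sq_norm w \<le> M" "M > 0" by (auto simp: M_def less_le)
    have "4 * ?p / (?p - 2) * (2 * sqrt (K * M)) powr (?p - 2) * weighted_sq_norm w = C * weighted_sq_norm w powr (?p / 2)"
    proof (cases "weighted_sq_norm w = 0")
      case False
      then have M': "M = weighted_sq_norm w" by (simp add: M_def)
      have "(2 * sqrt (K * M)) powr (?p - 2) = (2 * sqrt K) powr (?p - 2) * sqrt M powr (?p - 2)"
        using K M by (simp add: real_sqrt_mult powr_mult)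
      moreover have "sqrt M powr (?p - 2) * M = M powr (?p / 2)"
      proof -
        have "sqrt M powr (?p - 2) * M = M powr (1/2 * (?p - 2)) * M powr 1"
          using M by (simp add: powr_half_sqrt[symmetric] powr_powr)
        also have "\<dots> = M powr (?p / 2)" unfolding powr_add[symmetric] by (simp add: field_simps)
        finally show ?thesis .
      qed
      ultimately show ?thesis by (simp add: C_def M'[symmetric])
    qed simp
    with fourier_ext_power_bound[OF n w K M]
    have f: "(\<integral>\<^sup>+x. ennreal (norm (fourier_ext w x) powr ?p) \<partial>lebesgue) \<le> ennreal (C * weighted_sq_norm w powr (?p / 2))"
      by simp
    have i: "integrable lebesgue (\<lambda>x. norm (fourier_ext w x) powr ?p)"
      by (rule integrableI_nonneg)
         (use f fourier_ext_measurable[OF n w] in \<open>auto intro: le_less_trans\<close>)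
    then show ?thesis
      using f nn_integral_eq_integral[OF i] C by simp
  qed
  show ?thesis
    by (rule that[OF C]) (use main fourier_ext_measurable[OF n] in \<open>auto simp: memLp_def\<close>)
qed

section \<open>Test functions\<close>

subsection \<open>Bump functions of one variable\<close>

text \<open>The sequence of all derivatives is given explicitly, because a partial
derivative of a product of such functions of different variables advances one of the sequences by one
step.\<close>

definition smooth_real :: "(real \<Rightarrow> real) \<Rightarrow> bool" where
  "smooth_real f \<longleftrightarrow> (\<exists>D. D (0::nat) = f \<and> (\<forall>j t. (D j has_real_derivative D (Suc j) t) (at t)))"

text \<open>Starting from \<open>exp (-c / (1 - t\<^sup>2))\<close> on \<open>(-1, 1)\<close>, this family is closed under differentiation. The
parameter \<open>c\<close> is kept because \<open>bump c\<close> increases to the indicator of \<open>(-1, 1)\<close> as \<open>c \<rightarrow> 0\<close>.\<close>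

definition bump_family :: "real \<Rightarrow> real poly \<Rightarrow> nat \<Rightarrow> real \<Rightarrow> real" where
  "bump_family c P k t = (if \<bar>t\<bar> < 1 then poly P t / (1 - t\<^sup>2) ^ k * exp (- (c / (1 - t\<^sup>2))) else 0)"

abbreviation bump :: "real \<Rightarrow> real \<Rightarrow> real" where
  "bump c \<equiv> bump_family c 1 0"

text \<open>The numerator of the derivative, over the denominator \<open>(1 - t\<^sup>2)\<^bsup>k + 2\<^esup>\<close>.\<close>

definition bump_numerator :: "real \<Rightarrow> real poly \<Rightarrow> nat \<Rightarrow> real poly" where
  "bump_numerator c P k = pderiv P * [:1, 0, -1:] ^ 2 + smult (2 * real k) ([:0, 1:] * [:1, 0, -1:] * P) - smult (2 * c) ([:0, 1:] * P)"

text \<open>With \<open>s = 1 - t\<^sup>2\<close>, the factor \<open>exp (-c / s)\<close> is at most a constant times \<open>s\<^bsup>k + 2\<^esup>\<close>, which leaves a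
factor \<open>s\<^sup>2\<close> after division by \<open>s\<^sup>k\<close>. Quadratic vanishing is what makes the function differentiable at
the two end points.\<close>

lemma bump_family_bound:
  assumes c: "c > 0"
  obtains C where "\<And>t. \<bar>bump_family c P k t\<bar> \<le> C * (t - 1)\<^sup>2" "\<And>t. \<bar>bump_family c P k t\<bar> \<le> C * (t + 1)\<^sup>2"
proof -
  have "compact (poly P ` {-1..1})"
    by (intro compact_continuous_image continuous_intros) simp
  then have "bounded (poly P ` {-1..1})" by (rule compact_imp_bounded)
  then obtain M where M: "\<And>t. t \<in> {-1..1} \<Longrightarrow> \<bar>poly P t\<bar> \<le> M"
    unfolding bounded_iff by (metis imageI real_norm_def)
  have M0: "M \<ge> 0" using M[of 0] by (smt (verit) atLeastAtMost_iff)
  \<comment> \<open>two powers of \<open>s\<close> beyond the denominator remain for the quadratic bound\<close>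
  define m where "m = k + 2"
  define C where "C = M * (real m / c) ^ m"
  have C: "C \<ge> 0" using M0 c by (simp add: C_def)
  have main: "\<bar>bump_family c P k t\<bar> \<le> C * (1 - t\<^sup>2)\<^sup>2" if t: "\<bar>t\<bar> < 1" for t
  proof -
    define s where "s = 1 - t\<^sup>2"
    have s: "s > 0" using t by (simp add: s_def abs_square_less_1)
    have "(c / s / real m) ^ m \<le> (1 + c / s / real m) ^ m"
      using c s by (intro power_mono) auto
    also have "\<dots> \<le> exp (c / s)"
    proof (rule exp_ge_one_plus_x_over_n_power_n)
      have "0 < c / s" using c s by simp
      then show "- real m \<le> c / s" by (meson less_imp_le neg_le_0_iff_le of_nat_0_le_iff order_trans)
    qed (simp add: m_def)
    finally have e1: "(c / s / real m) ^ m \<le> exp (c / s)" .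
    have pos: "(c / s / real m) ^ m > 0" using c s by (simp add: m_def)
    have "exp (- (c / s)) = 1 / exp (c / s)" by (simp add: exp_minus inverse_eq_divide)
    also have "\<dots> \<le> 1 / (c / s / real m) ^ m"
      using e1 pos by (intro divide_left_mono mult_pos_pos) auto
    also have "\<dots> = (real m / c) ^ m * s ^ m"
      using c s by (simp add: power_divide field_simps)
    finally have e: "exp (- (c / s)) \<le> (real m / c) ^ m * s ^ m" .
    have Mt: "\<bar>poly P t\<bar> \<le> M" using t by (intro M) auto
    have "\<bar>bump_family c P k t\<bar> = \<bar>poly P t\<bar> / s ^ k * exp (- (c / s))"
      using t s by (simp add: bump_family_def s_def[symmetric] abs_mult)
    also have "\<dots> \<le> M / s ^ k * ((real m / c) ^ m * s ^ m)"
      using Mt s e M0 by (intro mult_mono divide_right_mono) auto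
    also have "\<dots> = C * s\<^sup>2" using s by (simp add: C_def m_def power_add power2_eq_square)
    finally show ?thesis by (simp add: s_def)
  qed
  have le: "C * (1 - t\<^sup>2)\<^sup>2 \<le> 4 * C * (t - 1)\<^sup>2" "C * (1 - t\<^sup>2)\<^sup>2 \<le> 4 * C * (t + 1)\<^sup>2" if t: "\<bar>t\<bar> < 1" for t
  proof -
    have eq: "(1 - t\<^sup>2)\<^sup>2 = (t + 1)\<^sup>2 * (t - 1)\<^sup>2" by (simp add: power2_eq_square algebra_simps)
    have "(t + 1)\<^sup>2 \<le> 2\<^sup>2" "(t - 1)\<^sup>2 \<le> 2\<^sup>2"
      unfolding abs_le_square_iff[symmetric] using t by linarith+
    then have "(t + 1)\<^sup>2 * (t - 1)\<^sup>2 \<le> 4 * (t - 1)\<^sup>2" "(t + 1)\<^sup>2 * (t - 1)\<^sup>2 \<le> 4 * (t + 1)\<^sup>2"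
      using mult_right_mono[of "(t + 1)\<^sup>2" 4 "(t - 1)\<^sup>2"] mult_right_mono[of "(t - 1)\<^sup>2" 4 "(t + 1)\<^sup>2"]
      by (simp_all add: mult.commute)
    then show "C * (1 - t\<^sup>2)\<^sup>2 \<le> 4 * C * (t - 1)\<^sup>2" "C * (1 - t\<^sup>2)\<^sup>2 \<le> 4 * C * (t + 1)\<^sup>2"
      using C mult_left_mono[of _ _ C] unfolding eq by (metis mult.assoc mult.commute)+
  qed
  show ?thesis
  proof (rule that[of "4 * C"])
    fix t
    show "\<bar>bump_family c P k t\<bar> \<le> 4 * C * (t - 1)\<^sup>2"
    proof (cases "\<bar>t\<bar> < 1")
      case True then show ?thesis using main[OF True] le(1)[OF True] by linarith
    qed (use C in \<open>simp add: bump_family_def\<close>)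
    show "\<bar>bump_family c P k t\<bar> \<le> 4 * C * (t + 1)\<^sup>2"
    proof (cases "\<bar>t\<bar> < 1")
      case True then show ?thesis using main[OF True] le(2)[OF True] by linarith
    qed (use C in \<open>simp add: bump_family_def\<close>)
  qed
qed

lemma has_derivative_zero_if_quadratic:
  fixes f :: "real \<Rightarrow> real"
  assumes "\<And>t. \<bar>f t\<bar> \<le> C * (t - a)\<^sup>2"
  shows "(f has_real_derivative 0) (at a)"
proof -
  have fa: "f a = 0" using assms[of a] by simp
  have "(\<lambda>h. (f (a + h) - f a) / h) \<midarrow>0\<rightarrow> 0"
  proof (rule Lim_null_comparison)
    show "\<forall>\<^sub>F h in at 0. norm ((f (a + h) - f a) / h) \<le> C * \<bar>h\<bar>"
      unfolding eventually_at_filter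
    proof (rule always_eventually, safe)
      fix h :: real assume h: "h \<noteq> 0"
      have "\<bar>f (a + h)\<bar> / \<bar>h\<bar> \<le> C * h\<^sup>2 / \<bar>h\<bar>" using assms[of "a + h"] by (intro divide_right_mono) auto
      also have "\<dots> = C * \<bar>h\<bar>" using h by (cases "h > 0") (simp_all add: power2_eq_square)
      finally show "norm ((f (a + h) - f a) / h) \<le> C * \<bar>h\<bar>" by (simp add: fa)
    qed
    have "(\<lambda>h::real. C * \<bar>h\<bar>) \<midarrow>0\<rightarrow> C * \<bar>0\<bar>" by (intro tendsto_intros)
    then show "(\<lambda>h::real. C * \<bar>h\<bar>) \<midarrow>0\<rightarrow> 0" by simp
  qed
  then show ?thesis by (simp add: DERIV_def)
qed

lemma bump_family_deriv:
  assumes c: "c > 0"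
  shows "(bump_family c P k has_real_derivative bump_family c (bump_numerator c P k) (k + 2) t) (at t)"
proof -
  consider "\<bar>t\<bar> < 1" | "\<bar>t\<bar> > 1" | "t = 1" | "t = -1" by linarith
  then show ?thesis
  proof cases
    case 1
    define s where "s = 1 - t\<^sup>2"
    have s: "s > 0" using 1 by (simp add: s_def abs_square_less_1)
    have s': "1 - t\<^sup>2 \<noteq> 0" using s s_def by simp
    let ?g = "\<lambda>t. poly P t / (1 - t\<^sup>2) ^ k * exp (- (c / (1 - t\<^sup>2)))"
    have d2: "((\<lambda>t. 1 - t\<^sup>2) has_real_derivative - (2 * t)) (at t)"
      by (auto intro!: derivative_eq_intros)
    have d3: "((\<lambda>t. (1 - t\<^sup>2) ^ k) has_real_derivative real k * (- (2 * t) * (1 - t\<^sup>2) ^ (k - Suc 0))) (at t)"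
      by (rule DERIV_power[OF d2])
    have d4: "((\<lambda>t. poly P t / (1 - t\<^sup>2) ^ k) has_real_derivative
        (poly (pderiv P) t * (1 - t\<^sup>2) ^ k - poly P t * (real k * (- (2 * t) * (1 - t\<^sup>2) ^ (k - Suc 0)))) / ((1 - t\<^sup>2) ^ k * (1 - t\<^sup>2) ^ k)) (at t)"
      using s' by (intro DERIV_divide poly_DERIV d3) simp
    have d5: "((\<lambda>t. - (c / (1 - t\<^sup>2))) has_real_derivative - ((0 * (1 - t\<^sup>2) - c * (- (2 * t))) / ((1 - t\<^sup>2) * (1 - t\<^sup>2)))) (at t)"
      by (intro DERIV_minus DERIV_divide DERIV_const d2 s')
    have "(?g has_real_derivative
        ((poly (pderiv P) t * s ^ k - poly P t * (real k * s ^ (k - 1) * (- (2 * t)))) / (s ^ k * s ^ k)) * exp (- (c / s))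
        + (poly P t / s ^ k) * (exp (- (c / s)) * (- (2 * t * c / s\<^sup>2)))) (at t)"
      by (rule DERIV_cong[OF DERIV_mult[OF d4 DERIV_fun_exp[OF d5]]])
         (simp add: s_def power2_eq_square mult_ac)
    also have "((poly (pderiv P) t * s ^ k - poly P t * (real k * s ^ (k - 1) * (- (2 * t)))) / (s ^ k * s ^ k)) * exp (- (c / s))
        + (poly P t / s ^ k) * (exp (- (c / s)) * (- (2 * t * c / s\<^sup>2)))
      = (poly (pderiv P) t * s\<^sup>2 + 2 * real k * (t * s * poly P t) - 2 * c * (t * poly P t)) / s ^ (k + 2) * exp (- (c / s))"
    proof (cases k)
      case 0 then show ?thesis using s by (simp add: field_simps power2_eq_square)
    next
      case (Suc j) then show ?thesis using s by (simp add: field_simps power2_eq_square)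
    qed
    also have "poly (pderiv P) t * s\<^sup>2 + 2 * real k * (t * s * poly P t) - 2 * c * (t * poly P t) = poly (bump_numerator c P k) t"
      by (simp add: bump_numerator_def s_def poly_power power2_eq_square algebra_simps)
    finally have d: "(?g has_real_derivative bump_family c (bump_numerator c P k) (k + 2) t) (at t)"
      using 1 by (simp add: bump_family_def s_def)
    show ?thesis
      by (rule has_field_derivative_transform_within_open[OF d, of "{-1<..<1}"])
         (use 1 in \<open>auto simp: bump_family_def\<close>)
  next
    case 2
    have "((\<lambda>_. 0) has_real_derivative 0) (at t)" by simp
    then have "(bump_family c P k has_real_derivative 0) (at t)"
      by (rule has_field_derivative_transform_within_open[of _ _ _ "- {-1..1}"])
         (use 2 in \<open>auto simp: bump_family_def\<close>)
    then show ?thesis using 2 by (simp add: bump_family_def)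
  next
    case 3
    obtain C where "\<And>t. \<bar>bump_family c P k t\<bar> \<le> C * (t - 1)\<^sup>2" using bump_family_bound[OF c] by blast
    from has_derivative_zero_if_quadratic[OF this]
    have "(bump_family c P k has_real_derivative 0) (at t)" by (simp only: 3)
    moreover have "bump_family c (bump_numerator c P k) (k + 2) t = 0" by (simp add: bump_family_def 3)
    ultimately show ?thesis by (simp only:)
  next
    case 4
    obtain C where "\<And>t. \<bar>bump_family c P k t\<bar> \<le> C * (t + 1)\<^sup>2" using bump_family_bound[OF c] by blast
    then have "\<And>t. \<bar>bump_family c P k t\<bar> \<le> C * (t - (-1))\<^sup>2" by simp
    from has_derivative_zero_if_quadratic[OF this]
    have "(bump_family c P k has_real_derivative 0) (at t)" by (simp only: 4)
    moreover have "bump_family c (bump_numerator c P k) (k + 2) t = 0" by (simp add: bump_family_def 4)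
    ultimately show ?thesis by (simp only:)
  qed
qed

lemma smooth_real_bump:
  assumes c: "c > 0"
  shows "smooth_real (bump c)"
proof -
  define Q where "Q = rec_nat (1 :: real poly, 0 :: nat) (\<lambda>_ (P, k). (bump_numerator c P k, k + 2))"
  define D where "D j = bump_family c (fst (Q j)) (snd (Q j))" for j
  have "(D j has_real_derivative D (Suc j) t) (at t)" for j t
    unfolding D_def using bump_family_deriv[OF c, of "fst (Q j)" "snd (Q j)" t]
    by (simp add: Q_def split_beta)
  moreover have "D 0 = bump c" by (simp add: D_def Q_def)
  ultimately show ?thesis unfolding smooth_real_def by blast
qed

lemma smooth_real_affine:
  assumes "smooth_real f"
  shows "smooth_real (\<lambda>s. f (r * (s - m)))"
proof -
  obtain D where D: "D (0::nat) = f" "\<And>j t. (D j has_real_derivative D (Suc j) t) (at t)"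
    using assms unfolding smooth_real_def by blast
  have "((\<lambda>s. r ^ j * D j (r * (s - m))) has_real_derivative r ^ Suc j * D (Suc j) (r * (t - m))) (at t)" for j t
    by (rule derivative_eq_intros DERIV_chain'[OF _ D(2)] refl | simp)+
  then show ?thesis unfolding smooth_real_def using D(1)
    by (intro exI[of _ "\<lambda>j s. r ^ j * D j (r * (s - m))"]) auto
qed

subsection \<open>Products of functions of one variable\<close>

lemma has_derivative_prod_components:
  fixes g g' :: "'n::finite \<Rightarrow> real \<Rightarrow> real" and x :: "real^'n"
  assumes "\<And>i t. (g i has_real_derivative g' i t) (at t)"
  shows "((\<lambda>x. \<Prod>i\<in>UNIV. g i (x $ i)) has_derivative
    (\<lambda>h. \<Sum>i\<in>UNIV. h $ i * g' i (x $ i) * (\<Prod>j\<in>UNIV - {i}. g j (x $ j)))) (at x)"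
proof (rule has_derivative_prod)
  fix i
  have "((\<lambda>x::real^'n. x $ i) has_derivative (\<lambda>h. h $ i)) (at x)"
    by (intro bounded_linear_imp_has_derivative bounded_linear_vec_nth)
  from has_derivative_compose[OF this, of "g i" "(*) (g' i (x $ i))"]
  show "((\<lambda>x. g i (x $ i)) has_derivative (\<lambda>h. h $ i * g' i (x $ i))) (at x)"
    using assms[of i "x $ i"] by (simp only: has_field_derivative_def mult.commute[of "g' i (x $ i)"])
qed

lemma partial_deriv_prod:
  fixes g g' :: "'n::finite \<Rightarrow> real \<Rightarrow> real"
  assumes d: "\<And>i t. (g i has_real_derivative g' i t) (at t)"
  shows "(\<lambda>x. \<Prod>i\<in>UNIV. g i (x $ i)) differentiable (at x)"
    "partial_deriv k (\<lambda>x. \<Prod>i\<in>UNIV. g i (x $ i)) = (\<lambda>x. \<Prod>i\<in>UNIV. (g(k := g' k)) i (x $ i))"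
proof -
  note hd = has_derivative_prod_components[of g g', OF d]
  show "(\<lambda>x. \<Prod>i\<in>UNIV. g i (x $ i)) differentiable (at x)" using hd differentiable_def by blast
  show "partial_deriv k (\<lambda>x. \<Prod>i\<in>UNIV. g i (x $ i)) = (\<lambda>x. \<Prod>i\<in>UNIV. (g(k := g' k)) i (x $ i))"
  proof
    fix x :: "real^'n"
    have "partial_deriv k (\<lambda>x. \<Prod>i\<in>UNIV. g i (x $ i)) x = (\<Sum>i\<in>UNIV. (axis k 1 :: real^'n) $ i * g' i (x $ i) * (\<Prod>j\<in>UNIV - {i}. g j (x $ j)))"
      unfolding partial_deriv_def frechet_derivative_at[OF hd, symmetric] ..
    also have "\<dots> = (\<Sum>i\<in>UNIV. if i = k then g' k (x $ k) * (\<Prod>j\<in>UNIV - {k}. g j (x $ j)) else 0)"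
      by (intro sum.cong) (auto simp: axis_def)
    also have "\<dots> = g' k (x $ k) * (\<Prod>j\<in>UNIV - {k}. g j (x $ j))" by simp
    also have "\<dots> = (\<Prod>i\<in>UNIV. (g(k := g' k)) i (x $ i))"
      by (subst (2) prod.remove[of _ k]) (auto intro!: prod.cong)
    finally show "partial_deriv k (\<lambda>x. \<Prod>i\<in>UNIV. g i (x $ i)) x = (\<Prod>i\<in>UNIV. (g(k := g' k)) i (x $ i))" .
  qed
qed

lemma smooth_prod:
  fixes f :: "'n::finite \<Rightarrow> real \<Rightarrow> real"
  assumes "\<And>i. smooth_real (f i)"
  shows "smooth (\<lambda>x. \<Prod>i\<in>UNIV. f i (x $ i))"
proof -
  obtain D where D: "\<And>i. D i (0::nat) = f i" "\<And>i j t. (D i j has_real_derivative D i (Suc j) t) (at t)"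
    using assms unfolding smooth_real_def by metis
  have ex: "\<exists>m. partial_derivs is (\<lambda>x. \<Prod>i\<in>UNIV. f i (x $ i)) = (\<lambda>x. \<Prod>i\<in>UNIV. D i (m i) (x $ i))" for "is"
  proof (induction "is")
    case Nil
    show ?case by (rule exI[of _ "\<lambda>_. 0"]) (simp add: partial_derivs_def D)
  next
    case (Cons k "is")
    then obtain m where m: "partial_derivs is (\<lambda>x. \<Prod>i\<in>UNIV. f i (x $ i)) = (\<lambda>x. \<Prod>i\<in>UNIV. D i (m i) (x $ i))" by blast
    have "partial_derivs (k # is) (\<lambda>x. \<Prod>i\<in>UNIV. f i (x $ i)) = partial_deriv k (\<lambda>x. \<Prod>i\<in>UNIV. D i (m i) (x $ i))"
      using m by (simp add: partial_derivs_def)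
    also have "\<dots> = (\<lambda>x. \<Prod>i\<in>UNIV. ((\<lambda>i. D i (m i))(k := D k (Suc (m k)))) i (x $ i))"
      by (rule partial_deriv_prod(2)[of _ "\<lambda>i. D i (Suc (m i))"]) (rule D(2))
    also have "(\<lambda>i. D i (m i))(k := D k (Suc (m k))) = (\<lambda>i. D i ((m(k := Suc (m k))) i))" by auto
    finally show ?case by blast
  qed
  show ?thesis unfolding smooth_def
  proof (intro allI)
    fix "is" and x :: "real^'n"
    obtain m where m: "partial_derivs is (\<lambda>x. \<Prod>i\<in>UNIV. f i (x $ i)) = (\<lambda>x. \<Prod>i\<in>UNIV. D i (m i) (x $ i))"
      using ex by blast
    show "partial_derivs is (\<lambda>x. \<Prod>i\<in>UNIV. f i (x $ i)) differentiable (at x)"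
      unfolding m by (rule partial_deriv_prod(1)[of _ "\<lambda>i. D i (Suc (m i))"]) (rule D(2))
  qed
qed

text \<open>The affine map in each coordinate takes the side \<open>(a\<^sub>i, b\<^sub>i)\<close> of the box to \<open>(-1, 1)\<close>.\<close>

definition box_bump :: "real \<Rightarrow> real^'n::finite \<Rightarrow> real^'n \<Rightarrow> real^'n \<Rightarrow> real" where
  "box_bump c a b x = (\<Prod>i\<in>UNIV. bump c (2 / (b $ i - a $ i) * (x $ i - (a $ i + b $ i) / 2)))"

lemma box_coordinate:
  assumes "(a::real) < b"
  shows "\<bar>2 / (b - a) * (x - (a + b) / 2)\<bar> < 1 \<longleftrightarrow> a < x \<and> x < b"
proof -
  have eq: "2 / (b - a) * (x - (a + b) / 2) = (2 * x - a - b) / (b - a)"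
    using assms by (simp add: field_simps)
  have "\<bar>2 / (b - a) * (x - (a + b) / 2)\<bar> < 1 \<longleftrightarrow> \<bar>2 * x - a - b\<bar> < b - a"
    unfolding eq abs_divide using assms by simp
  also have "\<dots> \<longleftrightarrow> a < x \<and> x < b" by linarith
  finally show ?thesis .
qed

lemma bump_range: "c > 0 \<Longrightarrow> 0 \<le> bump c t" "c > 0 \<Longrightarrow> bump c t \<le> 1" "c > 0 \<Longrightarrow> bump c t > 0 \<longleftrightarrow> \<bar>t\<bar> < 1"
  by (auto simp: bump_family_def abs_square_less_1[symmetric] intro!: divide_nonneg_pos)

lemma box_bump_range:
  assumes c: "c > 0" and ab: "\<And>i. a $ i < b $ i"
  shows "0 \<le> box_bump c a b x" "box_bump c a b x \<le> 1" "box_bump c a b x \<noteq> 0 \<longleftrightarrow> x \<in> box a b"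
proof -
  show "0 \<le> box_bump c a b x" unfolding box_bump_def by (intro prod_nonneg ballI bump_range c)
  show "box_bump c a b x \<le> 1" unfolding box_bump_def by (intro prod_le_1 conjI bump_range c)
  have "bump c t \<noteq> 0 \<longleftrightarrow> \<bar>t\<bar> < 1" for t using bump_range[OF c, of t] by linarith
  then show "box_bump c a b x \<noteq> 0 \<longleftrightarrow> x \<in> box a b"
    unfolding box_bump_def prod_zero_iff[OF finite_class.finite_UNIV] mem_box_cart
    using box_coordinate[OF ab] by blast
qed

lemma box_bump_tendsto:
  assumes ab: "\<And>i. a $ i < b $ i"
  shows "(\<lambda>k. box_bump (1 / real (Suc k)) a b x) \<longlonglongrightarrow> indicator (box a b) x"
proof (cases "x \<in> box a b")
  case True
  let ?t = "\<lambda>i. 2 / (b $ i - a $ i) * (x $ i - (a $ i + b $ i) / 2)"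
  have t: "\<bar>?t i\<bar> < 1" for i using True box_coordinate[OF ab] by (simp add: mem_box_cart)
  have "(\<lambda>k. bump (1 / real (Suc k)) (?t i)) \<longlonglongrightarrow> 1" for i
  proof -
    have "(\<lambda>k. exp (- (1 / real (Suc k) / (1 - (?t i)\<^sup>2)))) \<longlonglongrightarrow> exp (- (0 / (1 - (?t i)\<^sup>2)))"
      using abs_square_less_1[of "?t i"] t[of i] by (intro tendsto_intros LIMSEQ_Suc[OF lim_1_over_n]) linarith
    then show ?thesis unfolding bump_family_def if_P[OF t] by simp
  qed
  then have "(\<lambda>k. \<Prod>i\<in>UNIV. bump (1 / real (Suc k)) (?t i)) \<longlonglongrightarrow> (\<Prod>i::'a\<in>UNIV. 1)"
    by (intro tendsto_prod)
  then show ?thesis using True by (simp add: box_bump_def)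
next
  case False
  then have "box_bump (1 / real (Suc k)) a b x = 0" for k
    using box_bump_range(3)[of "1 / real (Suc k)" a b x] ab by simp
  then show ?thesis using False by simp
qed

lemma test_function_box_bump:
  assumes c: "c > 0" and ab: "\<And>i. a $ i < b $ i"
  shows "test_function (box_bump c a b)"
proof -
  have "smooth (box_bump c a b)"
    unfolding box_bump_def[abs_def] by (rule smooth_prod) (intro smooth_real_affine smooth_real_bump c)
  moreover have "{x. box_bump c a b x \<noteq> 0} \<subseteq> cbox a b"
    using box_bump_range(3)[OF c ab] box_subset_cbox by blast
  then have "compact (closure {x. box_bump c a b x \<noteq> 0})"
    using bounded_subset[OF bounded_cbox] compact_closure by blast
  ultimately show ?thesis by (simp add: test_function_def)
qed

subsection \<open>Basic properties of test functions\<close>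

lemma test_function_differentiable: "test_function \<phi> \<Longrightarrow> \<phi> differentiable (at x)"
  unfolding test_function_def smooth_def partial_derivs_def by (metis foldr_Nil id_apply)

lemma test_function_continuous: "test_function \<phi> \<Longrightarrow> continuous_on A \<phi>"
  using test_function_differentiable differentiable_imp_continuous_on differentiable_on_def
    differentiable_at_withinI by (metis (no_types, lifting))

lemma test_function_borel: "test_function \<phi> \<Longrightarrow> \<phi> \<in> borel_measurable borel"
  by (intro borel_measurable_continuous_onI test_function_continuous)

lemma partial_deriv_along_axis:
  assumes "\<phi> differentiable (at (x + t *\<^sub>R axis i 1))"
  shows "((\<lambda>t. \<phi> (x + t *\<^sub>R axis i 1)) has_real_derivative partial_deriv i \<phi> (x + t *\<^sub>R axis i 1)) (at t)"
proof -
  let ?D = "frechet_derivative \<phi> (at (x + t *\<^sub>R axis i 1))"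
  have D: "(\<phi> has_derivative ?D) (at (x + t *\<^sub>R axis i 1))"
    using assms frechet_derivative_works by blast
  have "((\<lambda>t. x + t *\<^sub>R axis i 1) has_derivative (\<lambda>h. h *\<^sub>R axis i 1)) (at t)"
    by (auto intro!: derivative_eq_intros)
  from has_derivative_compose[OF this D]
  have "((\<lambda>t. \<phi> (x + t *\<^sub>R axis i 1)) has_derivative (\<lambda>h. ?D (h *\<^sub>R axis i 1))) (at t)" .
  moreover have "?D (h *\<^sub>R axis i 1) = partial_deriv i \<phi> (x + t *\<^sub>R axis i 1) * h" for h
    using linear_cmul[OF has_derivative_linear[OF D], of h "axis i 1"] by (simp add: partial_deriv_def)
  ultimately show ?thesis by (simp add: has_field_derivative_def)
qed

lemma partial_deriv_outside_support:
  assumes "x \<notin> closure {x. \<phi> x \<noteq> 0}"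
  shows "partial_deriv i \<phi> x = 0"
proof -
  have "((\<lambda>_. 0) has_derivative (\<lambda>_. 0)) (at x)" by simp
  then have "(\<phi> has_derivative (\<lambda>_. 0)) (at x)"
    by (rule has_derivative_transform_within_open[of _ _ _ _ "- closure {x. \<phi> x \<noteq> 0}"])
       (use assms closure_subset[of "{x. \<phi> x \<noteq> 0}"] in auto)
  from frechet_derivative_at[OF this] show ?thesis unfolding partial_deriv_def by metis
qed

lemma test_function_partial_deriv:
  assumes "test_function \<phi>"
  shows "test_function (partial_deriv i \<phi>)"
proof -
  have "partial_derivs is (partial_deriv i \<phi>) = partial_derivs (is @ [i]) \<phi>" for "is"
    by (simp add: partial_derivs_def)
  then have "smooth (partial_deriv i \<phi>)" using assms by (simp add: test_function_def smooth_def)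
  have "{x. partial_deriv i \<phi> x \<noteq> 0} \<subseteq> closure {x. \<phi> x \<noteq> 0}"
    using partial_deriv_outside_support by blast
  moreover have "bounded (closure {x. \<phi> x \<noteq> 0})"
    using assms by (intro compact_imp_bounded) (simp add: test_function_def)
  ultimately have "bounded {x. partial_deriv i \<phi> x \<noteq> 0}" by (blast intro: bounded_subset)
  with \<open>smooth (partial_deriv i \<phi>)\<close> show ?thesis by (simp add: test_function_def compact_closure)
qed

lemma partial_deriv_translate:
  assumes "\<And>x. \<phi> differentiable (at x)"
  shows "partial_deriv i (\<lambda>x. \<phi> (x - y)) = (\<lambda>x. partial_deriv i \<phi> (x - y))" "(\<lambda>x. \<phi> (x - y)) differentiable (at x)"
proof -
  have D: "((\<lambda>x. \<phi> (x - y)) has_derivative frechet_derivative \<phi> (at (x - y))) (at x)" for x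
  proof -
    have "((\<lambda>x. x - y) has_derivative (\<lambda>h. h)) (at x)" by (auto intro!: derivative_eq_intros)
    moreover have "(\<phi> has_derivative frechet_derivative \<phi> (at (x - y))) (at (x - y))"
      using assms frechet_derivative_works by blast
    ultimately show ?thesis using has_derivative_compose by blast
  qed
  show "partial_deriv i (\<lambda>x. \<phi> (x - y)) = (\<lambda>x. partial_deriv i \<phi> (x - y))"
    unfolding partial_deriv_def using frechet_derivative_at[OF D] by metis
  show "(\<lambda>x. \<phi> (x - y)) differentiable (at x)" using D differentiable_def by blast
qed

lemma test_function_translate:
  assumes t: "test_function \<phi>"
  shows "test_function (\<lambda>x. \<phi> (x - y))"
proof -
  have d: "partial_derivs is \<phi> differentiable (at x)" for "is" x
    using t by (simp add: test_function_def smooth_def)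
  have eq: "partial_derivs is (\<lambda>x. \<phi> (x - y)) = (\<lambda>x. partial_derivs is \<phi> (x - y))" for "is"
  proof (induction "is")
    case (Cons i "is")
    then show ?case using partial_deriv_translate(1)[of "partial_derivs is \<phi>", OF d] by (simp add: partial_derivs_def)
  qed (simp add: partial_derivs_def)
  have "smooth (\<lambda>x. \<phi> (x - y))"
    unfolding smooth_def eq using partial_deriv_translate(2)[OF d] by blast
  moreover have "compact (closure {x. \<phi> (x - y) \<noteq> 0})"
  proof -
    have "{x. \<phi> (x - y) \<noteq> 0} = (+) y ` {x. \<phi> x \<noteq> 0}"
      by (auto simp: image_iff intro!: exI[of _ "_ - y"])
    then show ?thesis using t by (simp add: test_function_def closure_translation compact_translation)
  qed
  ultimately show ?thesis by (simp add: test_function_def)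
qed

lemma test_function_bounds:
  assumes t: "test_function \<phi>"
  obtains B R where "\<And>x. \<bar>\<phi> x\<bar> \<le> B * indicator (cball 0 R) x" "B \<ge> 0" "R > 0"
proof -
  let ?K = "closure {x. \<phi> x \<noteq> 0}"
  have K: "compact ?K" using t by (simp add: test_function_def)
  then obtain R where R: "R > 0" "\<And>x. x \<in> ?K \<Longrightarrow> norm x \<le> R"
    using compact_imp_bounded bounded_pos by metis
  have "bounded (\<phi> ` ?K)"
    by (intro compact_imp_bounded compact_continuous_image test_function_continuous t K)
  then obtain B where B: "B > 0" "\<And>x. x \<in> ?K \<Longrightarrow> \<bar>\<phi> x\<bar> \<le> B"
    unfolding bounded_pos by (metis imageI real_norm_def)
  show ?thesis
  proof (rule that[of B R])
    fix x
    show "\<bar>\<phi> x\<bar> \<le> B * indicator (cball 0 R) x"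
    proof (cases "\<phi> x = 0")
      case False
      then have "x \<in> ?K" using closure_subset[of "{x. \<phi> x \<noteq> 0}"] by auto
      then show ?thesis using R B by simp
    qed (use B in simp)
  qed (use B R in auto)
qed

lemma bounded_support_L1_L2:
  fixes f :: "'a::euclidean_space \<Rightarrow> 'b::euclidean_space"
  assumes m: "f \<in> borel_measurable lebesgue" and b: "\<And>x. norm (f x) \<le> B * indicator (cball 0 R) x"
  shows "L1_L2 f"
proof -
  have i: "integrable lebesgue (\<lambda>x. C * indicat_real (cball (0::'a) R) x)" for C
    by (intro integrable_mult_right integrable_indicator_cball)
  have "integrable lebesgue f"
    by (rule Bochner_Integration.integrable_bound[OF i[of B] m]) (intro AE_I2 order_trans[OF b], simp)
  moreover have "integrable lebesgue (\<lambda>x. (norm (f x))\<^sup>2)"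
  proof (rule Bochner_Integration.integrable_bound[OF i[of "B\<^sup>2"]])
    show "AE x in lebesgue. norm ((norm (f x))\<^sup>2) \<le> norm (B\<^sup>2 * indicat_real (cball 0 R) x)"
    proof (rule AE_I2)
      fix x :: 'a
      have "(norm (f x))\<^sup>2 \<le> (B * indicator (cball 0 R) x)\<^sup>2" by (intro power_mono b) simp
      then show "norm ((norm (f x))\<^sup>2) \<le> norm (B\<^sup>2 * indicat_real (cball 0 R) x)"
        by (cases "norm x \<le> R") (simp_all add: power_mult_distrib)
    qed
  qed (use m in measurable)
  ultimately show ?thesis using m by (simp add: L1_L2_def memLp_1_iff memLp_2_iff)
qed

lemma test_function_L1_L2:
  assumes t: "test_function \<phi>"
  shows "L1_L2 \<phi>" "L1_L2 (\<lambda>x. complex_of_real (\<phi> x))"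
proof -
  obtain B R where B: "\<And>x. \<bar>\<phi> x\<bar> \<le> B * indicator (cball 0 R) x" using test_function_bounds[OF t] by metis
  have m [measurable]: "\<phi> \<in> borel_measurable lebesgue" by (intro measurable_lebesgue_borel test_function_borel t)
  show "L1_L2 \<phi>" by (rule bounded_support_L1_L2[OF m]) (use B in simp)
  have "(\<lambda>x. complex_of_real (\<phi> x)) \<in> borel_measurable lebesgue" by measurable
  then show "L1_L2 (\<lambda>x. complex_of_real (\<phi> x))" by (rule bounded_support_L1_L2) (use B in simp)
qed

text \<open>The mean value theorem bounds the quotient by a value of the derivative at distance at most one,
which gives a majorant with bounded support for dominated convergence.\<close>

lemma difference_quotient_bound:
  assumes t: "test_function \<phi>"
  obtains B R where "\<And>x h. 0 < h \<Longrightarrow> h \<le> 1 \<Longrightarrow> \<bar>(\<phi> (x + h *\<^sub>R axis i 1) - \<phi> x) / h\<bar> \<le> B * indicator (cball 0 R) x" "B \<ge> 0"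
proof -
  obtain B R where B: "\<And>x. \<bar>partial_deriv i \<phi> x\<bar> \<le> B * indicator (cball 0 R) x" "B \<ge> 0"
    using test_function_bounds[OF test_function_partial_deriv[OF t]] by metis
  show ?thesis
  proof (rule that[of B "R + 1"])
    fix x and h :: real assume h: "0 < h" "h \<le> 1"
    have d: "((\<lambda>t. \<phi> (x + t *\<^sub>R axis i 1)) has_real_derivative partial_deriv i \<phi> (x + t *\<^sub>R axis i 1)) (at t)" for t
      by (intro partial_deriv_along_axis test_function_differentiable t)
    obtain s where s: "0 < s" "s < h" "\<phi> (x + h *\<^sub>R axis i 1) - \<phi> (x + 0 *\<^sub>R axis i 1) = (h - 0) * partial_deriv i \<phi> (x + s *\<^sub>R axis i 1)"
      using MVT2[OF h(1), of "\<lambda>t. \<phi> (x + t *\<^sub>R axis i 1)" "\<lambda>t. partial_deriv i \<phi> (x + t *\<^sub>R axis i 1)"] d by blast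
    then have "(\<phi> (x + h *\<^sub>R axis i 1) - \<phi> x) / h = partial_deriv i \<phi> (x + s *\<^sub>R axis i 1)"
      using h by simp
    then have "\<bar>(\<phi> (x + h *\<^sub>R axis i 1) - \<phi> x) / h\<bar> \<le> B * indicator (cball 0 R) (x + s *\<^sub>R axis i 1)"
      using B(1) by simp
    also have "\<dots> \<le> B * indicator (cball 0 (R + 1)) x"
    proof -
      have "norm x \<le> norm (x + s *\<^sub>R axis i 1) + 1"
        using norm_triangle_ineq4[of "x + s *\<^sub>R axis i 1" "s *\<^sub>R axis i (1::real)"] s h by simp
      then show ?thesis using B(2) by (auto simp: indicator_def)
    qed
    finally show "\<bar>(\<phi> (x + h *\<^sub>R axis i 1) - \<phi> x) / h\<bar> \<le> B * indicator (cball 0 (R + 1)) x" .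
  qed (rule B)
qed

lemma difference_quotient_tendsto:
  assumes "test_function \<phi>"
  shows "(\<lambda>k. (\<phi> (x + (1 / real (Suc k)) *\<^sub>R axis i 1) - \<phi> x) / (1 / real (Suc k))) \<longlonglongrightarrow> partial_deriv i \<phi> x"
proof -
  have "((\<lambda>t. \<phi> (x + t *\<^sub>R axis i 1)) has_real_derivative partial_deriv i \<phi> (x + 0 *\<^sub>R axis i 1)) (at 0)"
    by (intro partial_deriv_along_axis test_function_differentiable assms)
  then have "(\<lambda>h. (\<phi> (x + h *\<^sub>R axis i 1) - \<phi> x) / h) \<midarrow>0\<rightarrow> partial_deriv i \<phi> x"
    by (simp add: DERIV_def)
  moreover have "filterlim (\<lambda>k. 1 / real (Suc k)) (at 0) sequentially"
    using LIMSEQ_Suc[OF lim_1_over_n] by (simp add: filterlim_at del: of_nat_Suc)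
  ultimately show ?thesis by (rule filterlim_compose)
qed

subsection \<open>Translations and derivatives under the Fourier transform\<close>

lemma fourier_int_translate:
  fixes g :: "real^'n::finite \<Rightarrow> complex"
  assumes [measurable]: "g \<in> borel_measurable borel"
  shows "fourier_int (\<lambda>x. g (x - y)) z = cis (- (2 * pi * (y \<bullet> z))) * fourier_int g z"
proof -
  let ?f = "\<lambda>x. g x * cis (- (2 * pi * (x \<bullet> z)))"
  have "fourier_int (\<lambda>x. g (x - y)) z = (LINT x|lborel. g (x - y) * cis (- (2 * pi * (x \<bullet> z))))"
    by (intro fourier_int_borel_lborel) measurable
  also have "\<dots> = (LINT x|lborel. cis (- (2 * pi * (y \<bullet> z))) * ?f (x - y))"
    by (intro Bochner_Integration.integral_cong refl)
       (simp add: cis_mult inner_diff_left algebra_simps)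
  also have "\<dots> = cis (- (2 * pi * (y \<bullet> z))) * (LINT x|lborel. ?f (x - y))" by simp
  also have "(LINT x|lborel. ?f (x - y)) = (LINT x|lborel. ?f x)"
    by (rule lborel_integral_translate(1)) measurable
  finally show ?thesis by (simp add: fourier_int_borel_lborel)
qed

text \<open>No integration by parts: translation multiplies the transform by a character, and the derivative
  is the limit of difference quotients.\<close>

lemma fourier_partial_deriv:
  fixes \<phi> :: "real^'n::finite \<Rightarrow> real"
  assumes t: "test_function \<phi>"
  shows "fourier_int (\<lambda>x. complex_of_real (partial_deriv i \<phi> x)) z
    = 2 * complex_of_real pi * \<i> * complex_of_real (z $ i) * fourier_int (\<lambda>x. complex_of_real (\<phi> x)) z"
proof -
  define h where "h k = 1 / real (Suc k)" for k
  have h: "0 < h k" "h k \<le> 1" for k by (auto simp: h_def)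
  let ?e = "axis i 1 :: real^'n"
  let ?q = "\<lambda>k x. (\<phi> (x + h k *\<^sub>R ?e) - \<phi> x) / h k"
  let ?\<phi> = "\<lambda>x. complex_of_real (\<phi> x)"
  have [measurable]: "\<phi> \<in> borel_measurable borel" by (rule test_function_borel[OF t])
  have [measurable]: "partial_deriv i \<phi> \<in> borel_measurable borel"
    by (intro test_function_borel test_function_partial_deriv t)
  have int: "integrable lebesgue ?\<phi>" using test_function_L1_L2(2)[OF t] by (simp add: L1_L2_def memLp_1_iff)
  have int': "integrable lebesgue (\<lambda>x. ?\<phi> (x - y))" for y
    using test_function_L1_L2(2)[OF test_function_translate[OF t]] by (simp add: L1_L2_def memLp_1_iff)
  obtain B R where B: "\<And>k x. \<bar>?q k x\<bar> \<le> B * indicator (cball 0 R) x"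
    using difference_quotient_bound[OF t, of i] h by metis
  have "(\<lambda>k. fourier_int (\<lambda>x. complex_of_real (?q k x)) z) \<longlonglongrightarrow> fourier_int (\<lambda>x. complex_of_real (partial_deriv i \<phi> x)) z"
    unfolding fourier_int_cis
  proof (rule integral_dominated_convergence)
    show "integrable lebesgue (\<lambda>x. B * indicat_real (cball (0::real^'n) R) x)"
      by (intro integrable_mult_right integrable_indicator_cball)
    have "(\<lambda>x. complex_of_real (partial_deriv i \<phi> x) * cis (- (2 * pi * (x \<bullet> z)))) \<in> borel_measurable borel"
      "(\<lambda>x. complex_of_real (?q k x) * cis (- (2 * pi * (x \<bullet> z)))) \<in> borel_measurable borel" for k
      by measurable
    then show "(\<lambda>x. complex_of_real (partial_deriv i \<phi> x) * cis (- (2 * pi * (x \<bullet> z)))) \<in> borel_measurable lebesgue"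
      "(\<lambda>x. complex_of_real (?q k x) * cis (- (2 * pi * (x \<bullet> z)))) \<in> borel_measurable lebesgue" for k
      by (auto intro: measurable_lebesgue_borel)
    show "AE x in lebesgue. (\<lambda>k. complex_of_real (?q k x) * cis (- (2 * pi * (x \<bullet> z)))) \<longlonglongrightarrow> complex_of_real (partial_deriv i \<phi> x) * cis (- (2 * pi * (x \<bullet> z)))"
      unfolding h_def by (intro AE_I2 tendsto_intros tendsto_of_real difference_quotient_tendsto t)
    show "AE x in lebesgue. norm (complex_of_real (?q k x) * cis (- (2 * pi * (x \<bullet> z)))) \<le> B * indicat_real (cball 0 R) x" for k
      using B by (simp only: norm_mult norm_of_real norm_cis mult_1_right) simp
  qed
  moreover have "fourier_int (\<lambda>x. complex_of_real (?q k x)) z = (cis (2 * pi * z $ i * h k) - 1) / of_real (h k) * fourier_int ?\<phi> z" for k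
  proof -
    have "(\<lambda>x. complex_of_real (?q k x)) = (\<lambda>x. (1 / of_real (h k)) * (?\<phi> (x - (- (h k *\<^sub>R ?e))) - ?\<phi> x))"
      by (auto simp: field_simps)
    then have "fourier_int (\<lambda>x. complex_of_real (?q k x)) z
        = (1 / of_real (h k)) * (fourier_int (\<lambda>x. ?\<phi> (x - (- (h k *\<^sub>R ?e)))) z - fourier_int ?\<phi> z)"
      by (simp only: fourier_int_cmult fourier_int_diff[OF int' int])
    also have "fourier_int (\<lambda>x. ?\<phi> (x - (- (h k *\<^sub>R ?e)))) z = cis (- (2 * pi * ((- (h k *\<^sub>R ?e)) \<bullet> z))) * fourier_int ?\<phi> z"
      by (rule fourier_int_translate) measurable
    also have "- (2 * pi * ((- (h k *\<^sub>R ?e)) \<bullet> z)) = 2 * pi * z $ i * h k"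
      by (simp add: inner_axis')
    finally show ?thesis by (simp add: algebra_simps diff_divide_distrib)
  qed
  moreover have "(\<lambda>k. (cis (2 * pi * z $ i * h k) - 1) / of_real (h k) * fourier_int ?\<phi> z)
      \<longlonglongrightarrow> 2 * complex_of_real pi * \<i> * complex_of_real (z $ i) * fourier_int ?\<phi> z"
  proof (intro tendsto_mult tendsto_const)
    let ?c = "2 * complex_of_real pi * \<i> * complex_of_real (z $ i)"
    have "((\<lambda>t. exp (?c * t)) has_field_derivative ?c) (at 0)"
      by (auto intro!: derivative_eq_intros)
    then have "(\<lambda>t. (exp (?c * t) - 1) / t) \<midarrow>0\<rightarrow> ?c" by (simp add: DERIV_def)
    moreover have "filterlim (\<lambda>k. complex_of_real (h k)) (at 0) sequentially"
    proof -
      have "(\<lambda>k. complex_of_real (h k)) \<longlonglongrightarrow> complex_of_real 0"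
        unfolding h_def by (intro tendsto_of_real LIMSEQ_Suc[OF lim_1_over_n])
      moreover have "complex_of_real (h k) \<noteq> 0" for k using h(1)[of k] by simp
      ultimately show ?thesis by (simp add: filterlim_at)
    qed
    ultimately have "(\<lambda>k. (exp (?c * of_real (h k)) - 1) / of_real (h k)) \<longlonglongrightarrow> ?c" by (rule filterlim_compose)
    moreover have "exp (?c * of_real (h k)) = cis (2 * pi * z $ i * h k)" for k
      by (simp add: cis_conv_exp mult_ac)
    ultimately show "(\<lambda>k. (cis (2 * pi * z $ i * h k) - 1) / of_real (h k)) \<longlonglongrightarrow> ?c" by simp
  qed
  ultimately show ?thesis by (simp add: LIMSEQ_unique)
qed

text \<open>For a nonnegative bump supported so close to the origin that \<open>\<bar>x \<bullet> z\<bar> \<le> 1/8\<close> on its support, the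
real part of the transform at \<open>z\<close> is positive. A sequence of shrinking boxes serves all \<open>z\<close>, and being
countable it can be used under an almost everywhere quantifier.\<close>

lemma exists_fourier_nonzero:
  obtains \<Phi> :: "nat \<Rightarrow> real^'n::finite \<Rightarrow> real" where "\<And>k. test_function (\<Phi> k)"
    "\<And>z. \<exists>k. fourier_int (\<lambda>x. complex_of_real (\<Phi> k x)) z \<noteq> 0"
proof -
  define a where "a k = (\<chi> i::'n. - (1 / real (Suc k)))" for k
  define b where "b k = (\<chi> i::'n. 1 / real (Suc k))" for k
  have ab: "a k $ i < b k $ i" for k i by (simp add: a_def b_def)
  define \<Phi> where "\<Phi> k = box_bump 1 (a k) (b k)" for k
  have t: "test_function (\<Phi> k)" for k unfolding \<Phi>_def by (intro test_function_box_bump ab) simp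
  have nz: "\<exists>k. fourier_int (\<lambda>x. complex_of_real (\<Phi> k x)) z \<noteq> 0" for z
  proof -
    obtain k :: nat where k: "8 * (\<Sum>i\<in>UNIV. \<bar>z $ i\<bar>) < real k" using reals_Archimedean2 by blast
    have [measurable]: "\<Phi> k \<in> borel_measurable borel" by (rule test_function_borel[OF t])
    have i: "integrable lborel (\<Phi> k)"
      using test_function_L1_L2(1)[OF t, of k] by (intro integrable_completion_I) (auto simp: L1_L2_def memLp_1_iff)
    have ic: "integrable lborel (\<lambda>x. complex_of_real (\<Phi> k x) * cis (- (2 * pi * (x \<bullet> z))))"
      using i by (intro integrable_times_unimodular) auto
    have nn: "\<Phi> k x \<ge> 0" and supp: "\<Phi> k x \<noteq> 0 \<longleftrightarrow> x \<in> box (a k) (b k)" for x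
      unfolding \<Phi>_def using box_bump_range[OF zero_less_one ab] by auto
    have cos: "1 / 2 * \<Phi> k x \<le> Re (complex_of_real (\<Phi> k x) * cis (- (2 * pi * (x \<bullet> z))))" for x
    proof (cases "\<Phi> k x = 0")
      case False
      then have x: "\<bar>x $ i\<bar> \<le> 1 / real (Suc k)" for i
        using supp[of x] by (simp add: mem_box_cart a_def b_def abs_le_iff) (smt (verit))
      have "\<bar>x \<bullet> z\<bar> \<le> (\<Sum>i\<in>UNIV. \<bar>x $ i * z $ i\<bar>)" unfolding inner_cart by (rule sum_abs)
      also have "\<dots> \<le> (\<Sum>i\<in>UNIV. 1 / real (Suc k) * \<bar>z $ i\<bar>)"
        unfolding abs_mult by (intro sum_mono mult_right_mono x) simp
      also have "\<dots> = (\<Sum>i\<in>UNIV. \<bar>z $ i\<bar>) / real (Suc k)" by (simp add: sum_divide_distrib)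
      also have "\<dots> \<le> 1 / 8" using k by (simp add: field_simps)
      finally have xz: "\<bar>2 * pi * (x \<bullet> z)\<bar> \<le> pi / 4" by (simp add: abs_mult field_simps)
      have "cos (pi / 4) \<le> cos \<bar>2 * pi * (x \<bullet> z)\<bar>" using xz by (intro cos_monotone_0_pi_le) auto
      moreover have "1 / 2 \<le> cos (pi / 4)" by (simp add: cos_45)
      ultimately have "1 / 2 \<le> cos (2 * pi * (x \<bullet> z))" by simp
      then have "1 / 2 * \<Phi> k x \<le> cos (2 * pi * (x \<bullet> z)) * \<Phi> k x" by (intro mult_right_mono nn)
      then show ?thesis by (simp add: mult.commute)
    qed simp
    have "\<not> (AE x in lborel. \<Phi> k x = 0)"
    proof
      assume "AE x in lborel. \<Phi> k x = 0"
      then have "AE x in lborel. x \<notin> box (a k) (b k)" by eventually_elim (use supp in blast)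
      then have "emeasure lborel (box (a k) (b k)) = 0"
        by (subst (asm) AE_iff_measurable[of "box (a k) (b k)"]) auto
      moreover have "emeasure lborel (box (a k) (b k)) = (\<Prod>j\<in>Basis. (b k - a k) \<bullet> j)"
        using ab by (intro emeasure_lborel_box) (auto simp: Basis_vec_def inner_axis less_imp_le)
      moreover have "(\<Prod>j\<in>Basis. (b k - a k) \<bullet> j) > 0"
        using ab by (intro prod_pos) (auto simp: Basis_vec_def inner_axis)
      ultimately show False by (metis ennreal_eq_0_iff not_le)
    qed
    then have "(LINT x|lborel. \<Phi> k x) \<noteq> 0"
      using integral_nonneg_eq_0_iff_AE[OF i] nn by simp
    then have "(LINT x|lborel. \<Phi> k x) > 0" using nn by (simp add: less_le)
    then have "0 < (LINT x|lborel. 1 / 2 * \<Phi> k x)" by simp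
    also have "\<dots> \<le> (LINT x|lborel. Re (complex_of_real (\<Phi> k x) * cis (- (2 * pi * (x \<bullet> z)))))"
      using i ic by (intro integral_mono cos integrable_mult_right integrable_Re)
    also have "\<dots> = Re (LINT x|lborel. complex_of_real (\<Phi> k x) * cis (- (2 * pi * (x \<bullet> z))))"
      by (rule integral_Re[OF ic])
    also have "\<dots> = Re (fourier_int (\<lambda>x. complex_of_real (\<Phi> k x)) z)"
      by (subst fourier_int_borel_lborel) auto
    finally have "fourier_int (\<lambda>x. complex_of_real (\<Phi> k x)) z \<noteq> 0" by (metis less_irrefl zero_complex.sel(1))
    then show ?thesis by blast
  qed
  show ?thesis by (rule that[OF t nz])
qed

subsection \<open>The fundamental lemma of the calculus of variations\<close>

text \<open>The measures with densities the positive and the negative part of \<open>f\<close> agree on boxes, which are an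
intersection stable generator, hence everywhere.\<close>

lemma AE_eq_0_of_box_integrals:
  fixes f :: "'a::euclidean_space \<Rightarrow> real"
  assumes f: "integrable lborel f" and box: "\<And>a b. (LINT x|lborel. indicator (box a b) x * f x) = 0"
  shows "AE x in lborel. f x = 0"
proof -
  have [measurable]: "f \<in> borel_measurable borel" using borel_measurable_integrable[OF f] by simp
  let ?P = "density lborel (\<lambda>x. ennreal (f x))" and ?N = "density lborel (\<lambda>x. ennreal (- f x))"
  have finP: "(\<integral>\<^sup>+x. ennreal (f x) \<partial>lborel) < \<infinity>" and finN: "(\<integral>\<^sup>+x. ennreal (- f x) \<partial>lborel) < \<infinity>"
    using f unfolding real_integrable_def by (auto simp: less_top)
  have eq: "emeasure ?P X = emeasure ?N X" if X: "X \<in> range (\<lambda>(a, b). box a b :: 'a set)" for X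
  proof -
    obtain a b where X: "X = box a b" using X by auto
    have i: "integrable lborel (\<lambda>x. indicator X x * f x)"
      using f by (rule integrable_real_mult_indicator[rotated, where A=X, unfolded mult.commute[of _ "indicator X _"]]) (simp add: X)
    have "(LINT x|lborel. indicator X x * f x)
        = enn2real (\<integral>\<^sup>+x. ennreal (indicator X x * f x) \<partial>lborel) - enn2real (\<integral>\<^sup>+x. ennreal (- (indicator X x * f x)) \<partial>lborel)"
      by (rule real_lebesgue_integral_def[OF i])
    then have "enn2real (\<integral>\<^sup>+x. ennreal (indicator X x * f x) \<partial>lborel) = enn2real (\<integral>\<^sup>+x. ennreal (- (indicator X x * f x)) \<partial>lborel)"
      using box[of a b] X by simp
    moreover have "(\<integral>\<^sup>+x. ennreal (indicator X x * f x) \<partial>lborel) < \<infinity>" "(\<integral>\<^sup>+x. ennreal (- (indicator X x * f x)) \<partial>lborel) < \<infinity>"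
      using i unfolding real_integrable_def by (auto simp: less_top)
    ultimately have e: "(\<integral>\<^sup>+x. ennreal (indicator X x * f x) \<partial>lborel) = (\<integral>\<^sup>+x. ennreal (- (indicator X x * f x)) \<partial>lborel)"
      by (metis ennreal_enn2real infinity_ennreal_def)
    have "emeasure ?P X = (\<integral>\<^sup>+x. ennreal (indicator X x * f x) \<partial>lborel)"
      using X by (subst emeasure_density) (auto intro!: nn_integral_cong simp: indicator_def)
    moreover have "emeasure ?N X = (\<integral>\<^sup>+x. ennreal (- (indicator X x * f x)) \<partial>lborel)"
      using X by (subst emeasure_density) (auto intro!: nn_integral_cong simp: indicator_def)
    ultimately show ?thesis using e by simp
  qed
  have "?P = ?N"
  proof (rule measure_eqI_generator_eq[where E="range (\<lambda>(a, b). box a b :: 'a set)" and \<Omega>=UNIV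
        and A="\<lambda>n::nat. box (- (real n *\<^sub>R One)) (real n *\<^sub>R One)"])
    show "Int_stable (range (\<lambda>(a, b). box a b :: 'a set))"
      unfolding Int_stable_def by (auto simp: Int_interval box_Int_box)
    show "sets ?P = sigma_sets UNIV (range (\<lambda>(a, b). box a b :: 'a set))"
      "sets ?N = sigma_sets UNIV (range (\<lambda>(a, b). box a b :: 'a set))"
      by (simp_all add: borel_eq_box)
    show "(\<Union>n::nat. box (- (real n *\<^sub>R One)) (real n *\<^sub>R One :: 'a)) = UNIV" by (rule UN_box_eq_UNIV)
    show "emeasure ?P (box (- (real n *\<^sub>R One)) (real n *\<^sub>R One)) \<noteq> \<infinity>" for n
    proof -
      have "emeasure ?P (box (- (real n *\<^sub>R One)) (real n *\<^sub>R One)) \<le> emeasure ?P (space ?P)"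
        by (rule emeasure_space)
      also have "\<dots> = (\<integral>\<^sup>+x. ennreal (f x) \<partial>lborel)" by (subst emeasure_density) auto
      finally show ?thesis using finP by (auto simp: top_unique)
    qed
  qed (auto simp: eq)
  then have "AE x in lborel. ennreal (f x) = ennreal (- f x)"
    using finP by (subst (asm) finite_density_unique) auto
  then show ?thesis
  proof eventually_elim
    case (elim x)
    then show ?case by (cases "f x \<ge> 0") (auto simp: ennreal_neg ennreal_eq_0_iff)
  qed
qed

text \<open>The bumps on a box tend to its indicator, so all integrals of \<open>g\<close> over boxes vanish.\<close>

theorem fundamental_lemma:
  fixes g :: "real^'n::finite \<Rightarrow> real"
  assumes m: "g \<in> borel_measurable lebesgue" and loc: "\<And>R. integrable lebesgue (\<lambda>x. indicator (cball 0 R) x * g x)"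
    and zero: "\<And>\<phi>. test_function \<phi> \<Longrightarrow> (LINT x|lebesgue. g x * \<phi> x) = 0"
  shows "AE x in lebesgue. g x = 0"
proof -
  obtain f where f [measurable]: "f \<in> borel_measurable borel" and ae: "AE x in lebesgue. g x = f x"
    using completion_ex_borel_measurable_real[OF m] by (auto dest: AE_completion)
  note [measurable] = m measurable_lebesgue_borel[OF f]
  have locf: "integrable lborel (\<lambda>x. indicator (cball 0 R) x * f x)" for R
  proof (rule integrable_completion_I)
    show fm: "(\<lambda>x. indicator (cball 0 R) x * f x) \<in> borel_measurable borel"
      by (intro borel_measurable_times borel_measurable_indicator f) simp
    then show "integrable lebesgue (\<lambda>x. indicator (cball 0 R) x * f x)"
      by (rule integrable_cong_AE_imp[OF loc[of R] measurable_lebesgue_borel]) (use ae in \<open>auto elim: eventually_mono\<close>)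
  qed
  have box0: "(LINT x|lborel. indicator (box a b) x * f x) = 0" for a b :: "real^'n"
  proof (cases "\<forall>i. a $ i < b $ i")
    case True
    then have ab: "\<And>i. a $ i < b $ i" by blast
    obtain R where R: "cbox a b \<subseteq> cball 0 R"
      using bounded_subset_ballD[OF bounded_cbox, of a b 0] ball_subset_cball by blast
    let ?\<phi> = "\<lambda>k. box_bump (1 / real (Suc k)) a b"
    have t: "test_function (?\<phi> k)" for k by (intro test_function_box_bump ab) simp
    note [measurable] = test_function_borel[OF t]
    have pm: "(\<lambda>x. ?\<phi> k x * f x) \<in> borel_measurable borel" for k
      by (intro borel_measurable_times test_function_borel t f)
    have "(\<lambda>k. LINT x|lborel. ?\<phi> k x * f x) \<longlonglongrightarrow> (LINT x|lborel. indicator (box a b) x * f x)"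
    proof (rule integral_dominated_convergence)
      show "integrable lborel (\<lambda>x. norm (indicator (cball 0 R) x * f x))" by (intro integrable_norm locf)
      show "AE x in lborel. (\<lambda>k. ?\<phi> k x * f x) \<longlonglongrightarrow> indicator (box a b) x * f x"
        by (intro AE_I2 tendsto_intros box_bump_tendsto ab)
      show "AE x in lborel. norm (?\<phi> k x * f x) \<le> norm (indicator (cball 0 R) x * f x)" for k
      proof (rule AE_I2)
        fix x
        have "0 \<le> ?\<phi> k x" "?\<phi> k x \<le> indicator (cball 0 R) x"
          using box_bump_range[of "1 / real (Suc k)" a b x] ab R box_subset_cbox[of a b]
          by (auto simp: indicator_def)
        then show "norm (?\<phi> k x * f x) \<le> norm (indicator (cball 0 R) x * f x)"
          by (simp add: abs_mult mult_right_mono)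
      qed
    qed measurable
    moreover have "(LINT x|lborel. ?\<phi> k x * f x) = 0" for k
    proof -
      have "(LINT x|lborel. ?\<phi> k x * f x) = (LINT x|lebesgue. ?\<phi> k x * f x)"
        by (rule integral_completion[symmetric]) (use pm in \<open>simp del: of_nat_Suc\<close>)
      also have "\<dots> = (LINT x|lebesgue. g x * ?\<phi> k x)"
        using ae measurable_lebesgue_borel[OF test_function_borel[OF t[of k]]]
        by (intro integral_cong_AE) (auto elim: eventually_mono)
      finally show ?thesis using zero[OF t] by simp
    qed
    ultimately show ?thesis by (simp add: LIMSEQ_const_iff)
  next
    case False
    then have "box a b = {}" by (force simp: mem_box_cart intro: less_trans)
    then show ?thesis by simp
  qed
  have "AE x in lborel. indicator (box (- (real N *\<^sub>R One)) (real N *\<^sub>R One)) x * f x = 0" for N :: nat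
  proof (rule AE_eq_0_of_box_integrals)
    let ?B = "box (- (real N *\<^sub>R One)) (real N *\<^sub>R One) :: (real^'n) set"
    obtain R where R: "?B \<subseteq> cball 0 R" using bounded_subset_ballD[OF bounded_box] ball_subset_cball by blast
    have le: "norm (indicator ?B x * f x) \<le> norm (indicator (cball 0 R) x * f x)" for x
    proof (cases "x \<in> ?B")
      case True
      then have "x \<in> cball 0 R" using R by blast
      then show ?thesis using True by simp
    qed simp
    have "(\<lambda>x. indicator ?B x * f x) \<in> borel_measurable lborel" by simp
    then show "integrable lborel (\<lambda>x. indicator ?B x * f x)"
      by (rule Bochner_Integration.integrable_bound[OF locf[of R]]) (intro AE_I2 le)
    fix a b :: "real^'n"
    obtain a' b' where ab': "box a b \<inter> ?B = box a' b'" by (rule that[OF box_Int_box])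
    have "(LINT x|lborel. indicator (box a b) x * (indicator ?B x * f x)) = (LINT x|lborel. indicator (box a b \<inter> ?B) x * f x)"
      by (intro Bochner_Integration.integral_cong refl) (simp add: indicator_inter_arith)
    then show "(LINT x|lborel. indicator (box a b) x * (indicator ?B x * f x)) = 0"
      by (simp add: ab' box0)
  qed
  then have "AE x in lborel. \<forall>N::nat. indicator (box (- (real N *\<^sub>R One)) (real N *\<^sub>R One)) x * f x = 0"
    unfolding AE_all_countable by (rule allI)
  then have "AE x in lborel. f x = 0"
  proof eventually_elim
    case (elim x)
    have "x \<in> (\<Union>N::nat. box (- (real N *\<^sub>R One)) (real N *\<^sub>R One))" by (simp add: UN_box_eq_UNIV)
    then obtain N :: nat where "x \<in> box (- (real N *\<^sub>R One)) (real N *\<^sub>R One)" by blast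
    then show ?case using elim[rule_format, of N] by simp
  qed
  from AE_completion[OF this] ae show ?thesis by eventually_elim simp
qed

section \<open>Weak gradients\<close>

lemma locally_integrable_cball:
  fixes f :: "'a::euclidean_space \<Rightarrow> 'b::euclidean_space"
  shows "locally_integrable f \<Longrightarrow> integrable lebesgue (\<lambda>x. indicator (cball 0 R) x *\<^sub>R f x)"
  by (simp add: locally_integrable_def set_integrable_def)

lemma locally_integrable_measurable:
  fixes f :: "'a::euclidean_space \<Rightarrow> 'b::euclidean_space"
  assumes "locally_integrable f"
  shows "f \<in> borel_measurable lebesgue"
proof (rule borel_measurable_LIMSEQ_metric)
  show "(\<lambda>x. indicator (cball 0 (real k)) x *\<^sub>R f x) \<in> borel_measurable lebesgue" for k
    using locally_integrable_cball[OF assms] by (rule borel_measurable_integrable)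
  fix x :: 'a
  obtain N :: nat where N: "norm x \<le> real N" using real_arch_simple by blast
  have "\<forall>\<^sub>F k in sequentially. indicator (cball 0 (real k)) x *\<^sub>R f x = f x"
    using eventually_ge_at_top[of N]
  proof eventually_elim
    case (elim k)
    then have "real N \<le> real k" by simp
    then have "norm x \<le> real k" using N by linarith
    then show ?case by simp
  qed
  then show "(\<lambda>k. indicator (cball 0 (real k)) x *\<^sub>R f x) \<longlonglongrightarrow> f x" by (rule tendsto_eventually)
qed

lemma locally_integrable_of_bounded_linear:
  fixes f :: "'a::euclidean_space \<Rightarrow> 'b::euclidean_space" and T :: "'b \<Rightarrow> 'c::euclidean_space"
  assumes "locally_integrable f" "bounded_linear T"
  shows "locally_integrable (\<lambda>x. T (f x))"
  unfolding locally_integrable_def set_integrable_def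
proof (intro allI impI)
  fix K :: "'a set" assume "compact K"
  then have "integrable lebesgue (\<lambda>x. indicator K x *\<^sub>R f x)"
    using assms by (simp add: locally_integrable_def set_integrable_def)
  from integrable_bounded_linear[OF assms(2) this]
  show "integrable lebesgue (\<lambda>x. indicat_real K x *\<^sub>R T (f x))"
    by (simp add: linear_cmul[OF bounded_linear.linear[OF assms(2)]])
qed

lemma locally_integrable_diff:
  fixes f g :: "'a::euclidean_space \<Rightarrow> 'b::euclidean_space"
  shows "locally_integrable f \<Longrightarrow> locally_integrable g \<Longrightarrow> locally_integrable (\<lambda>x. f x - g x)"
  unfolding locally_integrable_def set_integrable_def by (simp add: scaleR_diff_right)

lemma le_one_plus_powr: "0 \<le> (t::real) \<Longrightarrow> p \<ge> 1 \<Longrightarrow> t \<le> 1 + t powr p"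
proof (cases "t \<le> 1")
  case False
  assume "0 \<le> t" "p \<ge> 1"
  then have "t powr 1 \<le> t powr p" using False by (intro powr_mono) auto
  then show ?thesis using False by simp
qed (simp add: add_increasing2)

lemma memLp_locally_integrable:
  fixes f :: "'a::euclidean_space \<Rightarrow> 'b::euclidean_space"
  assumes "memLp p f" "p \<ge> 1"
  shows "locally_integrable f"
  unfolding locally_integrable_def set_integrable_def
proof (intro allI impI)
  fix K :: "'a set" assume K: "compact K"
  have m [measurable]: "f \<in> borel_measurable lebesgue" and i: "integrable lebesgue (\<lambda>x. norm (f x) powr p)"
    using assms by (auto simp: memLp_def)
  have Kb: "K \<in> sets borel" using K by (rule borel_compact)
  then have Km: "K \<in> sets lebesgue" by simp
  have iK: "integrable lebesgue (indicat_real K)"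
    using K Km emeasure_compact_finite[OF K] by (intro integrable_real_indicator) (auto simp: less_top borel_compact)
  show "integrable lebesgue (\<lambda>x. indicat_real K x *\<^sub>R f x)"
  proof (rule Bochner_Integration.integrable_bound)
    show "integrable lebesgue (\<lambda>x. indicat_real K x + norm (f x) powr p)"
      by (intro Bochner_Integration.integrable_add iK i)
    show "(\<lambda>x. indicat_real K x *\<^sub>R f x) \<in> borel_measurable lebesgue"
      using Km m by (intro borel_measurable_scaleR borel_measurable_indicator)
    show "AE x in lebesgue. norm (indicat_real K x *\<^sub>R f x) \<le> norm (indicat_real K x + norm (f x) powr p)"
      using le_one_plus_powr[OF norm_ge_zero assms(2)] by (intro AE_I2) (auto simp: indicator_def)
  qed
qed

lemma locally_integrable_mult_test_function:
  fixes g :: "real^'n::finite \<Rightarrow> real"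
  assumes g: "locally_integrable g" and t: "test_function \<phi>"
  shows "integrable lebesgue (\<lambda>x. g x * \<phi> x)"
proof -
  obtain B R where B: "\<And>x. \<bar>\<phi> x\<bar> \<le> B * indicator (cball 0 R) x" "B \<ge> 0" using test_function_bounds[OF t] by metis
  have m: "g \<in> borel_measurable lebesgue" "\<phi> \<in> borel_measurable lebesgue"
    using locally_integrable_measurable[OF g] measurable_lebesgue_borel[OF test_function_borel[OF t]] by auto
  show ?thesis
  proof (rule Bochner_Integration.integrable_bound)
    show "integrable lebesgue (\<lambda>x. B * norm (indicat_real (cball 0 R) x *\<^sub>R g x))"
      by (intro integrable_mult_right integrable_norm locally_integrable_cball g)
    show "(\<lambda>x. g x * \<phi> x) \<in> borel_measurable lebesgue" using m by measurable
    show "AE x in lebesgue. norm (g x * \<phi> x) \<le> norm (B * norm (indicat_real (cball 0 R) x *\<^sub>R g x))"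
    proof (rule AE_I2)
      fix x
      have "norm (g x * \<phi> x) \<le> \<bar>g x\<bar> * (B * indicator (cball 0 R) x)"
        using mult_left_mono[OF B(1)[of x], of "\<bar>g x\<bar>"] by (simp add: abs_mult)
      then show "norm (g x * \<phi> x) \<le> norm (B * norm (indicat_real (cball 0 R) x *\<^sub>R g x))"
        using B(2) by (simp add: abs_mult mult_ac)
    qed
  qed
qed

lemma fundamental_lemma_locally_integrable:
  fixes g :: "real^'n::finite \<Rightarrow> real"
  assumes g: "locally_integrable g" and "\<And>\<phi>. test_function \<phi> \<Longrightarrow> (LINT x|lebesgue. g x * \<phi> x) = 0"
  shows "AE x in lebesgue. g x = 0"
  by (rule fundamental_lemma[OF locally_integrable_measurable[OF g] _ assms(2)])
     (use locally_integrable_cball[OF g] in simp)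

lemma bounded_linear_entry: "bounded_linear (\<lambda>Q :: real^'n::finite^'N::finite. Q $ \<alpha> $ i)"
  by (intro bounded_linear_compose[OF bounded_linear_vec_nth bounded_linear_vec_nth])

lemma is_weak_gradientD:
  fixes u :: "real^'n::finite \<Rightarrow> real^'N::finite"
  assumes "is_weak_gradient u G"
  shows "locally_integrable u" "locally_integrable G" "locally_integrable (\<lambda>x. u x $ \<alpha>)" "locally_integrable (\<lambda>x. G x $ \<alpha> $ i)"
    "test_function \<phi> \<Longrightarrow> (LINT x|lebesgue. u x $ \<alpha> * partial_deriv i \<phi> x) = - (LINT x|lebesgue. G x $ \<alpha> $ i * \<phi> x)"
  using assms unfolding is_weak_gradient_def
  by (auto intro: locally_integrable_of_bounded_linear[OF _ bounded_linear_vec_nth]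
      locally_integrable_of_bounded_linear[OF _ bounded_linear_entry])

lemma is_weak_gradient_diff:
  fixes u v :: "real^'n::finite \<Rightarrow> real^'N::finite"
  assumes u: "is_weak_gradient u G" and v: "is_weak_gradient v H"
  shows "is_weak_gradient (\<lambda>x. u x - v x) (\<lambda>x. G x - H x)"
  unfolding is_weak_gradient_def
proof (intro conjI allI impI)
  show "locally_integrable (\<lambda>x. u x - v x)" "locally_integrable (\<lambda>x. G x - H x)"
    by (intro locally_integrable_diff is_weak_gradientD[OF u] is_weak_gradientD[OF v])+
  fix \<phi> :: "real^'n \<Rightarrow> real" and \<alpha> i assume t: "test_function \<phi>"
  note int = locally_integrable_mult_test_function[OF _ t] locally_integrable_mult_test_function[OF _ test_function_partial_deriv[OF t]]
  show "(LINT x|lebesgue. (u x - v x) $ \<alpha> * partial_deriv i \<phi> x) = - (LINT x|lebesgue. (G x - H x) $ \<alpha> $ i * \<phi> x)"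
    using is_weak_gradientD(5)[OF u t, of \<alpha> i] is_weak_gradientD(5)[OF v t, of \<alpha> i]
    by (simp add: left_diff_distrib int is_weak_gradientD(3,4)[OF u] is_weak_gradientD(3,4)[OF v])
qed

lemma is_weak_gradient_unique:
  fixes u :: "real^'n::finite \<Rightarrow> real^'N::finite"
  assumes G: "is_weak_gradient u G" and H: "is_weak_gradient u H"
  shows "AE x in lebesgue. G x = H x"
proof -
  have d: "is_weak_gradient (\<lambda>x. u x - u x) (\<lambda>x. G x - H x)" by (rule is_weak_gradient_diff[OF G H])
  have "AE x in lebesgue. (G x - H x) $ \<alpha> $ i = 0" for \<alpha> i
    by (rule fundamental_lemma_locally_integrable[OF is_weak_gradientD(4)[OF d]])
       (use is_weak_gradientD(5)[OF d, of _ \<alpha> i] in simp)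
  then have "AE x in lebesgue. \<forall>\<alpha> i. (G x - H x) $ \<alpha> $ i = 0"
    by (simp only: AE_all_countable simp_thms)
  then show ?thesis by eventually_elim (simp add: vec_eq_iff)
qed

lemma weak_gradient:
  assumes "is_weak_gradient u G"
  shows "is_weak_gradient u (weak_gradient u)" "AE x in lebesgue. weak_gradient u x = G x"
proof -
  show "is_weak_gradient u (weak_gradient u)"
    unfolding weak_gradient_def by (rule someI[of "is_weak_gradient u", OF assms])
  then show "AE x in lebesgue. weak_gradient u x = G x" by (rule is_weak_gradient_unique[OF _ assms])
qed

section \<open>Uniqueness\<close>

text \<open>The Fourier transforms of both sides are \<open>(2\<pi>i)\<^sup>2 z\<^sub>i z\<^sub>j\<close> times that of \<open>\<phi>\<close>, so the symmetry
follows from Plancherel's theorem without Schwarz's theorem on mixed derivatives.\<close>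

lemma test_function_mixed_partials:
  fixes \<phi> :: "real^'n::finite \<Rightarrow> real"
  assumes t: "test_function \<phi>"
  shows "AE x in lebesgue. partial_deriv i (partial_deriv j \<phi>) x = partial_deriv j (partial_deriv i \<phi>) x"
proof -
  let ?a = "\<lambda>x. complex_of_real (partial_deriv i (partial_deriv j \<phi>) x)" and ?b = "\<lambda>x. complex_of_real (partial_deriv j (partial_deriv i \<phi>) x)"
  have a: "L1_L2 ?a" and b: "L1_L2 ?b" by (intro test_function_L1_L2 test_function_partial_deriv t)+
  then have d: "L1_L2 (\<lambda>x. ?a x - ?b x)" by (intro F.L1_L2_diff)
  have "fourier_int (\<lambda>x. ?a x - ?b x) = (\<lambda>z. 0)"
    unfolding F.T_diff[OF a b] by (simp add: fourier_partial_deriv test_function_partial_deriv t mult_ac)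
  then have "sq_norm (\<lambda>x. ?a x - ?b x) = 0" using F.T_norm[OF d] by (simp add: sq_norm_def)
  moreover have "memLp 2 (\<lambda>x. ?a x - ?b x)" using d by (simp add: L1_L2_def)
  ultimately have "AE x in lebesgue. ?a x - ?b x = 0" using sq_norm_eq_0_iff by blast
  then show ?thesis by eventually_elim (simp flip: of_real_diff)
qed

lemma weak_gradient_curl_free:
  fixes v :: "real^'n::finite \<Rightarrow> real^'N::finite"
  assumes G: "is_weak_gradient v G" and t: "test_function \<phi>"
  shows "(LINT x|lebesgue. G x $ \<alpha> $ i * partial_deriv j \<phi> x) = (LINT x|lebesgue. G x $ \<alpha> $ j * partial_deriv i \<phi> x)"
proof -
  have "(LINT x|lebesgue. G x $ \<alpha> $ i * partial_deriv j \<phi> x) = - (LINT x|lebesgue. v x $ \<alpha> * partial_deriv i (partial_deriv j \<phi>) x)"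
    using is_weak_gradientD(5)[OF G test_function_partial_deriv[OF t]] by simp
  also have "(LINT x|lebesgue. v x $ \<alpha> * partial_deriv i (partial_deriv j \<phi>) x) = (LINT x|lebesgue. v x $ \<alpha> * partial_deriv j (partial_deriv i \<phi>) x)"
  proof (rule integral_cong_AE)
    show "AE x in lebesgue. v x $ \<alpha> * partial_deriv i (partial_deriv j \<phi>) x = v x $ \<alpha> * partial_deriv j (partial_deriv i \<phi>) x"
      using test_function_mixed_partials[OF t, of i j] by eventually_elim simp
  qed (intro borel_measurable_integrable locally_integrable_mult_test_function is_weak_gradientD[OF G] test_function_partial_deriv t)+
  also have "- \<dots> = (LINT x|lebesgue. G x $ \<alpha> $ j * partial_deriv i \<phi> x)"
    using is_weak_gradientD(5)[OF G test_function_partial_deriv[OF t]] by simp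
  finally show ?thesis .
qed

lemma memLp_2_of_real_component:
  assumes G: "memLp 2 (G :: real^'n::finite \<Rightarrow> 'b::euclidean_space)" and T: "bounded_linear T" and le: "\<And>Q. \<bar>T Q\<bar> \<le> norm Q"
  shows "memLp 2 (\<lambda>x. complex_of_real (T (G x)))" "sq_norm (\<lambda>x. complex_of_real (T (G x))) \<le> sq_norm G"
proof -
  have [measurable]: "G \<in> borel_measurable lebesgue" using G by (simp add: memLp_def)
  have [measurable]: "T \<in> borel_measurable borel"
    by (intro borel_measurable_continuous_onI linear_continuous_on T)
  have m: "(\<lambda>x. complex_of_real (T (G x))) \<in> borel_measurable lebesgue" by measurable
  show "memLp 2 (\<lambda>x. complex_of_real (T (G x)))" "sq_norm (\<lambda>x. complex_of_real (T (G x))) \<le> sq_norm G"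
    using memLp_2_bound[OF G m, of 1] le by auto
qed

lemma entry_le_norm: "\<bar>Q $ \<alpha> $ i\<bar> \<le> norm (Q :: real^'n::finite^'N::finite)"
  by (rule order_trans[OF component_le_norm_cart[of "Q $ \<alpha>" i] Finite_Cartesian_Product.norm_nth_le])

lemma memLp_2_entry:
  fixes G :: "real^'n::finite \<Rightarrow> real^'n^'N::finite"
  assumes "memLp 2 G" shows "memLp 2 (\<lambda>x. complex_of_real (G x $ \<alpha> $ i))"
  by (rule memLp_2_of_real_component(1)[OF assms bounded_linear_entry entry_le_norm])

lemma integral_of_real_mult:
  "(LINT x|M. complex_of_real (a x) * complex_of_real (b x)) = complex_of_real (LINT x|M. a x * b x)"
  by (simp flip: of_real_mult)

text \<open>On the Fourier side a weak gradient is a rank-one matrix \<open>\<eta> \<otimes> z\<close>. Testing the curl-free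
  condition with all translates of \<open>\<phi>\<close> shows that \<open>(z\<^sub>j g\<^sub>i - z\<^sub>i g\<^sub>j) \<phi>^\<close> has Fourier transform zero.
  This function lies in \<open>L\<^sup>1 \<inter> L\<^sup>2\<close>, so it vanishes by Plancherel's theorem, and the factor \<open>\<phi>^\<close> is
  removed by letting \<open>\<phi>\<close> run through a sequence whose transforms have no common zero.\<close>

lemma weak_gradient_fourier_parallel:
  fixes v :: "real^'n::finite \<Rightarrow> real^'N::finite"
  assumes G: "is_weak_gradient v G" and G2: "memLp 2 G"
  defines "g \<equiv> \<lambda>\<alpha> i. L2_extension inv_fourier_int (\<lambda>x. complex_of_real (G x $ \<alpha> $ i))"
  shows "AE z in lebesgue. of_real (z $ j) * g \<alpha> i z = of_real (z $ i) * g \<alpha> j z"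
proof -
  let ?G = "\<lambda>i x. complex_of_real (G x $ \<alpha> $ i)"
  have G2': "memLp 2 (?G i)" for i by (rule memLp_2_entry[OF G2])
  have g2: "memLp 2 (g \<alpha> i)" for i unfolding g_def by (rule I.X_memLp[OF G2'])
  have Fg: "AE x in lebesgue. F.X (g \<alpha> i) x = ?G i x" for i
    unfolding g_def by (rule fourier_L2_inversion(2)[OF G2'])
  let ?d = "\<lambda>i \<phi> x. complex_of_real (partial_deriv i \<phi> x)"
  have pair: "(LINT z|lebesgue. g \<alpha> i z * fourier_int (?d j \<phi>) z) = complex_of_real (LINT x|lebesgue. G x $ \<alpha> $ i * partial_deriv j \<phi> x)"
    if t: "test_function \<phi>" for i j \<phi>
  proof -
    have L: "L1_L2 (?d j \<phi>)" by (intro test_function_L1_L2 test_function_partial_deriv t)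
    then have L2: "memLp 2 (?d j \<phi>)" by (simp add: L1_L2_def)
    have "(LINT z|lebesgue. g \<alpha> i z * fourier_int (?d j \<phi>) z) = (LINT x|lebesgue. F.X (g \<alpha> i) x * ?d j \<phi> x)"
      by (rule F.X_multiplication[OF g2 L, symmetric])
    also have "\<dots> = (LINT x|lebesgue. ?G i x * ?d j \<phi> x)"
    proof (rule integral_cong_AE)
      show "AE x in lebesgue. F.X (g \<alpha> i) x * ?d j \<phi> x = ?G i x * ?d j \<phi> x"
        using Fg[of i] by eventually_elim simp
    qed (intro borel_measurable_integrable L2_mult_integrable F.X_memLp g2 G2' L2)+
    finally show ?thesis unfolding integral_of_real_mult .
  qed
  have H0: "AE z in lebesgue. g \<alpha> i z * fourier_int (?d j \<phi>) z - g \<alpha> j z * fourier_int (?d i \<phi>) z = 0"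
    if t: "test_function \<phi>" for \<phi>
  proof -
    let ?H = "\<lambda>z. g \<alpha> i z * fourier_int (?d j \<phi>) z - g \<alpha> j z * fourier_int (?d i \<phi>) z"
    have L: "L1_L2 (?d k \<phi>)" for k by (intro test_function_L1_L2 test_function_partial_deriv t)
    have part: "L1_L2 (\<lambda>z. g \<alpha> k z * fourier_int (?d l \<phi>) z)" for k l
    proof -
      have "memLp 1 (\<lambda>z. g \<alpha> k z * fourier_int (?d l \<phi>) z)"
        unfolding memLp_1_iff by (intro L2_mult_integrable g2 F.T_L2 L)
      moreover have "memLp 2 (\<lambda>z. g \<alpha> k z * fourier_int (?d l \<phi>) z)"
      proof (rule memLp_2_bound(1)[OF g2])
        show "(\<lambda>z. g \<alpha> k z * fourier_int (?d l \<phi>) z) \<in> borel_measurable lebesgue"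
          by (intro borel_measurable_integrable L2_mult_integrable g2 F.T_L2 L)
        have "integrable lebesgue (?d l \<phi>)" using L by (simp add: L1_L2_def memLp_1_iff)
        then show "AE z in lebesgue. norm (g \<alpha> k z * fourier_int (?d l \<phi>) z) \<le> (LINT x|lebesgue. norm (?d l \<phi> x)) * norm (g \<alpha> k z)"
          unfolding norm_mult mult.commute[of "norm (g \<alpha> k _)"]
          by (intro AE_I2 mult_right_mono fourier_int_norm_le norm_ge_zero)
      qed
      ultimately show ?thesis by (simp add: L1_L2_def)
    qed
    have HL: "L1_L2 ?H" by (intro F.L1_L2_diff part)
    have "fourier_int ?H y = 0" for y
    proof -
      have tr: "fourier_int (?d k (\<lambda>x. \<phi> (x - y))) z = cis (- (2 * pi * (z \<bullet> y))) * fourier_int (?d k \<phi>) z" for k z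
      proof -
        have m: "(\<lambda>x. ?d k \<phi> x) \<in> borel_measurable borel"
          using test_function_borel[OF test_function_partial_deriv[OF t]] by measurable
        have "?d k (\<lambda>x. \<phi> (x - y)) = (\<lambda>x. ?d k \<phi> (x - y))"
          using partial_deriv_translate(1)[OF test_function_differentiable[OF t]] by metis
        then show ?thesis using fourier_int_translate[OF m, of y z] by (simp add: inner_commute)
      qed
      have ty: "test_function (\<lambda>x. \<phi> (x - y))" by (rule test_function_translate[OF t])
      have Ly: "L1_L2 (?d k (\<lambda>x. \<phi> (x - y)))" for k by (intro test_function_L1_L2 test_function_partial_deriv ty)
      have "fourier_int ?H y = (LINT z|lebesgue. g \<alpha> i z * fourier_int (?d j (\<lambda>x. \<phi> (x - y))) z - g \<alpha> j z * fourier_int (?d i (\<lambda>x. \<phi> (x - y))) z)"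
        unfolding fourier_int_cis[of ?H] tr by (intro Bochner_Integration.integral_cong refl) (simp add: algebra_simps)
      also have "\<dots> = (LINT z|lebesgue. g \<alpha> i z * fourier_int (?d j (\<lambda>x. \<phi> (x - y))) z) - (LINT z|lebesgue. g \<alpha> j z * fourier_int (?d i (\<lambda>x. \<phi> (x - y))) z)"
        by (intro Bochner_Integration.integral_diff L2_mult_integrable g2 F.T_L2 Ly)
      also have "\<dots> = 0" unfolding pair[OF ty] weak_gradient_curl_free[OF G ty, of \<alpha> i j] by simp
      finally show ?thesis .
    qed
    then have "sq_norm ?H = 0" using F.T_norm[OF HL] by (simp add: sq_norm_def)
    moreover have "memLp 2 ?H" using HL by (simp add: L1_L2_def)
    ultimately show ?thesis using sq_norm_eq_0_iff by blast
  qed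
  obtain \<Phi> :: "nat \<Rightarrow> real^'n \<Rightarrow> real" where \<Phi>: "\<And>k. test_function (\<Phi> k)"
    "\<And>z. \<exists>k. fourier_int (\<lambda>x. complex_of_real (\<Phi> k x)) z \<noteq> 0" using exists_fourier_nonzero by blast
  have "AE z in lebesgue. \<forall>k. g \<alpha> i z * fourier_int (?d j (\<Phi> k)) z - g \<alpha> j z * fourier_int (?d i (\<Phi> k)) z = 0"
    unfolding AE_all_countable by (intro allI H0 \<Phi>)
  then show ?thesis
  proof eventually_elim
    case (elim z)
    obtain k where k: "fourier_int (\<lambda>x. complex_of_real (\<Phi> k x)) z \<noteq> 0" using \<Phi>(2) by blast
    have "2 * complex_of_real pi * \<i> * fourier_int (\<lambda>x. complex_of_real (\<Phi> k x)) z * (of_real (z $ j) * g \<alpha> i z - of_real (z $ i) * g \<alpha> j z) = 0"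
      using elim[rule_format, of k] unfolding fourier_partial_deriv[OF \<Phi>(1)] by (simp add: algebra_simps)
    then show ?case using k by simp
  qed
qed

text \<open>The parallelism condition means \<open>g = \<eta> \<otimes> z\<close> with the complex vector \<open>\<eta> = g z / \<bar>z\<bar>\<^sup>2\<close>. As \<open>A\<close> and
\<open>z\<close> are real, ellipticity applies to the real and the imaginary part of \<open>\<eta>\<close> separately.\<close>

lemma parallel_in_kernel_zero:
  fixes A :: "real^'n::finite^'N::finite \<Rightarrow> real^'N" and g :: "'N \<Rightarrow> 'n \<Rightarrow> complex"
  assumes A: "linear A" and ell: "\<And>\<eta> a. norm (A (tensor \<eta> a)) \<ge> \<nu> * norm \<eta> * norm a" and \<nu>: "\<nu> > 0"
    and z: "z \<noteq> 0" and par: "\<And>\<beta> i j. of_real (z $ j) * g \<beta> i = of_real (z $ i) * g \<beta> j"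
    and ker: "\<And>\<alpha>. (\<Sum>\<beta>\<in>UNIV. \<Sum>j\<in>UNIV. of_real (tensor_component A \<alpha> \<beta> j) * g \<beta> j) = 0"
  shows "g \<beta> i = 0"
proof -
  define N2 where "N2 = (\<Sum>j\<in>UNIV. (z $ j)\<^sup>2)"
  have N2: "N2 > 0"
    using z by (simp add: N2_def vec_eq_iff sum_nonneg_eq_0_iff less_le sum_nonneg)
  define \<eta> where "\<eta> \<beta> = (\<Sum>j\<in>UNIV. of_real (z $ j) * g \<beta> j) / of_real N2" for \<beta>
  have g: "g \<beta> i = \<eta> \<beta> * of_real (z $ i)" for \<beta> i
  proof -
    have "\<eta> \<beta> * of_real (z $ i) = (\<Sum>j\<in>UNIV. of_real (z $ j) * (of_real (z $ i) * g \<beta> j)) / of_real N2"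
      by (simp add: \<eta>_def sum_distrib_left sum_distrib_right mult_ac)
    also have "\<dots> = (\<Sum>j\<in>UNIV. of_real (z $ j) * (of_real (z $ j) * g \<beta> i)) / of_real N2"
      by (simp only: par[of _ \<beta> i])
    also have "(\<Sum>j\<in>UNIV. of_real (z $ j) * (of_real (z $ j) * g \<beta> i)) = of_real N2 * g \<beta> i"
      by (simp add: N2_def sum_distrib_left sum_distrib_right power2_eq_square mult_ac)
    finally show ?thesis using N2 by simp
  qed
  have zero: "h = 0" if "\<And>\<alpha>. (\<Sum>\<beta>\<in>UNIV. \<Sum>j\<in>UNIV. tensor_component A \<alpha> \<beta> j * (h $ \<beta> * z $ j)) = 0" for h
  proof -
    have "A (tensor h z) = 0"
      unfolding vec_eq_iff using that by (simp add: linear_tensor_component[OF A] tensor_def)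
    then have "\<nu> * norm h * norm z \<le> 0" using ell[of h z] by simp
    then show ?thesis using \<nu> z by (simp add: mult_le_0_iff not_less zero_less_mult_iff)
  qed
  have "(\<Sum>\<beta>\<in>UNIV. \<Sum>j\<in>UNIV. tensor_component A \<alpha> \<beta> j * (Re (\<eta> \<beta>) * z $ j)) = 0"
    "(\<Sum>\<beta>\<in>UNIV. \<Sum>j\<in>UNIV. tensor_component A \<alpha> \<beta> j * (Im (\<eta> \<beta>) * z $ j)) = 0" for \<alpha>
    using arg_cong[OF ker[of \<alpha>], of Re] arg_cong[OF ker[of \<alpha>], of Im] unfolding g by simp_all
  then have "(\<chi> \<beta>. Re (\<eta> \<beta>)) = 0" "(\<chi> \<beta>. Im (\<eta> \<beta>)) = 0" by (auto intro!: zero)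
  then have "\<eta> \<beta> = 0" by (simp add: vec_eq_iff complex_eq_iff)
  then show ?thesis by (simp add: g)
qed

lemma weak_gradient_in_kernel_zero:
  fixes A :: "real^'n::finite^'N::finite \<Rightarrow> real^'N"
  assumes A: "linear A" and ell: "\<And>\<eta> a. norm (A (tensor \<eta> a)) \<ge> \<nu> * norm \<eta> * norm a" and \<nu>: "\<nu> > 0"
    and G: "is_weak_gradient v G" and G2: "memLp 2 G" and AG: "AE x in lebesgue. A (G x) = 0"
  shows "AE x in lebesgue. G x = 0"
proof -
  let ?G = "\<lambda>\<alpha> i x. complex_of_real (G x $ \<alpha> $ i)"
  have G2': "memLp 2 (?G \<alpha> i)" for \<alpha> i by (rule memLp_2_entry[OF G2])
  let ?g = "\<lambda>\<alpha> i. I.X (?G \<alpha> i)"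
  have ker: "AE z in lebesgue. (\<Sum>\<beta>\<in>UNIV. \<Sum>j\<in>UNIV. of_real (tensor_component A \<alpha> \<beta> j) * ?g \<beta> j z) = 0" for \<alpha>
  proof -
    let ?c = "\<lambda>(\<beta>, j). complex_of_real (tensor_component A \<alpha> \<beta> j)" and ?h = "\<lambda>(\<beta>, j). ?G \<beta> j"
    let ?s = "\<lambda>x. \<Sum>p\<in>UNIV. ?c p * ?h p x"
    have h: "memLp 2 (?h p)" for p using G2' by (cases p) simp
    note X = I.X_sum[of UNIV ?h ?c, OF finite_class.finite_UNIV h]
    have "AE x in lebesgue. ?s x = 0"
      using AG
    proof eventually_elim
      case (elim x)
      have "?s x = of_real (A (G x) $ \<alpha>)"
        unfolding linear_tensor_component[OF A]
        by (simp add: sum.cartesian_product split_beta UNIV_Times_UNIV[symmetric] del: UNIV_Times_UNIV)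
      then show ?case by (simp add: elim)
    qed
    then have "AE z in lebesgue. I.X ?s z = I.X (\<lambda>_. 0) z" by (intro I.X_cong) (use X in auto)
    moreover have "AE z in lebesgue. I.X ?s z = (\<Sum>p\<in>UNIV. ?c p * I.X (?h p) z)" using X by blast
    ultimately show ?thesis using I.X_0
    proof eventually_elim
      case (elim z)
      have "(\<Sum>\<beta>\<in>UNIV. \<Sum>j\<in>UNIV. of_real (tensor_component A \<alpha> \<beta> j) * ?g \<beta> j z) = (\<Sum>p\<in>UNIV. ?c p * I.X (?h p) z)"
        by (simp add: sum.cartesian_product split_beta UNIV_Times_UNIV[symmetric] del: UNIV_Times_UNIV)
      then show ?case using elim by simp
    qed
  qed
  have "AE z in lebesgue. \<forall>\<alpha>. (\<Sum>\<beta>\<in>UNIV. \<Sum>j\<in>UNIV. of_real (tensor_component A \<alpha> \<beta> j) * ?g \<beta> j z) = 0"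
    unfolding AE_all_countable by (intro allI ker)
  moreover have "AE z in lebesgue. \<forall>\<beta> i j. of_real (z $ j) * ?g \<beta> i z = of_real (z $ i) * ?g \<beta> j z"
    unfolding AE_all_countable by (intro allI weak_gradient_fourier_parallel[OF G G2])
  ultimately have g0: "AE z in lebesgue. \<forall>\<alpha> i. ?g \<alpha> i z = 0"
    using AE_nonzero
  proof eventually_elim
    case (elim z)
    show ?case using parallel_in_kernel_zero[OF A ell \<nu>, of z "\<lambda>\<alpha> i. ?g \<alpha> i z"] elim by blast
  qed
  have "AE x in lebesgue. ?G \<alpha> i x = 0" for \<alpha> i
  proof -
    have "AE z in lebesgue. ?g \<alpha> i z = 0" using g0 by eventually_elim blast
    then have "sq_norm (?G \<alpha> i) = 0" using sq_norm_eq_0_iff[OF I.X_memLp[OF G2']] I.X_norm[OF G2'] by simp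
    then show ?thesis using sq_norm_eq_0_iff[OF G2'] by blast
  qed
  then have "AE x in lebesgue. \<forall>\<alpha> i. ?G \<alpha> i x = 0" unfolding AE_all_countable by blast
  then show ?thesis by eventually_elim (simp add: vec_eq_iff)
qed

subsection \<open>Functions with vanishing weak gradient\<close>

text \<open>The quotient for a negative increment is the one for a positive increment at the shifted point, which
costs an enlargement of the ball by one.\<close>

lemma difference_quotient_bound_both:
  fixes \<phi> :: "real^'n::finite \<Rightarrow> real"
  assumes t: "test_function \<phi>"
  obtains B R where "\<And>x h. h \<noteq> 0 \<Longrightarrow> \<bar>h\<bar> \<le> 1 \<Longrightarrow> \<bar>(\<phi> (x + h *\<^sub>R axis i 1) - \<phi> x) / h\<bar> \<le> B * indicator (cball 0 R) x" "B \<ge> 0"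
proof -
  obtain B R where B: "\<And>x h. 0 < h \<Longrightarrow> h \<le> 1 \<Longrightarrow> \<bar>(\<phi> (x + h *\<^sub>R axis i 1) - \<phi> x) / h\<bar> \<le> B * indicator (cball 0 R) x" "B \<ge> 0"
    using difference_quotient_bound[OF t, of i] by metis
  show ?thesis
  proof (rule that[of B "R + 1"])
    fix x :: "real^'n" and h :: real assume h: "h \<noteq> 0" "\<bar>h\<bar> \<le> 1"
    have mono: "B * indicator (cball 0 R) y \<le> B * indicator (cball 0 (R + 1)) x" if "norm (x - y) \<le> 1" for y
      using B(2) norm_triangle_ineq[of "x - y" y] that by (auto simp: indicator_def)
    show "\<bar>(\<phi> (x + h *\<^sub>R axis i 1) - \<phi> x) / h\<bar> \<le> B * indicator (cball 0 (R + 1)) x"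
    proof (cases "h > 0")
      case True
      then show ?thesis using B(1)[of h x] mono[of x] h by simp
    next
      case False
      let ?y = "x + h *\<^sub>R axis i 1"
      have "(\<phi> (x + h *\<^sub>R axis i 1) - \<phi> x) / h = (\<phi> (?y + (- h) *\<^sub>R axis i 1) - \<phi> ?y) / (- h)"
        using h by (simp add: field_simps)
      then show ?thesis using B(1)[of "- h" ?y] mono[of ?y] False h by simp
    qed
  qed (rule B)
qed

text \<open>The derivative of the pairing with respect to the translation is the pairing with a derivative of a
test function, which is zero.\<close>

lemma integral_translate_constant:
  fixes w \<psi> :: "real^'n::finite \<Rightarrow> real"
  assumes w: "locally_integrable w" and zero: "\<And>\<phi>. test_function \<phi> \<Longrightarrow> (LINT x|lebesgue. w x * partial_deriv i \<phi> x) = 0"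
    and t: "test_function \<psi>"
  shows "(LINT x|lebesgue. w x * \<psi> (x - s *\<^sub>R axis i 1)) = (LINT x|lebesgue. w x * \<psi> x)"
proof -
  define J where "J s = (LINT x|lebesgue. w x * \<psi> (x + s *\<^sub>R axis i 1))" for s
  have ts: "test_function (\<lambda>x. \<psi> (x + s *\<^sub>R axis i 1))" for s
    using test_function_translate[OF t, of "- (s *\<^sub>R axis i 1)"] by simp
  have wm: "w \<in> borel_measurable lebesgue" by (rule locally_integrable_measurable[OF w])
  have "(J has_real_derivative 0) (at s)" for s
  proof -
    let ?\<psi> = "\<lambda>x. \<psi> (x + s *\<^sub>R axis i 1)"
    obtain B R where B: "\<And>x h. h \<noteq> 0 \<Longrightarrow> \<bar>h\<bar> \<le> 1 \<Longrightarrow> \<bar>(?\<psi> (x + h *\<^sub>R axis i 1) - ?\<psi> x) / h\<bar> \<le> B * indicator (cball 0 R) x"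
      using difference_quotient_bound_both[OF ts[of s], of i] by metis
    have "(\<lambda>h. (J (s + h) - J s) / h) \<midarrow>0\<rightarrow> 0"
      unfolding LIMSEQ_SEQ_conv[symmetric]
    proof (intro allI impI)
      fix S :: "nat \<Rightarrow> real" assume S: "(\<forall>n. S n \<noteq> 0) \<and> S \<longlonglongrightarrow> 0"
      let ?q = "\<lambda>n x. (?\<psi> (x + S n *\<^sub>R axis i 1) - ?\<psi> x) / S n"
      have qm: "?q n \<in> borel_measurable lebesgue" for n
      proof -
        have "?\<psi> \<in> borel_measurable borel" "(\<lambda>x. ?\<psi> (x + S n *\<^sub>R axis i 1)) \<in> borel_measurable borel"
          using test_function_borel[OF ts[of s]] test_function_borel[OF ts[of "S n + s"]]
          by (simp_all add: scaleR_add_left add.assoc)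
        then have "?q n \<in> borel_measurable borel" by measurable
        then show ?thesis by (rule measurable_lebesgue_borel)
      qed
      have eq: "(J (s + S n) - J s) / S n = (LINT x|lebesgue. w x * ?q n x)" for n
      proof -
        have "J (s + S n) - J s = (LINT x|lebesgue. w x * \<psi> (x + (s + S n) *\<^sub>R axis i 1) - w x * \<psi> (x + s *\<^sub>R axis i 1))"
          unfolding J_def by (intro Bochner_Integration.integral_diff[symmetric] locally_integrable_mult_test_function w ts)
        then have "(J (s + S n) - J s) / S n = (LINT x|lebesgue. (w x * \<psi> (x + (s + S n) *\<^sub>R axis i 1) - w x * \<psi> (x + s *\<^sub>R axis i 1)) / S n)"
          by simp
        also have "\<dots> = (LINT x|lebesgue. w x * ?q n x)"
          by (intro Bochner_Integration.integral_cong refl) (simp add: scaleR_add_left add_ac right_diff_distrib)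
        finally show ?thesis .
      qed
      have "(\<lambda>n. LINT x|lebesgue. w x * ?q n x) \<longlonglongrightarrow> (LINT x|lebesgue. w x * partial_deriv i ?\<psi> x)"
      proof (rule Lim_transform_eventually)
        obtain N where N: "\<And>n. n \<ge> N \<Longrightarrow> \<bar>S n\<bar> \<le> 1"
          using LIMSEQ_D[of S 0 1] S by (auto intro: less_imp_le)
        have "(\<lambda>n. LINT x|lebesgue. w x * ?q (n + N) x) \<longlonglongrightarrow> (LINT x|lebesgue. w x * partial_deriv i ?\<psi> x)"
        proof (rule integral_dominated_convergence)
          show "integrable lebesgue (\<lambda>x. B * norm (indicator (cball 0 R) x *\<^sub>R w x))"
            by (intro integrable_mult_right integrable_norm locally_integrable_cball w)
          show "(\<lambda>x. w x * partial_deriv i ?\<psi> x) \<in> borel_measurable lebesgue"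
            by (intro borel_measurable_integrable locally_integrable_mult_test_function w test_function_partial_deriv ts)
          show "(\<lambda>x. w x * ?q (n + N) x) \<in> borel_measurable lebesgue" for n
            by (intro borel_measurable_times wm qm)
          show "AE x in lebesgue. (\<lambda>n. w x * ?q (n + N) x) \<longlonglongrightarrow> w x * partial_deriv i ?\<psi> x"
          proof (rule AE_I2)
            fix x
            have "((\<lambda>t. ?\<psi> (x + t *\<^sub>R axis i 1)) has_real_derivative partial_deriv i ?\<psi> (x + 0 *\<^sub>R axis i 1)) (at 0)"
              by (intro partial_deriv_along_axis test_function_differentiable ts)
            then have "(\<lambda>h. (?\<psi> (x + h *\<^sub>R axis i 1) - ?\<psi> x) / h) \<midarrow>0\<rightarrow> partial_deriv i ?\<psi> x"
              by (simp add: DERIV_def)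
            moreover have "filterlim (\<lambda>n. S (n + N)) (at 0) sequentially"
              using S LIMSEQ_ignore_initial_segment[of S 0 N] by (simp add: filterlim_at)
            ultimately have "(\<lambda>n. ?q (n + N) x) \<longlonglongrightarrow> partial_deriv i ?\<psi> x" by (rule filterlim_compose)
            then show "(\<lambda>n. w x * ?q (n + N) x) \<longlonglongrightarrow> w x * partial_deriv i ?\<psi> x" by (rule tendsto_mult_left)
          qed
          show "AE x in lebesgue. norm (w x * ?q (n + N) x) \<le> B * norm (indicator (cball 0 R) x *\<^sub>R w x)" for n
          proof (rule AE_I2)
            fix x
            have "\<bar>?q (n + N) x\<bar> \<le> B * indicator (cball 0 R) x" using B[of "S (n + N)" x] S N[of "n + N"] by simp
            from mult_left_mono[OF this, of "\<bar>w x\<bar>"]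
            show "norm (w x * ?q (n + N) x) \<le> B * norm (indicator (cball 0 R) x *\<^sub>R w x)" by (simp add: abs_mult mult_ac)
          qed
        qed
        then show "(\<lambda>n. LINT x|lebesgue. w x * ?q n x) \<longlonglongrightarrow> (LINT x|lebesgue. w x * partial_deriv i ?\<psi> x)"
          by (rule LIMSEQ_offset)
      qed simp
      then show "(\<lambda>n. (J (s + S n) - J s) / S n) \<longlonglongrightarrow> 0" unfolding eq zero[OF ts] .
    qed
    then show ?thesis by (simp add: DERIV_def)
  qed
  then have "J (- s) = J 0" using DERIV_isconst_all by blast
  then show ?thesis by (simp add: J_def)
qed

text \<open>For each \<open>\<delta> > 0\<close>, \<open>\<bar>w\<bar> \<le> \<delta> + \<delta>\<^bsup>1 - p\<^esup> \<bar>w\<bar>\<^sup>p\<close>. The first term contributes \<open>\<delta>\<close> times the volume of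
the ball, and the second tends to zero as the ball escapes to infinity.\<close>

lemma integral_escaping_ball_tendsto_0:
  fixes w :: "real^'n::finite \<Rightarrow> real"
  assumes w: "memLp p w" and p: "p > 1"
  shows "(\<lambda>k::nat. LINT x|lebesgue. indicator (cball (real k *\<^sub>R axis i 1) R) x * \<bar>w x\<bar>) \<longlonglongrightarrow> 0"
proof -
  let ?B = "\<lambda>k::nat. cball (real k *\<^sub>R axis i 1) R :: (real^'n) set"
  have wm [measurable]: "w \<in> borel_measurable lebesgue" and wi: "integrable lebesgue (\<lambda>x. \<bar>w x\<bar> powr p)"
    using w by (auto simp: memLp_def)
  have Bm: "indicat_real (?B k) \<in> borel_measurable lebesgue" for k
    by (intro measurable_lebesgue_borel borel_measurable_indicator) simp
  note [measurable] = Bm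
  define V where "V = measure lborel (cball (0::real^'n) R)"
  have Bi: "integrable lebesgue (indicat_real (?B k))" for k by (rule integrable_indicator_cball)
  have BV: "(LINT x|lebesgue. indicat_real (?B k) x) = V" for k
    by (cases "R \<ge> 0") (simp_all add: V_def content_cball)
  have 2: "(\<lambda>k. LINT x|lebesgue. indicator (?B k) x * \<bar>w x\<bar> powr p) \<longlonglongrightarrow> (LINT x::(real^'n)|lebesgue. 0)"
  proof (rule integral_dominated_convergence[OF _ _ wi])
    show "AE x in lebesgue. (\<lambda>k. indicator (?B k) x * \<bar>w x\<bar> powr p) \<longlonglongrightarrow> 0"
    proof (rule AE_I2)
      fix x :: "real^'n"
      obtain K :: nat where K: "norm x + R < real K" using reals_Archimedean2 by blast
      have "\<forall>\<^sub>F k in sequentially. indicator (?B k) x * \<bar>w x\<bar> powr p = 0"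
        using eventually_ge_at_top[of K]
      proof eventually_elim
        case (elim k)
        then have "real K \<le> real k" by simp
        moreover have "real k \<le> dist (real k *\<^sub>R axis i 1) x + norm x"
          using norm_triangle_ineq[of "real k *\<^sub>R axis i (1::real) - x" x] by (simp add: dist_norm)
        ultimately show ?case using K by simp
      qed
      then show "(\<lambda>k. indicator (?B k) x * \<bar>w x\<bar> powr p) \<longlonglongrightarrow> 0" by (rule tendsto_eventually)
    qed
    show "AE x in lebesgue. norm (indicator (?B k) x * \<bar>w x\<bar> powr p) \<le> \<bar>w x\<bar> powr p" for k
      by (intro AE_I2) (auto simp: indicator_def)
  qed measurable
  have iBp: "integrable lebesgue (\<lambda>x. indicator (?B k) x * \<bar>w x\<bar> powr p)" for k
    by (rule Bochner_Integration.integrable_bound[OF wi]) (measurable, auto simp: indicator_def)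
  have iB: "integrable lebesgue (\<lambda>x. indicator (?B k) x * \<bar>w x\<bar>)" for k
  proof (rule Bochner_Integration.integrable_bound)
    show "integrable lebesgue (\<lambda>x. indicator (?B k) x + \<bar>w x\<bar> powr p)" by (intro Bochner_Integration.integrable_add Bi wi)
    show "AE x in lebesgue. norm (indicator (?B k) x * \<bar>w x\<bar>) \<le> norm (indicator (?B k) x + \<bar>w x\<bar> powr p)"
      using le_one_plus_powr[of "\<bar>w _\<bar>" p] p by (intro AE_I2) (auto simp: indicator_def)
  qed measurable
  have bound: "(LINT x|lebesgue. indicator (?B k) x * \<bar>w x\<bar>) \<le> \<delta> * V + \<delta> powr (1 - p) * (LINT x|lebesgue. indicator (?B k) x * \<bar>w x\<bar> powr p)"
    if \<delta>: "\<delta> > 0" for k \<delta>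
  proof -
    have "(LINT x|lebesgue. indicator (?B k) x * \<bar>w x\<bar>)
        \<le> (LINT x|lebesgue. \<delta> * indicator (?B k) x + \<delta> powr (1 - p) * (indicator (?B k) x * \<bar>w x\<bar> powr p))"
    proof (intro integral_mono iB Bochner_Integration.integrable_add integrable_mult_right Bi iBp)
      fix x
      have "\<bar>w x\<bar> \<le> \<delta> + \<delta> powr (1 - p) * \<bar>w x\<bar> powr p"
      proof (cases "\<bar>w x\<bar> \<le> \<delta>")
        case False
        then have "\<bar>w x\<bar> = \<bar>w x\<bar> powr (1 - p) * \<bar>w x\<bar> powr p" using \<delta> by (simp add: powr_add[symmetric])
        also have "\<dots> \<le> \<delta> powr (1 - p) * \<bar>w x\<bar> powr p"
          using False \<delta> p by (intro mult_right_mono powr_mono2') auto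
        finally show ?thesis using \<delta> by linarith
      qed (simp add: add_increasing2)
      then show "indicator (?B k) x * \<bar>w x\<bar> \<le> \<delta> * indicator (?B k) x + \<delta> powr (1 - p) * (indicator (?B k) x * \<bar>w x\<bar> powr p)"
        by (simp add: indicator_def)
    qed
    also have "\<dots> = \<delta> * V + \<delta> powr (1 - p) * (LINT x|lebesgue. indicator (?B k) x * \<bar>w x\<bar> powr p)"
      using Bi iBp BV by simp
    finally show ?thesis .
  qed
  show ?thesis
  proof (rule LIMSEQ_I)
    fix e :: real assume e: "e > 0"
    define \<delta> where "\<delta> = e / (2 * (V + 1))"
    have V: "V \<ge> 0" by (simp add: V_def)
    have \<delta>: "\<delta> > 0" using e V by (simp add: \<delta>_def)
    have dV: "\<delta> * V < e / 2"
    proof -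
      have "\<delta> * V < \<delta> * (V + 1)" using \<delta> by simp
      also have "\<dots> = e / 2" using V by (simp add: \<delta>_def field_simps)
      finally show ?thesis .
    qed
    have "(\<lambda>k. \<delta> powr (1 - p) * (LINT x|lebesgue. indicator (?B k) x * \<bar>w x\<bar> powr p)) \<longlonglongrightarrow> \<delta> powr (1 - p) * 0"
      using 2 by (intro tendsto_intros) simp
    then have "\<forall>\<^sub>F k in sequentially. \<delta> powr (1 - p) * (LINT x|lebesgue. indicator (?B k) x * \<bar>w x\<bar> powr p) < e / 2"
      using e by (intro order_tendstoD(2)) auto
    then obtain N where N: "\<And>k. k \<ge> N \<Longrightarrow> \<delta> powr (1 - p) * (LINT x|lebesgue. indicator (?B k) x * \<bar>w x\<bar> powr p) < e / 2"
      unfolding eventually_sequentially by blast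
    have "norm ((LINT x|lebesgue. indicator (?B k) x * \<bar>w x\<bar>) - 0) < e" if "k \<ge> N" for k
    proof -
      have "0 \<le> (LINT x|lebesgue. indicator (?B k) x * \<bar>w x\<bar>)" by simp
      then show ?thesis using bound[OF \<delta>, of k] dV N[OF that] by simp
    qed
    then show "\<exists>N. \<forall>k\<ge>N. norm ((LINT x|lebesgue. indicator (?B k) x * \<bar>w x\<bar>) - 0) < e" by blast
  qed
qed

text \<open>The pairing with a test function equals the pairing with its translates far away, where a function
in \<open>L\<^sup>p\<close> has arbitrarily little mass.\<close>

lemma zero_weak_gradient_imp_zero:
  fixes w :: "real^'n::finite \<Rightarrow> real"
  assumes w: "memLp p w" and p: "p > 1"
    and zero: "\<And>\<phi> i. test_function \<phi> \<Longrightarrow> (LINT x|lebesgue. w x * partial_deriv i \<phi> x) = 0"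
  shows "AE x in lebesgue. w x = 0"
proof (rule fundamental_lemma_locally_integrable)
  show wl: "locally_integrable w" using memLp_locally_integrable[OF w] p by simp
  fix \<psi> :: "real^'n \<Rightarrow> real" assume t: "test_function \<psi>"
  obtain B R where B: "\<And>x. \<bar>\<psi> x\<bar> \<le> B * indicator (cball 0 R) x" "B \<ge> 0" using test_function_bounds[OF t] by metis
  define i :: 'n where "i = undefined"
  let ?B = "\<lambda>k::nat. cball (real k *\<^sub>R axis i 1) R :: (real^'n) set"
  have "\<bar>LINT x|lebesgue. w x * \<psi> x\<bar> \<le> B * (LINT x|lebesgue. indicator (?B k) x * \<bar>w x\<bar>)" for k
  proof -
    have int: "integrable lebesgue (\<lambda>x. w x * \<psi> (x - real k *\<^sub>R axis i 1))"
      by (intro locally_integrable_mult_test_function wl test_function_translate t)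
    have "compact (?B k)" by simp
    then have iB: "integrable lebesgue (\<lambda>x. indicator (?B k) x * \<bar>w x\<bar>)"
      using wl integrable_norm[of lebesgue "\<lambda>x. indicator (?B k) x *\<^sub>R w x"]
      by (simp add: locally_integrable_def set_integrable_def abs_mult)
    have "\<bar>LINT x|lebesgue. w x * \<psi> x\<bar> = \<bar>LINT x|lebesgue. w x * \<psi> (x - real k *\<^sub>R axis i 1)\<bar>"
      by (subst integral_translate_constant[OF wl zero t]) auto
    also have "\<dots> \<le> (LINT x|lebesgue. \<bar>w x * \<psi> (x - real k *\<^sub>R axis i 1)\<bar>)" by (rule integral_abs_bound)
    also have "\<dots> \<le> (LINT x|lebesgue. B * (indicator (?B k) x * \<bar>w x\<bar>))"
    proof (intro integral_mono integrable_abs int integrable_mult_right iB)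
      fix x
      have "indicat_real (cball 0 R) (x - real k *\<^sub>R axis i 1) = indicator (?B k) x"
        by (simp add: indicator_def dist_norm norm_minus_commute)
      then have "\<bar>\<psi> (x - real k *\<^sub>R axis i 1)\<bar> \<le> B * indicator (?B k) x" using B(1)[of "x - real k *\<^sub>R axis i 1"] by simp
      from mult_left_mono[OF this, of "\<bar>w x\<bar>"]
      show "\<bar>w x * \<psi> (x - real k *\<^sub>R axis i 1)\<bar> \<le> B * (indicator (?B k) x * \<bar>w x\<bar>)" by (simp add: abs_mult mult_ac)
    qed
    also have "\<dots> = B * (LINT x|lebesgue. indicator (?B k) x * \<bar>w x\<bar>)" by (rule integral_mult_right_zero)
    finally show ?thesis .
  qed
  moreover have "(\<lambda>k. B * (LINT x|lebesgue. indicator (?B k) x * \<bar>w x\<bar>)) \<longlonglongrightarrow> B * 0"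
    by (intro tendsto_intros integral_escaping_ball_tendsto_0[OF w p])
  ultimately have "\<bar>LINT x|lebesgue. w x * \<psi> x\<bar> \<le> B * 0"
    by (intro LIMSEQ_le_const) auto
  then show "(LINT x|lebesgue. w x * \<psi> x) = 0" by simp
qed

lemma homogeneous_zero:
  fixes A :: "real^'n::finite^'N::finite \<Rightarrow> real^'N"
  assumes A: "linear A" and ell: "\<And>\<eta> a. norm (A (tensor \<eta> a)) \<ge> \<nu> * norm \<eta> * norm a" and \<nu>: "\<nu> > 0"
    and v: "memLp p v" and p: "p > 1"
    and G: "is_weak_gradient v G" and G2: "memLp 2 G" and AG: "AE x in lebesgue. A (G x) = 0"
  shows "AE x in lebesgue. v x = 0"
proof -
  have G0: "AE x in lebesgue. G x = 0" by (rule weak_gradient_in_kernel_zero[OF A ell \<nu> G G2 AG])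
  have "AE x in lebesgue. v x $ \<alpha> = 0" for \<alpha>
  proof (rule zero_weak_gradient_imp_zero[OF _ p])
    have m: "v \<in> borel_measurable lebesgue" and i: "integrable lebesgue (\<lambda>x. norm (v x) powr p)"
      using v by (auto simp: memLp_def)
    have m': "(\<lambda>x. v x $ \<alpha>) \<in> borel_measurable lebesgue"
      by (intro locally_integrable_measurable is_weak_gradientD(3)[OF G])
    have "integrable lebesgue (\<lambda>x. norm (v x $ \<alpha>) powr p)"
    proof (rule Bochner_Integration.integrable_bound[OF i])
      show "AE x in lebesgue. norm (norm (v x $ \<alpha>) powr p) \<le> norm (norm (v x) powr p)"
        using p component_le_norm_cart by (intro AE_I2) (auto intro!: powr_mono2)
    qed (use m' in measurable)
    then show "memLp p (\<lambda>x. v x $ \<alpha>)" using m' by (simp add: memLp_def)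
    fix \<phi> :: "real^'n \<Rightarrow> real" and i assume t: "test_function \<phi>"
    have "(LINT x|lebesgue. G x $ \<alpha> $ i * \<phi> x) = (LINT x::(real^'n)|lebesgue. 0)"
    proof (rule integral_cong_AE)
      show "AE x in lebesgue. G x $ \<alpha> $ i * \<phi> x = 0" using G0 by eventually_elim simp
    qed (use borel_measurable_integrable[OF locally_integrable_mult_test_function[OF is_weak_gradientD(4)[OF G] t]] in auto)
    then show "(LINT x|lebesgue. v x $ \<alpha> * partial_deriv i \<phi> x) = 0"
      using is_weak_gradientD(5)[OF G t] by simp
  qed
  then have "AE x in lebesgue. \<forall>\<alpha>. v x $ \<alpha> = 0" unfolding AE_all_countable by blast
  then show ?thesis by eventually_elim (simp add: vec_eq_iff)
qed

section \<open>The symbol and its inverse\<close>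

lemma symbol_mult_vec:
  fixes A :: "real^'n::finite^'N::finite \<Rightarrow> real^'N"
  assumes "linear A"
  shows "symbol A a *v \<eta> = A (tensor \<eta> a)"
  unfolding vec_eq_iff linear_tensor_component[OF assms]
  by (simp add: symbol_def matrix_vector_mult_def tensor_def sum_distrib_left sum_distrib_right mult_ac)

lemma det_measurable:
  fixes X :: "'a \<Rightarrow> real^'k::finite^'k"
  assumes "\<And>i j. (\<lambda>z. X z $ i $ j) \<in> borel_measurable M"
  shows "(\<lambda>z. det (X z)) \<in> borel_measurable M"
  unfolding det_def by (intro borel_measurable_sum borel_measurable_times borel_measurable_prod borel_measurable_const assms)

lemma multiplier_measurable:
  fixes A :: "real^'n::finite^'N::finite \<Rightarrow> real^'N"
  shows "(\<lambda>z. multiplier A z $ \<beta> $ \<gamma>) \<in> borel_measurable borel"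
proof -
  have s: "(\<lambda>z. symbol A (sgn z) $ i $ j) \<in> borel_measurable borel" for i j
    unfolding symbol_def sgn_div_norm by simp
  have c: "(\<lambda>z. (\<chi> r. if r = i then axis j 1 else symbol A (sgn z) $ r) $ k $ l) \<in> borel_measurable borel" for i j k l
    using s by (cases "k = i") simp_all
  have "multiplier A z $ \<beta> $ \<gamma> = 1 / det (symbol A (sgn z)) * det (\<chi> r. if r = \<gamma> then axis \<beta> 1 else symbol A (sgn z) $ r)" for z
    by (simp add: multiplier_def transpose_def cof_def)
  then show ?thesis
    by (simp only:) (intro borel_measurable_times borel_measurable_divide borel_measurable_const det_measurable s c)
qed

context
  fixes A :: "real^'n::finite^'N::finite \<Rightarrow> real^'N" and \<nu> :: real
  assumes A: "linear A" and ell: "\<And>\<eta> a. norm (A (tensor \<eta> a)) \<ge> \<nu> * norm \<eta> * norm a" and \<nu>: "\<nu> > 0"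
begin

lemma symbol_sgn_lower_bound: "z \<noteq> 0 \<Longrightarrow> norm (symbol A (sgn z) *v \<eta>) \<ge> \<nu> * norm \<eta>"
  using ell[of \<eta> "sgn z"] by (simp add: symbol_mult_vec[OF A] norm_sgn)

lemma symbol_sgn_det_nonzero:
  assumes "z \<noteq> 0" shows "det (symbol A (sgn z)) \<noteq> 0"
proof -
  have "\<eta> = 0" if "symbol A (sgn z) *v \<eta> = 0" for \<eta>
    using symbol_sgn_lower_bound[OF assms, of \<eta>] \<nu> that by (simp add: mult_le_0_iff)
  then have "invertible (symbol A (sgn z))"
    unfolding invertible_left_inverse matrix_left_invertible_ker by blast
  then show ?thesis by (simp add: invertible_det_nz)
qed

lemma symbol_mult_multiplier:
  assumes "z \<noteq> 0"
  shows "(\<Sum>\<beta>\<in>UNIV. symbol A (sgn z) $ \<alpha> $ \<beta> * multiplier A z $ \<beta> $ \<gamma>) = (if \<alpha> = \<gamma> then 1 else 0)"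
proof -
  let ?X = "symbol A (sgn z)"
  have "(\<Sum>\<beta>\<in>UNIV. ?X $ \<alpha> $ \<beta> * multiplier A z $ \<beta> $ \<gamma>) = (1 / det ?X) * (\<Sum>\<beta>\<in>UNIV. ?X $ \<alpha> $ \<beta> * transpose (cof ?X) $ \<beta> $ \<gamma>)"
    by (simp add: multiplier_def sum_distrib_left mult_ac)
  also have "(\<Sum>\<beta>\<in>UNIV. ?X $ \<alpha> $ \<beta> * transpose (cof ?X) $ \<beta> $ \<gamma>) = (?X ** transpose (cof ?X)) $ \<alpha> $ \<gamma>"
    by (simp add: matrix_matrix_mult_def)
  also have "\<dots> = det ?X * (if \<alpha> = \<gamma> then 1 else 0)"
    by (simp add: matrix_mult_transpose_cof mat_def)
  finally show ?thesis using symbol_sgn_det_nonzero[OF assms] by simp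
qed

text \<open>A column of the multiplier is mapped by the symbol to a unit vector.\<close>

lemma multiplier_bounded:
  assumes "z \<noteq> 0" shows "\<bar>multiplier A z $ \<beta> $ \<gamma>\<bar> \<le> 1 / \<nu>"
proof -
  let ?c = "\<chi> \<beta>. multiplier A z $ \<beta> $ \<gamma>"
  have "symbol A (sgn z) *v ?c = axis \<gamma> 1"
    unfolding vec_eq_iff by (simp add: matrix_vector_mult_def symbol_mult_multiplier[OF assms] axis_def)
  then have "\<nu> * norm ?c \<le> 1" using symbol_sgn_lower_bound[OF assms, of ?c] by simp
  then have "norm ?c \<le> 1 / \<nu>" using \<nu> by (simp add: field_simps)
  moreover have "\<bar>?c $ \<beta>\<bar> \<le> norm ?c" by (rule component_le_norm_cart)
  ultimately show ?thesis by simp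
qed

end

section \<open>Generalities on \<open>L\<^sup>p\<close>\<close>

lemma measurable_vec:
  fixes f :: "'a \<Rightarrow> 'b::euclidean_space^'m::finite"
  assumes "\<And>i. (\<lambda>x. f x $ i) \<in> borel_measurable M"
  shows "f \<in> borel_measurable M"
  unfolding borel_measurable_euclidean_space[of f]
proof
  fix b :: "'b^'m" assume "b \<in> Basis"
  then obtain i c where b: "b = axis i c" by (auto simp: Basis_vec_def)
  have "(\<lambda>x. f x $ i \<bullet> c) \<in> borel_measurable M" by (intro borel_measurable_inner assms borel_measurable_const)
  then show "(\<lambda>x. f x \<bullet> b) \<in> borel_measurable M" by (simp add: b inner_axis)
qed

lemma norm_vec_powr_le:
  fixes v :: "'b::euclidean_space^'m::finite"
  assumes p: "p > 0"
  shows "norm v powr p \<le> real CARD('m) powr p * (\<Sum>i\<in>UNIV. norm (v $ i) powr p)"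
proof -
  let ?M = "Max (range (\<lambda>i. norm (v $ i)))"
  have "?M \<in> range (\<lambda>i. norm (v $ i))" by (intro Max_in) auto
  then obtain j where j: "?M = norm (v $ j)" by blast
  have "norm v \<le> (\<Sum>i\<in>UNIV. norm (v $ i))" unfolding norm_vec_def by (rule L2_set_le_sum) simp
  also have "\<dots> \<le> (\<Sum>i::'m\<in>UNIV. norm (v $ j))"
    unfolding j[symmetric] by (intro sum_mono Max_ge) auto
  also have "\<dots> = real CARD('m) * norm (v $ j)" by simp
  finally have "norm v powr p \<le> (real CARD('m) * norm (v $ j)) powr p" using p by (intro powr_mono2) auto
  also have "\<dots> = real CARD('m) powr p * norm (v $ j) powr p" by (simp add: powr_mult)
  also have "\<dots> \<le> real CARD('m) powr p * (\<Sum>i\<in>UNIV. norm (v $ i) powr p)"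
    by (intro mult_left_mono member_le_sum[of j UNIV "\<lambda>i. norm (v $ i) powr p"]) auto
  finally show ?thesis .
qed

lemma memLp_vec:
  fixes f :: "'a::euclidean_space \<Rightarrow> 'b::euclidean_space^'m::finite"
  assumes p: "p > 0" and f: "\<And>i. memLp p (\<lambda>x. f x $ i)"
  shows "memLp p f"
    "(LINT x|lebesgue. norm (f x) powr p) \<le> real CARD('m) powr p * (\<Sum>i\<in>UNIV. LINT x|lebesgue. norm (f x $ i) powr p)"
proof -
  have m: "f \<in> borel_measurable lebesgue" using f by (intro measurable_vec) (simp add: memLp_def)
  have int: "integrable lebesgue (\<lambda>x. real CARD('m) powr p * (\<Sum>i\<in>UNIV. norm (f x $ i) powr p))"
    using f by (intro integrable_mult_right Bochner_Integration.integrable_sum) (simp add: memLp_def)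
  have i: "integrable lebesgue (\<lambda>x. norm (f x) powr p)"
  proof (rule Bochner_Integration.integrable_bound[OF int])
    show "(\<lambda>x. norm (f x) powr p) \<in> borel_measurable lebesgue" using m by measurable
    show "AE x in lebesgue. norm (norm (f x) powr p) \<le> norm (real CARD('m) powr p * (\<Sum>i\<in>UNIV. norm (f x $ i) powr p))"
    proof (rule AE_I2)
      fix x
      have "norm (f x) powr p \<le> real CARD('m) powr p * (\<Sum>i\<in>UNIV. norm (f x $ i) powr p)" by (rule norm_vec_powr_le[OF p])
      also have "\<dots> \<le> \<bar>\<dots>\<bar>" by (rule abs_ge_self)
      finally show "norm (norm (f x) powr p) \<le> norm (real CARD('m) powr p * (\<Sum>i\<in>UNIV. norm (f x $ i) powr p))"
        by (simp only: real_norm_def abs_of_nonneg powr_ge_zero)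
    qed
  qed
  then show "memLp p f" using m by (simp add: memLp_def)
  have "(LINT x|lebesgue. norm (f x) powr p) \<le> (LINT x|lebesgue. real CARD('m) powr p * (\<Sum>i\<in>UNIV. norm (f x $ i) powr p))"
    by (intro integral_mono i int norm_vec_powr_le p)
  also have "\<dots> = real CARD('m) powr p * (LINT x|lebesgue. (\<Sum>i\<in>UNIV. norm (f x $ i) powr p))"
    by (rule integral_mult_right_zero)
  also have "(LINT x|lebesgue. (\<Sum>i\<in>UNIV. norm (f x $ i) powr p)) = (\<Sum>i\<in>UNIV. LINT x|lebesgue. norm (f x $ i) powr p)"
    using f by (intro Bochner_Integration.integral_sum) (simp add: memLp_def)
  finally show "(LINT x|lebesgue. norm (f x) powr p) \<le> real CARD('m) powr p * (\<Sum>i\<in>UNIV. LINT x|lebesgue. norm (f x $ i) powr p)" .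
qed

lemma memLp_bound:
  fixes f :: "'a::euclidean_space \<Rightarrow> 'b::euclidean_space" and g :: "'a \<Rightarrow> 'c::euclidean_space"
  assumes p: "p > 0" and g: "memLp p g" and m: "f \<in> borel_measurable lebesgue" and le: "AE x in lebesgue. norm (f x) \<le> norm (g x)"
  shows "memLp p f" "(LINT x|lebesgue. norm (f x) powr p) \<le> (LINT x|lebesgue. norm (g x) powr p)"
proof -
  have le': "AE x in lebesgue. norm (f x) powr p \<le> norm (g x) powr p"
    using le by eventually_elim (use p in \<open>auto intro: powr_mono2\<close>)
  have gi: "integrable lebesgue (\<lambda>x. norm (g x) powr p)" using g by (simp add: memLp_def)
  have fi: "integrable lebesgue (\<lambda>x. norm (f x) powr p)"
  proof (rule Bochner_Integration.integrable_bound[OF gi])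
    show "(\<lambda>x. norm (f x) powr p) \<in> borel_measurable lebesgue" using m by measurable
    show "AE x in lebesgue. norm (norm (f x) powr p) \<le> norm (norm (g x) powr p)"
      using le' by eventually_elim simp
  qed
  then show "memLp p f" using m by (simp add: memLp_def)
  show "(LINT x|lebesgue. norm (f x) powr p) \<le> (LINT x|lebesgue. norm (g x) powr p)"
    by (rule integral_mono_AE[OF fi gi le'])
qed

lemma memLp_diff:
  fixes f g :: "'a::euclidean_space \<Rightarrow> 'b::euclidean_space"
  assumes p: "p > 0" and f: "memLp p f" and g: "memLp p g"
  shows "memLp p (\<lambda>x. f x - g x)"
proof -
  have [measurable]: "f \<in> borel_measurable lebesgue" "g \<in> borel_measurable lebesgue"
    using f g by (auto simp: memLp_def)
  have int: "integrable lebesgue (\<lambda>x. 2 powr p * (norm (f x) powr p + norm (g x) powr p))"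
    using f g by (intro integrable_mult_right Bochner_Integration.integrable_add) (auto simp: memLp_def)
  have "integrable lebesgue (\<lambda>x. norm (f x - g x) powr p)"
  proof (rule Bochner_Integration.integrable_bound[OF int])
    show "AE x in lebesgue. norm (norm (f x - g x) powr p) \<le> norm (2 powr p * (norm (f x) powr p + norm (g x) powr p))"
    proof (rule AE_I2)
      fix x
      let ?M = "max (norm (f x)) (norm (g x))"
      have "norm (f x - g x) \<le> 2 * ?M" using norm_triangle_ineq4[of "f x" "g x"] by linarith
      then have "norm (f x - g x) powr p \<le> (2 * ?M) powr p" using p by (intro powr_mono2) auto
      also have "\<dots> = 2 powr p * ?M powr p" by (simp add: powr_mult max_def)
      also have "\<dots> \<le> 2 powr p * (norm (f x) powr p + norm (g x) powr p)"
        by (intro mult_left_mono) (auto simp: max_def)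
      finally show "norm (norm (f x - g x) powr p) \<le> norm (2 powr p * (norm (f x) powr p + norm (g x) powr p))" by simp
    qed
  qed measurable
  then show ?thesis by (simp add: memLp_def)
qed

lemma memLp_2_sum:
  fixes h :: "'i \<Rightarrow> 'a::euclidean_space \<Rightarrow> 'b::euclidean_space"
  assumes "finite I" "\<And>i. i \<in> I \<Longrightarrow> memLp 2 (h i)" "\<And>i. i \<in> I \<Longrightarrow> sq_norm (h i) \<le> S" "S \<ge> 0"
  shows "memLp 2 (\<lambda>x. \<Sum>i\<in>I. h i x) \<and> sq_norm (\<lambda>x. \<Sum>i\<in>I. h i x) \<le> 4 ^ card I * S"
  using assms
proof (induction I rule: finite_induct)
  case empty
  then show ?case by (simp add: memLp_2_iff sq_norm_def)
next
  case (insert i I)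
  then have IH: "memLp 2 (\<lambda>x. \<Sum>i\<in>I. h i x)" "sq_norm (\<lambda>x. \<Sum>i\<in>I. h i x) \<le> 4 ^ card I * S"
    and i: "memLp 2 (h i)" "sq_norm (h i) \<le> S" by auto
  have "1 * S \<le> 4 ^ card I * S" using insert.prems by (intro mult_right_mono) auto
  then have "2 * sq_norm (h i) + 2 * sq_norm (\<lambda>x. \<Sum>i\<in>I. h i x) \<le> 4 ^ card (insert i I) * S"
    using IH i insert.hyps by simp
  then show ?case
    using insert.hyps memLp_2_add(1)[OF i(1) IH(1)] sq_norm_add_le[OF i(1) IH(1)] by simp
qed

text \<open>Young's inequality for \<open>(t a)(b / t)\<close>: first \<open>t\<close> is chosen large to make the contribution of the test
function small, then \<open>m\<close>.\<close>

lemma strong_Lp_imp_weak: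
  fixes v :: "nat \<Rightarrow> 'a::euclidean_space \<Rightarrow> 'b::euclidean_space"
  assumes p: "p > 1" and v: "\<And>m. memLp p (v m)" and u: "memLp p u"
    and lim: "(\<lambda>m. LINT x|lebesgue. norm (v m x - u x) powr p) \<longlonglongrightarrow> 0"
  shows "weak_Lp_tendsto p v u"
  unfolding weak_Lp_tendsto_def
proof (intro conjI allI impI v u)
  define q where "q = p / (p - 1)"
  have q: "q > 1" "1 / p + 1 / q = 1" using p by (auto simp: q_def field_simps)
  fix \<phi> :: "'a \<Rightarrow> 'b" assume "memLp (p / (p - 1)) \<phi>"
  then have \<phi>: "memLp q \<phi>" by (simp add: q_def)
  have [measurable]: "\<phi> \<in> borel_measurable lebesgue" "v m \<in> borel_measurable lebesgue" "u \<in> borel_measurable lebesgue" for m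
    using \<phi> v u by (auto simp: memLp_def)
  have young: "norm (a \<bullet> b) \<le> t powr p * norm a powr p + t powr (- q) * norm b powr q" if "t > 0" for a b :: 'b and t
  proof -
    have "norm (a \<bullet> b) \<le> (t * norm a) * (norm b / t)" using that Cauchy_Schwarz_ineq2[of a b] by simp
    also have "\<dots> \<le> (t * norm a) powr p / p + (norm b / t) powr q / q"
      using that by (intro Youngs_inequality p q) auto
    also have "\<dots> \<le> (t * norm a) powr p / 1 + (norm b / t) powr q / 1"
      using p q by (intro add_mono divide_left_mono) auto
    also have "\<dots> = t powr p * norm a powr p + t powr (- q) * norm b powr q"
      using that by (simp add: powr_mult powr_divide powr_minus_divide)
    finally show ?thesis .
  qed
  have \<phi>i: "integrable lebesgue (\<lambda>x. norm (\<phi> x) powr q)" using \<phi> by (simp add: memLp_def)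
  have bnd: "integrable lebesgue (\<lambda>x. a x \<bullet> \<phi> x) \<and> norm (LINT x|lebesgue. a x \<bullet> \<phi> x) \<le>
      t powr p * (LINT x|lebesgue. norm (a x) powr p) + t powr (- q) * (LINT x|lebesgue. norm (\<phi> x) powr q)"
    if a: "memLp p a" and t: "t > 0" for a t
  proof -
    have am [measurable]: "a \<in> borel_measurable lebesgue" and ai: "integrable lebesgue (\<lambda>x. norm (a x) powr p)"
      using a by (auto simp: memLp_def)
    let ?w = "\<lambda>x. t powr p * norm (a x) powr p + t powr (- q) * norm (\<phi> x) powr q"
    have wi: "integrable lebesgue ?w" by (intro Bochner_Integration.integrable_add integrable_mult_right ai \<phi>i)
    have i: "integrable lebesgue (\<lambda>x. a x \<bullet> \<phi> x)"
    proof (rule Bochner_Integration.integrable_bound[OF wi])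
      show "AE x in lebesgue. norm (a x \<bullet> \<phi> x) \<le> norm (?w x)"
        using order_trans[OF young[OF t] abs_ge_self] by (intro AE_I2) simp
    qed measurable
    have "norm (LINT x|lebesgue. a x \<bullet> \<phi> x) \<le> (LINT x|lebesgue. norm (a x \<bullet> \<phi> x))" by (rule integral_norm_bound)
    also have "\<dots> \<le> (LINT x|lebesgue. ?w x)" by (intro integral_mono integrable_norm i wi young t)
    also have "\<dots> = t powr p * (LINT x|lebesgue. norm (a x) powr p) + t powr (- q) * (LINT x|lebesgue. norm (\<phi> x) powr q)"
      using ai \<phi>i by simp
    finally show ?thesis using i by blast
  qed
  have d: "memLp p (\<lambda>x. v m x - u x)" for m using p by (intro memLp_diff v u) simp
  have eq: "(LINT x|lebesgue. v m x \<bullet> \<phi> x) - (LINT x|lebesgue. u x \<bullet> \<phi> x) = (LINT x|lebesgue. (v m x - u x) \<bullet> \<phi> x)" for m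
    using bnd[OF v[of m] zero_less_one] bnd[OF u zero_less_one] by (simp add: inner_diff_left)
  let ?Q = "LINT x|lebesgue. norm (\<phi> x) powr q"
  show "(\<lambda>m. LINT x|lebesgue. v m x \<bullet> \<phi> x) \<longlonglongrightarrow> (LINT x|lebesgue. u x \<bullet> \<phi> x)"
  proof (rule LIMSEQ_I)
    fix e :: real assume e: "e > 0"
    have Q: "?Q \<ge> 0" by simp
    \<comment> \<open>so that \<open>t\<^bsup>-q\<^esup> Q < e/2\<close>\<close>
    define t where "t = ((?Q + 1) * 2 / e) powr (1 / q)"
    have base: "0 < (?Q + 1) * 2 / e"
      by (intro divide_pos_pos mult_pos_pos add_nonneg_pos Q e zero_less_one zero_less_numeral)
    then have t: "t > 0" unfolding t_def powr_gt_zero by (rule less_imp_neq[symmetric])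
    have tQ: "t powr (- q) * ?Q < e / 2"
    proof -
      have gen: "(b powr (1 / q)) powr q = b" if "b > 0" for b using that q by (simp add: powr_powr)
      have "t powr q = (?Q + 1) * 2 / e" unfolding t_def by (rule gen[OF base])
      then have "t powr (- q) = e / (2 * (?Q + 1))" by (simp add: powr_minus_divide mult.commute)
      then have "t powr (- q) * ?Q = (e / 2) * (?Q / (?Q + 1))"
        by (simp only: times_divide_times_eq times_divide_eq_left times_divide_eq_right divide_divide_eq_left mult.commute)
      also have "\<dots> < (e / 2) * 1"
      proof (rule mult_strict_left_mono)
        have "b / (b + 1) < 1" if "b \<ge> 0" for b :: real using that by simp
        from this[OF Q] show "?Q / (?Q + 1) < 1" .
      qed (use e in simp)
      finally show ?thesis by simp
    qed
    have "(\<lambda>m. t powr p * (LINT x|lebesgue. norm (v m x - u x) powr p)) \<longlonglongrightarrow> t powr p * 0"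
      by (intro tendsto_intros lim)
    then have "\<forall>\<^sub>F m in sequentially. t powr p * (LINT x|lebesgue. norm (v m x - u x) powr p) < e / 2"
      using e by (intro order_tendstoD(2)) auto
    then obtain M where M: "\<And>m. m \<ge> M \<Longrightarrow> t powr p * (LINT x|lebesgue. norm (v m x - u x) powr p) < e / 2"
      unfolding eventually_sequentially by blast
    have "norm ((LINT x|lebesgue. v m x \<bullet> \<phi> x) - (LINT x|lebesgue. u x \<bullet> \<phi> x)) < e" if "m \<ge> M" for m
    proof -
      have "norm (LINT x|lebesgue. (v m x - u x) \<bullet> \<phi> x)
          \<le> t powr p * (LINT x|lebesgue. norm (v m x - u x) powr p) + t powr (- q) * ?Q"
        using bnd[OF d[of m] t] by (rule conjunct2)
      also have "\<dots> < e / 2 + e / 2" by (intro add_strict_mono M that tQ)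
      finally show ?thesis unfolding eq by simp
    qed
    then show "\<exists>M. \<forall>m\<ge>M. norm ((LINT x|lebesgue. v m x \<bullet> \<phi> x) - (LINT x|lebesgue. u x \<bullet> \<phi> x)) < e" by blast
  qed
qed

lemma strong_Lp_imp_AE_subseq:
  fixes v :: "nat \<Rightarrow> 'a::euclidean_space \<Rightarrow> 'b::euclidean_space"
  assumes p: "p > 0" and v: "\<And>m. memLp p (v m)" and u: "memLp p u"
    and lim: "(\<lambda>m. LINT x|lebesgue. norm (v m x - u x) powr p) \<longlonglongrightarrow> 0"
  shows "AE_tendsto_subseq v u"
  unfolding AE_tendsto_subseq_def
proof (intro allI impI)
  fix s :: "nat \<Rightarrow> nat" assume s: "strict_mono s"
  have i: "integrable lebesgue (\<lambda>x. norm (v (s m) x - u x) powr p)" for m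
    using memLp_diff[OF p v u] by (simp add: memLp_def)
  have "(\<lambda>m. LINT x|lebesgue. norm (norm (v (s m) x - u x) powr p)) \<longlonglongrightarrow> 0"
    using LIMSEQ_subseq_LIMSEQ[OF lim s] by (simp add: o_def)
  from tendsto_L1_AE_subseq[OF i this]
  obtain r where r: "strict_mono r" "AE x in lebesgue. (\<lambda>m. norm (v (s (r m)) x - u x) powr p) \<longlonglongrightarrow> 0" by blast
  have "AE x in lebesgue. (\<lambda>m. v (s (r m)) x) \<longlonglongrightarrow> u x"
    using r(2)
  proof eventually_elim
    case (elim x)
    have "(\<lambda>m. (norm (v (s (r m)) x - u x) powr p) powr (1 / p)) \<longlonglongrightarrow> 0 powr (1 / p)"
      using p by (intro tendsto_powr'[OF elim tendsto_const]) auto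
    then have "(\<lambda>m. norm (v (s (r m)) x - u x)) \<longlonglongrightarrow> 0" using p by (simp add: powr_powr)
    then show ?case by (simp add: tendsto_norm_zero_iff LIM_zero_iff)
  qed
  then show "\<exists>r. strict_mono r \<and> (AE x in lebesgue. (\<lambda>m. v (s (r m)) x) \<longlonglongrightarrow> u x)" using r(1) by blast
qed

section \<open>Schwartz functions\<close>

lemma schwartz_borel:
  assumes "schwartz h" shows "h \<in> borel_measurable borel"
proof -
  have "partial_derivs [] h differentiable (at x)" for x using assms unfolding schwartz_def smooth_def by blast
  then have "h differentiable_on UNIV"
    by (simp add: partial_derivs_def differentiable_on_def)
  then show ?thesis by (intro borel_measurable_continuous_onI differentiable_imp_continuous_on)
qed

lemma schwartz_bounded:
  assumes "schwartz h"
  obtains B where "\<And>x. norm x ^ k * \<bar>h x\<bar> \<le> B"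
proof -
  have "bounded (range (\<lambda>x. norm x ^ k * partial_derivs [] h x))"
    using assms unfolding schwartz_def by blast
  then obtain B where "\<And>x. norm (norm x ^ k * h x) \<le> B"
    unfolding bounded_iff by (auto simp: partial_derivs_def)
  then show ?thesis by (intro that[of B]) (simp add: abs_mult)
qed

lemma integrable_prod_inverse_square:
  "integrable lborel (\<lambda>x::real^'n::finite. \<Prod>i\<in>UNIV. inverse (1 + (x $ i)\<^sup>2))"
proof -
  have "integrable lborel (\<lambda>t::real. inverse (1 + t\<^sup>2))"
    using integrable_inverse_1_plus_square by (simp add: set_integrable_def)
  then have "integrable lborel (\<lambda>t. complex_of_real (inverse (1 + t\<^sup>2)))" by (rule integrable_of_real)
  from product_integral_cart(1)[OF this]
  have "integrable lborel (\<lambda>x::real^'n. complex_of_real (\<Prod>i\<in>UNIV. inverse (1 + (x $ i)\<^sup>2)))" by simp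
  then show ?thesis by (simp only: complex_of_real_integrable_eq)
qed

text \<open>Rapid decay bounds \<open>h\<close> by a multiple of the product of the functions \<open>1 / (1 + x\<^sub>i\<^sup>2)\<close>, each integrable
on the line.\<close>

lemma schwartz_L1_L2:
  fixes h :: "real^'n::finite \<Rightarrow> real"
  assumes h: "schwartz h"
  shows "L1_L2 (\<lambda>x. complex_of_real (h x))" "\<exists>B. \<forall>x. \<bar>h x\<bar> \<le> B"
proof -
  let ?n = "CARD('n)"
  have m [measurable]: "h \<in> borel_measurable borel" by (rule schwartz_borel[OF h])
  obtain B0 where B0: "\<And>x. norm x ^ 0 * \<bar>h x\<bar> \<le> B0" using schwartz_bounded[OF h] by blast
  then have B0: "\<bar>h x\<bar> \<le> B0" for x by simp
  obtain B1 where B1: "\<And>x. norm x ^ (2 * ?n) * \<bar>h x\<bar> \<le> B1" using schwartz_bounded[OF h] by blast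
  show "\<exists>B. \<forall>x. \<bar>h x\<bar> \<le> B" using B0 by blast
  let ?P = "\<lambda>x::real^'n. \<Prod>i\<in>UNIV. inverse (1 + (x $ i)\<^sup>2)"
  let ?C = "2 ^ ?n * (B0 + B1)"
  have le: "\<bar>h x\<bar> \<le> ?C * ?P x" for x
  proof -
    let ?M = "max 1 (norm x)"
    have "(\<Prod>i\<in>UNIV. 1 + (x $ i)\<^sup>2) \<le> (\<Prod>i::'n\<in>UNIV. 2 * ?M\<^sup>2)"
    proof (intro prod_mono conjI)
      fix i
      have "\<bar>x $ i\<bar> \<le> ?M" using component_le_norm_cart[of x i] by linarith
      then have "(x $ i)\<^sup>2 \<le> ?M\<^sup>2" by (metis abs_ge_zero power2_abs power_mono)
      moreover have "1 \<le> ?M\<^sup>2" by (intro one_le_power) simp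
      ultimately show "1 + (x $ i)\<^sup>2 \<le> 2 * ?M\<^sup>2" by linarith
    qed simp
    also have "\<dots> = 2 ^ ?n * ?M ^ (2 * ?n)" by (simp add: power_mult_distrib power_mult)
    finally have "(\<Prod>i\<in>UNIV. 1 + (x $ i)\<^sup>2) * \<bar>h x\<bar> \<le> 2 ^ ?n * ?M ^ (2 * ?n) * \<bar>h x\<bar>"
      by (intro mult_right_mono) auto
    also have "\<dots> \<le> ?C"
    proof -
      have n0: "0 \<le> B0" using B0[of x] by linarith
      have n1: "0 \<le> B1" using order_trans[OF _ B1[of x]] by simp
      have "?M ^ (2 * ?n) * \<bar>h x\<bar> \<le> B0 + B1"
        using B0[of x] B1[of x] n0 n1 by (cases "norm x \<le> 1") (auto simp: max_def)
      then show ?thesis by (simp add: mult.assoc)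
    qed
    finally have *: "(\<Prod>i\<in>UNIV. 1 + (x $ i)\<^sup>2) * \<bar>h x\<bar> \<le> ?C" .
    have pos: "(\<Prod>i\<in>UNIV. 1 + (x $ i)\<^sup>2) > 0" by (intro prod_pos) (auto intro: add_pos_nonneg)
    have "?P x = 1 / (\<Prod>i\<in>UNIV. 1 + (x $ i)\<^sup>2)" by (simp add: prod_inversef[symmetric] inverse_eq_divide o_def prod_dividef)
    then show ?thesis using * pos by (simp add: field_simps)
  qed
  have i: "integrable lebesgue h"
  proof (rule integrable_lebesgueI[OF m], rule Bochner_Integration.integrable_bound)
    show "integrable lborel (\<lambda>x. ?C * ?P x)" by (intro integrable_mult_right integrable_prod_inverse_square)
    show "AE x in lborel. norm (h x) \<le> norm (?C * ?P x)"
      using order_trans[OF le abs_ge_self] by (intro AE_I2) simp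
  qed simp
  have "integrable lebesgue (\<lambda>x. (h x)\<^sup>2)"
  proof (rule Bochner_Integration.integrable_bound)
    show "integrable lebesgue (\<lambda>x. B0 * h x)" using i by simp
    show "(\<lambda>x. (h x)\<^sup>2) \<in> borel_measurable lebesgue" by (rule measurable_lebesgue_borel) measurable
    show "AE x in lebesgue. norm ((h x)\<^sup>2) \<le> norm (B0 * h x)"
    proof (rule AE_I2)
      fix x
      have "norm ((h x)\<^sup>2) = \<bar>h x\<bar> * \<bar>h x\<bar>" by (simp add: power2_eq_square)
      also have "\<dots> \<le> \<bar>B0\<bar> * \<bar>h x\<bar>" using B0[of x] by (intro mult_right_mono) auto
      finally show "norm ((h x)\<^sup>2) \<le> norm (B0 * h x)" by (simp add: abs_mult)
    qed
  qed
  then show "L1_L2 (\<lambda>x. complex_of_real (h x))"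
    using i by (simp add: L1_L2_def memLp_1_iff memLp_2_iff borel_measurable_integrable measurable_lebesgue_borel)
qed

subsection \<open>Convolution with the transform of a Schwartz function\<close>

text \<open>As a function of \<open>y\<close>, \<open>fourier_int k (x - y)\<close> is the inverse transform of \<open>k\<close> times a character. The
multiplication formula moves this inverse transform to the other factor, where it cancels. The
identity holds at every point \<open>x\<close>, as both sides are absolutely convergent integrals.\<close>

lemma convolution_fourier:
  fixes k H :: "real^'n::finite \<Rightarrow> complex"
  assumes k: "L1_L2 k" and H: "memLp 2 H"
  shows "(LINT y|lebesgue. fourier_int k (x - y) * L2_extension fourier_int H y) = fourier_int (\<lambda>z. k z * H z) x"
proof -
  let ?k = "\<lambda>z. k z * cis (- (2 * pi * (z \<bullet> x)))"
  have [measurable]: "k \<in> borel_measurable lebesgue" using k by (simp add: L1_L2_def memLp_def)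
  have k': "L1_L2 ?k"
  proof -
    have "?k \<in> borel_measurable lebesgue" by measurable
    then show ?thesis using k by (simp add: L1_L2_def memLp_def norm_mult)
  qed
  have eq: "inv_fourier_int ?k y = fourier_int k (x - y)" for y
    unfolding inv_fourier_int_cis fourier_int_cis
    by (intro Bochner_Integration.integral_cong refl)
       (simp add: mult.assoc cis_mult inner_diff_right algebra_simps inner_commute)
  have FH: "memLp 2 (F.X H)" by (rule F.X_memLp[OF H])
  have "(LINT y|lebesgue. fourier_int k (x - y) * F.X H y) = (LINT y|lebesgue. F.X H y * inv_fourier_int ?k y)"
    unfolding eq by (intro Bochner_Integration.integral_cong refl mult.commute)
  also have "\<dots> = (LINT z|lebesgue. I.X (F.X H) z * ?k z)"
    by (rule I.X_multiplication[OF FH k', symmetric])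
  also have "\<dots> = (LINT z|lebesgue. H z * ?k z)"
  proof (rule integral_cong_AE)
    show "AE z in lebesgue. I.X (F.X H) z * ?k z = H z * ?k z"
      using fourier_L2_inversion(1)[OF H] by eventually_elim simp
  qed (use k' in \<open>auto intro!: borel_measurable_integrable L2_mult_integrable I.X_memLp FH H simp: L1_L2_def\<close>)
  also have "\<dots> = fourier_int (\<lambda>z. k z * H z) x"
    unfolding fourier_int_cis by (intro Bochner_Integration.integral_cong refl) (simp add: mult_ac)
  finally show ?thesis .
qed

section \<open>The solution\<close>

definition data_transform :: "(real^'n::finite \<Rightarrow> real^'N::finite) \<Rightarrow> 'N \<Rightarrow> real^'n \<Rightarrow> complex" where
  "data_transform f \<gamma> = L2_extension inv_fourier_int (\<lambda>x. complex_of_real (f x $ \<gamma>))"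

definition sol_density :: "(real^'n::finite^'N::finite \<Rightarrow> real^'N) \<Rightarrow> (real^'n \<Rightarrow> real^'N) \<Rightarrow> 'N \<Rightarrow> real^'n \<Rightarrow> complex" where
  "sol_density A f \<beta> z = (\<Sum>\<gamma>\<in>UNIV. complex_of_real (multiplier A z $ \<beta> $ \<gamma>) * data_transform f \<gamma> z)"

text \<open>At the origin this is zero, as the inverse of zero is zero.\<close>

definition sol_freq :: "(real^'n::finite^'N::finite \<Rightarrow> real^'N) \<Rightarrow> (real^'n \<Rightarrow> real^'N) \<Rightarrow> 'N \<Rightarrow> real^'n \<Rightarrow> complex" where
  "sol_freq A f \<beta> z = inverse (norm z) *\<^sub>R sol_density A f \<beta> z"

definition sol_factor :: complex where
  "sol_factor = - (1 / (2 * complex_of_real pi * \<i>))"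

text \<open>The solution with complex values. It is real almost everywhere, but this comes out last, from
uniqueness.\<close>

definition sol :: "(real^'n::finite^'N::finite \<Rightarrow> real^'N) \<Rightarrow> (real^'n \<Rightarrow> real^'N) \<Rightarrow> 'N \<Rightarrow> real^'n \<Rightarrow> complex" where
  "sol A f \<beta> x = sol_factor * fourier_ext (sol_freq A f \<beta>) x"

definition sol_grad :: "(real^'n::finite^'N::finite \<Rightarrow> real^'N) \<Rightarrow> (real^'n \<Rightarrow> real^'N) \<Rightarrow> 'N \<Rightarrow> 'n \<Rightarrow> real^'n \<Rightarrow> complex" where
  "sol_grad A f \<beta> j = L2_extension fourier_int (\<lambda>z. complex_of_real (z $ j) * sol_freq A f \<beta> z)"

lemma sol_factor: "sol_factor * (2 * complex_of_real pi * \<i>) = -1" "norm sol_factor \<le> 1"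
proof -
  show "sol_factor * (2 * complex_of_real pi * \<i>) = -1" by (simp add: sol_factor_def)
  have "1 \<le> 2 * pi" using pi_ge_two by linarith
  then show "norm sol_factor \<le> 1" by (simp add: sol_factor_def norm_divide norm_mult)
qed

lemma component_measurable_lebesgue: "(\<lambda>z::real^'n::finite. complex_of_real (z $ j)) \<in> borel_measurable lebesgue"
  by (rule measurable_lebesgue_borel) measurable

lemma memLp_2_component:
  fixes f :: "real^'n::finite \<Rightarrow> real^'N::finite"
  assumes "memLp 2 f"
  shows "memLp 2 (\<lambda>x. complex_of_real (f x $ \<gamma>))" "sq_norm (\<lambda>x. complex_of_real (f x $ \<gamma>)) \<le> sq_norm f"
  using memLp_2_of_real_component[OF assms bounded_linear_vec_nth component_le_norm_cart] by auto

text \<open>Both sides are moved to the frequency variable by the multiplication formula, where the derivative of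
the test function is multiplication by \<open>2\<pi>i z\<^sub>j\<close>.\<close>

lemma weak_derivative_fourier_ext:
  fixes w :: "real^'n::finite \<Rightarrow> complex"
  assumes n: "CARD('n) \<ge> 3" and w: "weighted_L2 w" and t: "test_function \<phi>"
  shows "(LINT x|lebesgue. (sol_factor * fourier_ext w x) * complex_of_real (partial_deriv j \<phi> x))
    = - (LINT x|lebesgue. L2_extension fourier_int (\<lambda>z. complex_of_real (z $ j) * w z) x * complex_of_real (\<phi> x))"
    and "memLp 2 (\<lambda>z. complex_of_real (z $ j) * w z)" "sq_norm (\<lambda>z. complex_of_real (z $ j) * w z) \<le> weighted_sq_norm w"
proof -
  let ?\<phi> = "\<lambda>x. complex_of_real (\<phi> x)" and ?d = "\<lambda>x. complex_of_real (partial_deriv j \<phi> x)"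
  let ?h = "\<lambda>z. complex_of_real (z $ j) * w z"
  have wm: "w \<in> borel_measurable lebesgue" and w2: "memLp 2 (\<lambda>z. norm z *\<^sub>R w z)" using w by (auto simp: weighted_L2_def)
  have hm: "?h \<in> borel_measurable lebesgue"
    by (intro borel_measurable_times wm component_measurable_lebesgue)
  have le: "AE z in lebesgue. norm (?h z) \<le> 1 * norm (norm z *\<^sub>R w z)"
    by (intro AE_I2) (simp add: norm_mult component_le_norm_cart mult_right_mono)
  show h2: "memLp 2 ?h" and "sq_norm ?h \<le> weighted_sq_norm w" using memLp_2_bound[OF w2 hm le] by auto
  have L: "L1_L2 ?d" "L1_L2 ?\<phi>" by (intro test_function_L1_L2 test_function_partial_deriv t)+
  have "(LINT x|lebesgue. fourier_ext w x * ?d x) = (LINT z|lebesgue. w z * fourier_int ?d z)"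
    by (rule fourier_ext_multiplication(3)[OF n w L(1)])
  also have "\<dots> = (LINT z|lebesgue. (2 * complex_of_real pi * \<i>) * (?h z * fourier_int ?\<phi> z))"
    by (intro Bochner_Integration.integral_cong refl) (simp add: fourier_partial_deriv[OF t])
  also have "\<dots> = (2 * complex_of_real pi * \<i>) * (LINT z|lebesgue. ?h z * fourier_int ?\<phi> z)" by (rule integral_mult_right_zero)
  also have "(LINT z|lebesgue. ?h z * fourier_int ?\<phi> z) = (LINT x|lebesgue. F.X ?h x * ?\<phi> x)"
    by (rule F.X_multiplication[OF h2 L(2), symmetric])
  finally have "sol_factor * (LINT x|lebesgue. fourier_ext w x * ?d x) = (sol_factor * (2 * complex_of_real pi * \<i>)) * (LINT x|lebesgue. F.X ?h x * ?\<phi> x)"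
    by (simp only: mult.assoc)
  then show "(LINT x|lebesgue. (sol_factor * fourier_ext w x) * ?d x) = - (LINT x|lebesgue. F.X ?h x * ?\<phi> x)"
    unfolding sol_factor(1) mult.assoc[of sol_factor] integral_mult_right_zero by simp
qed

text \<open>Used with the real and the imaginary part in the role of \<open>T\<close>, both of which are needed: the first
is the solution, the second is shown to vanish.\<close>

lemma parts_of_complex_weak_gradient:
  fixes U :: "'N::finite \<Rightarrow> real^'n::finite \<Rightarrow> complex" and D :: "'N \<Rightarrow> 'n \<Rightarrow> real^'n \<Rightarrow> complex"
  assumes T: "bounded_linear T" and le: "\<And>c. \<bar>T c\<bar> \<le> norm c" and p: "p \<ge> 1"
    and U: "\<And>\<beta>. memLp p (U \<beta>)" and D: "\<And>\<beta> j. memLp 2 (D \<beta> j)"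
    and weak: "\<And>\<phi> \<beta> j. test_function \<phi> \<Longrightarrow>
      (LINT x|lebesgue. U \<beta> x * complex_of_real (partial_deriv j \<phi> x)) = - (LINT x|lebesgue. D \<beta> j x * complex_of_real (\<phi> x))"
  defines "u \<equiv> \<lambda>x. \<chi> \<beta>. T (U \<beta> x)" and "G \<equiv> \<lambda>x. \<chi> \<beta> j. T (D \<beta> j x)"
  shows "is_weak_gradient u G" "memLp p u" "memLp 2 G"
    "(LINT x|lebesgue. norm (u x) powr p) \<le> real CARD('N) powr p * (\<Sum>\<beta>\<in>UNIV. LINT x|lebesgue. norm (U \<beta> x) powr p)"
    "sq_norm G \<le> (real CARD('N))\<^sup>2 * (real CARD('n))\<^sup>2 * (\<Sum>\<beta>\<in>UNIV. \<Sum>j\<in>UNIV. sq_norm (D \<beta> j))"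
proof -
  have Tm: "T \<in> borel_measurable borel" by (intro borel_measurable_continuous_onI linear_continuous_on T)
  have TU: "(\<lambda>x. T (U \<beta> x)) \<in> borel_measurable lebesgue" and TD: "(\<lambda>x. T (D \<beta> j x)) \<in> borel_measurable lebesgue" for \<beta> j
    using measurable_compose[OF memLp_measurable[OF U] Tm] measurable_compose[OF memLp_measurable[OF D] Tm] by auto
  have Up: "memLp p (\<lambda>x. T (U \<beta> x))" "(LINT x|lebesgue. norm (T (U \<beta> x)) powr p) \<le> (LINT x|lebesgue. norm (U \<beta> x) powr p)" for \<beta>
    using memLp_bound[OF _ U[of \<beta>] TU[of \<beta>]] le p by auto
  have Dp: "memLp 2 (\<lambda>x. T (D \<beta> j x))" "sq_norm (\<lambda>x. T (D \<beta> j x)) \<le> sq_norm (D \<beta> j)" for \<beta> j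
    using memLp_2_bound[OF D[of \<beta> j] TD[of \<beta> j], of 1] le by auto
  have p0: "p > 0" using p by simp
  have Uc: "memLp p (\<lambda>x. u x $ \<beta>)" for \<beta> using Up by (simp add: u_def)
  show up: "memLp p u" by (rule memLp_vec(1)[OF p0 Uc])
  have "(LINT x|lebesgue. norm (u x) powr p) \<le> real CARD('N) powr p * (\<Sum>\<beta>\<in>UNIV. LINT x|lebesgue. norm (u x $ \<beta>) powr p)"
    by (rule memLp_vec(2)[OF p0 Uc])
  also have "\<dots> \<le> real CARD('N) powr p * (\<Sum>\<beta>\<in>UNIV. LINT x|lebesgue. norm (U \<beta> x) powr p)"
    unfolding u_def vec_lambda_beta by (intro mult_left_mono sum_mono Up(2)) simp
  finally show "(LINT x|lebesgue. norm (u x) powr p) \<le> real CARD('N) powr p * (\<Sum>\<beta>\<in>UNIV. LINT x|lebesgue. norm (U \<beta> x) powr p)" .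
  have powr2: "(LINT x|lebesgue. norm (g x) powr 2) = sq_norm g" for g :: "real^'n \<Rightarrow> 'z::euclidean_space"
    by (simp add: sq_norm_def powr_two)
  have two: "(0::real) < 2" by simp
  have Gc: "memLp 2 (\<lambda>x. G x $ \<beta> $ j)" for \<beta> j using Dp by (simp add: G_def)
  have Gr: "memLp 2 (\<lambda>x. G x $ \<beta>)" for \<beta> by (rule memLp_vec(1)[OF two Gc])
  show G2: "memLp 2 G" by (rule memLp_vec(1)[OF two Gr])
  have "sq_norm G \<le> real CARD('N) powr 2 * (\<Sum>\<beta>\<in>UNIV. sq_norm (\<lambda>x. G x $ \<beta>))"
    using memLp_vec(2)[OF two Gr] by (simp only: powr2)
  also have "\<dots> \<le> real CARD('N) powr 2 * (\<Sum>\<beta>\<in>UNIV. real CARD('n) powr 2 * (\<Sum>j\<in>UNIV. sq_norm (D \<beta> j)))"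
  proof (intro mult_left_mono sum_mono)
    fix \<beta>
    have "sq_norm (\<lambda>x. G x $ \<beta>) \<le> real CARD('n) powr 2 * (\<Sum>j\<in>UNIV. sq_norm (\<lambda>x. G x $ \<beta> $ j))"
      using memLp_vec(2)[OF two Gc] by (simp only: powr2)
    also have "\<dots> \<le> real CARD('n) powr 2 * (\<Sum>j\<in>UNIV. sq_norm (D \<beta> j))"
      unfolding G_def vec_lambda_beta by (intro mult_left_mono sum_mono Dp(2)) simp
    finally show "sq_norm (\<lambda>x. G x $ \<beta>) \<le> real CARD('n) powr 2 * (\<Sum>j\<in>UNIV. sq_norm (D \<beta> j))" .
  qed simp
  finally show "sq_norm G \<le> (real CARD('N))\<^sup>2 * (real CARD('n))\<^sup>2 * (\<Sum>\<beta>\<in>UNIV. \<Sum>j\<in>UNIV. sq_norm (D \<beta> j))"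
    by (simp add: powr_two sum_distrib_left[symmetric] mult.assoc)
  show "is_weak_gradient u G"
    unfolding is_weak_gradient_def
  proof (intro conjI allI impI)
    show "locally_integrable u" by (rule memLp_locally_integrable[OF up p])
    show "locally_integrable G" by (rule memLp_locally_integrable[OF G2]) simp
    fix \<phi> :: "real^'n \<Rightarrow> real" and \<beta> j assume t: "test_function \<phi>"
    have ip: "integrable lebesgue (\<lambda>x. V x * complex_of_real (\<psi> x))"
      if V: "locally_integrable V" and \<psi>: "test_function \<psi>" for V :: "real^'n \<Rightarrow> complex" and \<psi>
    proof -
      have "integrable lebesgue (\<lambda>x. complex_of_real (Re (V x) * \<psi> x) + \<i> * complex_of_real (Im (V x) * \<psi> x))"
        using locally_integrable_mult_test_function[OF locally_integrable_of_bounded_linear[OF V bounded_linear_Re] \<psi>]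
          locally_integrable_mult_test_function[OF locally_integrable_of_bounded_linear[OF V bounded_linear_Im] \<psi>]
        by (intro Bochner_Integration.integrable_add integrable_mult_right integrable_of_real)
      moreover have "complex_of_real (Re (V x) * \<psi> x) + \<i> * complex_of_real (Im (V x) * \<psi> x) = V x * complex_of_real (\<psi> x)" for x
        by (simp add: complex_eq_iff)
      ultimately show ?thesis by simp
    qed
    have Tint: "(LINT x|lebesgue. T (V x) * \<psi> x) = T (LINT x|lebesgue. V x * complex_of_real (\<psi> x))"
      if V: "locally_integrable V" and \<psi>: "test_function \<psi>" for V :: "real^'n \<Rightarrow> complex" and \<psi>
    proof -
      have ptw: "T (V x * complex_of_real (\<psi> x)) = T (V x) * \<psi> x" for x
        using linear_cmul[OF bounded_linear.linear[OF T], of "\<psi> x" "V x"] by (simp add: scaleR_conv_of_real mult.commute)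
      show ?thesis
        using integral_bounded_linear[OF T ip[OF V \<psi>]] unfolding ptw .
    qed
    have Ul: "locally_integrable (U \<beta>)" by (rule memLp_locally_integrable[OF U p])
    have Dl: "locally_integrable (D \<beta> j)" by (rule memLp_locally_integrable[OF D]) simp
    show "(LINT x|lebesgue. u x $ \<beta> * partial_deriv j \<phi> x) = - (LINT x|lebesgue. G x $ \<beta> $ j * \<phi> x)"
      unfolding u_def G_def vec_lambda_beta Tint[OF Ul test_function_partial_deriv[OF t]] Tint[OF Dl t] weak[OF t]
      by (rule linear_neg[OF bounded_linear.linear[OF T]])
  qed
qed

text \<open>\<open>K\<close> bounds the squared norm of each component of the density in terms of that of \<open>f\<close>: a component is a
sum of \<open>N\<close> terms, each bounded by \<open>1 / \<nu>\<close> times a component of the transformed data, and each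
addition costs a factor of at most four.\<close>

locale elliptic_problem =
  fixes A :: "real^'n::finite^'N::finite \<Rightarrow> real^'N" and \<nu> :: real and f :: "real^'n \<Rightarrow> real^'N"
    and p K :: real
  assumes n: "CARD('n) \<ge> 3" and A: "linear A"
    and ell: "\<And>\<eta> a. norm (A (tensor \<eta> a)) \<ge> \<nu> * norm \<eta> * norm a" and \<nu>: "\<nu> > 0"
    and f: "memLp 2 f"
    and p_eq: "p = sobolev_exponent CARD('n)" and K_eq: "K = 4 ^ CARD('N) * (1 / \<nu>)\<^sup>2"
begin

lemma p_gt: "p > 2"
  using n by (simp add: p_eq sobolev_exponent_def field_simps)

lemma data_transform_L2: "memLp 2 (data_transform f \<gamma>)" "sq_norm (data_transform f \<gamma>) \<le> sq_norm f"
  unfolding data_transform_def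
  using I.X_memLp[OF memLp_2_component(1)[OF f]] I.X_norm[OF memLp_2_component(1)[OF f]] memLp_2_component(2)[OF f] by auto

lemma sol_density_L2: "memLp 2 (sol_density A f \<beta>)" "sq_norm (sol_density A f \<beta>) \<le> K * sq_norm f"
proof -
  let ?h = "\<lambda>\<gamma> z. complex_of_real (multiplier A z $ \<beta> $ \<gamma>) * data_transform f \<gamma> z"
  have h: "memLp 2 (?h \<gamma>)" "sq_norm (?h \<gamma>) \<le> (1 / \<nu>)\<^sup>2 * sq_norm f" for \<gamma>
  proof -
    have m: "?h \<gamma> \<in> borel_measurable lebesgue"
    proof -
      have "(\<lambda>z. complex_of_real (multiplier A z $ \<beta> $ \<gamma>)) \<in> borel_measurable borel"
        using multiplier_measurable[of A] by measurable
      then show ?thesis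
        by (intro borel_measurable_times measurable_lebesgue_borel memLp_measurable[OF data_transform_L2(1)])
    qed
    have le: "AE z in lebesgue. norm (?h \<gamma> z) \<le> 1 / \<nu> * norm (data_transform f \<gamma> z)"
      using AE_nonzero
    proof eventually_elim
      case (elim z)
      show ?case unfolding norm_mult norm_of_real
        by (intro mult_right_mono multiplier_bounded[OF A ell \<nu> elim] norm_ge_zero)
    qed
    show "memLp 2 (?h \<gamma>)" by (rule memLp_2_bound(1)[OF data_transform_L2(1) m le])
    have "sq_norm (?h \<gamma>) \<le> (1 / \<nu>)\<^sup>2 * sq_norm (data_transform f \<gamma>)"
      by (rule memLp_2_bound(2)[OF data_transform_L2(1) m le])
    also have "\<dots> \<le> (1 / \<nu>)\<^sup>2 * sq_norm f" by (intro mult_left_mono data_transform_L2) simp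
    finally show "sq_norm (?h \<gamma>) \<le> (1 / \<nu>)\<^sup>2 * sq_norm f" .
  qed
  have "memLp 2 (\<lambda>z. \<Sum>\<gamma>\<in>UNIV. ?h \<gamma> z) \<and> sq_norm (\<lambda>z. \<Sum>\<gamma>\<in>UNIV. ?h \<gamma> z) \<le> 4 ^ card (UNIV :: 'N set) * ((1 / \<nu>)\<^sup>2 * sq_norm f)"
    by (rule memLp_2_sum) (use h in auto)
  then show "memLp 2 (sol_density A f \<beta>)" "sq_norm (sol_density A f \<beta>) \<le> K * sq_norm f"
    by (simp_all add: sol_density_def[abs_def] K_eq mult.assoc)
qed

lemma norm_scaleR_sol_freq: "z \<noteq> 0 \<Longrightarrow> norm z *\<^sub>R sol_freq A f \<beta> z = sol_density A f \<beta> z"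
  by (simp add: sol_freq_def)

lemma sol_freq_weighted: "weighted_L2 (sol_freq A f \<beta>)" "weighted_sq_norm (sol_freq A f \<beta>) \<le> K * sq_norm f"
proof -
  have dm: "sol_density A f \<beta> \<in> borel_measurable lebesgue" by (rule memLp_measurable[OF sol_density_L2(1)])
  have m: "sol_freq A f \<beta> \<in> borel_measurable lebesgue"
    unfolding sol_freq_def[abs_def]
    by (intro borel_measurable_scaleR dm borel_measurable_inverse norm_lebesgue_measurable)
  have ae: "AE z in lebesgue. sol_density A f \<beta> z = norm z *\<^sub>R sol_freq A f \<beta> z"
    using AE_nonzero by eventually_elim (simp add: norm_scaleR_sol_freq)
  have m2: "memLp 2 (\<lambda>z. norm z *\<^sub>R sol_freq A f \<beta> z)" by (rule memLp_cong_AE'[OF sol_density_L2(1) ae])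
  then show "weighted_L2 (sol_freq A f \<beta>)" using m by (simp add: weighted_L2_def)
  have "weighted_sq_norm (sol_freq A f \<beta>) = sq_norm (sol_density A f \<beta>)"
    by (rule sq_norm_cong_AE[symmetric, OF dm memLp_measurable[OF m2] ae])
  then show "weighted_sq_norm (sol_freq A f \<beta>) \<le> K * sq_norm f" using sol_density_L2(2) by simp
qed

lemma sol_grad_L2: "memLp 2 (sol_grad A f \<beta> j)" "sq_norm (sol_grad A f \<beta> j) \<le> K * sq_norm f"
proof -
  obtain \<phi> :: "real^'n \<Rightarrow> real" where t: "test_function \<phi>" using exists_fourier_nonzero by metis
  note h = weak_derivative_fourier_ext(2,3)[OF n sol_freq_weighted(1) t, of j \<beta>]
  show "memLp 2 (sol_grad A f \<beta> j)" unfolding sol_grad_def by (rule F.X_memLp[OF h(1)])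
  show "sq_norm (sol_grad A f \<beta> j) \<le> K * sq_norm f"
    unfolding sol_grad_def F.X_norm[OF h(1)] by (rule order_trans[OF h(2) sol_freq_weighted(2)])
qed

text \<open>At each frequency the symbol cancels the multiplier, which leaves the inverse transform of \<open>f\<close>.\<close>

lemma sol_grad_solves:
  "AE x in lebesgue. (\<Sum>\<beta>\<in>UNIV. \<Sum>j\<in>UNIV. complex_of_real (tensor_component A \<alpha> \<beta> j) * sol_grad A f \<beta> j x) = complex_of_real (f x $ \<alpha>)"
proof -
  obtain \<phi> :: "real^'n \<Rightarrow> real" where t: "test_function \<phi>" using exists_fourier_nonzero by metis
  let ?h = "\<lambda>(\<beta>, j) z. complex_of_real (z $ j) * sol_freq A f \<beta> z" and ?c = "\<lambda>(\<beta>, j). complex_of_real (tensor_component A \<alpha> \<beta> j)"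
  have h: "memLp 2 (?h q)" for q
    using weak_derivative_fourier_ext(2)[OF n sol_freq_weighted(1) t] by (cases q) simp
  note X = F.X_sum[of UNIV ?h ?c, OF finite_class.finite_UNIV h]
  let ?s = "\<lambda>z. \<Sum>q\<in>UNIV. ?c q * ?h q z"
  have "AE z in lebesgue. ?s z = data_transform f \<alpha> z"
    using AE_nonzero
  proof eventually_elim
    case (elim z)
    have "?s z = (\<Sum>\<beta>\<in>UNIV. \<Sum>j\<in>UNIV. complex_of_real (tensor_component A \<alpha> \<beta> j) * (complex_of_real (z $ j) * sol_freq A f \<beta> z))"
      by (simp add: sum.cartesian_product split_beta UNIV_Times_UNIV[symmetric] del: UNIV_Times_UNIV)
    also have "\<dots> = (\<Sum>\<beta>\<in>UNIV. complex_of_real (symbol A (sgn z) $ \<alpha> $ \<beta>) * sol_density A f \<beta> z)"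
    proof (rule sum.cong[OF refl])
      fix \<beta>
      have "complex_of_real (symbol A (sgn z) $ \<alpha> $ \<beta>) = (\<Sum>j\<in>UNIV. complex_of_real (tensor_component A \<alpha> \<beta> j) * complex_of_real (z $ j)) * complex_of_real (inverse (norm z))"
        by (simp add: symbol_def sgn_div_norm sum_distrib_left sum_distrib_right mult_ac)
      then show "(\<Sum>j\<in>UNIV. complex_of_real (tensor_component A \<alpha> \<beta> j) * (complex_of_real (z $ j) * sol_freq A f \<beta> z)) = complex_of_real (symbol A (sgn z) $ \<alpha> $ \<beta>) * sol_density A f \<beta> z"
        by (simp add: sol_freq_def scaleR_conv_of_real sum_distrib_left sum_distrib_right mult_ac)
    qed
    also have "\<dots> = (\<Sum>\<beta>\<in>UNIV. \<Sum>\<gamma>\<in>UNIV. complex_of_real (symbol A (sgn z) $ \<alpha> $ \<beta> * multiplier A z $ \<beta> $ \<gamma>) * data_transform f \<gamma> z)"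
      by (simp add: sol_density_def sum_distrib_left mult_ac)
    also have "\<dots> = (\<Sum>\<gamma>\<in>UNIV. complex_of_real (\<Sum>\<beta>\<in>UNIV. symbol A (sgn z) $ \<alpha> $ \<beta> * multiplier A z $ \<beta> $ \<gamma>) * data_transform f \<gamma> z)"
      by (subst sum.swap) (simp add: sum_distrib_right)
    also have "\<dots> = data_transform f \<alpha> z"
      unfolding symbol_mult_multiplier[OF A ell \<nu> elim] by (simp add: if_distrib if_distribR cong: if_cong)
    finally show ?case .
  qed
  then have "AE x in lebesgue. F.X ?s x = F.X (data_transform f \<alpha>) x" by (intro F.X_cong) (use X in auto)
  moreover have "AE x in lebesgue. F.X (data_transform f \<alpha>) x = complex_of_real (f x $ \<alpha>)"
    unfolding data_transform_def by (rule fourier_L2_inversion(2)[OF memLp_2_component(1)[OF f]])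
  moreover have "AE x in lebesgue. F.X ?s x = (\<Sum>q\<in>UNIV. ?c q * F.X (?h q) x)" using X by blast
  ultimately show ?thesis
  proof eventually_elim
    case (elim x)
    have "(\<Sum>\<beta>\<in>UNIV. \<Sum>j\<in>UNIV. complex_of_real (tensor_component A \<alpha> \<beta> j) * sol_grad A f \<beta> j x) = (\<Sum>q\<in>UNIV. ?c q * F.X (?h q) x)"
      by (simp add: sol_grad_def sum.cartesian_product split_beta UNIV_Times_UNIV[symmetric] del: UNIV_Times_UNIV)
    then show ?case using elim by simp
  qed
qed

end

section \<open>Existence, uniqueness and the representation formula\<close>

context elliptic_problem
begin

text \<open>The frequency function whose transform gives the approximant; it replaces \<open>1 / \<bar>z\<bar>\<close> by \<open>h\<close> in
\<open>sol_freq\<close>.\<close>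

definition approx_freq :: "(real^'n \<Rightarrow> real) \<Rightarrow> 'N \<Rightarrow> real^'n \<Rightarrow> complex" where
  "approx_freq h \<beta> z = complex_of_real (h z) * sol_density A f \<beta> z"

lemma approximant_eq:
  assumes "schwartz h"
  shows "approximant A f h x $ \<beta> = sol_factor * fourier_int (approx_freq h \<beta>) x"
proof -
  have dens: "(map_matrix complex_of_real (multiplier A z) *v inv_fourier_L2 (\<lambda>y. cvec (f y)) z) $ \<beta> = sol_density A f \<beta> z" for z
    by (simp add: matrix_vector_mult_def map_matrix_def inv_fourier_L2_def cvec_def sol_density_def data_transform_def)
  have "approximant A f h x $ \<beta> = sol_factor * (LINT y|lebesgue. fourier_int (\<lambda>y. complex_of_real (h y)) (x - y) * F.X (sol_density A f \<beta>) y)"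
    by (simp add: approximant_def Defs.convolution_def fourier_L2_def dens sol_factor_def)
  then show ?thesis
    using convolution_fourier[OF schwartz_L1_L2(1)[OF assms] sol_density_L2(1)] by (simp add: approx_freq_def[abs_def])
qed

lemma approx_freq:
  assumes h: "schwartz h" and bound: "AE x in lebesgue. 0 \<le> h x \<and> h x \<le> 1 / norm x"
  shows "L1_L2 (approx_freq h \<beta>)" "weighted_L2 (approx_freq h \<beta>)"
proof -
  let ?h = "\<lambda>x. complex_of_real (h x)"
  have h2: "memLp 2 ?h" using schwartz_L1_L2(1)[OF h] by (simp add: L1_L2_def)
  obtain B where B: "\<And>x. \<bar>h x\<bar> \<le> B" using schwartz_L1_L2(2)[OF h] by blast
  have i: "integrable lebesgue (approx_freq h \<beta>)"
    unfolding approx_freq_def[abs_def] by (rule L2_mult_integrable[OF h2 sol_density_L2(1)])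
  have m: "approx_freq h \<beta> \<in> borel_measurable lebesgue" using i by (rule borel_measurable_integrable)
  have "memLp 2 (approx_freq h \<beta>)"
  proof (rule memLp_2_bound(1)[OF sol_density_L2(1) m])
    show "AE z in lebesgue. norm (approx_freq h \<beta> z) \<le> B * norm (sol_density A f \<beta> z)"
      unfolding approx_freq_def norm_mult norm_of_real by (intro AE_I2 mult_right_mono B norm_ge_zero)
  qed
  with i show "L1_L2 (approx_freq h \<beta>)" by (simp add: L1_L2_def memLp_1_iff)
  have "memLp 2 (\<lambda>z. norm z *\<^sub>R approx_freq h \<beta> z)"
  proof (rule memLp_2_bound(1)[OF sol_density_L2(1)])
    show "(\<lambda>z. norm z *\<^sub>R approx_freq h \<beta> z) \<in> borel_measurable lebesgue"
      by (intro borel_measurable_scaleR m norm_lebesgue_measurable)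
    show "AE z in lebesgue. norm (norm z *\<^sub>R approx_freq h \<beta> z) \<le> 1 * norm (sol_density A f \<beta> z)"
      using bound AE_nonzero
    proof eventually_elim
      case (elim z)
      then have "norm z * \<bar>h z\<bar> \<le> 1" by (simp add: field_simps)
      from mult_right_mono[OF this norm_ge_zero[of "sol_density A f \<beta> z"]]
      show ?case by (simp add: approx_freq_def norm_mult mult.assoc)
    qed
  qed
  with m show "weighted_L2 (approx_freq h \<beta>)" by (simp add: weighted_L2_def)
qed

text \<open>The weight \<open>\<bar>z\<bar>\<close> turns the error into \<open>(\<bar>z\<bar>h - 1)\<close> times the density, where \<open>0 \<le> \<bar>z\<bar>h \<le> 1\<close>.\<close>

lemma approx_freq_tendsto:
  assumes h: "admissible_sequence h"
  shows "(\<lambda>m. weighted_sq_norm (\<lambda>z. approx_freq (h m) \<beta> z - sol_freq A f \<beta> z)) \<longlonglongrightarrow> 0"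
proof (rule sq_norm_dominated_tendsto_0[OF sol_density_L2(1)])
  have ae: "AE x in lebesgue. (\<forall>m. 0 \<le> h m x \<and> h m x \<le> 1 / norm x) \<and> (\<lambda>m. h m x) \<longlonglongrightarrow> 1 / norm x"
    and s: "schwartz (h m)" for m using h by (auto simp: admissible_sequence_def)
  have b: "AE x in lebesgue. 0 \<le> h m x \<and> h m x \<le> 1 / norm x" for m using ae by eventually_elim blast
  show "(\<lambda>z. norm z *\<^sub>R (approx_freq (h m) \<beta> z - sol_freq A f \<beta> z)) \<in> borel_measurable lebesgue" for m
    using approx_freq(2)[OF s b, of m \<beta>] sol_freq_weighted(1)[of \<beta>]
    by (intro borel_measurable_scaleR borel_measurable_diff norm_lebesgue_measurable) (auto simp: weighted_L2_def)
  have eq: "norm z *\<^sub>R (approx_freq (h m) \<beta> z - sol_freq A f \<beta> z) = complex_of_real (norm z * h m z - 1) * sol_density A f \<beta> z"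
    if "z \<noteq> 0" for m z
    using norm_scaleR_sol_freq[OF that, of \<beta>] by (simp add: scaleR_diff_right approx_freq_def scaleR_conv_of_real algebra_simps)
  show "AE z in lebesgue. norm (norm z *\<^sub>R (approx_freq (h m) \<beta> z - sol_freq A f \<beta> z)) \<le> norm (sol_density A f \<beta> z)" for m
    using b[of m] AE_nonzero
  proof eventually_elim
    case (elim z)
    then have "\<bar>norm z * h m z - 1\<bar> \<le> 1" by (simp add: field_simps abs_le_iff)
    from mult_right_mono[OF this norm_ge_zero[of "sol_density A f \<beta> z"]]
    show ?case unfolding eq[OF elim(2)] norm_mult norm_of_real by simp
  qed
  show "AE z in lebesgue. (\<lambda>m. norm z *\<^sub>R (approx_freq (h m) \<beta> z - sol_freq A f \<beta> z)) \<longlonglongrightarrow> 0"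
    using ae AE_nonzero
  proof eventually_elim
    case (elim z)
    have "(\<lambda>m. complex_of_real (norm z * h m z - 1) * sol_density A f \<beta> z) \<longlonglongrightarrow> complex_of_real (norm z * (1 / norm z) - 1) * sol_density A f \<beta> z"
      using elim by (intro tendsto_mult tendsto_of_real tendsto_diff tendsto_const) auto
    then show ?case using elim by (simp add: eq)
  qed
qed

lemma sol_memLp: "memLp p (sol A f \<beta>)"
proof -
  have E: "memLp p (fourier_ext (sol_freq A f \<beta>))" using sobolev_fourier_ext[OF n, folded p_eq] sol_freq_weighted(1) by metis
  show ?thesis
  proof (rule memLp_bound(1)[OF _ E])
    show "sol A f \<beta> \<in> borel_measurable lebesgue"
      unfolding sol_def[abs_def] by (intro borel_measurable_times memLp_measurable[OF E] borel_measurable_const)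
    show "AE x in lebesgue. norm (sol A f \<beta> x) \<le> norm (fourier_ext (sol_freq A f \<beta>) x)"
      unfolding sol_def norm_mult using mult_right_mono[OF sol_factor(2) norm_ge_zero] by (intro AE_I2) simp
  qed (use p_gt in simp)
qed

lemma sol_weak_derivative:
  assumes "test_function \<phi>"
  shows "(LINT x|lebesgue. sol A f \<beta> x * complex_of_real (partial_deriv j \<phi> x)) = - (LINT x|lebesgue. sol_grad A f \<beta> j x * complex_of_real (\<phi> x))"
  unfolding sol_def sol_grad_def by (rule weak_derivative_fourier_ext(1)[OF n sol_freq_weighted(1) assms])

definition part :: "(complex \<Rightarrow> real) \<Rightarrow> real^'n \<Rightarrow> real^'N" where
  "part T x = (\<chi> \<beta>. T (sol A f \<beta> x))"

definition part_grad :: "(complex \<Rightarrow> real) \<Rightarrow> real^'n \<Rightarrow> real^'n^'N" where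
  "part_grad T x = (\<chi> \<beta> j. T (sol_grad A f \<beta> j x))"

lemma part:
  assumes T: "bounded_linear T" and le: "\<And>c. \<bar>T c\<bar> \<le> norm c"
  shows "is_weak_gradient (part T) (part_grad T)" "memLp p (part T)" "memLp 2 (part_grad T)"
    "(LINT x|lebesgue. norm (part T x) powr p) \<le> real CARD('N) powr p * (\<Sum>\<beta>\<in>UNIV. LINT x|lebesgue. norm (sol A f \<beta> x) powr p)"
    "sq_norm (part_grad T) \<le> (real CARD('N))\<^sup>2 * (real CARD('n))\<^sup>2 * (\<Sum>\<beta>\<in>UNIV. \<Sum>j\<in>UNIV. sq_norm (sol_grad A f \<beta> j))"
    "AE x in lebesgue. A (part_grad T x) = (\<chi> \<alpha>. T (complex_of_real (f x $ \<alpha>)))"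
proof -
  have p1: "p \<ge> 1" using p_gt by simp
  note P = parts_of_complex_weak_gradient[where T=T and p=p and U="sol A f" and D="sol_grad A f", OF T le p1 sol_memLp sol_grad_L2(1) sol_weak_derivative]
  have pe: "part T = (\<lambda>x. \<chi> \<beta>. T (sol A f \<beta> x))" and ge: "part_grad T = (\<lambda>x. \<chi> \<beta> j. T (sol_grad A f \<beta> j x))"
    by (auto simp: part_def part_grad_def)
  show "is_weak_gradient (part T) (part_grad T)" unfolding pe ge by (rule P(1))
  show "memLp p (part T)" unfolding pe by (rule P(2))
  show "memLp 2 (part_grad T)" unfolding ge by (rule P(3))
  show "(LINT x|lebesgue. norm (part T x) powr p) \<le> real CARD('N) powr p * (\<Sum>\<beta>\<in>UNIV. LINT x|lebesgue. norm (sol A f \<beta> x) powr p)"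
    unfolding pe by (rule P(4))
  show "sq_norm (part_grad T) \<le> (real CARD('N))\<^sup>2 * (real CARD('n))\<^sup>2 * (\<Sum>\<beta>\<in>UNIV. \<Sum>j\<in>UNIV. sq_norm (sol_grad A f \<beta> j))"
    unfolding ge by (rule P(5))
  have "AE x in lebesgue. \<forall>\<alpha>. (\<Sum>\<beta>\<in>UNIV. \<Sum>j\<in>UNIV. complex_of_real (tensor_component A \<alpha> \<beta> j) * sol_grad A f \<beta> j x) = complex_of_real (f x $ \<alpha>)"
    unfolding AE_all_countable by (intro allI sol_grad_solves)
  then show "AE x in lebesgue. A (part_grad T x) = (\<chi> \<alpha>. T (complex_of_real (f x $ \<alpha>)))"
  proof eventually_elim
    case (elim x)
    note lin = bounded_linear.linear[OF T]
    show ?case unfolding vec_eq_iff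
    proof
      fix \<alpha>
      have "T (complex_of_real (f x $ \<alpha>)) = T (\<Sum>\<beta>\<in>UNIV. \<Sum>j\<in>UNIV. tensor_component A \<alpha> \<beta> j *\<^sub>R sol_grad A f \<beta> j x)"
        using elim by (simp add: scaleR_conv_of_real)
      also have "\<dots> = (\<Sum>\<beta>\<in>UNIV. \<Sum>j\<in>UNIV. tensor_component A \<alpha> \<beta> j * T (sol_grad A f \<beta> j x))"
        by (simp add: linear_sum[OF lin] linear_cmul[OF lin])
      also have "\<dots> = A (part_grad T x) $ \<alpha>"
        by (simp add: linear_tensor_component[OF A] part_grad_def)
      finally show "A (part_grad T x) $ \<alpha> = (\<chi> \<alpha>. T (complex_of_real (f x $ \<alpha>))) $ \<alpha>" by simp
    qed
  qed
qed

text \<open>The imaginary part solves the homogeneous system, so it vanishes by uniqueness.\<close>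

lemma sol_real: "AE x in lebesgue. cvec (part Re x) = (\<chi> \<beta>. sol A f \<beta> x)"
proof -
  note P = part[OF bounded_linear_Im abs_Im_le_cmod]
  have "AE x in lebesgue. A (part_grad Im x) = 0" using P(6) by eventually_elim (simp add: vec_eq_iff)
  then have "AE x in lebesgue. part Im x = 0"
    using homogeneous_zero[OF A ell \<nu> P(2) _ P(1,3)] p_gt by simp
  then show ?thesis
    by eventually_elim (simp add: vec_eq_iff part_def cvec_def complex_eq_iff)
qed

lemma solves_part_Re: "solves A f (part Re)"
proof -
  note P = part[OF bounded_linear_Re abs_Re_le_cmod]
  note w = weak_gradient[OF P(1)]
  have w': "AE x in lebesgue. part_grad Re x = weak_gradient (part Re) x" using w(2) by eventually_elim simp
  have "memLp 2 (weak_gradient (part Re))" by (rule memLp_cong_AE'[OF P(3) w'])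
  moreover have "AE x in lebesgue. A (weak_gradient (part Re) x) = f x"
    using w(2) P(6) by eventually_elim (simp add: vec_lambda_eta)
  ultimately show ?thesis using P(1,2) by (auto simp: solves_def W1_def p_eq)
qed

lemma solves_unique:
  assumes v: "solves A f v" and u: "solves A f u"
  shows "AE x in lebesgue. v x = u x"
proof -
  have V: "memLp p v" "is_weak_gradient v (weak_gradient v)" "memLp 2 (weak_gradient v)" "AE x in lebesgue. A (weak_gradient v x) = f x"
    and U: "memLp p u" "is_weak_gradient u (weak_gradient u)" "memLp 2 (weak_gradient u)" "AE x in lebesgue. A (weak_gradient u x) = f x"
    using v u weak_gradient(1) by (auto simp: solves_def W1_def p_eq)
  have d: "memLp p (\<lambda>x. v x - u x)" using p_gt by (intro memLp_diff V U) simp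
  have "AE x in lebesgue. A (weak_gradient v x - weak_gradient u x) = 0"
    using V(4) U(4) by eventually_elim (simp add: linear_diff[OF A])
  then have "AE x in lebesgue. v x - u x = 0"
    using homogeneous_zero[OF A ell \<nu> d _ is_weak_gradient_diff[OF V(2) U(2)] memLp_2_diff(1)[OF V(3) U(3)]] p_gt by simp
  then show ?thesis by eventually_elim simp
qed

text \<open>The difference between approximant and solution is again a transform \<open>fourier_ext\<close>, so that the
Sobolev inequality bounds it by the weighted norm of the difference of the frequency functions.\<close>

lemma approximant_converges:
  assumes h: "admissible_sequence h"
  shows "memLp p (approximant A f (h m))" "memLp p (\<lambda>x. cvec (part Re x))"
    "(\<lambda>m. LINT x|lebesgue. norm (approximant A f (h m) x - cvec (part Re x)) powr p) \<longlonglongrightarrow> 0"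
proof -
  have p0: "p > 0" using p_gt by simp
  obtain C where C: "C > 0"
    "\<And>w :: real^'n \<Rightarrow> complex. weighted_L2 w \<Longrightarrow> memLp p (fourier_ext w)"
    "\<And>w :: real^'n \<Rightarrow> complex. weighted_L2 w \<Longrightarrow> (LINT x|lebesgue. norm (fourier_ext w x) powr p) \<le> C * weighted_sq_norm w powr (p / 2)"
    by (rule sobolev_fourier_ext[OF n, folded p_eq]) blast
  have ae: "AE x in lebesgue. (\<forall>m. 0 \<le> h m x \<and> h m x \<le> 1 / norm x) \<and> (\<lambda>m. h m x) \<longlonglongrightarrow> 1 / norm x"
    and s: "schwartz (h m)" for m using h by (auto simp: admissible_sequence_def)
  have b: "AE x in lebesgue. 0 \<le> h m x \<and> h m x \<le> 1 / norm x" for m using ae by eventually_elim blast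
  let ?a = "\<lambda>m. approx_freq (h m)" and ?w = "sol_freq A f"
  have aL: "L1_L2 (?a m \<beta>)" and aw: "weighted_L2 (?a m \<beta>)" for m \<beta> using approx_freq[OF s b] by auto
  have dw: "weighted_L2 (\<lambda>z. ?a m \<beta> z - ?w \<beta> z)" for m \<beta> by (rule fourier_ext_diff(1)[OF n aw sol_freq_weighted(1)])
  have am: "(\<lambda>x. approximant A f (h m) x $ \<beta>) \<in> borel_measurable lebesgue" for m \<beta>
    unfolding approximant_eq[OF s] using aL[of m \<beta>]
    by (intro borel_measurable_times borel_measurable_const fourier_int_measurable_lebesgue) (simp add: L1_L2_def memLp_def)
  have um: "(\<lambda>x. sol A f \<beta> x) \<in> borel_measurable lebesgue" for \<beta> using memLp_measurable[OF sol_memLp] by simp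
  have ap: "memLp p (\<lambda>x. approximant A f (h m) x $ \<beta>)" for m \<beta>
  proof (rule memLp_bound(1)[OF p0 C(2)[OF aw] am])
    show "AE x in lebesgue. norm (approximant A f (h m) x $ \<beta>) \<le> norm (fourier_ext (?a m \<beta>) x)"
      using fourier_ext_L1_L2[OF n aw[of m \<beta>] aL[of m \<beta>]]
    proof eventually_elim
      case (elim x)
      then show ?case unfolding approximant_eq[OF s] norm_mult
        using mult_right_mono[OF sol_factor(2) norm_ge_zero] by simp
    qed
  qed
  show am_p: "memLp p (approximant A f (h m))" for m by (rule memLp_vec(1)[OF p0 ap])
  let ?U = "\<lambda>x. \<chi> \<beta>. sol A f \<beta> x"
  have U_p: "memLp p ?U" by (rule memLp_vec(1)[OF p0]) (simp add: sol_memLp)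
  have real: "AE x in lebesgue. ?U x = cvec (part Re x)" using sol_real by eventually_elim simp
  show u_p: "memLp p (\<lambda>x. cvec (part Re x))" by (rule memLp_cong_AE'[OF U_p real])
  have comp: "(LINT x|lebesgue. norm (approximant A f (h m) x $ \<beta> - sol A f \<beta> x) powr p)
      \<le> C * weighted_sq_norm (\<lambda>z. ?a m \<beta> z - ?w \<beta> z) powr (p / 2)" for m \<beta>
  proof -
    have "(LINT x|lebesgue. norm (approximant A f (h m) x $ \<beta> - sol A f \<beta> x) powr p)
        \<le> (LINT x|lebesgue. norm (fourier_ext (\<lambda>z. ?a m \<beta> z - ?w \<beta> z) x) powr p)"
    proof (rule memLp_bound(2)[OF p0 C(2)[OF dw]])
      show "(\<lambda>x. approximant A f (h m) x $ \<beta> - sol A f \<beta> x) \<in> borel_measurable lebesgue"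
        by (intro borel_measurable_diff am um)
      show "AE x in lebesgue. norm (approximant A f (h m) x $ \<beta> - sol A f \<beta> x) \<le> norm (fourier_ext (\<lambda>z. ?a m \<beta> z - ?w \<beta> z) x)"
        using fourier_ext_L1_L2[OF n aw[of m \<beta>] aL[of m \<beta>]]
          fourier_ext_diff(2)[OF n aw[of m \<beta>] sol_freq_weighted(1)[of \<beta>]]
      proof eventually_elim
        case (elim x)
        have "approximant A f (h m) x $ \<beta> - sol A f \<beta> x = sol_factor * (fourier_ext (?a m \<beta>) x - fourier_ext (?w \<beta>) x)"
          unfolding approximant_eq[OF s] sol_def elim(1) by (simp add: right_diff_distrib)
        then show ?case unfolding elim(2)
          using mult_right_mono[OF sol_factor(2) norm_ge_zero] by (simp add: norm_mult)
      qed
    qed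
    also have "\<dots> \<le> C * weighted_sq_norm (\<lambda>z. ?a m \<beta> z - ?w \<beta> z) powr (p / 2)" by (rule C(3)[OF dw])
    finally show ?thesis .
  qed
  have "(LINT x|lebesgue. norm (approximant A f (h m) x - cvec (part Re x)) powr p)
      \<le> real CARD('N) powr p * (\<Sum>\<beta>\<in>UNIV. C * weighted_sq_norm (\<lambda>z. ?a m \<beta> z - ?w \<beta> z) powr (p / 2))" for m
  proof -
    have "(LINT x|lebesgue. norm (approximant A f (h m) x - cvec (part Re x)) powr p)
        \<le> (LINT x|lebesgue. norm (approximant A f (h m) x - ?U x) powr p)"
    proof (rule memLp_bound(2)[OF p0 memLp_diff[OF p0 am_p U_p] memLp_measurable[OF memLp_diff[OF p0 am_p u_p]]])
      show "AE x in lebesgue. norm (approximant A f (h m) x - cvec (part Re x)) \<le> norm (approximant A f (h m) x - ?U x)"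
        using real by eventually_elim simp
    qed
    also have "\<dots> \<le> real CARD('N) powr p * (\<Sum>\<beta>\<in>UNIV. LINT x|lebesgue. norm ((approximant A f (h m) x - ?U x) $ \<beta>) powr p)"
    proof (rule memLp_vec(2)[OF p0])
      show "memLp p (\<lambda>x. (approximant A f (h m) x - ?U x) $ \<beta>)" for \<beta>
        using memLp_diff[OF p0 ap sol_memLp] by simp
    qed
    also have "\<dots> \<le> real CARD('N) powr p * (\<Sum>\<beta>\<in>UNIV. C * weighted_sq_norm (\<lambda>z. ?a m \<beta> z - ?w \<beta> z) powr (p / 2))"
      using comp by (intro mult_left_mono sum_mono) auto
    finally show ?thesis .
  qed
  moreover have "(\<lambda>m. real CARD('N) powr p * (\<Sum>\<beta>\<in>UNIV. C * weighted_sq_norm (\<lambda>z. ?a m \<beta> z - ?w \<beta> z) powr (p / 2)))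
      \<longlonglongrightarrow> real CARD('N) powr p * (\<Sum>\<beta>::'N\<in>UNIV. C * 0 powr (p / 2))"
  proof (intro tendsto_mult tendsto_const tendsto_sum tendsto_powr'[OF approx_freq_tendsto[OF h] tendsto_const])
    show "(0::real) \<noteq> 0 \<or> 0 < p / 2 \<and> (\<forall>\<^sub>F m in sequentially. 0 \<le> weighted_sq_norm (\<lambda>z. ?a m \<beta> z - ?w \<beta> z))" for \<beta>
      using p_gt by simp
  qed
  then have "(\<lambda>m. real CARD('N) powr p * (\<Sum>\<beta>\<in>UNIV. C * weighted_sq_norm (\<lambda>z. ?a m \<beta> z - ?w \<beta> z) powr (p / 2))) \<longlonglongrightarrow> 0"
    by simp
  ultimately show "(\<lambda>m. LINT x|lebesgue. norm (approximant A f (h m) x - cvec (part Re x)) powr p) \<longlonglongrightarrow> 0"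
    by (rule tendsto_0_le[rotated]) simp
qed

lemma solution_estimate:
  assumes C: "C > 0" and sob: "\<And>w :: real^'n \<Rightarrow> complex. weighted_L2 w \<Longrightarrow> memLp p (fourier_ext w)"
    "\<And>w :: real^'n \<Rightarrow> complex. weighted_L2 w \<Longrightarrow> (LINT x|lebesgue. norm (fourier_ext w x) powr p) \<le> C * weighted_sq_norm w powr (p / 2)"
  shows "Lp_norm p (part Re) + Lp_norm 2 (weak_gradient (part Re))
    \<le> ((real CARD('N) powr p * (real CARD('N) * C)) powr (1 / p) * sqrt K
        + sqrt ((real CARD('N))\<^sup>2 * (real CARD('n))\<^sup>2 * (real CARD('N) * real CARD('n)) * K)) * Lp_norm 2 f"
proof -
  note P = part[OF bounded_linear_Re abs_Re_le_cmod]
  have p0: "p > 0" using p_gt by simp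
  let ?N = "real CARD('N)" and ?n = "real CARD('n)"
  let ?S = "K * sq_norm f"
  have d0: "K \<ge> 0" by (simp add: K_eq)
  have S: "?S \<ge> 0" using d0 by simp
  have E: "(LINT x|lebesgue. norm (sol A f \<beta> x) powr p) \<le> C * ?S powr (p / 2)" for \<beta>
  proof -
    have "(LINT x|lebesgue. norm (sol A f \<beta> x) powr p) \<le> (LINT x|lebesgue. norm (fourier_ext (sol_freq A f \<beta>) x) powr p)"
    proof (rule memLp_bound(2)[OF p0 sob(1)[OF sol_freq_weighted(1)] memLp_measurable[OF sol_memLp]])
      show "AE x in lebesgue. norm (sol A f \<beta> x) \<le> norm (fourier_ext (sol_freq A f \<beta>) x)"
        unfolding sol_def norm_mult using mult_right_mono[OF sol_factor(2) norm_ge_zero] by (intro AE_I2) simp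
    qed
    also have "\<dots> \<le> C * weighted_sq_norm (sol_freq A f \<beta>) powr (p / 2)" by (rule sob(2)[OF sol_freq_weighted(1)])
    also have "\<dots> \<le> C * ?S powr (p / 2)"
      using C p0 by (intro mult_left_mono powr_mono2 sol_freq_weighted(2)) auto
    finally show ?thesis .
  qed
  have "(LINT x|lebesgue. norm (part Re x) powr p) \<le> ?N powr p * (\<Sum>\<beta>::'N\<in>UNIV. C * ?S powr (p / 2))"
    by (rule order_trans[OF P(4)]) (intro mult_left_mono sum_mono E, simp)
  also have "\<dots> = (?N powr p * (?N * C)) * ?S powr (p / 2)" by simp
  finally have "Lp_norm p (part Re) \<le> ((?N powr p * (?N * C)) * ?S powr (p / 2)) powr (1 / p)"
    unfolding Lp_norm_def using p0 by (intro powr_mono2) auto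
  also have "\<dots> = (?N powr p * (?N * C)) powr (1 / p) * (?S powr (p / 2)) powr (1 / p)"
    using C by (simp add: powr_mult)
  also have "(?S powr (p / 2)) powr (1 / p) = sqrt ?S"
    using p0 S by (simp add: powr_powr powr_half_sqrt)
  also have "sqrt ?S = sqrt K * Lp_norm 2 f" by (simp add: real_sqrt_mult Lp_norm_2)
  finally have 1: "Lp_norm p (part Re) \<le> (?N powr p * (?N * C)) powr (1 / p) * (sqrt K * Lp_norm 2 f)" .
  note w = weak_gradient[OF P(1)]
  have "sq_norm (weak_gradient (part Re)) = sq_norm (part_grad Re)"
  proof (rule sq_norm_cong_AE[OF _ _ w(2)])
    show "weak_gradient (part Re) \<in> borel_measurable lebesgue"
      by (rule locally_integrable_measurable[OF is_weak_gradientD(2)[OF w(1)]])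
  qed (rule memLp_measurable[OF P(3)])
  also have "\<dots> \<le> ?N\<^sup>2 * ?n\<^sup>2 * (\<Sum>\<beta>::'N\<in>UNIV. \<Sum>j::'n\<in>UNIV. ?S)"
    by (rule order_trans[OF P(5)]) (intro mult_left_mono sum_mono sol_grad_L2(2), simp)
  also have "\<dots> = (?N\<^sup>2 * ?n\<^sup>2 * (?N * ?n) * K) * sq_norm f" by simp
  finally have "Lp_norm 2 (weak_gradient (part Re)) \<le> sqrt (?N\<^sup>2 * ?n\<^sup>2 * (?N * ?n) * K) * Lp_norm 2 f"
    unfolding Lp_norm_2 real_sqrt_mult[symmetric] by (rule real_sqrt_le_mono)
  with 1 show ?thesis by (simp add: distrib_right mult.assoc)
qed

end

theorem theorem2:
  fixes A :: "real^'n::finite^'N::finite \<Rightarrow> real^'N"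
  assumes "CARD('n) \<ge> 3" and "CARD('N) \<ge> 2"
    and "linear A"
    and "\<exists>\<nu>>0. \<forall>\<eta> a. norm (A (tensor \<eta> a)) \<ge> \<nu> * norm \<eta> * norm a"
  shows "\<exists>C>0. \<forall>f::real^'n \<Rightarrow> real^'N. memLp 2 f \<longrightarrow>
    (\<exists>u. solves A f u \<and>
      (\<forall>v. solves A f v \<longrightarrow> (AE x in lebesgue. v x = u x)) \<and>
      Lp_norm (sobolev_exponent CARD('n)) u + Lp_norm 2 (weak_gradient u) \<le> C * Lp_norm 2 f \<and>
      (\<forall>h. admissible_sequence h \<longrightarrow>
        weak_Lp_tendsto (sobolev_exponent CARD('n))
          (\<lambda>m. approximant A f (h m)) (\<lambda>x. cvec (u x)) \<and>
        AE_tendsto_subseq (\<lambda>m. approximant A f (h m)) (\<lambda>x. cvec (u x))))"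
proof -
  obtain \<nu> where \<nu>: "\<nu> > 0" "\<And>\<eta> a. norm (A (tensor \<eta> a)) \<ge> \<nu> * norm \<eta> * norm a"
    using assms(4) by blast
  let ?p = "sobolev_exponent CARD('n)" and ?N = "real CARD('N)" and ?n = "real CARD('n)"
  obtain S where S: "S > 0"
    "\<And>w :: real^'n \<Rightarrow> complex. weighted_L2 w \<Longrightarrow> memLp ?p (fourier_ext w)"
    "\<And>w :: real^'n \<Rightarrow> complex. weighted_L2 w \<Longrightarrow> (LINT x|lebesgue. norm (fourier_ext w x) powr ?p) \<le> S * weighted_sq_norm w powr (?p / 2)"
    by (rule sobolev_fourier_ext[OF assms(1)]) blast
  define K where "K = 4 ^ CARD('N) * (1 / \<nu>)\<^sup>2"
  define C where "C = (?N powr ?p * (?N * S)) powr (1 / ?p) * sqrt K + sqrt (?N\<^sup>2 * ?n\<^sup>2 * (?N * ?n) * K)"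
  have K: "K > 0" using \<nu> by (simp add: K_def)
  have "C > 0" unfolding C_def using K S(1) by (intro add_pos_pos mult_pos_pos) auto
  moreover have "\<exists>u. solves A f u \<and>
      (\<forall>v. solves A f v \<longrightarrow> (AE x in lebesgue. v x = u x)) \<and>
      Lp_norm ?p u + Lp_norm 2 (weak_gradient u) \<le> C * Lp_norm 2 f \<and>
      (\<forall>h. admissible_sequence h \<longrightarrow>
        weak_Lp_tendsto ?p (\<lambda>m. approximant A f (h m)) (\<lambda>x. cvec (u x)) \<and>
        AE_tendsto_subseq (\<lambda>m. approximant A f (h m)) (\<lambda>x. cvec (u x)))"
    if f: "memLp 2 f" for f
  proof -
    interpret elliptic_problem A \<nu> f ?p K
      by (rule elliptic_problem.intro[OF assms(1,3) \<nu>(2,1) f refl K_def])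
    have est: "Lp_norm ?p (part Re) + Lp_norm 2 (weak_gradient (part Re)) \<le> C * Lp_norm 2 f"
      using solution_estimate[OF S] by (simp add: C_def)
    have p1: "?p > 1" "?p > 0" using p_gt by auto
    show ?thesis
    proof (intro exI[of _ "part Re"] conjI allI impI solves_part_Re est)
      show "AE x in lebesgue. v x = part Re x" if "solves A f v" for v
        by (rule solves_unique[OF that solves_part_Re])
      fix h :: "nat \<Rightarrow> real^'n \<Rightarrow> real" assume h: "admissible_sequence h"
      show "weak_Lp_tendsto ?p (\<lambda>m. approximant A f (h m)) (\<lambda>x. cvec (part Re x))"
        by (rule strong_Lp_imp_weak[OF p1(1) approximant_converges[OF h]])
      show "AE_tendsto_subseq (\<lambda>m. approximant A f (h m)) (\<lambda>x. cvec (part Re x))"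
        by (rule strong_Lp_imp_AE_subseq[OF p1(2) approximant_converges[OF h]])
    qed
  qed
  ultimately show ?thesis by blast
qed

end
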